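(* Let $D>2$ be a natural number that is not a perfect square. Associate with $D$ three systems of polynomial equations, each one obtained by equating the coefficients of like powers of $x$ on the two sides of a pair of polynomial identities in the indeterminate $x$. If $D$ is odd, the three pairs of identities are $$(1)\quad\begin{cases} kx\prod_{i=1}^{\frac{D-1}{2}}(x-\alpha_i)^2-\prod_{i=1}^{\frac{D-1}{2}}(x-\beta_i)^2=k(x-1)\prod_{i=1}^{\frac{D-1}{2}}(x-\gamma_i)^2\\ kx\prod_{i=1}^{\frac{D-1}{2}}(x-\alpha_i)^2-\lambda\prod_{i=1}^{\frac{D-1}{2}}(x-\beta_i)^2=k(x-\lambda)\prod_{i=1}^{\frac{D-1}{2}}(x-\delta_i)^2 \end{cases}$$ $$(2)\quad\begin{cases} kx\prod_{i=1}^{\frac{D-1}{2}}(x-\alpha_i)^2-\prod_{i=1}^{\frac{D-1}{2}}(x-\beta_i)^2=k(x-\lambda)\prod_{i=1}^{\frac{D-1}{2}}(x-\gamma_i)^2\\ kx\prod_{i=1}^{\frac{D-1}{2}}(x-\alpha_i)^2-\lambda\prod_{i=1}^{\frac{D-1}{2}}(x-\beta_i)^2=k(x-1)\prod_{i=1}^{\frac{D-1}{2}}(x-\delta_i)^2 \end{cases}$$ $$(3)\quad\begin{cases} k(x-\lambda)\prod_{i=1}^{\frac{D-1}{2}}(x-\alpha_i)^2-\prod_{i=1}^{\frac{D-1}{2}}(x-\beta_i)^2=kx\prod_{i=1}^{\frac{D-1}{2}}(x-\gamma_i)^2\\ k(x-\lambda)\prod_{i=1}^{\frac{D-1}{2}}(x-\alpha_i)^2-\lambda\prod_{i=1}^{\frac{D-1}{2}}(x-\beta_i)^2=k(x-1)\prod_{i=1}^{\frac{D-1}{2}}(x-\delta_i)^2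 \end{cases}$$ If $D$ is even, the three pairs of identities are $$(4)\quad\begin{cases} k\prod_{i=1}^{\frac{D}{2}}(x-\alpha_i)^2-x(x-1)(x-\lambda)\prod_{i=1}^{\frac{D}{2}-2}(x-\beta_i)^2=k\prod_{i=1}^{\frac{D}{2}}(x-\gamma_i)^2\\ k\prod_{i=1}^{\frac{D}{2}}(x-\alpha_i)^2-\lambda x(x-1)(x-\lambda)\prod_{i=1}^{\frac{D}{2}-2}(x-\beta_i)^2=k\prod_{i=1}^{\frac{D}{2}}(x-\delta_i)^2 \end{cases}$$ $$(5)\quad\begin{cases} k(x-1)(x-\lambda)\prod_{i=1}^{\frac{D}{2}-1}(x-\alpha_i)^2-x\prod_{i=1}^{\frac{D}{2}-1}(x-\beta_i)^2=k\prod_{i=1}^{\frac{D}{2}}(x-\gamma_i)^2\\ k(x-1)(x-\lambda)\prod_{i=1}^{\frac{D}{2}-1}(x-\alpha_i)^2-\lambda x\prod_{i=1}^{\frac{D}{2}-1}(x-\beta_i)^2=k\prod_{i=1}^{\frac{D}{2}}(x-\delta_i)^2 \end{cases}$$ $$(6)\quad\begin{cases} kx(x-1)\prod_{i=1}^{\frac{D}{2}-1}(x-\alpha_i)^2-(x-\lambda)\prod_{i=1}^{\frac{D}{2}-1}(x-\beta_i)^2=k\prod_{i=1}^{\frac{D}{2}}(x-\gamma_i)^2\\ kx(x-1)\prod_{i=1}^{\frac{D}{2}-1}(x-\alpha_i)^2-\lambda(x-\lambda)\prod_{i=1}^{\frac{D}{2}-1}(x-\beta_i)^2=k\prod_{i=1}^{\frac{D}{2}}(x-\delta_i)^2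 \end{cases}$$ Each system has $2D$ equations and $2D$ unknowns, namely a complex number $k\neq 0$ together with $\lambda$ and all the $\alpha_i,\beta_i,\gamma_i,\delta_i$, where $\lambda$ and the $\alpha_i,\beta_i,\gamma_i,\delta_i$ are required to be pairwise distinct numbers in $\mathbb{C}-\{0,1\}$. Then the set of values that $256\frac{(\lambda^2-\lambda+1)^3}{(\lambda^2-\lambda)^2}$ takes at the solutions of the three systems corresponding to $D$ (according to its parity) is exactly the set of values of the modular function $j:\mathbb{H}\rightarrow\mathbb{C}$ at the points of the upper half plane of the form $\tau=\frac{1}{2b}\left(u+\sqrt{4D-a^2}\,\mathrm{i}\right)$, where $u,a,b$ are integers with $|a|<2\sqrt{D}$ and $4b\mid u^2+4D-a^2$.
   Context: $\mathbb{H}$ is the upper half plane. $j:\mathbb{H}\to\mathbb{C}$ is the usual modular $j$-function for $\mathrm{SL}_2(\mathbb{Z})$, normalized so that $j(\tau)=\frac1q+744+196884q+\cdots$ with $q=e^{2\pi\mathrm{i}\tau}$ (so $j(\mathrm{i})=1728$). *)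

theory Defs
  imports "HOL-Analysis.Analysis" "HOL-Computational_Algebra.Polynomial"
begin

definition eisenstein_G :: "nat \<Rightarrow> complex \<Rightarrow> complex" where
  "eisenstein_G k \<tau> =
     (\<Sum>\<^sub>\<infinity>(m, n) \<in> UNIV - {(0, 0)}. 1 / (of_int m + of_int n * \<tau>) ^ k)"

(* The classical formula 1728 * g2^3 / (g2^3 - 27 * g3^2) for the lattice spanned by 1 and tau,
   where g2 = 60 * G_4 and g3 = 140 * G_6. This is the normalisation with q-expansion
   1/q + 744 + 196884 q + ... and value 1728 at the imaginary unit.
   It is only meaningful for Im tau > 0. *)
definition modular_j :: "complex \<Rightarrow> complex" where
  "modular_j \<tau> =
     (let g2 = 60 * eisenstein_G 4 \<tau>; g3 = 140 * eisenstein_G 6 \<tau>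
      in 1728 * g2 ^ 3 / (g2 ^ 3 - 27 * g3 ^ 2))"

(* The indexed unknowns alpha_1, ..., alpha_n (and likewise beta, gamma, delta) are
   represented by lists, whose lengths are fixed in each of the systems below. *)

definition sq_prod :: "complex list \<Rightarrow> complex poly" where
  "sq_prod as = (\<Prod>a\<leftarrow>as. [:- a, 1:] ^ 2)"

definition admissible ::
  "complex \<Rightarrow> complex \<Rightarrow> complex list \<Rightarrow> complex list \<Rightarrow> complex list \<Rightarrow> complex list \<Rightarrow> bool" where
  "admissible k l as bs cs ds \<longleftrightarrow>
     k \<noteq> 0 \<and> distinct (l # as @ bs @ cs @ ds) \<and> set (l # as @ bs @ cs @ ds) \<subseteq> UNIV - {0, 1}"

definition system1 ::
  "nat \<Rightarrow> complex \<Rightarrow> complex \<Rightarrow> complex list \<Rightarrow> complex list \<Rightarrow> complex list \<Rightarrow> complex list \<Rightarrow> bool" where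
  "system1 D k l as bs cs ds \<longleftrightarrow>
     length as = (D - 1) div 2 \<and> length bs = (D - 1) div 2 \<and>
     length cs = (D - 1) div 2 \<and> length ds = (D - 1) div 2 \<and>
     smult k ([:0, 1:] * sq_prod as) - sq_prod bs = smult k ([:-1, 1:] * sq_prod cs) \<and>
     smult k ([:0, 1:] * sq_prod as) - smult l (sq_prod bs) = smult k ([:- l, 1:] * sq_prod ds)"

definition system2 ::
  "nat \<Rightarrow> complex \<Rightarrow> complex \<Rightarrow> complex list \<Rightarrow> complex list \<Rightarrow> complex list \<Rightarrow> complex list \<Rightarrow> bool" where
  "system2 D k l as bs cs ds \<longleftrightarrow>
     length as = (D - 1) div 2 \<and> length bs = (D - 1) div 2 \<and>
     length cs = (D - 1) div 2 \<and> length ds = (D - 1) div 2 \<and>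
     smult k ([:0, 1:] * sq_prod as) - sq_prod bs = smult k ([:- l, 1:] * sq_prod cs) \<and>
     smult k ([:0, 1:] * sq_prod as) - smult l (sq_prod bs) = smult k ([:-1, 1:] * sq_prod ds)"

definition system3 ::
  "nat \<Rightarrow> complex \<Rightarrow> complex \<Rightarrow> complex list \<Rightarrow> complex list \<Rightarrow> complex list \<Rightarrow> complex list \<Rightarrow> bool" where
  "system3 D k l as bs cs ds \<longleftrightarrow>
     length as = (D - 1) div 2 \<and> length bs = (D - 1) div 2 \<and>
     length cs = (D - 1) div 2 \<and> length ds = (D - 1) div 2 \<and>
     smult k ([:- l, 1:] * sq_prod as) - sq_prod bs = smult k ([:0, 1:] * sq_prod cs) \<and>
     smult k ([:- l, 1:] * sq_prod as) - smult l (sq_prod bs) = smult k ([:-1, 1:] * sq_prod ds)"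

definition system4 ::
  "nat \<Rightarrow> complex \<Rightarrow> complex \<Rightarrow> complex list \<Rightarrow> complex list \<Rightarrow> complex list \<Rightarrow> complex list \<Rightarrow> bool" where
  "system4 D k l as bs cs ds \<longleftrightarrow>
     length as = D div 2 \<and> length bs = D div 2 - 2 \<and>
     length cs = D div 2 \<and> length ds = D div 2 \<and>
     smult k (sq_prod as) - [:0, 1:] * [:-1, 1:] * [:- l, 1:] * sq_prod bs
       = smult k (sq_prod cs) \<and>
     smult k (sq_prod as) - smult l ([:0, 1:] * [:-1, 1:] * [:- l, 1:] * sq_prod bs)
       = smult k (sq_prod ds)"

definition system5 ::
  "nat \<Rightarrow> complex \<Rightarrow> complex \<Rightarrow> complex list \<Rightarrow> complex list \<Rightarrow> complex list \<Rightarrow> complex list \<Rightarrow> bool" where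
  "system5 D k l as bs cs ds \<longleftrightarrow>
     length as = D div 2 - 1 \<and> length bs = D div 2 - 1 \<and>
     length cs = D div 2 \<and> length ds = D div 2 \<and>
     smult k ([:-1, 1:] * [:- l, 1:] * sq_prod as) - [:0, 1:] * sq_prod bs
       = smult k (sq_prod cs) \<and>
     smult k ([:-1, 1:] * [:- l, 1:] * sq_prod as) - smult l ([:0, 1:] * sq_prod bs)
       = smult k (sq_prod ds)"

definition system6 ::
  "nat \<Rightarrow> complex \<Rightarrow> complex \<Rightarrow> complex list \<Rightarrow> complex list \<Rightarrow> complex list \<Rightarrow> complex list \<Rightarrow> bool" where
  "system6 D k l as bs cs ds \<longleftrightarrow>
     length as = D div 2 - 1 \<and> length bs = D div 2 - 1 \<and>
     length cs = D div 2 \<and> length ds = D div 2 \<and>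
     smult k ([:0, 1:] * [:-1, 1:] * sq_prod as) - [:- l, 1:] * sq_prod bs
       = smult k (sq_prod cs) \<and>
     smult k ([:0, 1:] * [:-1, 1:] * sq_prod as) - smult l ([:- l, 1:] * sq_prod bs)
       = smult k (sq_prod ds)"

definition is_solution ::
  "nat \<Rightarrow> complex \<Rightarrow> complex \<Rightarrow> complex list \<Rightarrow> complex list \<Rightarrow> complex list \<Rightarrow> complex list \<Rightarrow> bool" where
  "is_solution D k l as bs cs ds \<longleftrightarrow>
     admissible k l as bs cs ds \<and>
     (if odd D
      then system1 D k l as bs cs ds \<or> system2 D k l as bs cs ds \<or> system3 D k l as bs cs ds
      else system4 D k l as bs cs ds \<or> system5 D k l as bs cs ds \<or> system6 D k l as bs cs ds)"

end

theory Submission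
  imports Defs "HOL-Complex_Analysis.Complex_Analysis"
    "HOL-Computational_Algebra.Computational_Algebra"
begin

text \<open>
  A solution of one of the systems amounts to a rational function \<open>f = p / q\<close> of degree \<open>D\<close> with a pole at
  infinity such that \<open>(x - e1) (x - e2) (x - e3) f'\<^sup>2 = \<kappa> (f - e1) (f - e2) (f - e3)\<close> for
  \<open>{e1, e2, e3} = {0, 1, \<lambda>}\<close>: the identities say that \<open>f\<close> is ramified with index two at all points
  over \<open>0, 1, \<lambda>, \<infinity>\<close> other than these four points themselves, and a parity count of these multiplicities shows
  that, after a permutation of the \<open>e\<^sub>i\<close>, one of the systems applies.
  If \<open>e1, e2, e3\<close> are the finite branch values of a Weierstrass function \<open>\<wp>\<close> of a lattice \<open>\<Lambda>\<close>,
  then by uniqueness for the differential equation of \<open>1 / \<wp>\<close> at its double zero such an \<open>f\<close>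
  satisfies \<open>\<wp> (\<mu> z) = f (\<wp> z)\<close> with \<open>\<mu>\<^sup>2 = \<kappa>\<close>. Hence \<open>\<mu> \<Lambda> \<subseteq> \<Lambda>\<close>, and \<open>D\<close> is the index of \<open>\<mu> \<Lambda>\<close>
  in \<open>\<Lambda>\<close>, which is \<open>\<bar>\<mu>\<bar>\<^sup>2\<close>. Conversely, each multiplier \<open>\<mu>\<close> with \<open>\<bar>\<mu>\<bar>\<^sup>2 = D\<close> yields such an \<open>f\<close>, because
  \<open>\<wp> (\<mu> z)\<close> is even and elliptic. Writing \<open>\<mu> = c + b \<tau>\<close> with trace \<open>a\<close> and norm \<open>D\<close> gives the formula for \<open>\<tau>\<close>.

  That every \<open>\<lambda> \<noteq> 0, 1\<close> comes from a lattice is shown without modular forms: the local solution of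
  \<open>v'\<^sup>2 = 4 v (1 - v) (1 - \<lambda> v)\<close> with a double zero at \<open>0\<close> is a quotient of two functions that the
  duplication formula extends to entire functions, and Picard's theorem shows that its group of periods has rank two.
\<close>

section \<open>Algebraic differential equations\<close>

text \<open>An equation of first order does not determine its solution at a zero of the right-hand
  side: \<open>v'^2 = 4 v + ...\<close> with \<open>v 0 = 0\<close> is also solved by the zero
  function. Every uniqueness argument therefore passes to the second-order equation obtained by
  differentiation, and it works with the reciprocal of the Weierstrass function because the function
  itself has no initial value at a lattice point. The systems refer to an ordered triple, a lattice
  only to the unordered set of its branch values. This does no harm: the value attached to
  \<open>\<lambda>\<close> is the same for all six orderings, so the points may be relabelled until
  a system fits. That \<open>D\<close> is not a square excludes integral multipliers, which
  stabilize every lattice. For every other multiplier \<open>c + b \<tau>\<close> the coefficient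
  \<open>b\<close> is nonzero, and stability becomes a quadratic equation for \<open>\<tau>\<close>.
  In the uniformization the local solution is split into numerator and denominator because the
  duplication formula for the quotient has poles, whereas on the pair it acts by forms of degree
  four and can be iterated without restriction.\<close>

text \<open>Leibniz' rule applied to \<open>q * d\<close> expresses each derivative of order at
  least two at \<open>z0\<close> through lower derivatives of \<open>d\<close>. The two initial
  conditions thus annihilate the whole Taylor series, and the identity theorem finishes.\<close>

lemma linear_ode2_eq_0:
  fixes d q :: "complex \<Rightarrow> complex"
  assumes d: "d holomorphic_on S" and q: "q holomorphic_on S" and S: "open S" "connected S"
    and ode: "\<And>z. z \<in> S \<Longrightarrow> deriv (deriv d) z = q z * d z"
    and z0: "z0 \<in> S" "d z0 = 0" "deriv d z0 = 0" and z: "z \<in> S"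
  shows "d z = 0"
proof -
  have "(deriv ^^ n) d z0 = 0" for n
  proof (induction n rule: less_induct)
    case (less n)
    consider "n = 0" | "n = 1" | m where "n = Suc (Suc m)"
      by (metis One_nat_def not0_implies_Suc)
    then show ?case
    proof cases
      case 3
      have ev: "eventually (\<lambda>z. deriv (deriv d) z = q z * d z) (nhds z0)"
        using eventually_nhds_in_open[OF S(1) z0(1)] by eventually_elim (use ode in auto)
      have "(deriv ^^ n) d z0 = (deriv ^^ m) (deriv (deriv d)) z0"
        unfolding 3 funpow_Suc_right by simp
      also have "\<dots> = (deriv ^^ m) (\<lambda>z. q z * d z) z0"
        by (rule higher_deriv_cong_ev[OF ev refl])
      also have "\<dots> = (\<Sum>i = 0..m. of_nat (m choose i) * (deriv ^^ i) q z0 * (deriv ^^ (m-i)) d z0)"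
        by (rule higher_deriv_mult[OF q d S(1) z0(1)])
      also have "\<dots> = 0"
        using less 3 by (intro sum.neutral) auto
      finally show ?thesis .
    qed (use z0 in auto)
  qed
  from holomorphic_fun_eq_0_on_connected[OF d S this z0(1) z] show ?thesis .
qed

text \<open>The holomorphic functions on a connected open set have no zero divisors. This is what
  permits cancelling \<open>deriv v\<close> in a differentiated equation although it may have
  zeros.\<close>

lemma holomorphic_mult_eq_0D:
  fixes f g :: "complex \<Rightarrow> complex"
  assumes f: "f holomorphic_on S" and g: "g holomorphic_on S" and S: "open S" "connected S"
    and fg: "\<And>z. z \<in> S \<Longrightarrow> f z * g z = 0" and z1: "z1 \<in> S" "f z1 \<noteq> 0" and z: "z \<in> S"
  shows "g z = 0"
proof -
  have "continuous_on S f" using f by (rule holomorphic_on_imp_continuous_on)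
  then obtain U where U: "open U" "z1 \<in> U" "U \<subseteq> S" "\<And>z. z \<in> U \<Longrightarrow> f z \<noteq> 0"
    using that[of "S \<inter> f -` (- {0})"] S(1) z1 continuous_open_preimage[of S f "-{0}"] by auto
  have "g z = 0" if "z \<in> U" for z
    using fg[of z] U that by auto
  then show ?thesis
    using analytic_continuation[OF g S U(3) z1(1) _ _ z] U z1
    by (simp add: interior_limit_point interior_open)
qed

text \<open>The difference of two solutions satisfies a linear equation; its coefficient
  \<open>?q\<close> is the divided difference of the cubic right-hand side.\<close>

lemma ode2_unique:
  fixes v w :: "complex \<Rightarrow> complex"
  assumes v: "v holomorphic_on S" and w: "w holomorphic_on S" and S: "open S" "connected S"
    and odev: "\<And>z. z \<in> S \<Longrightarrow> deriv (deriv v) z = a + b * v z + c * v z ^ 2 + d * v z ^ 3"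
    and odew: "\<And>z. z \<in> S \<Longrightarrow> deriv (deriv w) z = a + b * w z + c * w z ^ 2 + d * w z ^ 3"
    and z0: "z0 \<in> S" "v z0 = w z0" "deriv v z0 = deriv w z0" and z: "z \<in> S"
  shows "v z = w z"
proof -
  let ?d = "\<lambda>z. v z - w z" and ?q = "\<lambda>z. b + c * (v z + w z) + d * (v z ^ 2 + v z * w z + w z ^ 2)"
  have d: "?d holomorphic_on S" and q: "?q holomorphic_on S"
    by (intro holomorphic_intros v w)+
  have D1: "deriv ?d z = deriv v z - deriv w z" if "z \<in> S" for z
    using that v w S by (intro deriv_diff) (auto simp: holomorphic_on_imp_differentiable_at)
  have ode: "deriv (deriv ?d) z = ?q z * ?d z" if z: "z \<in> S" for z
  proof -
    have "deriv (deriv ?d) z = deriv (\<lambda>z. deriv v z - deriv w z) z"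
      by (rule deriv_cong_ev) (use eventually_nhds_in_open[OF S(1) z] D1 in \<open>auto elim!: eventually_mono\<close>)
    also have "\<dots> = deriv (deriv v) z - deriv (deriv w) z"
      using holomorphic_deriv[OF v S(1)] holomorphic_deriv[OF w S(1)] z S(1)
      by (intro deriv_diff) (auto simp: holomorphic_on_imp_differentiable_at)
    also have "\<dots> = ?q z * ?d z"
      using odev[OF z] odew[OF z] by (simp add: algebra_simps power2_eq_square power3_eq_cube)
    finally show ?thesis .
  qed
  have "?d z = 0"
    by (rule linear_ode2_eq_0[OF d q S ode z0(1) _ _ z]) (use z0 D1 in auto)
  then show ?thesis by simp
qed

text \<open>Differentiating \<open>v'^2 = F(v)\<close> gives \<open>2 v' v'' = F'(v) v'\<close>. The
  point \<open>z1\<close> excludes the constant solutions, so \<open>v'\<close> can be cancelled on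
  the whole connected set.\<close>

lemma ode1_imp_ode2:
  fixes v :: "complex \<Rightarrow> complex"
  assumes v: "v holomorphic_on S" and S: "open S" "connected S"
    and ode: "\<And>z. z \<in> S \<Longrightarrow> deriv v z ^ 2 = a + b * v z + c * v z ^ 2 + d * v z ^ 3 + e * v z ^ 4"
    and nc: "z1 \<in> S" "deriv v z1 \<noteq> 0" and z: "z \<in> S"
  shows "deriv (deriv v) z = b / 2 + c * v z + 3 * d / 2 * v z ^ 2 + 2 * e * v z ^ 3"
proof -
  have v': "deriv v holomorphic_on S" and v'': "deriv (deriv v) holomorphic_on S"
    by (intro holomorphic_deriv v S)+
  have "deriv (deriv v) z - (b / 2 + c * v z + 3 * d / 2 * v z ^ 2 + 2 * e * v z ^ 3) = 0"
  proof (rule holomorphic_mult_eq_0D[OF v' _ S _ nc z])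
    show "(\<lambda>z. deriv (deriv v) z - (b / 2 + c * v z + 3 * d / 2 * v z ^ 2 + 2 * e * v z ^ 3)) holomorphic_on S"
      by (intro holomorphic_intros v v'')
    fix z assume z: "z \<in> S"
    have Dv: "(v has_field_derivative deriv v z) (at z)"
         and Dv': "(deriv v has_field_derivative deriv (deriv v) z) (at z)"
      using v v' S z by (auto intro: holomorphic_derivI)
    let ?D = "2 * deriv v z * deriv (deriv v) z - (b * deriv v z + c * (2 * v z * deriv v z) +
        d * (3 * v z ^ 2 * deriv v z) + e * (4 * v z ^ 3 * deriv v z))"
    have "((\<lambda>z. deriv v z ^ 2 - (a + b * v z + c * v z ^ 2 + d * v z ^ 3 + e * v z ^ 4)) has_field_derivative ?D) (at z)"
      by (rule derivative_eq_intros Dv Dv' refl | simp add: algebra_simps)+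
    moreover have "((\<lambda>z. deriv v z ^ 2 - (a + b * v z + c * v z ^ 2 + d * v z ^ 3 + e * v z ^ 4)) has_field_derivative 0) (at z)"
      by (rule has_field_derivative_transform_within_open[OF DERIV_const[of 0] S(1) z])
         (use ode in auto)
    ultimately have "?D = 0" by (rule DERIV_unique)
    then show "deriv v z * (deriv (deriv v) z - (b / 2 + c * v z + 3 * d / 2 * v z ^ 2 + 2 * e * v z ^ 3)) = 0"
      by algebra
  qed
  then show ?thesis by simp
qed

text \<open>The sum is a limit along finite subsets, uniform by the M-test, so it may be
  differentiated term by term. The second conclusion is a \<open>has_sum\<close> because later
  arguments reindex the derivative series.\<close>

lemma holomorphic_infsum:
  fixes f :: "'a \<Rightarrow> complex \<Rightarrow> complex"
  assumes hol: "\<And>p. p \<in> X \<Longrightarrow> f p holomorphic_on ball a R"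
    and le: "\<And>p z. p \<in> X \<Longrightarrow> z \<in> ball a R \<Longrightarrow> norm (f p z) \<le> M p"
    and M: "M summable_on X"
  shows "(\<lambda>z. \<Sum>\<^sub>\<infinity>p\<in>X. f p z) holomorphic_on ball a R"
    and "\<And>z. z \<in> ball a R \<Longrightarrow>
           ((\<lambda>p. deriv (f p) z) has_sum deriv (\<lambda>z. \<Sum>\<^sub>\<infinity>p\<in>X. f p z) z) X"
proof -
  have *: "\<exists>D. ((\<lambda>z. \<Sum>\<^sub>\<infinity>p\<in>X. f p z) has_field_derivative D) (at z) \<and>
             ((\<lambda>p. deriv (f p) z) has_sum D) X" if z: "z \<in> ball a R" for z
  proof -
    obtain r where r: "r > 0" "cball z r \<subseteq> ball a R"
      using z open_contains_cball by blast
    have "\<forall>\<^sub>F P in finite_subsets_at_top X. continuous_on (cball z r) (\<lambda>z. \<Sum>p\<in>P. f p z) \<and>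
       (\<forall>w\<in>ball z r. ((\<lambda>z. \<Sum>p\<in>P. f p z) has_field_derivative (\<Sum>p\<in>P. deriv (f p) w)) (at w))"
    proof (rule eventually_finite_subsets_at_top_weakI, intro conjI ballI)
      fix P assume P: "finite P" "P \<subseteq> X"
      show "continuous_on (cball z r) (\<lambda>z. \<Sum>p\<in>P. f p z)"
        using P r hol by (intro continuous_intros) (meson holomorphic_on_imp_continuous_on continuous_on_subset subsetD)
      fix w assume "w \<in> ball z r"
      then have "w \<in> ball a R" using r(2) by (meson ball_subset_cball subsetD)
      then show "((\<lambda>z. \<Sum>p\<in>P. f p z) has_field_derivative (\<Sum>p\<in>P. deriv (f p) w)) (at w)"
        using P hol by (intro DERIV_sum) (auto intro!: holomorphic_derivI[OF _ open_ball])
    qed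
    moreover have "uniform_limit (cball z r) (\<lambda>P z. \<Sum>p\<in>P. f p z) (\<lambda>z. \<Sum>\<^sub>\<infinity>p\<in>X. f p z) (finite_subsets_at_top X)"
      by (rule Weierstrass_m_test_general[OF _ M]) (use le r in auto)
    ultimately obtain g' where g': "\<And>w. w \<in> ball z r \<Longrightarrow>
        ((\<lambda>z. \<Sum>\<^sub>\<infinity>p\<in>X. f p z) has_field_derivative g' w) (at w) \<and>
        ((\<lambda>P. \<Sum>p\<in>P. deriv (f p) w) \<longlongrightarrow> g' w) (finite_subsets_at_top X)"
      by (rule has_complex_derivative_uniform_limit[OF _ _ finite_subsets_at_top_neq_bot r(1)]) blast
    then show ?thesis
      using r(1) by (intro exI[of _ "g' z"]) (auto simp: has_sum_def)
  qed
  then show "(\<lambda>z. \<Sum>\<^sub>\<infinity>p\<in>X. f p z) holomorphic_on ball a R"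
    unfolding holomorphic_on_def field_differentiable_def
    by (blast intro: has_field_derivative_at_within)
  fix z assume "z \<in> ball a R"
  with * show "((\<lambda>p. deriv (f p) z) has_sum deriv (\<lambda>z. \<Sum>\<^sub>\<infinity>p\<in>X. f p z) z) X"
    by (metis DERIV_imp_deriv)
qed

section \<open>Rational functions ramified over four points\<close>

text \<open>The numerator of the derivative of \<open>p / q\<close> over the denominator
  \<open>q ^ 2\<close>.\<close>

definition wronskian :: "complex poly \<Rightarrow> complex poly \<Rightarrow> complex poly" where
  "wronskian p q = pderiv p * q - p * pderiv q"

text \<open>These are Lattes maps: the last condition is the differential equation for
  \<open>f = p / q\<close> multiplied by \<open>q ^ 4\<close>. The condition on the degrees says
  that infinity is a simple preimage of itself.\<close>

definition lattes ::
  "complex \<Rightarrow> complex \<Rightarrow> complex \<Rightarrow> complex poly \<Rightarrow> complex poly \<Rightarrow> complex \<Rightarrow> bool" where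
  "lattes e1 e2 e3 p q \<kappa> \<longleftrightarrow> distinct [e1, e2, e3] \<and> (\<forall>x. poly p x = 0 \<longrightarrow> poly q x \<noteq> 0) \<and>
     degree p = Suc (degree q) \<and> \<kappa> \<noteq> 0 \<and>
     [:- e1, 1:] * [:- e2, 1:] * [:- e3, 1:] * wronskian p q ^ 2 =
       smult \<kappa> (q * (p - smult e1 q) * (p - smult e2 q) * (p - smult e3 q))"

lemma wronskian_diff_smult: "wronskian (p - smult e q) q = wronskian p q"
  by (simp add: wronskian_def pderiv_diff pderiv_smult algebra_simps)

lemma wronskian_swap: "wronskian q p = - wronskian p q"
  by (simp add: wronskian_def algebra_simps)

lemma order_linear_factor: "order a [:- b, 1:] = (if a = b then 1 else (0::nat))" for a b :: complex
proof (cases "a = b")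
  case True
  then show ?thesis using order_power_n_n[of a 1] by simp
next
  case False
  then have "poly [:- b, 1:] a \<noteq> 0" by simp
  then have "order a [:- b, 1:] = 0" by (rule order_0I)
  then show ?thesis using False by simp
qed

text \<open>With \<open>t = (x - a)^m u\<close>, the cofactor of \<open>(x - a)^(m - 1)\<close> in
  the Wronskian takes the value \<open>m * u(a) * s(a)\<close> at \<open>a\<close>, which is nonzero
  in characteristic zero.\<close>

lemma order_wronskian:
  fixes t s :: "complex poly"
  assumes t: "t \<noteq> 0" "poly t a = 0" and s: "poly s a \<noteq> 0"
  shows "wronskian t s \<noteq> 0" "order a (wronskian t s) = order a t - 1"
proof -
  define m where "m = order a t"
  have m: "m > 0" using t by (simp add: m_def order_root)
  obtain u where u: "t = [:- a, 1:] ^ m * u" "\<not> [:- a, 1:] dvd u"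
    using order_decomp[OF t(1), of a] by (auto simp: m_def)
  then have ua: "poly u a \<noteq> 0" by (simp add: poly_eq_0_iff_dvd)
  obtain n where n: "m = Suc n" using m by (cases m) auto
  define v where "v = smult (of_nat m) (u * s) + [:- a, 1:] * (pderiv u * s - u * pderiv s)"
  have W: "wronskian t s = [:- a, 1:] ^ n * v"
  proof -
    define L where "L = [:- a, 1:]"
    have "pderiv L = 1" by (simp add: L_def pderiv_pCons)
    then have "pderiv t = L ^ n * (smult (of_nat m) u + L * pderiv u)"
      unfolding u(1) pderiv_mult n pderiv_power_Suc L_def[symmetric] by (simp add: algebra_simps)
    then show ?thesis
      unfolding wronskian_def v_def L_def[symmetric] by (simp add: u(1) n L_def[symmetric] algebra_simps)
  qed
  have va: "poly v a \<noteq> 0" using ua s m by (simp add: v_def)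
  then have v0: "v \<noteq> 0" by auto
  then show W0: "wronskian t s \<noteq> 0" unfolding W by simp
  have "order a ([:- a, 1:] ^ n * v) = n"
    using W0 va order_power_n_n[of a n] order_0I[OF va] unfolding W by (subst order_mult) (auto simp del: mult_pCons_left)
  then show "order a (wronskian t s) = order a t - 1" unfolding W m_def[symmetric] n by simp
qed

text \<open>Comparison of orders at \<open>a\<close>: if \<open>m\<close> is the order of
  \<open>t\<close>, the left side has order \<open>\<epsilon> + 2 (m - 1)\<close>, where
  \<open>\<epsilon>\<close> is 1 or 0 according to whether \<open>a\<close> is one of the
  \<open>e\<close>s, and the right side has order \<open>m\<close>. Hence
  \<open>m = 2 - \<epsilon>\<close>.\<close>

lemma lattes_order_aux:
  assumes e: "distinct [e1, e2, e3]" and \<kappa>: "\<kappa> \<noteq> 0"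
    and eq: "[:- e1, 1:] * [:- e2, 1:] * [:- e3, 1:] * wronskian t s ^ 2 = smult \<kappa> (t * u)"
    and t: "t \<noteq> 0" "poly t a = 0" and "poly s a \<noteq> 0" and u: "poly u a \<noteq> 0"
  shows "order a t = (if a \<in> {e1, e2, e3} then 1 else 2)"
proof -
  note w = order_wronskian[OF t \<open>poly s a \<noteq> 0\<close>]
  have u0: "u \<noteq> 0" using u by auto
  have "order a ([:- e1, 1:] * [:- e2, 1:] * [:- e3, 1:] * wronskian t s ^ 2) =
     order a [:- e1, 1:] + order a [:- e2, 1:] + order a [:- e3, 1:] + 2 * order a (wronskian t s)"
    using w(1) by (subst order_mult; simp del: mult_pCons_left mult_pCons_right)+ 
      (simp add: order_mult power2_eq_square)
  also have "\<dots> = (if a \<in> {e1, e2, e3} then 1 else 0) + 2 * (order a t - 1)"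
    using e w(2) by (auto simp: order_linear_factor)
  finally have "order a (smult \<kappa> (t * u)) = (if a \<in> {e1, e2, e3} then 1 else 0) + 2 * (order a t - 1)"
    by (simp only: eq)
  moreover have "order a (smult \<kappa> (t * u)) = order a t"
    using \<kappa> u0 t order_0I[OF u] by (simp add: order_smult order_mult)
  moreover have "order a t > 0" using t by (simp add: order_root)
  ultimately show ?thesis by (auto split: if_splits)
qed

lemma lattes_nonzero:
  assumes "lattes e1 e2 e3 p q \<kappa>"
  shows "p \<noteq> 0" "q \<noteq> 0" "p - smult e q \<noteq> 0" "degree (p - smult e q) = degree p"
    "lead_coeff (p - smult e q) = lead_coeff p"
proof -
  have d: "degree p = Suc (degree q)" and nr: "\<forall>x. poly p x = 0 \<longrightarrow> poly q x \<noteq> 0"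
    using assms by (auto simp: lattes_def)
  show p: "p \<noteq> 0" using d by auto
  have "\<not> constant (poly p)" using d by (simp add: constant_degree)
  then obtain x where "poly p x = 0" using fundamental_theorem_of_algebra by blast
  then show "q \<noteq> 0" using nr by auto
  have lt: "degree (- smult e q) < degree p" using d degree_smult_le[of e q] by simp
  from degree_add_eq_left[OF this] show d': "degree (p - smult e q) = degree p" by simp
  show "lead_coeff (p - smult e q) = lead_coeff p"
    unfolding d' using d degree_smult_le[of e q] by (simp add: coeff_eq_0)
  show "p - smult e q \<noteq> 0" using d' d by auto
qed

lemma lattes_perm:
  assumes "lattes e1 e2 e3 p q \<kappa>"
  shows "lattes e2 e1 e3 p q \<kappa>" "lattes e1 e3 e2 p q \<kappa>"
  using assms unfolding lattes_def by (auto simp: mult_ac simp del: mult_pCons_left mult_pCons_right)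

lemma lattes_order_q:
  assumes L: "lattes e1 e2 e3 p q \<kappa>" and a: "poly q a = 0"
  shows "order a q = (if a \<in> {e1, e2, e3} then 1 else 2)"
proof (rule lattes_order_aux[where s = p and u = "(p - smult e1 q) * (p - smult e2 q) * (p - smult e3 q)" and \<kappa> = \<kappa>])
  have pa: "poly p a \<noteq> 0" using L a by (auto simp: lattes_def)
  then show "poly p a \<noteq> 0" "poly ((p - smult e1 q) * (p - smult e2 q) * (p - smult e3 q)) a \<noteq> 0"
    using a by auto
  show "[:- e1, 1:] * [:- e2, 1:] * [:- e3, 1:] * wronskian q p ^ 2 =
      smult \<kappa> (q * ((p - smult e1 q) * (p - smult e2 q) * (p - smult e3 q)))"
    using L unfolding lattes_def wronskian_swap[of q p] by (simp only: power2_minus mult.assoc)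
qed (use L a lattes_nonzero[OF L] in \<open>auto simp: lattes_def\<close>)

lemma lattes_order_e1:
  assumes L: "lattes e1 e2 e3 p q \<kappa>" and a: "poly (p - smult e1 q) a = 0"
  shows "order a (p - smult e1 q) = (if a \<in> {e1, e2, e3} then 1 else 2)"
proof (rule lattes_order_aux[where s = q and u = "q * (p - smult e2 q) * (p - smult e3 q)" and \<kappa> = \<kappa>])
  have e: "distinct [e1, e2, e3]" and nr: "poly p a = 0 \<longrightarrow> poly q a \<noteq> 0" using L by (auto simp: lattes_def)
  then show qa: "poly q a \<noteq> 0" using a by auto
  have "poly p a = e1 * poly q a" using a by simp
  then show "poly (q * (p - smult e2 q) * (p - smult e3 q)) a \<noteq> 0" using qa e by auto
  show "[:- e1, 1:] * [:- e2, 1:] * [:- e3, 1:] * wronskian (p - smult e1 q) q ^ 2 =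
      smult \<kappa> ((p - smult e1 q) * (q * (p - smult e2 q) * (p - smult e3 q)))"
    using L unfolding lattes_def wronskian_diff_smult by (simp only: mult_ac)
qed (use L a lattes_nonzero[OF L] in \<open>auto simp: lattes_def\<close>)

lemma lattes_order:
  assumes L: "lattes e1 e2 e3 p q \<kappa>" and t: "t \<in> {q, p - smult e1 q, p - smult e2 q, p - smult e3 q}"
    and a: "poly t a = 0"
  shows "order a t = (if a \<in> {e1, e2, e3} then 1 else 2)"
proof -
  have L2: "lattes e2 e1 e3 p q \<kappa>" and L3: "lattes e3 e1 e2 p q \<kappa>"
    using L lattes_perm by blast+
  from t consider "t = q" | "t = p - smult e1 q" | "t = p - smult e2 q" | "t = p - smult e3 q" by blast
  then show ?thesis
  proof cases
    case 1 then show ?thesis using lattes_order_q[OF L] a by simp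
  next
    case 2 then show ?thesis using lattes_order_e1[OF L] a by simp
  next
    case 3 then show ?thesis using lattes_order_e1[OF L2, of a] a by auto
  next
    case 4 then show ?thesis using lattes_order_e1[OF L3, of a] a by auto
  qed
qed

section \<open>Factorization of the numerators and the denominator\<close>

definition lin_prod :: "complex list \<Rightarrow> complex poly" where
  "lin_prod as = (\<Prod>a\<leftarrow>as. [:- a, 1:])"

lemma lin_prod_simps [simp]: "lin_prod [] = 1" "lin_prod (a # as) = [:- a, 1:] * lin_prod as"
  "lin_prod (as @ bs) = lin_prod as * lin_prod bs"
  by (simp_all add: lin_prod_def del: mult_pCons_left)

lemma sq_prod_eq: "sq_prod as = lin_prod as ^ 2"
  by (induction as) (simp_all add: sq_prod_def power_mult_distrib del: mult_pCons_left)

lemma lin_prod_nz [simp]: "lin_prod as \<noteq> 0"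
  by (induction as) (auto simp del: mult_pCons_left)

lemma degree_lin_prod [simp]: "degree (lin_prod as) = length as"
  by (induction as) (auto simp: degree_mult_eq simp del: mult_pCons_left)

lemma lead_coeff_lin_prod [simp]: "lead_coeff (lin_prod as) = 1"
  by (induction as) (auto simp: lead_coeff_mult simp del: mult_pCons_left degree_lin_prod)

lemma poly_lin_prod_eq_0 [simp]: "poly (lin_prod as) x = 0 \<longleftrightarrow> x \<in> set as"
  by (induction as) (auto simp del: mult_pCons_left)

lemma lin_prod_dvd:
  assumes "distinct as" "\<And>a. a \<in> set as \<Longrightarrow> poly p a = 0"
  shows "lin_prod as dvd p"
  using assms
proof (induction as)
  case (Cons a as)
  then obtain r where r: "p = lin_prod as * r" by auto
  have "poly (lin_prod as) a \<noteq> 0" using Cons by simp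
  then have "poly r a = 0" using Cons.prems(2)[of a] r by auto
  then obtain s where "r = [:- a, 1:] * s" by (auto simp: poly_eq_0_iff_dvd)
  then show ?case using r by (simp add: mult_ac del: mult_pCons_left mult_pCons_right)
qed auto

lemma prod_linear_set: "distinct xs \<Longrightarrow> (\<Prod>x\<in>set xs. [:- x, 1:] ^ n) = lin_prod xs ^ n"
  by (induction xs) (auto simp: power_mult_distrib simp del: mult_pCons_left)

text \<open>All multiplicities of roots are known, so \<open>t\<close> factors exactly as one side
  of the systems does: simple factors at the \<open>e\<close>s, squares elsewhere. The formula for
  the degree is the source of the parity count.\<close>

lemma lattes_factor:
  assumes L: "lattes e1 e2 e3 p q \<kappa>" and t: "t \<in> {q, p - smult e1 q, p - smult e2 q, p - smult e3 q}"
    and es: "distinct es" "set es = {x \<in> {e1, e2, e3}. poly t x = 0}"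
  obtains as where "t = smult (lead_coeff t) (lin_prod es * sq_prod as)" "distinct as"
    "set as = {x. poly t x = 0} - {e1, e2, e3}" "degree t = length es + 2 * length as"
proof -
  have t0: "t \<noteq> 0" using t lattes_nonzero[OF L] by auto
  have fin: "finite {x. poly t x = 0}" using t0 by (rule poly_roots_finite)
  then obtain as where as: "set as = {x. poly t x = 0} - {e1, e2, e3}" "distinct as"
    using finite_distinct_list by (metis finite_Diff)
  have "t = smult (lead_coeff t) (\<Prod>z|poly t z = 0. [:- z, 1:] ^ order z t)"
    by (simp add: complex_poly_decompose)
  also have "{x. poly t x = 0} = set es \<union> set as" using es as by auto
  also have "(\<Prod>z\<in>set es \<union> set as. [:- z, 1:] ^ order z t) =
       (\<Prod>z\<in>set es. [:- z, 1:] ^ order z t) * (\<Prod>z\<in>set as. [:- z, 1:] ^ order z t)"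
    by (rule prod.union_disjoint) (simp, simp, use es(2) as(1) in blast)
  also have "(\<Prod>z\<in>set es. [:- z, 1:] ^ order z t) = (\<Prod>z\<in>set es. [:- z, 1:] ^ 1)"
    using es lattes_order[OF L t] by (intro prod.cong) auto
  also have "(\<Prod>z\<in>set as. [:- z, 1:] ^ order z t) = (\<Prod>z\<in>set as. [:- z, 1:] ^ 2)"
    using as lattes_order[OF L t] by (intro prod.cong) auto
  also have "(\<Prod>z\<in>set es. [:- z, 1:] ^ 1) = lin_prod es"
    using prod_linear_set[OF es(1), of 1] by (simp del: power_Suc)
  also have "(\<Prod>z\<in>set as. [:- z, 1:] ^ 2) = sq_prod as"
    using prod_linear_set[OF as(2), of 2] by (simp only: sq_prod_eq)
  finally have eq: "t = smult (lead_coeff t) (lin_prod es * sq_prod as)" .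
  have "degree t = degree (lin_prod es * sq_prod as)" using t0 by (subst eq) simp
  also have "\<dots> = length es + 2 * length as"
    by (simp add: degree_mult_eq sq_prod_eq degree_power_eq)
  finally show ?thesis using that eq as by blast
qed

text \<open>The Wronskian is quadratic in the pair, so both sides of the identity are homogeneous of
  degree four.\<close>

lemma lattes_scale:
  assumes "lattes e1 e2 e3 p q \<kappa>" "c \<noteq> 0"
  shows "lattes e1 e2 e3 (smult c p) (smult c q) \<kappa>"
proof -
  have "wronskian (smult c p) (smult c q) = smult (c ^ 2) (wronskian p q)"
    by (simp add: wronskian_def pderiv_smult power2_eq_square smult_diff_right algebra_simps)
  moreover have "smult c p - smult e (smult c q) = smult c (p - smult e q)" for e
    by (simp add: smult_diff_right mult.commute)
  moreover have "(smult (c ^ 2) (wronskian p q)) ^ 2 = smult (c ^ 4) (wronskian p q ^ 2)"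
    by (simp add: smult_power)
  ultimately show ?thesis
    using assms unfolding lattes_def
    by (simp del: mult_pCons_left mult_pCons_right) (simp add: mult_ac eval_nat_numeral smult_diff_right)
qed

text \<open>Conjugation by \<open>x \<mapsto> \<alpha> x + \<beta>\<close>, whose inverse is
  \<open>r\<close>: the new map is \<open>\<alpha> f(r(x)) + \<beta>\<close>. Both sides of the
  differential equation scale by \<open>\<alpha> ^ 3\<close>, so \<open>\<kappa>\<close> survives.
  This moves between general branch values and the normalized triple.\<close>

lemma lattes_affine:
  fixes \<beta> :: complex
  assumes L: "lattes e1 e2 e3 p q \<kappa>" and \<alpha>: "\<alpha> \<noteq> 0"
  defines "r \<equiv> [:- \<beta> / \<alpha>, 1 / \<alpha>:]"
  defines "q' \<equiv> pcompose q r" and "p' \<equiv> smult \<alpha> (pcompose p r) + smult \<beta> (pcompose q r)"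
  shows "lattes (\<alpha> * e1 + \<beta>) (\<alpha> * e2 + \<beta>) (\<alpha> * e3 + \<beta>) p' q' \<kappa>"
    "degree p' = degree p" "degree q' = degree q"
    "\<And>x. poly q' (\<alpha> * x + \<beta>) = poly q x"
    "\<And>e x. poly (p' - smult (\<alpha> * e + \<beta>) q') (\<alpha> * x + \<beta>) = \<alpha> * poly (p - smult e q) x"
proof -
  have rx: "poly r (\<alpha> * x + \<beta>) = x" for x using \<alpha> by (simp add: r_def field_simps)
  have dr: "degree r = Suc 0" using \<alpha> by (simp add: r_def)
  have t: "p' - smult (\<alpha> * e + \<beta>) q' = smult \<alpha> (pcompose (p - smult e q) r)" for e
    by (simp add: p'_def q'_def pcompose_diff pcompose_smult smult_diff_right smult_add_left)
  show dq: "degree q' = degree q" by (simp add: q'_def dr degree_pcompose)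
  have "degree (p' - smult (\<alpha> * 0 + \<beta>) q') = degree p" unfolding t using \<alpha> lattes_nonzero(4)[OF L] by (simp add: dr degree_pcompose)
  moreover have "degree (smult \<beta> q') < degree p"
    using dq L degree_smult_le[of \<beta> q'] by (simp add: lattes_def)
  ultimately have "degree ((p' - smult \<beta> q') + smult \<beta> q') = degree p"
    by (subst degree_add_eq_left) auto
  then show dp: "degree p' = degree p" by simp
  show qx: "poly q' (\<alpha> * x + \<beta>) = poly q x" for x by (simp add: q'_def poly_pcompose rx)
  show px: "poly (p' - smult (\<alpha> * e + \<beta>) q') (\<alpha> * x + \<beta>) = \<alpha> * poly (p - smult e q) x" for e x
    unfolding t by (simp add: poly_pcompose rx)
  have D: "pderiv r = [:1 / \<alpha>:]" by (simp add: r_def pderiv_pCons)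
  have W: "wronskian p' q' = pcompose (wronskian p q) r"
  proof -
    have "wronskian p' q' = wronskian (p' - smult (\<alpha> * 0 + \<beta>) q') q'" by (simp only: wronskian_diff_smult)
    also have "\<dots> = pcompose (wronskian p q) r"
      unfolding t using \<alpha>
      by (simp add: wronskian_def q'_def pderiv_smult pderiv_pcompose D pcompose_diff pcompose_mult)
    finally show ?thesis .
  qed
  have lin: "[:- (\<alpha> * e + \<beta>), 1:] = smult \<alpha> (pcompose [:- e, 1:] r)" for e
    using \<alpha> by (simp add: r_def pcompose_pCons field_simps)
  have "[:- (\<alpha> * e1 + \<beta>), 1:] * [:- (\<alpha> * e2 + \<beta>), 1:] * [:- (\<alpha> * e3 + \<beta>), 1:] * wronskian p' q' ^ 2
     = smult (\<alpha> ^ 3) (pcompose ([:- e1, 1:] * [:- e2, 1:] * [:- e3, 1:] * wronskian p q ^ 2) r)"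
    unfolding lin W pcompose_mult power2_eq_square power3_eq_cube by (simp only: mult_smult_left mult_smult_right smult_smult mult.assoc)
  also have "[:- e1, 1:] * [:- e2, 1:] * [:- e3, 1:] * wronskian p q ^ 2 =
      smult \<kappa> (q * (p - smult e1 q) * (p - smult e2 q) * (p - smult e3 q))"
    using L by (simp only: lattes_def)
  also have "smult (\<alpha> ^ 3) (pcompose (smult \<kappa> (q * (p - smult e1 q) * (p - smult e2 q) * (p - smult e3 q))) r) =
     smult \<kappa> (q' * (p' - smult (\<alpha> * e1 + \<beta>) q') * (p' - smult (\<alpha> * e2 + \<beta>) q') * (p' - smult (\<alpha> * e3 + \<beta>) q'))"
    unfolding t unfolding pcompose_mult pcompose_smult q'_def power3_eq_cube
    by (simp only: mult_smult_left mult_smult_right smult_smult mult_ac)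
  finally have eq: "[:- (\<alpha> * e1 + \<beta>), 1:] * [:- (\<alpha> * e2 + \<beta>), 1:] * [:- (\<alpha> * e3 + \<beta>), 1:] * wronskian p' q' ^ 2 =
     smult \<kappa> (q' * (p' - smult (\<alpha> * e1 + \<beta>) q') * (p' - smult (\<alpha> * e2 + \<beta>) q') * (p' - smult (\<alpha> * e3 + \<beta>) q'))" .
  have nr: "poly q' x \<noteq> 0" if "poly p' x = 0" for x
  proof
    assume "poly q' x = 0"
    then have "poly q (poly r x) = 0" "poly p (poly r x) = 0"
      using that \<alpha> by (auto simp: p'_def q'_def poly_pcompose)
    then show False using L by (auto simp: lattes_def)
  qed
  show "lattes (\<alpha> * e1 + \<beta>) (\<alpha> * e2 + \<beta>) (\<alpha> * e3 + \<beta>) p' q' \<kappa>"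
    unfolding lattes_def using L eq nr dp dq \<alpha> by (auto simp: lattes_def simp del: mult_pCons_left mult_pCons_right)
qed

text \<open>A single \<open>k\<close> serves three polynomials because subtracting a multiple of
  \<open>q\<close>, which has smaller degree, does not change the leading coefficient of
  \<open>p\<close>. The four lists are disjoint since \<open>p / q\<close> takes four different
  values on them, namely infinity, 0, 1 and \<open>l\<close>.\<close>

lemma lattes_imp_factors:
  assumes L: "lattes 0 1 l p q \<kappa>" and q: "lead_coeff q = 1"
    and Sq: "distinct sq" "set sq = {x \<in> {0, 1, l}. poly q x = 0}"
    and S1: "distinct s1" "set s1 = {x \<in> {0, 1, l}. poly p x = 0}"
    and S2: "distinct s2" "set s2 = {x \<in> {0, 1, l}. poly p x = poly q x}"
    and S3: "distinct s3" "set s3 = {x \<in> {0, 1, l}. poly p x = l * poly q x}"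
  obtains k as bs cs ds where "admissible k l as bs cs ds"
    "q = lin_prod sq * sq_prod bs" "p = smult k (lin_prod s1 * sq_prod as)"
    "p - q = smult k (lin_prod s2 * sq_prod cs)" "p - smult l q = smult k (lin_prod s3 * sq_prod ds)"
    "degree q = length sq + 2 * length bs" "degree p = length s1 + 2 * length as"
    "degree p = length s2 + 2 * length cs" "degree p = length s3 + 2 * length ds"
proof -
  define k where "k = lead_coeff p"
  have k: "k \<noteq> 0" using lattes_nonzero(1)[OF L] by (simp add: k_def)
  note nz = lattes_nonzero[OF L]
  have l: "l \<noteq> 0" "l \<noteq> 1" and nr: "\<And>x. poly p x = 0 \<Longrightarrow> poly q x \<noteq> 0" using L by (auto simp: lattes_def)
  obtain bs where bs: "q = smult (lead_coeff q) (lin_prod sq * sq_prod bs)" "distinct bs"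
    "set bs = {x. poly q x = 0} - {0, 1, l}" "degree q = length sq + 2 * length bs"
    by (rule lattes_factor[OF L _ Sq]) auto
  obtain as where as: "p - smult 0 q = smult (lead_coeff (p - smult 0 q)) (lin_prod s1 * sq_prod as)" "distinct as"
    "set as = {x. poly (p - smult 0 q) x = 0} - {0, 1, l}" "degree (p - smult 0 q) = length s1 + 2 * length as"
    by (rule lattes_factor[OF L _ S1(1), where t = "p - smult 0 q"]) (use S1 in auto)
  obtain cs where cs: "p - smult 1 q = smult (lead_coeff (p - smult 1 q)) (lin_prod s2 * sq_prod cs)" "distinct cs"
    "set cs = {x. poly (p - smult 1 q) x = 0} - {0, 1, l}" "degree (p - smult 1 q) = length s2 + 2 * length cs"
    by (rule lattes_factor[OF L _ S2(1), where t = "p - smult 1 q"]) (use S2 in auto)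
  obtain ds where ds: "p - smult l q = smult (lead_coeff (p - smult l q)) (lin_prod s3 * sq_prod ds)" "distinct ds"
    "set ds = {x. poly (p - smult l q) x = 0} - {0, 1, l}" "degree (p - smult l q) = length s3 + 2 * length ds"
    by (rule lattes_factor[OF L _ S3(1), where t = "p - smult l q"]) (use S3 in auto)
  have sets: "set bs = {x. poly q x = 0} - {0, 1, l}" "set as = {x. poly p x = 0} - {0, 1, l}"
    "set cs = {x. poly p x = poly q x} - {0, 1, l}" "set ds = {x. poly p x = l * poly q x} - {0, 1, l}"
    using bs(3) as(3) cs(3) ds(3) by simp_all
  have "admissible k l as bs cs ds"
    unfolding admissible_def distinct.simps distinct_append set_append list.set
  proof (intro conjI)
    have "x \<notin> set bs" "x \<notin> set cs" "x \<notin> set ds" if "x \<in> set as" for x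
      using that nr[of x] l unfolding sets by auto
    then show "set as \<inter> (set bs \<union> (set cs \<union> set ds)) = {}" by blast
    have "x \<notin> set cs" "x \<notin> set ds" if "x \<in> set bs" for x
      using that nr[of x] l unfolding sets by auto
    then show "set bs \<inter> (set cs \<union> set ds) = {}" by blast
    have "x \<notin> set ds" if "x \<in> set cs" for x
      using that nr[of x] l unfolding sets by auto
    then show "set cs \<inter> set ds = {}" by blast
  qed (use k l bs(2) as(2) cs(2) ds(2) in \<open>auto simp: sets\<close>)
  moreover have "p = smult k (lin_prod s1 * sq_prod as)" "p - q = smult k (lin_prod s2 * sq_prod cs)"
    "p - smult l q = smult k (lin_prod s3 * sq_prod ds)" "q = lin_prod sq * sq_prod bs"
    using as(1) cs(1) ds(1) bs(1) unfolding nz(5) q k_def by simp_all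
  moreover have "degree p = length s1 + 2 * length as" "degree p = length s2 + 2 * length cs"
    "degree p = length s3 + 2 * length ds"
    using as(4) cs(4) ds(4) unfolding nz(4) by simp_all
  ultimately show ?thesis using bs(4) that by blast
qed

text \<open>The six disjuncts below are the six ways in which the rational function \<open>p / q\<close>
  can map the four points \<open>0, 1, l, \<infinity>\<close> to each other, one for each system.\<close>

definition lattes_type :: "complex \<Rightarrow> complex \<Rightarrow> complex \<Rightarrow> complex poly \<Rightarrow> complex poly \<Rightarrow> bool" where
  "lattes_type a b c p q \<longleftrightarrow>
     poly p a = a * poly q a \<and> poly p b = b * poly q b \<and> poly p c = c * poly q c \<or>
     poly p a = a * poly q a \<and> poly p c = b * poly q c \<and> poly p b = c * poly q b \<or>
     poly p c = a * poly q c \<and> poly p a = b * poly q a \<and> poly p b = c * poly q b \<or>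
     poly q a = 0 \<and> poly q b = 0 \<and> poly q c = 0 \<or>
     poly q a = 0 \<and> poly p b = a * poly q b \<and> poly p c = a * poly q c \<or>
     poly q c = 0 \<and> poly p a = a * poly q a \<and> poly p b = a * poly q b"

lemma is_solution_of_lattes_type:
  assumes L: "lattes 0 1 l p q \<kappa>" and q: "lead_coeff q = 1" and ty: "lattes_type 0 1 l p q"
    and D: "degree p = D"
  shows "\<exists>k as bs cs ds. is_solution D k l as bs cs ds"
proof -
  have l: "l \<noteq> 0" "l \<noteq> 1" "0 \<noteq> l" "1 \<noteq> l" and nr: "\<And>x. poly p x = 0 \<Longrightarrow> poly q x \<noteq> 0"
    and dq: "D = Suc (degree q)"
    using L D by (auto simp: lattes_def)
  note nr' = nr[of 0] nr[of 1] nr[of l]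
  \<comment> \<open>The lists \<open>sq\<close>, \<open>s1\<close>, \<open>s2\<close>,
    \<open>s3\<close> sort the points 0, 1, \<open>l\<close> by their value under
    \<open>p / q\<close>. Each type fixes all three values and hence all four lists; the degrees
    then give the lengths of the unknowns and the parity of \<open>D\<close>.\<close>
  have F: "\<exists>k as bs cs ds. admissible k l as bs cs ds \<and>
     smult k (lin_prod s1 * sq_prod as) - lin_prod sq * sq_prod bs = smult k (lin_prod s2 * sq_prod cs) \<and>
     smult k (lin_prod s1 * sq_prod as) - smult l (lin_prod sq * sq_prod bs) = smult k (lin_prod s3 * sq_prod ds) \<and>
     D = Suc (length sq + 2 * length bs) \<and> D = length s1 + 2 * length as \<and>
     D = length s2 + 2 * length cs \<and> D = length s3 + 2 * length ds"
    if "distinct sq" "set sq = {x \<in> {0, 1, l}. poly q x = 0}"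
       "distinct s1" "set s1 = {x \<in> {0, 1, l}. poly p x = 0}"
       "distinct s2" "set s2 = {x \<in> {0, 1, l}. poly p x = poly q x}"
       "distinct s3" "set s3 = {x \<in> {0, 1, l}. poly p x = l * poly q x}" for sq s1 s2 s3
    by (rule lattes_imp_factors[OF L q that]) (metis D dq)
  note is_def = is_solution_def system1_def system2_def system3_def system4_def system5_def system6_def
  from ty consider
      "poly p 0 = 0" "poly p 1 = poly q 1" "poly p l = l * poly q l"
    | "poly p 0 = 0" "poly p l = poly q l" "poly p 1 = l * poly q 1"
    | "poly p l = 0" "poly p 0 = poly q 0" "poly p 1 = l * poly q 1"
    | "poly q 0 = 0" "poly q 1 = 0" "poly q l = 0"
    | "poly q 0 = 0" "poly p 1 = 0" "poly p l = 0"
    | "poly q l = 0" "poly p 0 = 0" "poly p 1 = 0"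
    by (auto simp: lattes_type_def)
  then show ?thesis
  proof cases
    case 1
    then have "\<exists>k as bs cs ds. admissible k l as bs cs ds \<and>
     smult k (lin_prod [0] * sq_prod as) - lin_prod [] * sq_prod bs = smult k (lin_prod [1] * sq_prod cs) \<and>
     smult k (lin_prod [0] * sq_prod as) - smult l (lin_prod [] * sq_prod bs) = smult k (lin_prod [l] * sq_prod ds) \<and>
     D = Suc (length ([] :: complex list) + 2 * length bs) \<and> D = length ([0] :: complex list) + 2 * length as \<and>
     D = length ([1] :: complex list) + 2 * length cs \<and> D = length ([l] :: complex list) + 2 * length ds"
      using nr' l by (intro F) auto
    then obtain k as bs cs ds where f: "admissible k l as bs cs ds"
      "smult k (lin_prod [0] * sq_prod as) - lin_prod [] * sq_prod bs = smult k (lin_prod [1] * sq_prod cs)"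
      "smult k (lin_prod [0] * sq_prod as) - smult l (lin_prod [] * sq_prod bs) = smult k (lin_prod [l] * sq_prod ds)"
      and len: "D = Suc (0 + 2 * length bs)" "D = 1 + 2 * length as" "D = 1 + 2 * length cs" "D = 1 + 2 * length ds"
      by auto
    have "odd D" using len(1) by simp
    moreover have "length as = (D - 1) div 2" using len(2) by simp
    moreover have "length bs = (D - 1) div 2" using len(1) by simp
    moreover have "length cs = (D - 1) div 2" using len(3) by simp
    moreover have "length ds = (D - 1) div 2" using len(4) by simp
    ultimately have "is_solution D k l as bs cs ds"
      using f by (simp add: is_def mult.assoc del: mult_pCons_left mult_pCons_right)
    then show ?thesis by blast
  next
    case 2
    then have "\<exists>k as bs cs ds. admissible k l as bs cs ds \<and>
     smult k (lin_prod [0] * sq_prod as) - lin_prod [] * sq_prod bs = smult k (lin_prod [l] * sq_prod cs) \<and>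
     smult k (lin_prod [0] * sq_prod as) - smult l (lin_prod [] * sq_prod bs) = smult k (lin_prod [1] * sq_prod ds) \<and>
     D = Suc (length ([] :: complex list) + 2 * length bs) \<and> D = length ([0] :: complex list) + 2 * length as \<and>
     D = length ([l] :: complex list) + 2 * length cs \<and> D = length ([1] :: complex list) + 2 * length ds"
      using nr' l by (intro F) auto
    then obtain k as bs cs ds where f: "admissible k l as bs cs ds"
      "smult k (lin_prod [0] * sq_prod as) - lin_prod [] * sq_prod bs = smult k (lin_prod [l] * sq_prod cs)"
      "smult k (lin_prod [0] * sq_prod as) - smult l (lin_prod [] * sq_prod bs) = smult k (lin_prod [1] * sq_prod ds)"
      and len: "D = Suc (0 + 2 * length bs)" "D = 1 + 2 * length as" "D = 1 + 2 * length cs" "D = 1 + 2 * length ds"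
      by auto
    have "odd D" using len(1) by simp
    moreover have "length as = (D - 1) div 2" using len(2) by simp
    moreover have "length bs = (D - 1) div 2" using len(1) by simp
    moreover have "length cs = (D - 1) div 2" using len(3) by simp
    moreover have "length ds = (D - 1) div 2" using len(4) by simp
    ultimately have "is_solution D k l as bs cs ds"
      using f by (simp add: is_def mult.assoc del: mult_pCons_left mult_pCons_right)
    then show ?thesis by blast
  next
    case 3
    then have "\<exists>k as bs cs ds. admissible k l as bs cs ds \<and>
     smult k (lin_prod [l] * sq_prod as) - lin_prod [] * sq_prod bs = smult k (lin_prod [0] * sq_prod cs) \<and>
     smult k (lin_prod [l] * sq_prod as) - smult l (lin_prod [] * sq_prod bs) = smult k (lin_prod [1] * sq_prod ds) \<and>
     D = Suc (length ([] :: complex list) + 2 * length bs) \<and> D = length ([l] :: complex list) + 2 * length as \<and>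
     D = length ([0] :: complex list) + 2 * length cs \<and> D = length ([1] :: complex list) + 2 * length ds"
      using nr' l by (intro F) auto
    then obtain k as bs cs ds where f: "admissible k l as bs cs ds"
      "smult k (lin_prod [l] * sq_prod as) - lin_prod [] * sq_prod bs = smult k (lin_prod [0] * sq_prod cs)"
      "smult k (lin_prod [l] * sq_prod as) - smult l (lin_prod [] * sq_prod bs) = smult k (lin_prod [1] * sq_prod ds)"
      and len: "D = Suc (0 + 2 * length bs)" "D = 1 + 2 * length as" "D = 1 + 2 * length cs" "D = 1 + 2 * length ds"
      by auto
    have "odd D" using len(1) by simp
    moreover have "length as = (D - 1) div 2" using len(2) by simp
    moreover have "length bs = (D - 1) div 2" using len(1) by simp
    moreover have "length cs = (D - 1) div 2" using len(3) by simp
    moreover have "length ds = (D - 1) div 2" using len(4) by simp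
    ultimately have "is_solution D k l as bs cs ds"
      using f by (simp add: is_def mult.assoc del: mult_pCons_left mult_pCons_right)
    then show ?thesis by blast
  next
    case 4
    then have "\<exists>k as bs cs ds. admissible k l as bs cs ds \<and>
     smult k (lin_prod [] * sq_prod as) - lin_prod [0, 1, l] * sq_prod bs = smult k (lin_prod [] * sq_prod cs) \<and>
     smult k (lin_prod [] * sq_prod as) - smult l (lin_prod [0, 1, l] * sq_prod bs) = smult k (lin_prod [] * sq_prod ds) \<and>
     D = Suc (length ([0, 1, l] :: complex list) + 2 * length bs) \<and> D = length ([] :: complex list) + 2 * length as \<and>
     D = length ([] :: complex list) + 2 * length cs \<and> D = length ([] :: complex list) + 2 * length ds"
      using nr' l by (intro F) auto
    then obtain k as bs cs ds where f: "admissible k l as bs cs ds"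
      "smult k (lin_prod [] * sq_prod as) - lin_prod [0, 1, l] * sq_prod bs = smult k (lin_prod [] * sq_prod cs)"
      "smult k (lin_prod [] * sq_prod as) - smult l (lin_prod [0, 1, l] * sq_prod bs) = smult k (lin_prod [] * sq_prod ds)"
      and len: "D = Suc (3 + 2 * length bs)" "D = 0 + 2 * length as" "D = 0 + 2 * length cs" "D = 0 + 2 * length ds"
      by auto
    have "even D" using len(3) by simp
    moreover have "length as = D div 2" using len(2) by simp
    moreover have "length bs = D div 2 - 2" using len(1) by simp
    moreover have "length cs = D div 2" using len(3) by simp
    moreover have "length ds = D div 2" using len(4) by simp
    ultimately have "is_solution D k l as bs cs ds"
      using f by (simp add: is_def mult.assoc del: mult_pCons_left mult_pCons_right)
    then show ?thesis by blast
  next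
    case 5
    then have "\<exists>k as bs cs ds. admissible k l as bs cs ds \<and>
     smult k (lin_prod [1, l] * sq_prod as) - lin_prod [0] * sq_prod bs = smult k (lin_prod [] * sq_prod cs) \<and>
     smult k (lin_prod [1, l] * sq_prod as) - smult l (lin_prod [0] * sq_prod bs) = smult k (lin_prod [] * sq_prod ds) \<and>
     D = Suc (length ([0] :: complex list) + 2 * length bs) \<and> D = length ([1, l] :: complex list) + 2 * length as \<and>
     D = length ([] :: complex list) + 2 * length cs \<and> D = length ([] :: complex list) + 2 * length ds"
      using nr' l by (intro F) auto
    then obtain k as bs cs ds where f: "admissible k l as bs cs ds"
      "smult k (lin_prod [1, l] * sq_prod as) - lin_prod [0] * sq_prod bs = smult k (lin_prod [] * sq_prod cs)"
      "smult k (lin_prod [1, l] * sq_prod as) - smult l (lin_prod [0] * sq_prod bs) = smult k (lin_prod [] * sq_prod ds)"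
      and len: "D = Suc (1 + 2 * length bs)" "D = 2 + 2 * length as" "D = 0 + 2 * length cs" "D = 0 + 2 * length ds"
      by auto
    have "even D" using len(3) by simp
    moreover have "length as = D div 2 - 1" using len(2) by simp
    moreover have "length bs = D div 2 - 1" using len(1) by simp
    moreover have "length cs = D div 2" using len(3) by simp
    moreover have "length ds = D div 2" using len(4) by simp
    ultimately have "is_solution D k l as bs cs ds"
      using f by (simp add: is_def mult.assoc del: mult_pCons_left mult_pCons_right)
    then show ?thesis by blast
  next
    case 6
    then have "\<exists>k as bs cs ds. admissible k l as bs cs ds \<and>
     smult k (lin_prod [0, 1] * sq_prod as) - lin_prod [l] * sq_prod bs = smult k (lin_prod [] * sq_prod cs) \<and>
     smult k (lin_prod [0, 1] * sq_prod as) - smult l (lin_prod [l] * sq_prod bs) = smult k (lin_prod [] * sq_prod ds) \<and>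
     D = Suc (length ([l] :: complex list) + 2 * length bs) \<and> D = length ([0, 1] :: complex list) + 2 * length as \<and>
     D = length ([] :: complex list) + 2 * length cs \<and> D = length ([] :: complex list) + 2 * length ds"
      using nr' l by (intro F) auto
    then obtain k as bs cs ds where f: "admissible k l as bs cs ds"
      "smult k (lin_prod [0, 1] * sq_prod as) - lin_prod [l] * sq_prod bs = smult k (lin_prod [] * sq_prod cs)"
      "smult k (lin_prod [0, 1] * sq_prod as) - smult l (lin_prod [l] * sq_prod bs) = smult k (lin_prod [] * sq_prod ds)"
      and len: "D = Suc (1 + 2 * length bs)" "D = 2 + 2 * length as" "D = 0 + 2 * length cs" "D = 0 + 2 * length ds"
      by auto
    have "even D" using len(3) by simp
    moreover have "length as = D div 2 - 1" using len(2) by simp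
    moreover have "length bs = D div 2 - 1" using len(1) by simp
    moreover have "length cs = D div 2" using len(3) by simp
    moreover have "length ds = D div 2" using len(4) by simp
    ultimately have "is_solution D k l as bs cs ds"
      using f by (simp add: is_def mult.assoc del: mult_pCons_left mult_pCons_right)
    then show ?thesis by blast
  qed
qed

lemma lattes_type_imp_solution:
  assumes L: "lattes a b c p q \<kappa>" and ty: "lattes_type a b c p q" and D: "degree p = D"
  shows "\<exists>k as bs cs ds. is_solution D k ((c - a) / (b - a)) as bs cs ds"
proof -
  have ne: "b - a \<noteq> 0" "c \<noteq> a" "c \<noteq> b" using L by (auto simp: lattes_def)
  \<comment> \<open>The affine map that takes \<open>a\<close>, \<open>b\<close>, \<open>c\<close>
    to 0, 1 and \<open>(c - a) / (b - a)\<close>.\<close>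
  define \<alpha> \<beta> where "\<alpha> = 1 / (b - a)" and "\<beta> = - a / (b - a)"
  have \<alpha>: "\<alpha> \<noteq> 0" using ne by (simp add: \<alpha>_def)
  define l where "l = (c - a) / (b - a)"
  have val: "\<alpha> * a + \<beta> = 0" "\<alpha> * b + \<beta> = 1" "\<alpha> * c + \<beta> = l"
  proof -
    have "\<alpha> * x + \<beta> = (x - a) / (b - a)" for x by (simp add: \<alpha>_def \<beta>_def diff_divide_distrib)
    then show "\<alpha> * a + \<beta> = 0" "\<alpha> * b + \<beta> = 1" "\<alpha> * c + \<beta> = l" using ne by (simp_all add: l_def)
  qed
  define r where "r = [:- \<beta> / \<alpha>, 1 / \<alpha>:]"
  define q2 where "q2 = pcompose q r"
  define p2 where "p2 = smult \<alpha> (pcompose p r) + smult \<beta> q2"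
  note aff = lattes_affine[OF L \<alpha>, of \<beta>, folded r_def, folded q2_def, folded p2_def]
  have L2: "lattes 0 1 l p2 q2 \<kappa>" using aff(1) by (simp only: val)
  have qv: "poly q2 0 = poly q a" "poly q2 1 = poly q b" "poly q2 l = poly q c"
    using aff(4)[of a] aff(4)[of b] aff(4)[of c] by (simp_all only: val)
  have pv: "poly p2 (\<alpha> * x + \<beta>) = (\<alpha> * e + \<beta>) * poly q2 (\<alpha> * x + \<beta>) \<longleftrightarrow> poly p x = e * poly q x" for x e
    using aff(5)[of e x] \<alpha> by auto
  have ty2: "lattes_type 0 1 l p2 q2"
    using ty pv[of a a] pv[of a b] pv[of a c] pv[of b a] pv[of b b] pv[of b c] pv[of c a] pv[of c b] pv[of c c]
    unfolding val lattes_type_def qv by auto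
  \<comment> \<open>In the systems the squared product standing for the denominator has no scalar in
    front, so \<open>q\<close> is made monic.\<close>
  define c' where "c' = 1 / lead_coeff q2"
  have q2: "lead_coeff q2 \<noteq> 0" using lattes_nonzero(2)[OF L2] by simp
  then have c': "c' \<noteq> 0" by (simp add: c'_def)
  have "lattes 0 1 l (smult c' p2) (smult c' q2) \<kappa>" by (rule lattes_scale[OF L2 c'])
  moreover have "lattes_type 0 1 l (smult c' p2) (smult c' q2)"
    using ty2 c' unfolding lattes_type_def by auto
  moreover have "degree (smult c' p2) = D" using c' D aff(2) by simp
  moreover have "lead_coeff (smult c' q2) = 1" using q2 by (simp add: c'_def)
  ultimately show ?thesis unfolding l_def[symmetric] by (intro is_solution_of_lattes_type)
qed

text \<open>In \<open>perm_type\<close> the numbers \<open>1, 2, 3\<close> stand for the three roots and \<open>0\<close> for the point at infinity.\<close>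

definition perm_type :: "nat \<Rightarrow> nat \<Rightarrow> nat \<Rightarrow> nat \<Rightarrow> nat \<Rightarrow> nat \<Rightarrow> bool" where
  "perm_type a b c va vb vc \<longleftrightarrow> va = a \<and> vb = b \<and> vc = c \<or> va = a \<and> vc = b \<and> vb = c \<or>
      vc = a \<and> va = b \<and> vb = c \<or> va = 0 \<and> vb = 0 \<and> vc = 0 \<or> va = 0 \<and> vb = a \<and> vc = a \<or>
      vc = 0 \<and> va = a \<and> vb = a"

text \<open>A check of all 128 cases. Behind it: each of the four fibres inside the four-point set
  has the parity of \<open>D\<close>. If \<open>D\<close> is odd, every fibre is a single point, and
  the map is a permutation fixing infinity; up to relabelling it is the identity, a transposition or
  a 3-cycle. If \<open>D\<close> is even, either all points go to infinity, or one does and the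
  other two go to a common root, which is either the exceptional point or one of the two.\<close>

lemma parity_enumeration:
  "\<forall>x\<in>set [0,1,2,3]. \<forall>y\<in>set [0,1,2,3]. \<forall>z\<in>set [0,1,2,3]. \<forall>d\<in>set [0,1::nat].
     (\<forall>i\<in>set [1,2,3]. ((if x = i then 1 else 0) + (if y = i then 1 else 0) + (if z = i then 1 else 0)) mod 2 = d) \<longrightarrow>
     perm_type 1 2 3 x y z \<or> perm_type 1 3 2 x z y \<or> perm_type 2 1 3 y x z \<or>
     perm_type 2 3 1 y z x \<or> perm_type 3 1 2 z x y \<or> perm_type 3 2 1 z y x"
  by code_simp

lemma parity_cases:
  fixes v :: "nat \<Rightarrow> nat"
  assumes v: "v 1 \<in> {0,1,2,3}" "v 2 \<in> {0,1,2,3}" "v 3 \<in> {0,1,2,3}"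
    and par: "\<And>i. i \<in> {1,2,3} \<Longrightarrow> (of_bool (v 1 = i) + of_bool (v 2 = i) + of_bool (v 3 = i)) mod 2 = D mod (2::nat)"
  shows "\<exists>a b c. {a, b, c} = {1, 2, 3} \<and> perm_type a b c (v a) (v b) (v c)"
proof -
  have "D mod 2 \<in> set [0, 1]" by auto
  moreover have "\<forall>i\<in>set [1,2,3]. ((if v 1 = i then 1 else 0) + (if v 2 = i then 1 else 0) +
      (if v 3 = i then 1 else 0)) mod 2 = D mod (2::nat)"
    using par by (simp add: of_bool_def)
  moreover have "v 1 \<in> set [0,1,2,3]" "v 2 \<in> set [0,1,2,3]" "v 3 \<in> set [0,1,2,3]" using v by simp_all
  ultimately have "perm_type 1 2 3 (v 1) (v 2) (v 3) \<or> perm_type 1 3 2 (v 1) (v 3) (v 2) \<or>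
     perm_type 2 1 3 (v 2) (v 1) (v 3) \<or> perm_type 2 3 1 (v 2) (v 3) (v 1) \<or>
     perm_type 3 1 2 (v 3) (v 1) (v 2) \<or> perm_type 3 2 1 (v 3) (v 2) (v 1)"
    using parity_enumeration by blast
  moreover have "{1, 3, 2} = {1, 2, 3 :: nat}" "{2, 1, 3} = {1, 2, 3 :: nat}" "{2, 3, 1} = {1, 2, 3 :: nat}"
    "{3, 1, 2} = {1, 2, 3 :: nat}" "{3, 2, 1} = {1, 2, 3 :: nat}" by blast+
  ultimately show ?thesis by blast
qed

lemma lattes_imp_solution:
  assumes L: "lattes e1 e2 e3 p q \<kappa>" and D: "degree p = D"
  shows "\<exists>a b c. {a, b, c} = {e1, e2, e3} \<and> distinct [a, b, c] \<and>
           (\<exists>k as bs cs ds. is_solution D k ((c - a) / (b - a)) as bs cs ds)"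
proof -
  have de: "distinct [e1, e2, e3]" and \<kappa>: "\<kappa> \<noteq> 0" and nr: "\<And>x. poly p x = 0 \<Longrightarrow> poly q x \<noteq> 0"
    and eq: "[:- e1, 1:] * [:- e2, 1:] * [:- e3, 1:] * wronskian p q ^ 2 =
       smult \<kappa> (q * (p - smult e1 q) * (p - smult e2 q) * (p - smult e3 q))"
    using L by (auto simp: lattes_def)
  define e where "e = (\<lambda>i::nat. if i = 1 then e1 else if i = 2 then e2 else e3)"
  define v where "v = (\<lambda>i::nat. let x = e i in if poly q x = 0 then 0 else if poly p x = e1 * poly q x then 1
      else if poly p x = e2 * poly q x then 2 else 3::nat)"
  have e: "e 1 = e1" "e (Suc 0) = e1" "e 2 = e2" "e 3 = e3" by (simp_all add: e_def)
  have v: "v 1 \<in> {0,1,2,3}" "v 2 \<in> {0,1,2,3}" "v 3 \<in> {0,1,2,3}" by (simp_all add: v_def Let_def)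
  \<comment> \<open>The left side of the differential equation vanishes at the three roots, so
    \<open>p / q\<close> maps them back into the four-point set.\<close>
  have root: "poly q x = 0 \<or> poly p x = e1 * poly q x \<or> poly p x = e2 * poly q x \<or> poly p x = e3 * poly q x"
    if "x \<in> {e1, e2, e3}" for x
  proof -
    have "poly ([:- e1, 1:] * [:- e2, 1:] * [:- e3, 1:] * wronskian p q ^ 2) x = 0"
      using that by (auto simp del: mult_pCons_left mult_pCons_right)
    then show ?thesis unfolding eq using \<kappa> by auto
  qed
  have v0: "v i = 0 \<longleftrightarrow> poly q (e i) = 0" and vj: "j \<in> {1,2,3} \<Longrightarrow> v i = j \<longleftrightarrow> poly p (e i) = e j * poly q (e i)"
    if i: "i \<in> {1,2,3}" for i j
  proof -
    define x where "x = e i"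
    have x: "x \<in> {e1, e2, e3}" using i by (auto simp: x_def e_def)
    have e12: "e1 \<noteq> e2" "e1 \<noteq> e3" "e2 \<noteq> e3" using de by auto
    show "v i = 0 \<longleftrightarrow> poly q (e i) = 0" by (simp add: v_def Let_def)
    show "v i = j \<longleftrightarrow> poly p (e i) = e j * poly q (e i)" if "j \<in> {1,2,3}"
      using that root[OF x] nr[of x] e12 unfolding v_def Let_def x_def[symmetric]
      by (auto simp: e)
  qed
  \<comment> \<open>By the factorization, \<open>D\<close> equals the number of the three roots
    lying over \<open>e i\<close> plus twice the number of all other points there.\<close>
  have par: "(of_bool (v 1 = i) + of_bool (v 2 = i) + of_bool (v 3 = i)) mod 2 = D mod (2::nat)"
    if i: "i \<in> {1,2,3}" for i
  proof -
    define S where "S = {j \<in> {1,2,3::nat}. v j = i}"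
    have S: "{x \<in> {e1, e2, e3}. poly (p - smult (e i) q) x = 0} = e ` S"
    proof -
      have S1: "S = {j \<in> {1,2,3}. poly (p - smult (e i) q) (e j) = 0}"
        unfolding S_def by (rule Collect_cong) (use vj[OF _ i] in \<open>simp cong: conj_cong\<close>)
      have E1: "{e1, e2, e3} = e ` {1,2,3}" by (simp add: e)
      show ?thesis unfolding S1 E1 by blast
    qed
    have inj: "inj_on e S" using de by (auto simp: inj_on_def S_def e_def)
    have "finite (e ` S)" by (simp add: S_def)
    then obtain es where es: "set es = e ` S" "distinct es" using finite_distinct_list by blast
    have "p - smult (e i) q \<in> {q, p - smult e1 q, p - smult e2 q, p - smult e3 q}"
      using i by (auto simp: e_def)
    from lattes_factor[OF L this es(2)] S es(1)
    obtain as :: "complex list" where "degree (p - smult (e i) q) = length es + 2 * length as" by metis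
    then have "D = length es + 2 * length as" using lattes_nonzero(4)[OF L] D by simp
    moreover have "length es = card S"
      using distinct_card[OF es(2)] card_image[OF inj] es(1) by simp
    moreover have "card S = of_bool (v 1 = i) + of_bool (v 2 = i) + of_bool (v 3 = i)"
    proof -
      have "card S = (\<Sum>j\<in>{1,2,3}. if v j = i then 1 else 0)"
        unfolding S_def by (subst sum.If_cases) (auto simp: Int_def)
      then show ?thesis by simp
    qed
    ultimately show ?thesis by simp
  qed
  obtain a b c where abc: "{a, b, c} = {1, 2, 3}" "perm_type a b c (v a) (v b) (v c)"
    using parity_cases[OF v par] by blast
  have mem: "a \<in> {1,2,3}" "b \<in> {1,2,3}" "c \<in> {1,2,3}" using abc(1) by blast+
  have "card {a, b, c} = 3" unfolding abc(1) by simp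
  then have dabc: "a \<noteq> b" "a \<noteq> c" "b \<noteq> c" by (auto simp: card_insert_if split: if_splits)
  have ty: "lattes_type (e a) (e b) (e c) p q"
    using abc(2) unfolding lattes_type_def perm_type_def using mem by (simp add: v0 vj)
  have sets: "{e a, e b, e c} = {e1, e2, e3}"
    using arg_cong[OF abc(1), of "\<lambda>S. e ` S"] by (simp add: e)
  have dist: "distinct [e a, e b, e c]" using mem dabc de by (auto simp: e_def)
  have "lattes (e a) (e b) (e c) p q \<kappa>"
  proof -
    have "lattes e1 e2 e3 p q \<kappa>" "lattes e2 e1 e3 p q \<kappa>" "lattes e1 e3 e2 p q \<kappa>"
      "lattes e2 e3 e1 p q \<kappa>" "lattes e3 e1 e2 p q \<kappa>" "lattes e3 e2 e1 p q \<kappa>"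
      using L lattes_perm by blast+
    with mem dabc show ?thesis by (elim insertE emptyE) (simp_all only: e simp_thms)
  qed
  from lattes_type_imp_solution[OF this ty D]
  have "{e a, e b, e c} = {e1, e2, e3} \<and> distinct [e a, e b, e c] \<and>
      (\<exists>k as bs cs ds. is_solution D k ((e c - e a) / (e b - e a)) as bs cs ds)"
    using sets dist by (intro conjI)
  then show ?thesis
    by (rule exI[of _ "e a", OF exI[of _ "e b", OF exI[of _ "e c"]]])
qed

section \<open>From a solution of a system to a rational function\<close>

text \<open>With \<open>n = degree q\<close> the two products contribute \<open>n + 1\<close> and
  \<open>n\<close> times the leading coefficients, and the difference is never zero. So the
  Wronskian of nonzero polynomials has degree exactly \<open>2 n\<close>.\<close>

lemma coeff_wronskian:
  assumes "degree p = Suc (degree q)"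
  shows "coeff (wronskian p q) (2 * degree q) = lead_coeff p * lead_coeff q"
    and "degree (wronskian p q) \<le> 2 * degree q"
proof -
  define n where "n = degree q"
  have dp: "degree (pderiv p) = n" using assms by (simp add: degree_pderiv n_def)
  have "coeff (pderiv p * q) (degree (pderiv p) + degree q) = lead_coeff (pderiv p) * lead_coeff q"
    by (rule coeff_mult_degree_sum)
  then have 1: "coeff (pderiv p * q) (2 * n) = of_nat (Suc n) * lead_coeff p * lead_coeff q"
    using assms by (simp add: dp coeff_pderiv n_def mult_2)
  have 2: "coeff (p * pderiv q) (2 * n) = of_nat n * lead_coeff p * lead_coeff q"
  proof (cases n)
    case 0
    then obtain c where "q = [:c:]" using degree_eq_zeroE n_def by metis
    then show ?thesis using 0 by (simp add: pderiv_pCons)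
  next
    case (Suc m)
    have dq: "degree (pderiv q) = m" using Suc by (simp add: degree_pderiv n_def)
    have "coeff (p * pderiv q) (degree p + degree (pderiv q)) = lead_coeff p * lead_coeff (pderiv q)"
      by (rule coeff_mult_degree_sum)
    moreover have "degree p + degree (pderiv q) = 2 * n" using assms Suc dq n_def by simp
    moreover have "lead_coeff (pderiv q) = of_nat n * lead_coeff q"
      using Suc dq by (simp add: coeff_pderiv n_def)
    ultimately show ?thesis by simp
  qed
  show "coeff (wronskian p q) (2 * degree q) = lead_coeff p * lead_coeff q"
    using 1 2 by (simp add: wronskian_def n_def algebra_simps)
  have "degree (pderiv p * q) \<le> 2 * n" using degree_mult_le[of "pderiv p" q] dp n_def by simp
  moreover have "degree (p * pderiv q) \<le> 2 * n"
  proof (cases n)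
    case 0
    then obtain c where "q = [:c:]" using degree_eq_zeroE n_def by metis
    then show ?thesis by (simp add: pderiv_pCons)
  next
    case (Suc m)
    then show ?thesis using degree_mult_le[of p "pderiv q"] assms by (simp add: degree_pderiv n_def)
  qed
  ultimately show "degree (wronskian p q) \<le> 2 * degree q"
    unfolding wronskian_def n_def by (rule degree_diff_le)
qed

lemma wronskian_double_root:
  assumes "t = s * sq_prod as" "a \<in> set as"
  shows "poly (wronskian t q) a = 0"
proof -
  have "lin_prod as ^ 2 = lin_prod as * lin_prod as" by (rule power2_eq_square)
  then have "pderiv (sq_prod as) = pderiv (lin_prod as) * lin_prod as + lin_prod as * pderiv (lin_prod as)"
    by (simp add: sq_prod_eq pderiv_mult)
  moreover have "poly (lin_prod as) a = 0" using assms(2) by simp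
  ultimately show ?thesis
    by (simp add: assms(1) wronskian_def pderiv_mult sq_prod_eq del: poly_lin_prod_eq_0)
qed

text \<open>Riemann-Hurwitz in polynomial form: every listed point is a double root of one of the
  four polynomials, hence a root of the Wronskian. There are \<open>2 * degree q\<close> of them, as
  many as the degree allows, so the Wronskian is a constant times their product, and squaring
  recovers the differential equation.\<close>

lemma lattes_of_factors:
  assumes adm: "admissible k l as bs cs ds"
    and q: "q = s0 * sq_prod bs" and p: "p = smult k (s1 * sq_prod as)"
    and pq: "p - q = smult k (s2 * sq_prod cs)" and plq: "p - smult l q = smult k (s3 * sq_prod ds)"
    and s: "s0 * s1 * s2 * s3 = [:0, 1:] * [:- 1, 1:] * [:- l, 1:]"
    and nr: "\<And>x. poly s0 x = 0 \<Longrightarrow> poly s1 x \<noteq> 0"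
    and deg: "degree p = Suc (degree q)" and len: "length as + length bs + length cs + length ds = 2 * degree q"
  shows "\<exists>\<kappa>. lattes 0 1 l p q \<kappa>"
proof -
  define L where "L = as @ bs @ cs @ ds"
  have k: "k \<noteq> 0" and l: "l \<noteq> 0" "l \<noteq> 1" and L: "distinct L"
    using adm by (auto simp: admissible_def L_def)
  have L01: "x \<noteq> 0" "x \<noteq> 1" "x \<noteq> l" if "x \<in> set L" for x
    using adm that by (auto simp: admissible_def L_def)
  have disj: "set as \<inter> set bs = {}" using L by (auto simp: L_def)
  have s_root: "x \<in> {0, 1, l}" if "poly s0 x = 0 \<or> poly s1 x = 0" for x
  proof -
    have "poly (s0 * s1 * s2 * s3) x = 0" using that by auto
    then show ?thesis unfolding s by (auto simp del: mult_pCons_left mult_pCons_right)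
  qed
  have nr': "poly q x \<noteq> 0" if "poly p x = 0" for x
  proof
    assume "poly q x = 0"
    then have "poly s0 x = 0 \<or> x \<in> set bs" by (auto simp: q sq_prod_eq)
    moreover have "poly s1 x = 0 \<or> x \<in> set as" using that k by (auto simp: p sq_prod_eq)
    ultimately show False using nr[of x] s_root[of x] L01[of x] disj by (auto simp: L_def)
  qed
  have "p \<noteq> 0" using deg by auto
  moreover have "q \<noteq> 0"
  proof
    assume "q = 0"
    have "\<not> constant (poly p)" using deg by (simp add: constant_degree)
    then obtain x where "poly p x = 0" using fundamental_theorem_of_algebra by blast
    then show False using nr'[of x] \<open>q = 0\<close> by simp
  qed
  ultimately have lc: "lead_coeff p * lead_coeff q \<noteq> 0" by simp
  have W0: "wronskian p q \<noteq> 0" using coeff_wronskian(1)[OF deg] lc by auto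
  have roots: "poly (wronskian p q) a = 0" if "a \<in> set L" for a
  proof -
    from that consider "a \<in> set as" | "a \<in> set bs" | "a \<in> set cs" | "a \<in> set ds" by (auto simp: L_def)
    then show ?thesis
    proof cases
      case 1 then show ?thesis using wronskian_double_root[of p "smult k s1" as a q] p by simp
    next
      case 2 then show ?thesis using wronskian_double_root[of q s0 bs a p] q wronskian_swap[of p q] by simp
    next
      case 3 then show ?thesis using wronskian_double_root[of "p - q" "smult k s2" cs a q] pq
          wronskian_diff_smult[of p 1 q] by simp
    next
      case 4 then show ?thesis using wronskian_double_root[of "p - smult l q" "smult k s3" ds a q] plq
          wronskian_diff_smult[of p l q] by simp
    qed
  qed
  obtain c where c: "wronskian p q = lin_prod L * c" using lin_prod_dvd[OF L roots] by blast
  have "c \<noteq> 0" using W0 c by auto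
  then have "degree (wronskian p q) = length L + degree c" by (simp add: c degree_mult_eq)
  then have "degree c = 0" using coeff_wronskian(2)[OF deg] len by (simp add: L_def)
  then obtain c0 where c0: "c = [:c0:]" using degree_eq_zeroE by blast
  have c0': "c0 \<noteq> 0" using \<open>c \<noteq> 0\<close> c0 by auto
  have W: "wronskian p q = smult c0 (lin_prod L)" by (simp add: c c0)
  have sqL: "lin_prod L ^ 2 = sq_prod as * sq_prod bs * sq_prod cs * sq_prod ds"
    by (simp add: L_def sq_prod_eq power_mult_distrib mult_ac)
  have "[:- 0, 1:] * [:- 1, 1:] * [:- l, 1:] * wronskian p q ^ 2 =
      smult (c0 ^ 2) ((s0 * s1 * s2 * s3) * lin_prod L ^ 2)"
    unfolding W s by (simp add: smult_power del: mult_pCons_left mult_pCons_right)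
  \<comment> \<open>Three of the four polynomials carry the factor \<open>k\<close> and the
    denominator none, whence \<open>k ^ 3\<close>.\<close>
  also have "\<dots> = smult (c0 ^ 2 / k ^ 3) (smult (k ^ 3) ((s0 * s1 * s2 * s3) * lin_prod L ^ 2))"
    using k by simp
  also have "smult (k ^ 3) ((s0 * s1 * s2 * s3) * lin_prod L ^ 2) =
      q * (p - smult 0 q) * (p - smult 1 q) * (p - smult l q)"
    unfolding plq sqL using pq by (simp add: q p power3_eq_cube mult_ac)
  finally have "[:- 0, 1:] * [:- 1, 1:] * [:- l, 1:] * wronskian p q ^ 2 =
      smult (c0 ^ 2 / k ^ 3) (q * (p - smult 0 q) * (p - smult 1 q) * (p - smult l q))" .
  then show ?thesis
    unfolding lattes_def using k c0' l nr' deg by (intro exI[of _ "c0 ^ 2 / k ^ 3"]) auto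
qed

lemma solution_imp_lattes:
  assumes sol: "is_solution D k l as bs cs ds" and D: "D > 2"
  shows "\<exists>p q \<kappa>. lattes 0 1 l p q \<kappa> \<and> degree p = D"
proof -
  have adm: "admissible k l as bs cs ds" using sol by (simp add: is_solution_def)
  then have k: "k \<noteq> 0" and l: "l \<noteq> 0" "l \<noteq> 1" "0 \<noteq> l" "1 \<noteq> l" by (auto simp: admissible_def)
  \<comment> \<open>Common form of the six systems: \<open>s0\<close> is the linear part of the
    denominator, and \<open>s1\<close>, \<open>s2\<close>, \<open>s3\<close> are those of the three
    numerators. In every system their product is \<open>x (x - 1) (x - l)\<close>.\<close>
  have main: ?thesis
    if "smult k (s1 * sq_prod as) - s0 * sq_prod bs = smult k (s2 * sq_prod cs)"
       "smult k (s1 * sq_prod as) - smult l (s0 * sq_prod bs) = smult k (s3 * sq_prod ds)"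
       "s0 * s1 * s2 * s3 = [:0, 1:] * [:- 1, 1:] * [:- l, 1:]"
       "\<And>x. poly s0 x = 0 \<Longrightarrow> poly s1 x \<noteq> 0"
       "s0 \<noteq> 0" "s1 \<noteq> 0" "degree s1 + 2 * length as = D" "Suc (degree s0 + 2 * length bs) = D"
       "length as + length bs + length cs + length ds = 2 * (D - 1)"
     for s0 s1 s2 s3
  proof -
    define q where "q = s0 * sq_prod bs"
    define p where "p = smult k (s1 * sq_prod as)"
    have dp: "degree p = D" using k that(5-8) by (simp add: p_def degree_mult_eq sq_prod_eq degree_power_eq)
    have dq: "Suc (degree q) = D" using that(5-8) by (simp add: q_def degree_mult_eq sq_prod_eq degree_power_eq)
    have "\<exists>\<kappa>. lattes 0 1 l p q \<kappa>"
      by (rule lattes_of_factors[OF adm q_def p_def _ _ that(3) that(4)])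
         (use that dp dq in \<open>auto simp: p_def[symmetric] q_def[symmetric]\<close>)
    with dp show ?thesis by blast
  qed
  consider "odd D" "system1 D k l as bs cs ds" | "odd D" "system2 D k l as bs cs ds" | "odd D" "system3 D k l as bs cs ds"
    | "even D" "system4 D k l as bs cs ds" | "even D" "system5 D k l as bs cs ds" | "even D" "system6 D k l as bs cs ds"
    using sol by (auto simp: is_solution_def split: if_splits)
  then show ?thesis
  proof cases
    case 1
    note sys = 1(2)[unfolded system1_def]
    obtain n where n: "D = 2 * n + 1" using 1(1) by (elim oddE)
    have len: "length as + length bs + length cs + length ds = 2 * (D - 1)"
      using sys n D by auto
    have prod: "(1) * ([:0, 1:]) * ([:- 1, 1:]) * ([:- l, 1:]) = [:0, 1:] * [:- 1, 1:] * [:- l, 1:]"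
      by (simp add: algebra_simps)
    have eqs: "smult k (([:0, 1:]) * sq_prod as) - (1) * sq_prod bs = smult k (([:- 1, 1:]) * sq_prod cs)"
      "smult k (([:0, 1:]) * sq_prod as) - smult l ((1) * sq_prod bs) = smult k (([:- l, 1:]) * sq_prod ds)"
      using sys by (simp_all only: mult_1_left)
    show ?thesis
      by (rule main[OF eqs prod _ _ _ _ _ len])
         (use sys n D k l in \<open>auto simp: degree_mult_eq simp del: mult_pCons_left mult_pCons_right\<close>)
  next
    case 2
    note sys = 2(2)[unfolded system2_def]
    obtain n where n: "D = 2 * n + 1" using 2(1) by (elim oddE)
    have len: "length as + length bs + length cs + length ds = 2 * (D - 1)"
      using sys n D by auto
    have prod: "(1) * ([:0, 1:]) * ([:- l, 1:]) * ([:- 1, 1:]) = [:0, 1:] * [:- 1, 1:] * [:- l, 1:]"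
      by (simp add: algebra_simps)
    have eqs: "smult k (([:0, 1:]) * sq_prod as) - (1) * sq_prod bs = smult k (([:- l, 1:]) * sq_prod cs)"
      "smult k (([:0, 1:]) * sq_prod as) - smult l ((1) * sq_prod bs) = smult k (([:- 1, 1:]) * sq_prod ds)"
      using sys by (simp_all only: mult_1_left)
    show ?thesis
      by (rule main[OF eqs prod _ _ _ _ _ len])
         (use sys n D k l in \<open>auto simp: degree_mult_eq simp del: mult_pCons_left mult_pCons_right\<close>)
  next
    case 3
    note sys = 3(2)[unfolded system3_def]
    obtain n where n: "D = 2 * n + 1" using 3(1) by (elim oddE)
    have len: "length as + length bs + length cs + length ds = 2 * (D - 1)"
      using sys n D by auto
    have prod: "(1) * ([:- l, 1:]) * ([:0, 1:]) * ([:- 1, 1:]) = [:0, 1:] * [:- 1, 1:] * [:- l, 1:]"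
      by (simp add: algebra_simps)
    have eqs: "smult k (([:- l, 1:]) * sq_prod as) - (1) * sq_prod bs = smult k (([:0, 1:]) * sq_prod cs)"
      "smult k (([:- l, 1:]) * sq_prod as) - smult l ((1) * sq_prod bs) = smult k (([:- 1, 1:]) * sq_prod ds)"
      using sys by (simp_all only: mult_1_left)
    show ?thesis
      by (rule main[OF eqs prod _ _ _ _ _ len])
         (use sys n D k l in \<open>auto simp: degree_mult_eq simp del: mult_pCons_left mult_pCons_right\<close>)
  next
    case 4
    note sys = 4(2)[unfolded system4_def]
    obtain n where n: "D = 2 * n" using 4(1) by (elim evenE)
    \<comment> \<open>Here \<open>D > 2\<close> matters: it makes \<open>D div 2 - 2\<close> a
      genuine subtraction and not a truncated one.\<close>
    have len: "length as + length bs + length cs + length ds = 2 * (D - 1)"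
      using sys n D by auto
    have prod: "([:0, 1:] * [:- 1, 1:] * [:- l, 1:]) * (1) * (1) * (1) = [:0, 1:] * [:- 1, 1:] * [:- l, 1:]"
      by (simp add: algebra_simps)
    have eqs: "smult k ((1) * sq_prod as) - ([:0, 1:] * [:- 1, 1:] * [:- l, 1:]) * sq_prod bs = smult k ((1) * sq_prod cs)"
      "smult k ((1) * sq_prod as) - smult l (([:0, 1:] * [:- 1, 1:] * [:- l, 1:]) * sq_prod bs) = smult k ((1) * sq_prod ds)"
      using sys by (simp_all only: mult_1_left)
    show ?thesis
      by (rule main[OF eqs prod _ _ _ _ _ len])
         (use sys n D k l in \<open>auto simp: degree_mult_eq simp del: mult_pCons_left mult_pCons_right\<close>)
  next
    case 5
    note sys = 5(2)[unfolded system5_def]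
    obtain n where n: "D = 2 * n" using 5(1) by (elim evenE)
    have len: "length as + length bs + length cs + length ds = 2 * (D - 1)"
      using sys n D by auto
    have prod: "([:0, 1:]) * ([:- 1, 1:] * [:- l, 1:]) * (1) * (1) = [:0, 1:] * [:- 1, 1:] * [:- l, 1:]"
      by (simp add: algebra_simps)
    have eqs: "smult k (([:- 1, 1:] * [:- l, 1:]) * sq_prod as) - ([:0, 1:]) * sq_prod bs = smult k ((1) * sq_prod cs)"
      "smult k (([:- 1, 1:] * [:- l, 1:]) * sq_prod as) - smult l (([:0, 1:]) * sq_prod bs) = smult k ((1) * sq_prod ds)"
      using sys by (simp_all only: mult_1_left)
    show ?thesis
      by (rule main[OF eqs prod _ _ _ _ _ len])
         (use sys n D k l in \<open>auto simp: degree_mult_eq simp del: mult_pCons_left mult_pCons_right\<close>)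
  next
    case 6
    note sys = 6(2)[unfolded system6_def]
    obtain n where n: "D = 2 * n" using 6(1) by (elim evenE)
    have len: "length as + length bs + length cs + length ds = 2 * (D - 1)"
      using sys n D by auto
    have prod: "([:- l, 1:]) * ([:0, 1:] * [:- 1, 1:]) * (1) * (1) = [:0, 1:] * [:- 1, 1:] * [:- l, 1:]"
      by (simp add: algebra_simps)
    have eqs: "smult k (([:0, 1:] * [:- 1, 1:]) * sq_prod as) - ([:- l, 1:]) * sq_prod bs = smult k ((1) * sq_prod cs)"
      "smult k (([:0, 1:] * [:- 1, 1:]) * sq_prod as) - smult l (([:- l, 1:]) * sq_prod bs) = smult k ((1) * sq_prod ds)"
      using sys by (simp_all only: mult_1_left)
    show ?thesis
      by (rule main[OF eqs prod _ _ _ _ _ len])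
         (use sys n D k l in \<open>auto simp: degree_mult_eq simp del: mult_pCons_left mult_pCons_right\<close>)
  qed
qed

section \<open>The Weierstrass function\<close>

definition lat :: "complex \<Rightarrow> int \<times> int \<Rightarrow> complex" where
  "lat \<tau> p = of_int (fst p) + of_int (snd p) * \<tau>"

definition wp :: "complex \<Rightarrow> complex \<Rightarrow> complex" where
  "wp \<tau> z = 1 / z ^ 2 + (\<Sum>\<^sub>\<infinity>p\<in>UNIV - {(0,0)}. 1 / (z - lat \<tau> p) ^ 2 - 1 / lat \<tau> p ^ 2)"

lemma lat_add: "lat \<tau> (p + q) = lat \<tau> p + lat \<tau> q"
  by (simp add: lat_def algebra_simps)

lemma lat_minus: "lat \<tau> (- p) = - lat \<tau> p"
  by (simp add: lat_def algebra_simps)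

lemma lat_diff: "lat \<tau> (p - q) = lat \<tau> p - lat \<tau> q"
  by (simp add: lat_def algebra_simps)

lemma lat_0 [simp]: "lat \<tau> (0, 0) = 0"
  by (simp add: lat_def)

section \<open>Convergence of lattice sums\<close>

lemma summable_on_int_powr:
  assumes "s < -1"
  shows "(\<lambda>m::int. (1 + \<bar>of_int m\<bar>) powr s :: real) summable_on UNIV"
proof -
  have "summable (\<lambda>n. real (Suc n) powr s)"
    using assms by (subst summable_Suc_iff) (simp add: summable_real_powr_iff)
  then have nat: "(\<lambda>n::nat. (1 + real n) powr s) summable_on UNIV"
    by (intro summable_nonneg_imp_summable_on) (auto simp: add_ac)
  have "(\<lambda>m::int. (1 + \<bar>of_int m\<bar>) powr s :: real) summable_on range int"
    using nat by (subst summable_on_reindex) (auto simp: o_def)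
  moreover have "(\<lambda>m::int. (1 + \<bar>of_int m\<bar>) powr s :: real) summable_on range (\<lambda>n. - int n)"
    using nat by (subst summable_on_reindex) (auto simp: o_def inj_on_def)
  moreover have "UNIV = range int \<union> range (\<lambda>n. - int n)"
    by (auto simp: image_def) (metis int_cases2)
  ultimately show ?thesis
    using summable_on_union by fastforce
qed

locale upper_half =
  fixes \<tau> :: complex
  assumes Im_pos: "Im \<tau> > 0"
begin

abbreviation \<omega> where "\<omega> \<equiv> lat \<tau>"
abbreviation P where "P \<equiv> wp \<tau>"
definition \<Lambda> where "\<Lambda> = range \<omega>"

lemma lat_eq_0_iff [simp]: "\<omega> p = 0 \<longleftrightarrow> p = (0, 0)"
proof
  assume *: "\<omega> p = 0"
  from arg_cong[OF *, of Im] have "snd p = 0" using Im_pos by (simp add: lat_def)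
  with * show "p = (0, 0)" by (simp add: lat_def prod_eq_iff)
qed auto

lemma lat_inj: "\<omega> p = \<omega> q \<longleftrightarrow> p = q"
  using lat_eq_0_iff[of "p - q"] by (auto simp: lat_diff prod_eq_iff)

lemma Lambda_add: "a \<in> \<Lambda> \<Longrightarrow> b \<in> \<Lambda> \<Longrightarrow> a + b \<in> \<Lambda>"
  unfolding \<Lambda>_def by (auto simp flip: lat_add)
lemma Lambda_minus: "a \<in> \<Lambda> \<Longrightarrow> - a \<in> \<Lambda>"
  unfolding \<Lambda>_def by (auto simp flip: lat_minus)
lemma Lambda_diff: "a \<in> \<Lambda> \<Longrightarrow> b \<in> \<Lambda> \<Longrightarrow> a - b \<in> \<Lambda>"
  unfolding \<Lambda>_def by (auto simp flip: lat_diff)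
lemma Lambda_0 [simp]: "0 \<in> \<Lambda>"
  unfolding \<Lambda>_def using rangeI[of \<omega> 0] by simp
lemma Lambda_minus_iff [simp]: "- a \<in> \<Lambda> \<longleftrightarrow> a \<in> \<Lambda>"
  using Lambda_minus[of a] Lambda_minus[of "- a"] by auto
lemma Lambda_add_iff [simp]: "b \<in> \<Lambda> \<Longrightarrow> a + b \<in> \<Lambda> \<longleftrightarrow> a \<in> \<Lambda>" "b \<in> \<Lambda> \<Longrightarrow> b + a \<in> \<Lambda> \<longleftrightarrow> a \<in> \<Lambda>"
  "b \<in> \<Lambda> \<Longrightarrow> a - b \<in> \<Lambda> \<longleftrightarrow> a \<in> \<Lambda>"
proof -
  assume b: "b \<in> \<Lambda>"
  show 1: "a + b \<in> \<Lambda> \<longleftrightarrow> a \<in> \<Lambda>"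
    using Lambda_add[OF _ b, of a] Lambda_diff[OF _ b, of "a + b"] by (metis add_diff_cancel_right')
  then show "b + a \<in> \<Lambda> \<longleftrightarrow> a \<in> \<Lambda>" by (simp only: add.commute)
  show "a - b \<in> \<Lambda> \<longleftrightarrow> a \<in> \<Lambda>"
    using Lambda_diff[OF _ b, of a] Lambda_add[OF _ b, of "a - b"] by (metis diff_add_cancel)
qed

text \<open>The imaginary part bounds the second coordinate, and the triangle inequality then bounds
  the first. The summand 1 is absorbed because a nonzero point has a coordinate of absolute value at
  least one.\<close>

lemma lat_norm_ge:
  obtains K where "K > 0" "\<And>p. p \<noteq> (0,0) \<Longrightarrow> 1 + \<bar>of_int (fst p)\<bar> \<le> K * norm (\<omega> p)"
    "\<And>p. p \<noteq> (0,0) \<Longrightarrow> 1 + \<bar>of_int (snd p)\<bar> \<le> K * norm (\<omega> p)"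
proof -
  define T where "T = norm \<tau> / Im \<tau>"
  define K where "K = 1 / Im \<tau> + 1 + T + (1 + T + 1 / Im \<tau>)"
  have T: "T \<ge> 0" using Im_pos by (simp add: T_def)
  have *: "1 + \<bar>of_int (fst p)\<bar> \<le> K * norm (\<omega> p) \<and> 1 + \<bar>of_int (snd p)\<bar> \<le> K * norm (\<omega> p)"
    if "p \<noteq> (0,0)" for p
  proof -
    obtain m n where p: "p = (m, n)" by (cases p)
    define N where "N = norm (\<omega> p)"
    have "\<bar>of_int n * Im \<tau>\<bar> \<le> N"
      using abs_Im_le_cmod[of "\<omega> p"] by (simp add: N_def p lat_def)
    then have n: "\<bar>of_int n\<bar> \<le> (1 / Im \<tau>) * N"
      using Im_pos by (simp add: abs_mult field_simps)
    have "\<bar>of_int m\<bar> \<le> norm (\<omega> p) + norm (of_int n * \<tau>)"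
      using norm_triangle_ineq4[of "\<omega> p" "of_int n * \<tau>"] by (simp add: p lat_def)
    also have "norm (of_int n * \<tau>) = \<bar>of_int n\<bar> * norm \<tau>" by (simp add: norm_mult)
    also have "\<dots> \<le> (1 / Im \<tau>) * N * norm \<tau>" using n by (rule mult_right_mono) auto
    finally have m: "\<bar>of_int m\<bar> \<le> (1 + T) * N" by (simp add: N_def T_def algebra_simps)
    have "1 \<le> \<bar>m\<bar> + \<bar>n\<bar>" using that p by auto
    then have "1 \<le> \<bar>real_of_int m\<bar> + \<bar>real_of_int n\<bar>" by linarith
    then have one: "1 \<le> (1 + T) * N + (1 / Im \<tau>) * N" using m n by linarith
    have "0 \<le> (1 + T) * N" "0 \<le> (1 / Im \<tau>) * N" using T Im_pos by (auto simp: N_def)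
    moreover have "K * N = (1 / Im \<tau>) * N + (1 + T) * N + ((1 + T) * N + (1 / Im \<tau>) * N)"
      by (simp add: K_def algebra_simps)
    ultimately have "1 + \<bar>of_int m\<bar> \<le> K * N \<and> 1 + \<bar>of_int n\<bar> \<le> K * N"
      using one m n by linarith
    then show ?thesis unfolding N_def[symmetric] by (simp add: p)
  qed
  have "1 / Im \<tau> > 0" using Im_pos by simp
  then have "K > 0" using T unfolding K_def by linarith
  with * that show ?thesis by blast
qed

text \<open>Raising \<open>(1 + |m|) (1 + |n|) \<le> (K |\<omega>|)^2\<close> to the power 3/2
  dominates the sum by a product of two one-dimensional series with exponent -3/2.\<close>

lemma summable_inverse_cube: "(\<lambda>p. 1 / norm (\<omega> p) ^ 3) summable_on UNIV - {(0,0)}"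
proof -
  obtain K where K: "K > 0" "\<And>p. p \<noteq> (0,0) \<Longrightarrow> 1 + \<bar>of_int (fst p)\<bar> \<le> K * norm (\<omega> p)"
    "\<And>p. p \<noteq> (0,0) \<Longrightarrow> 1 + \<bar>of_int (snd p)\<bar> \<le> K * norm (\<omega> p)"
    by (rule lat_norm_ge) blast
  let ?g = "\<lambda>m::int. (1 + \<bar>of_int m\<bar>) powr (-3/2) :: real"
  have g: "?g summable_on UNIV" by (rule summable_on_int_powr) auto
  have "(\<lambda>p. ?g (fst p) * ?g (snd p)) summable_on UNIV \<times> UNIV"
  proof (rule summable_on_SigmaI)
    show "((\<lambda>y. ?g (fst (x, y)) * ?g (snd (x, y))) has_sum ?g x * infsum ?g UNIV) UNIV" for x
      using has_sum_cmult_right[OF has_sum_infsum[OF g]] by simp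
    show "(\<lambda>x. ?g x * infsum ?g UNIV) summable_on UNIV"
      using g by (rule summable_on_cmult_left)
  qed auto
  then have "(\<lambda>p. K ^ 3 * (?g (fst p) * ?g (snd p))) summable_on UNIV - {(0,0)}"
    by (intro summable_on_cmult_right summable_on_subset[of _ UNIV "UNIV - {(0,0)}"]) auto
  then show ?thesis
  proof (rule summable_on_comparison_test)
    fix p :: "int \<times> int" assume p: "p \<in> UNIV - {(0,0)}"
    define a b N where "a = 1 + \<bar>real_of_int (fst p)\<bar>" "b = 1 + \<bar>real_of_int (snd p)\<bar>" "N = norm (\<omega> p)"
    have ab: "a > 0" "b > 0" by (auto simp: a_b_N_def)
    have N: "N > 0" using p by (simp add: a_b_N_def)
    have "a \<le> K * N" "b \<le> K * N" using K p by (auto simp: a_b_N_def)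
    then have "a * b \<le> (K * N) powr 2" 
      using ab K N by (simp add: power2_eq_square mult_mono)
    then have "(a * b) powr (3/2) \<le> ((K * N) powr 2) powr (3/2)"
      using ab by (intro powr_mono2) auto
    also have "\<dots> = (K * N) ^ 3" using K(1) N by (simp add: powr_powr flip: powr_numeral)
    finally have "1 / N ^ 3 \<le> K ^ 3 / (a * b) powr (3/2)"
      using ab N by (simp add: field_simps)
    also have "\<dots> = K ^ 3 * (a powr (-3/2) * b powr (-3/2))"
      using ab by (simp add: powr_mult powr_minus field_simps)
    finally show "1 / norm (\<omega> p) ^ 3 \<le> K ^ 3 * (?g (fst p) * ?g (snd p))"
      by (simp add: a_b_N_def)
  qed auto
qed

lemma finite_lat_le: "finite {p. norm (\<omega> p) \<le> R}"
proof -
  obtain K where K: "K > 0" "\<And>p. p \<noteq> (0,0) \<Longrightarrow> 1 + \<bar>of_int (fst p)\<bar> \<le> K * norm (\<omega> p)"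
    "\<And>p. p \<noteq> (0,0) \<Longrightarrow> 1 + \<bar>of_int (snd p)\<bar> \<le> K * norm (\<omega> p)"
    by (rule lat_norm_ge) blast
  define B where "B = \<lceil>K * \<bar>R\<bar>\<rceil>"
  have "p \<in> {-B..B} \<times> {-B..B}" if "norm (\<omega> p) \<le> R" for p
  proof (cases "p = (0,0)")
    case False
    have "K * norm (\<omega> p) \<le> K * \<bar>R\<bar>" using that K(1) by (intro mult_left_mono) auto
    with K(2,3)[OF False] have "\<bar>real_of_int (fst p)\<bar> \<le> K * \<bar>R\<bar>" "\<bar>real_of_int (snd p)\<bar> \<le> K * \<bar>R\<bar>" by linarith+
    then have "\<bar>fst p\<bar> \<le> B" "\<bar>snd p\<bar> \<le> B" unfolding B_def by linarith+
    then show ?thesis by (auto simp: mem_Times_iff)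
  qed (use order.strict_trans2[OF _ mult_nonneg_nonneg[of K "\<bar>R\<bar>"], of "-1"] K(1) in \<open>simp add: B_def\<close>)
  then have "{p. norm (\<omega> p) \<le> R} \<subseteq> {-B..B} \<times> {-B..B}" by auto
  then show ?thesis by (rule finite_subset) auto
qed

lemma countable_Lambda: "countable \<Lambda>" by (simp add: \<Lambda>_def)

lemma closed_Lambda: "closed \<Lambda>"
proof -
  have "\<not> x islimpt \<Lambda>" for x
  proof
    assume "x islimpt \<Lambda>"
    then have "infinite (\<Lambda> \<inter> ball x 1)"
      by (meson centre_in_ball islimpt_eq_infinite_ball zero_less_one)
    moreover have "\<Lambda> \<inter> ball x 1 \<subseteq> \<omega> ` {p. norm (\<omega> p) \<le> norm x + 1}"
    proof
      fix y assume "y \<in> \<Lambda> \<inter> ball x 1"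
      then obtain p where "y = \<omega> p" "dist x y < 1" by (auto simp: \<Lambda>_def)
      then show "y \<in> \<omega> ` {p. norm (\<omega> p) \<le> norm x + 1}"
        using norm_triangle_sub[of y x] by (auto simp: dist_norm norm_minus_commute)
    qed
    ultimately show False using finite_lat_le finite_subset by blast
  qed
  then show ?thesis by (simp add: closed_limpt)
qed

lemma open_compl_Lambda [simp, intro]: "open (- \<Lambda>)"
  using closed_Lambda by (simp add: open_Compl)

lemma connected_compl_Lambda [simp, intro]: "connected (- \<Lambda>)"
  using connected_open_diff_countable[of "UNIV :: complex set" \<Lambda>] countable_Lambda connected_UNIV
  by (simp add: Compl_eq_Diff_UNIV)

lemma lat_norm_lower: obtains c where "c > 0" "\<And>p. p \<noteq> (0,0) \<Longrightarrow> c \<le> norm (\<omega> p)"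
proof -
  obtain K where K: "K > 0" "\<And>p. p \<noteq> (0,0) \<Longrightarrow> 1 + \<bar>of_int (fst p)\<bar> \<le> K * norm (\<omega> p)"
    by (rule lat_norm_ge) blast
  have "1 / K \<le> norm (\<omega> p)" if "p \<noteq> (0,0)" for p
    using K(2)[OF that] K(1) by (simp add: field_simps)
  with K(1) that[of "1 / K"] show ?thesis by auto
qed

text \<open>The difference equals \<open>z (2 w - z) / ((z - w)^2 w^2)\<close>, where
  \<open>|2 w - z| \<le> 5/2 |w|\<close> and \<open>|z - w| \<ge> |w| / 2\<close>. The constant is
  \<open>(5/2) / (1/2)^2 = 10\<close>.\<close>

lemma term_bound:
  fixes z w :: complex
  assumes "norm z \<le> R" "2 * R \<le> norm w" "w \<noteq> 0"
  shows "norm (1 / (z - w) ^ 2 - 1 / w ^ 2) \<le> 10 * R * (1 / norm w ^ 3)"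
proof -
  have R: "R \<ge> 0" using assms norm_ge_zero order_trans by blast
  have zw: "norm (z - w) \<ge> norm w / 2"
    using assms norm_triangle_ineq2[of w z] by (simp add: norm_minus_commute)
  then have "z \<noteq> w" using assms by auto
  then have "1 / (z - w) ^ 2 - 1 / w ^ 2 = z * (2 * w - z) / ((z - w) ^ 2 * w ^ 2)"
    using assms(3) by (simp add: divide_simps) (simp add: power2_eq_square algebra_simps)
  also have "norm \<dots> = norm z * norm (2 * w - z) / (norm (z - w) ^ 2 * norm w ^ 2)"
    by (simp add: norm_divide norm_mult norm_power)
  also have "\<dots> \<le> R * (5 / 2 * norm w) / ((norm w / 2) ^ 2 * norm w ^ 2)"
  proof (intro frac_le mult_mono power_mono zw)
    show "norm (2 * w - z) \<le> 5 / 2 * norm w"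
      using norm_triangle_ineq4[of "2 * w" z] assms by (simp add: norm_mult)
  qed (use assms R in auto)
  also have "\<dots> = 10 * R * (1 / norm w ^ 3)"
    using assms(3) by (simp add: field_simps power2_eq_square power3_eq_cube)
  finally show ?thesis .
qed

text \<open>On the disc of radius \<open>R\<close> the lattice points of norm at least
  \<open>2 R\<close> admit one uniform estimate; the finitely many others are treated as a finite
  sum.\<close>

lemma tail_holomorphic:
  assumes "R > 0"
  defines "I \<equiv> {p. p \<noteq> (0,0) \<and> 2 * R \<le> norm (\<omega> p)}"
  defines "T \<equiv> \<lambda>z. \<Sum>\<^sub>\<infinity>p\<in>I. 1 / (z - \<omega> p) ^ 2 - 1 / \<omega> p ^ 2"
  shows "T holomorphic_on ball 0 R"
    and "z \<in> ball 0 R \<Longrightarrow> ((\<lambda>p. - 2 / (z - \<omega> p) ^ 3) has_sum deriv T z) I"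
    and "z \<in> ball 0 R \<Longrightarrow> (\<lambda>p. 1 / (z - \<omega> p) ^ 2 - 1 / \<omega> p ^ 2) summable_on I"
proof -
  have ne: "z \<noteq> \<omega> p" if "z \<in> ball 0 R" "p \<in> I" for z p
    using that assms(1) by (auto simp: I_def)
  have M: "(\<lambda>p. 10 * R * (1 / norm (\<omega> p) ^ 3)) summable_on I"
    by (rule summable_on_cmult_right, rule summable_on_subset[OF summable_inverse_cube]) (auto simp: I_def)
  have le: "norm (1 / (z - \<omega> p) ^ 2 - 1 / \<omega> p ^ 2) \<le> 10 * R * (1 / norm (\<omega> p) ^ 3)"
    if "p \<in> I" "z \<in> ball 0 R" for p z
    using that by (intro term_bound) (auto simp: I_def)
  have hol: "(\<lambda>z. 1 / (z - \<omega> p) ^ 2 - 1 / \<omega> p ^ 2) holomorphic_on ball 0 R" if "p \<in> I" for p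
    using that ne by (intro holomorphic_intros) auto
  note * = holomorphic_infsum[of I "\<lambda>p z. 1 / (z - \<omega> p) ^ 2 - 1 / \<omega> p ^ 2" 0 R, OF hol le M]
  show "T holomorphic_on ball 0 R"
    unfolding T_def by (rule *(1))
  show "(\<lambda>p. 1 / (z - \<omega> p) ^ 2 - 1 / \<omega> p ^ 2) summable_on I" if z: "z \<in> ball 0 R"
    by (rule abs_summable_summable, rule Infinite_Sum.abs_summable_on_comparison_test'[OF M]) (use le z in auto)
  show "((\<lambda>p. - 2 / (z - \<omega> p) ^ 3) has_sum deriv T z) I" if z: "z \<in> ball 0 R"
  proof -
    have "deriv (\<lambda>z. 1 / (z - \<omega> p) ^ 2 - 1 / \<omega> p ^ 2) z = - 2 / (z - \<omega> p) ^ 3" if "p \<in> I" for p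
    proof -
      have "z - \<omega> p \<noteq> 0" using ne[OF z that] by simp
      then have "((\<lambda>z. (z - \<omega> p) powi (-2) - 1 / \<omega> p ^ 2) has_field_derivative
          of_int (-2) * (z - \<omega> p) powi (-3)) (at z)"
        by (auto intro!: derivative_eq_intros)
      then show ?thesis
        by (intro DERIV_imp_deriv) (simp add: power_int_minus field_simps)
    qed
    then show ?thesis
      using *(2)[OF _ _ _ z] unfolding T_def by (subst has_sum_cong[symmetric]) auto
  qed
qed

end

context upper_half
begin

abbreviation "G4 \<equiv> eisenstein_G 4 \<tau>"
abbreviation "G6 \<equiv> eisenstein_G 6 \<tau>"

lemma eisenstein_G_eq: "eisenstein_G k \<tau> = (\<Sum>\<^sub>\<infinity>p\<in>UNIV - {(0,0)}. 1 / \<omega> p ^ k)"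
  unfolding eisenstein_G_def by (rule infsum_cong) (auto simp: lat_def)

section \<open>Derivative and periods of the Weierstrass function\<close>

lemma wp_split:
  assumes "R > 0" "z \<in> ball 0 R"
  shows "P z = 1 / z ^ 2 + (\<Sum>p | p \<noteq> (0,0) \<and> norm (\<omega> p) < 2 * R. 1 / (z - \<omega> p) ^ 2 - 1 / \<omega> p ^ 2)
     + (\<Sum>\<^sub>\<infinity>p\<in>{p. p \<noteq> (0,0) \<and> 2 * R \<le> norm (\<omega> p)}. 1 / (z - \<omega> p) ^ 2 - 1 / \<omega> p ^ 2)"
proof -
  define F where "F = {p. p \<noteq> (0,0) \<and> norm (\<omega> p) < 2 * R}"
  define I where "I = {p. p \<noteq> (0,0) \<and> 2 * R \<le> norm (\<omega> p)}"
  let ?t = "\<lambda>p. 1 / (z - \<omega> p) ^ 2 - 1 / \<omega> p ^ 2"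
  have "finite F" by (rule finite_subset[OF _ finite_lat_le[of "2 * R"]]) (auto simp: F_def)
  moreover have "?t summable_on I" unfolding I_def by (rule tail_holomorphic(3)[OF assms])
  moreover have "F \<inter> I = {}" by (auto simp: F_def I_def)
  ultimately have "infsum ?t (F \<union> I) = sum ?t F + infsum ?t I"
    by (subst infsum_Un_disjoint) auto
  moreover have "F \<union> I = UNIV - {(0,0)}" by (auto simp: F_def I_def)
  ultimately show ?thesis by (simp add: wp_def F_def I_def)
qed

text \<open>In the derivative the correcting constants disappear, and \<open>1 / z ^ 2\<close>
  supplies the missing summand at the origin. The series thus runs over the whole lattice, and its
  periodicity is a mere reindexing.\<close>

lemma wp_derivative:
  assumes "z \<notin> \<Lambda>"
  shows "P field_differentiable at z"
    and "((\<lambda>p. - 2 / (z - \<omega> p) ^ 3) has_sum deriv P z) UNIV"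
proof -
  define R where "R = norm z + 1"
  have R: "R > 0" "z \<in> ball 0 R" by (auto simp: R_def add_nonneg_pos)
  define F where "F = {p. p \<noteq> (0,0) \<and> norm (\<omega> p) < 2 * R}"
  define I where "I = {p. p \<noteq> (0,0) \<and> 2 * R \<le> norm (\<omega> p)}"
  define T where "T = (\<lambda>z. \<Sum>\<^sub>\<infinity>p\<in>I. 1 / (z - \<omega> p) ^ 2 - 1 / \<omega> p ^ 2)"
  have F: "finite F" by (rule finite_subset[OF _ finite_lat_le[of "2 * R"]]) (auto simp: F_def)
  have ne: "z - \<omega> p \<noteq> 0" for p using assms by (auto simp: \<Lambda>_def)
  have z0: "z \<noteq> 0" using ne[of "(0,0)"] by simp
  have T: "T holomorphic_on ball 0 R" "((\<lambda>p. - 2 / (z - \<omega> p) ^ 3) has_sum deriv T z) I"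
    unfolding T_def I_def by (rule tail_holomorphic R)+
  have DT: "(T has_field_derivative deriv T z) (at z)"
    using T(1) R(2) by (intro holomorphic_derivI[of T "ball 0 R"]) auto
  have D: "((\<lambda>z. 1 / (z - w) ^ 2) has_field_derivative - 2 / (z - w) ^ 3) (at z)" if "z - w \<noteq> 0" for w
  proof -
    have "((\<lambda>z. (z - w) powi (-2)) has_field_derivative of_int (-2) * (z - w) powi (-3)) (at z)"
      using that by (auto intro!: derivative_eq_intros)
    then show ?thesis by (simp add: power_int_minus field_simps)
  qed
  let ?D = "- 2 / z ^ 3 + (\<Sum>p\<in>F. - 2 / (z - \<omega> p) ^ 3) + deriv T z"
  have "((\<lambda>z. 1 / z ^ 2 + (\<Sum>p\<in>F. 1 / (z - \<omega> p) ^ 2 - 1 / \<omega> p ^ 2) + T z) has_field_derivative ?D) (at z)"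
  proof (intro DERIV_add DERIV_sum)
    show "((\<lambda>z. 1 / z ^ 2) has_field_derivative - 2 / z ^ 3) (at z)"
      using D[of 0] z0 by simp
    show "((\<lambda>z. 1 / (z - \<omega> p) ^ 2 - 1 / \<omega> p ^ 2) has_field_derivative - 2 / (z - \<omega> p) ^ 3) (at z)" for p
      using DERIV_diff[OF D[OF ne[of p]] DERIV_const[of "1 / \<omega> p ^ 2"]] by simp
  qed (fact DT)
  then have DP: "(P has_field_derivative ?D) (at z)"
  proof (rule has_field_derivative_transform_within_open[OF _ open_ball R(2)])
    show "1 / z ^ 2 + (\<Sum>p\<in>F. 1 / (z - \<omega> p) ^ 2 - 1 / \<omega> p ^ 2) + T z = P z" if "z \<in> ball 0 R" for z
      using wp_split[OF R(1) that] by (simp add: F_def I_def T_def)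
  qed
  then show "P field_differentiable at z" by (auto simp: field_differentiable_def)
  have "((\<lambda>p. - 2 / (z - \<omega> p) ^ 3) has_sum (\<Sum>p\<in>insert (0,0) F. - 2 / (z - \<omega> p) ^ 3)) (insert (0,0) F)"
    using F by (intro has_sum_finite) auto
  moreover have "(\<Sum>p\<in>insert (0,0) F. - 2 / (z - \<omega> p) ^ 3) = - 2 / z ^ 3 + (\<Sum>p\<in>F. - 2 / (z - \<omega> p) ^ 3)"
    using F by (subst sum.insert) (auto simp: F_def)
  moreover have "insert (0,0) F \<inter> I = {}" by (auto simp: F_def I_def)
  ultimately have "((\<lambda>p. - 2 / (z - \<omega> p) ^ 3) has_sum ?D) (insert (0,0) F \<union> I)"
    using has_sum_Un_disjoint[OF _ T(2)] by metis
  moreover have "insert (0,0) F \<union> I = UNIV" by (auto simp: F_def I_def)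
  ultimately show "((\<lambda>p. - 2 / (z - \<omega> p) ^ 3) has_sum deriv P z) UNIV"
    using DERIV_imp_deriv[OF DP] by simp
qed

lemma wp_holomorphic: "P holomorphic_on - \<Lambda>"
  using wp_derivative(1) by (auto simp: holomorphic_on_def intro: field_differentiable_at_within)

lemma wp_has_derivative: "z \<notin> \<Lambda> \<Longrightarrow> (P has_field_derivative deriv P z) (at z)"
  using wp_derivative(1) by (simp add: DERIV_deriv_iff_field_differentiable)

lemma wp_minus: "P (- z) = P z"
proof -
  have "(\<Sum>\<^sub>\<infinity>p\<in>UNIV - {(0,0)}. 1 / (- z - \<omega> p) ^ 2 - 1 / \<omega> p ^ 2) =
        (\<Sum>\<^sub>\<infinity>p\<in>UNIV - {(0,0)}. 1 / (z - \<omega> p) ^ 2 - 1 / \<omega> p ^ 2)"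
    by (rule infsum_reindex_bij_witness[of _ uminus uminus])
       (auto simp: lat_def power2_eq_square algebra_simps prod_eq_iff)
  then show ?thesis by (simp add: wp_def)
qed

lemma deriv_wp_minus: assumes "z \<notin> \<Lambda>" shows "deriv P (- z) = - deriv P z"
proof -
  have "((\<lambda>z. P (- z)) has_field_derivative deriv P (- z) * (-1)) (at z)"
    using wp_has_derivative[of "- z"] assms
    by (intro DERIV_chain2[of P]) (auto intro!: derivative_eq_intros)
  then have "(P has_field_derivative - deriv P (- z)) (at z)"
    by (simp add: wp_minus)
  from DERIV_unique[OF this wp_has_derivative[OF assms]] show ?thesis by (metis minus_minus)
qed

lemma deriv_wp_periodic: assumes "z \<notin> \<Lambda>" "w \<in> \<Lambda>" shows "deriv P (z + w) = deriv P z"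
proof -
  obtain q where q: "w = \<omega> q" using assms by (auto simp: \<Lambda>_def)
  have "((\<lambda>p. - 2 / (z + w - \<omega> p) ^ 3) has_sum deriv P (z + w)) UNIV"
    using assms by (intro wp_derivative) auto
  also have "?this \<longleftrightarrow> ((\<lambda>p. - 2 / (z - \<omega> p) ^ 3) has_sum deriv P (z + w)) UNIV"
    by (rule has_sum_reindex_bij_witness[of _ "\<lambda>p. p + q" "\<lambda>p. p - q"]) (auto simp: q lat_diff algebra_simps)
  finally show ?thesis
    using wp_derivative(2)[OF assms(1)] has_sum_unique by blast
qed

text \<open>As the derivative is periodic, \<open>P (z + w) - P z\<close> is a constant. At
  \<open>z = - w / 2\<close> it vanishes by evenness, which is legitimate only if that point is not
  a pole; the generators 1 and \<open>\<tau>\<close> satisfy this.\<close>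

lemma wp_periodic_weak:
  assumes w: "w \<in> \<Lambda>" "w / 2 \<notin> \<Lambda>" and z: "z \<notin> \<Lambda>"
  shows "P (z + w) = P z"
proof -
  have D: "((\<lambda>z. P (z + w) - P z) has_field_derivative 0) (at z)" if "z \<notin> \<Lambda>" for z
  proof -
    have "((\<lambda>z. P (z + w) - P z) has_field_derivative deriv P (z + w) * 1 - deriv P z) (at z)"
      using that w by (intro DERIV_diff wp_has_derivative DERIV_chain2[of P]) (auto intro!: derivative_eq_intros)
    then show ?thesis using deriv_wp_periodic[OF that w(1)] by simp
  qed
  have "continuous_on (- \<Lambda>) (\<lambda>z. P (z + w) - P z)"
    using D by (intro DERIV_continuous_on) (auto intro: has_field_derivative_at_within)
  then obtain c where c: "\<And>x. x \<in> - \<Lambda> \<Longrightarrow> P (x + w) - P x = c"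
    by (rule DERIV_zero_connected_constant[OF connected_compl_Lambda open_compl_Lambda finite.emptyI])
       (use D in auto)
  have "- w / 2 \<notin> \<Lambda>" using w(2) Lambda_minus_iff[of "w / 2"] by (simp del: Lambda_minus_iff)
  with c[of "- w / 2"] have "c = 0" using wp_minus[of "w / 2"] by simp
  with c[of z] z show ?thesis by simp
qed

lemma half_not_Lambda: "1 / 2 \<notin> \<Lambda>" "\<tau> / 2 \<notin> \<Lambda>"
proof -
  show "1 / 2 \<notin> \<Lambda>"
  proof
    assume "1 / 2 \<in> \<Lambda>"
    then obtain p where "1 / 2 = \<omega> p" by (auto simp: \<Lambda>_def)
    then have "\<omega> (1,0) = \<omega> (p + p)" unfolding lat_add by (simp add: lat_def algebra_simps)
    then have "(1,0) = p + p" by (simp only: lat_inj)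
    then have "(1::int) = 2 * fst p" by (simp add: prod_eq_iff)
    then show False by presburger
  qed
  show "\<tau> / 2 \<notin> \<Lambda>"
  proof
    assume "\<tau> / 2 \<in> \<Lambda>"
    then obtain p where "\<tau> / 2 = \<omega> p" by (auto simp: \<Lambda>_def)
    then have "\<omega> (0,1) = \<omega> (p + p)" unfolding lat_add by (simp add: lat_def algebra_simps)
    then have "(0,1) = p + p" by (simp only: lat_inj)
    then have "(1::int) = 2 * snd p" by (simp add: prod_eq_iff)
    then show False by presburger
  qed
qed

lemma one_Lambda [simp]: "1 \<in> \<Lambda>" and tau_Lambda [simp]: "\<tau> \<in> \<Lambda>"
  using rangeI[of \<omega> "(1,0)"] rangeI[of \<omega> "(0,1)"] by (auto simp: \<Lambda>_def lat_def)

lemma Lambda_of_int: assumes "w \<in> \<Lambda>" shows "of_int m * w \<in> \<Lambda>"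
proof (induction m rule: int_induct[where k = 0])
  case (step1 i) then show ?case using assms by (simp add: algebra_simps)
next
  case (step2 i) then show ?case using assms by (simp add: algebra_simps)
qed simp

lemma wp_periodic:
  assumes w: "w \<in> \<Lambda>" and z: "z \<notin> \<Lambda>"
  shows "P (z + w) = P z"
proof -
  have *: "P (z + of_int m * w) = P z" if w: "w \<in> \<Lambda>" "w / 2 \<notin> \<Lambda>" and z: "z \<notin> \<Lambda>" for m w z
  proof (induction m rule: int_induct[where k = 0])
    case (step1 i)
    have "P (z + of_int i * w + w) = P (z + of_int i * w)"
      using Lambda_of_int[OF w(1)] by (intro wp_periodic_weak w) (auto simp: z)
    with step1 show ?case by (simp add: algebra_simps)
  next
    case (step2 i)
    have "P (z + of_int (i - 1) * w + w) = P (z + of_int (i - 1) * w)"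
      using Lambda_of_int[OF w(1)] by (intro wp_periodic_weak w) (auto simp: z simp del: of_int_diff)
    with step2 show ?case by (simp add: algebra_simps)
  qed simp
  obtain m n where "w = of_int m + of_int n * \<tau>"
    using w by (auto simp: \<Lambda>_def lat_def)
  then have "P (z + w) = P (z + of_int m * 1 + of_int n * \<tau>)" by (simp add: add_ac)
  also have "\<dots> = P (z + of_int m * 1)"
    by (rule *) (use half_not_Lambda z Lambda_of_int[OF one_Lambda, of m] in auto)
  also have "\<dots> = P z" by (rule *) (use half_not_Lambda z in auto)
  finally show ?thesis .
qed

section \<open>Laurent expansion and differential equation\<close>

lemma summable_inverse_power:
  assumes "n \<ge> 3"
  shows "(\<lambda>p. 1 / norm (\<omega> p) ^ n) summable_on UNIV - {(0,0)}"
proof -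
  obtain c where c: "c > 0" "\<And>p. p \<noteq> (0,0) \<Longrightarrow> c \<le> norm (\<omega> p)" by (rule lat_norm_lower) blast
  have "(\<lambda>p. (1 / c ^ (n - 3)) * (1 / norm (\<omega> p) ^ 3)) summable_on UNIV - {(0,0)}"
    by (intro summable_on_cmult_right summable_inverse_cube)
  then show ?thesis
  proof (rule summable_on_comparison_test)
    fix p :: "int \<times> int" assume p: "p \<in> UNIV - {(0,0)}"
    have "c ^ (n - 3) \<le> norm (\<omega> p) ^ (n - 3)" using c p by (intro power_mono) auto
    then have "c ^ (n - 3) * norm (\<omega> p) ^ 3 \<le> norm (\<omega> p) ^ n"
      using assms mult_right_mono[of "c ^ (n-3)" "norm (\<omega> p) ^ (n - 3)" "norm (\<omega> p) ^ 3"]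
      by (simp flip: power_add)
    moreover have "c ^ (n - 3) * norm (\<omega> p) ^ 3 > 0" using c p by auto
    ultimately show "1 / norm (\<omega> p) ^ n \<le> 1 / c ^ (n - 3) * (1 / norm (\<omega> p) ^ 3)"
      by (simp add: frac_le)
  qed auto
qed

text \<open>Pairing the terms of a lattice point and its negative leaves only even powers of
  \<open>z\<close>. \<open>\<kappa>\<close> is the exact remainder of such a pair after the terms in
  \<open>z ^ 2\<close> and \<open>z ^ 4\<close>, up to the factor \<open>2 z ^ 6\<close>, so no
  double series has to be rearranged.\<close>

lemma wp_expansion:
  obtains r k where "r > 0" "ball 0 r \<inter> \<Lambda> = {0}" "k holomorphic_on ball 0 r"
    "\<And>z. z \<in> ball 0 r - {0} \<Longrightarrow> P z = 1 / z ^ 2 + 3 * G4 * z ^ 2 + 5 * G6 * z ^ 4 + z ^ 6 * k z"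
proof -
  obtain c where c: "c > 0" "\<And>p. p \<noteq> (0,0) \<Longrightarrow> c \<le> norm (\<omega> p)" by (rule lat_norm_lower) blast
  define r where "r = c / 2"
  define X where "X = UNIV - {(0::int,0::int)}"
  have r: "r > 0" "\<And>p. p \<in> X \<Longrightarrow> 2 * r \<le> norm (\<omega> p)" using c by (auto simp: r_def X_def)
  define \<kappa> where "\<kappa> = (\<lambda>p z. (7 * \<omega> p ^ 2 - 5 * z ^ 2) / (\<omega> p ^ 6 * (\<omega> p ^ 2 - z ^ 2) ^ 2))"
  define k where "k = (\<lambda>z. \<Sum>\<^sub>\<infinity>p\<in>X. \<kappa> p z)"
  have low: "norm (\<omega> p ^ 2 - z ^ 2) \<ge> 3 / 4 * norm (\<omega> p) ^ 2" "\<omega> p ^ 2 - z ^ 2 \<noteq> 0" "\<omega> p \<noteq> 0"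
    "norm z ^ 2 \<le> norm (\<omega> p) ^ 2 / 4"
    if "p \<in> X" "z \<in> ball 0 r" for p z
  proof -
    have "norm z \<le> norm (\<omega> p) / 2" using that r(2)[of p] by simp
    then have "norm z ^ 2 \<le> (norm (\<omega> p) / 2) ^ 2" by (intro power_mono) auto
    then show z2: "norm z ^ 2 \<le> norm (\<omega> p) ^ 2 / 4" by (simp add: power_divide)
    then show *: "norm (\<omega> p ^ 2 - z ^ 2) \<ge> 3 / 4 * norm (\<omega> p) ^ 2"
      using norm_triangle_ineq2[of "\<omega> p ^ 2" "z ^ 2"] by (simp add: norm_power)
    show p0: "\<omega> p \<noteq> 0" using that by (auto simp: X_def)
    then show "\<omega> p ^ 2 - z ^ 2 \<noteq> 0" using * by (auto simp: zero_less_mult_iff)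
  qed
  have hol: "\<kappa> p holomorphic_on ball 0 r" if "p \<in> X" for p
    unfolding \<kappa>_def using low[OF that] by (intro holomorphic_intros) auto
  \<comment> \<open>The numerator is at most \<open>9 |\<omega>|^2\<close>, the denominator at least
    \<open>(3/4)^2 |\<omega>|^10\<close>, and \<open>9 / (3/4)^2 = 16\<close>.\<close>
  have le: "norm (\<kappa> p z) \<le> 16 * (1 / norm (\<omega> p) ^ 8)" if "p \<in> X" "z \<in> ball 0 r" for p z
  proof -
    have "norm (7 * \<omega> p ^ 2 - 5 * z ^ 2) \<le> 7 * norm (\<omega> p) ^ 2 + 5 * norm z ^ 2"
      using norm_triangle_ineq4[of "7 * \<omega> p ^ 2" "5 * z ^ 2"] by (simp add: norm_mult norm_power)
    also have "\<dots> \<le> 9 * norm (\<omega> p) ^ 2" using low(4)[OF that] zero_le_power2[of "norm (\<omega> p)"] by linarith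
    finally have num: "norm (7 * \<omega> p ^ 2 - 5 * z ^ 2) \<le> 9 * norm (\<omega> p) ^ 2" .
    have "norm (\<kappa> p z) = norm (7 * \<omega> p ^ 2 - 5 * z ^ 2) / (norm (\<omega> p) ^ 6 * norm (\<omega> p ^ 2 - z ^ 2) ^ 2)"
      by (simp add: \<kappa>_def norm_divide norm_mult norm_power)
    also have "\<dots> \<le> (9 * norm (\<omega> p) ^ 2) / (norm (\<omega> p) ^ 6 * (3 / 4 * norm (\<omega> p) ^ 2) ^ 2)"
      using num low[OF that] by (intro frac_le mult_left_mono power_mono) auto
    also have "\<dots> = 16 * (1 / norm (\<omega> p) ^ 8)"
      using low(3)[OF that] by (simp add: field_simps) 
    finally show ?thesis .
  qed
  have M: "(\<lambda>p. 16 * (1 / norm (\<omega> p) ^ 8)) summable_on X"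
    unfolding X_def by (intro summable_on_cmult_right summable_inverse_power) auto
  have khol: "k holomorphic_on ball 0 r"
    unfolding k_def by (rule holomorphic_infsum(1)[OF hol le M])
  have ksum: "((\<lambda>p. \<kappa> p z) has_sum k z) X" if "z \<in> ball 0 r" for z
    unfolding k_def
    by (rule has_sum_infsum, rule abs_summable_summable, rule Infinite_Sum.abs_summable_on_comparison_test'[OF M])
       (use le that in auto)
  have G: "((\<lambda>p. 1 / \<omega> p ^ n) has_sum eisenstein_G n \<tau>) X" if "n \<ge> 3" for n
    unfolding eisenstein_G_eq X_def
    by (rule has_sum_infsum, rule abs_summable_summable)
       (use summable_inverse_power[OF that] in \<open>simp add: norm_divide norm_power\<close>)
  have "P z = 1 / z ^ 2 + 3 * G4 * z ^ 2 + 5 * G6 * z ^ 4 + z ^ 6 * k z" if z: "z \<in> ball 0 r - {0}" for z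
  proof -
    define S where "S = (\<Sum>\<^sub>\<infinity>p\<in>X. 1 / (z - \<omega> p) ^ 2 - 1 / \<omega> p ^ 2)"
    have "{p. p \<noteq> (0,0) \<and> 2 * r \<le> norm (\<omega> p)} = X" using r by (auto simp: X_def)
    then have S1: "((\<lambda>p. 1 / (z - \<omega> p) ^ 2 - 1 / \<omega> p ^ 2) has_sum S) X"
      using tail_holomorphic(3)[OF r(1), of z] z by (simp add: S_def)
    also have "?this \<longleftrightarrow> ((\<lambda>p. 1 / (z + \<omega> p) ^ 2 - 1 / \<omega> p ^ 2) has_sum S) X"
      by (rule has_sum_reindex_bij_witness[of _ uminus uminus])
         (auto simp: lat_def power2_eq_square algebra_simps prod_eq_iff X_def)
    finally have S2: "((\<lambda>p. 1 / (z + \<omega> p) ^ 2 - 1 / \<omega> p ^ 2) has_sum S) X" .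
    have "((\<lambda>p. 6 * z ^ 2 * (1 / \<omega> p ^ 4) + 10 * z ^ 4 * (1 / \<omega> p ^ 6) + 2 * z ^ 6 * \<kappa> p z) has_sum
           (6 * z ^ 2 * G4 + 10 * z ^ 4 * G6 + 2 * z ^ 6 * k z)) X"
      using z by (intro has_sum_add has_sum_cmult_right G ksum) auto
    also have "?this \<longleftrightarrow> ((\<lambda>p. (1 / (z - \<omega> p) ^ 2 - 1 / \<omega> p ^ 2) + (1 / (z + \<omega> p) ^ 2 - 1 / \<omega> p ^ 2)) has_sum
           (6 * z ^ 2 * G4 + 10 * z ^ 4 * G6 + 2 * z ^ 6 * k z)) X"
    proof (rule has_sum_cong)
      fix p assume p: "p \<in> X"
      define w A where "w = \<omega> p" and "A = (w ^ 2 - z ^ 2) ^ 2"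
      have w: "w \<noteq> 0" "w ^ 2 - z ^ 2 \<noteq> 0" using low[OF p, of z] z by (auto simp: w_def)
      have "(z - w) * (z + w) \<noteq> 0" using w(2) by (auto simp: power2_eq_square algebra_simps)
      then have zw: "(z - w) ^ 2 \<noteq> 0" "(z + w) ^ 2 \<noteq> 0" by auto
      have A: "A \<noteq> 0" "A = (z - w) ^ 2 * (z + w) ^ 2" using w by (auto simp: A_def) algebra
      have "1 / (z - w) ^ 2 + 1 / (z + w) ^ 2 = ((z + w) ^ 2 + (z - w) ^ 2) / A"
        using zw by (simp add: A(2) add_divide_distrib)
      also have "(z + w) ^ 2 + (z - w) ^ 2 = 2 * (z ^ 2 + w ^ 2)" by algebra
      finally have 1: "1 / (z - w) ^ 2 + 1 / (z + w) ^ 2 = 2 * (z ^ 2 + w ^ 2) / A" .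
      have "(2 * (z ^ 2 + w ^ 2)) * w ^ 6 - 2 * w ^ 4 * A =
          (6 * z ^ 2 * w ^ 2 + 10 * z ^ 4) * A + 2 * z ^ 6 * (7 * w ^ 2 - 5 * z ^ 2)"
        unfolding A_def by algebra
      then have "2 * (z ^ 2 + w ^ 2) / A - 2 / w ^ 2 = 6 * z ^ 2 * (1 / w ^ 4) + 10 * z ^ 4 * (1 / w ^ 6) +
           2 * z ^ 6 * ((7 * w ^ 2 - 5 * z ^ 2) / (w ^ 6 * A))"
        (is "?L = ?R")
      proof -
        define u where "u = w ^ 2"
        have u: "w ^ 2 = u" "w ^ 4 = u * u" "w ^ 6 = u * u * u" "u \<noteq> 0"
          using w(1) by (simp_all add: u_def flip: power_add)
        have q: "a / w ^ 2 * (w ^ 6 * A) = a * w ^ 4 * A" "a / w ^ 4 * (w ^ 6 * A) = a * w ^ 2 * A"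
          "a / w ^ 6 * (w ^ 6 * A) = a * A" "a / A * (w ^ 6 * A) = a * w ^ 6"
          "a / (w ^ 6 * A) * (w ^ 6 * A) = a" for a
          unfolding u(1-3) using u(4) A(1) by simp_all
        have "?L * (w ^ 6 * A) = (2 * (z ^ 2 + w ^ 2)) * w ^ 6 - 2 * w ^ 4 * A"
          unfolding left_diff_distrib q ..
        moreover have "?R * (w ^ 6 * A) = (6 * z ^ 2 * w ^ 2 + 10 * z ^ 4) * A + 2 * z ^ 6 * (7 * w ^ 2 - 5 * z ^ 2)"
          unfolding distrib_right times_divide_eq_right q mult_1_right by (simp add: algebra_simps)
        moreover assume "(2 * (z ^ 2 + w ^ 2)) * w ^ 6 - 2 * w ^ 4 * A =
          (6 * z ^ 2 * w ^ 2 + 10 * z ^ 4) * A + 2 * z ^ 6 * (7 * w ^ 2 - 5 * z ^ 2)"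
        ultimately have "?L * (w ^ 6 * A) = ?R * (w ^ 6 * A)" by simp
        then show ?thesis using w(1) A(1) by simp
      qed
      with 1 show "6 * z ^ 2 * (1 / \<omega> p ^ 4) + 10 * z ^ 4 * (1 / \<omega> p ^ 6) + 2 * z ^ 6 * \<kappa> p z =
         (1 / (z - \<omega> p) ^ 2 - 1 / \<omega> p ^ 2) + (1 / (z + \<omega> p) ^ 2 - 1 / \<omega> p ^ 2)"
        unfolding w_def[symmetric] \<kappa>_def A_def[symmetric] by (simp add: algebra_simps)
    qed
    finally have "S + S = 6 * z ^ 2 * G4 + 10 * z ^ 4 * G6 + 2 * z ^ 6 * k z"
      using has_sum_add[OF S1 S2] has_sum_unique by blast
    then have "2 * S = 2 * (3 * G4 * z ^ 2 + 5 * G6 * z ^ 4 + z ^ 6 * k z)" by (simp add: algebra_simps)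
    then have "S = 3 * G4 * z ^ 2 + 5 * G6 * z ^ 4 + z ^ 6 * k z"
      by (subst (asm) mult_cancel_left) simp
    then show ?thesis by (simp add: wp_def S_def X_def)
  qed
  moreover have "ball 0 r \<inter> \<Lambda> = {0}"
  proof -
    have "p = (0,0)" if "norm (\<omega> p) < r" for p
      using that r(2)[of p] r(1) by (cases "p \<in> X") (auto simp: X_def)
    then have "x = 0" if "x \<in> ball 0 r \<inter> \<Lambda>" for x
      using that lat_0[of \<tau>] unfolding \<Lambda>_def by (metis Int_iff imageE mem_ball_0)
    moreover have "0 \<in> ball 0 r \<inter> \<Lambda>" using r(1) by simp
    ultimately show ?thesis by blast
  qed
  ultimately show thesis using that r(1) khol by blast
qed

end

lemma upper_half_basis:
  assumes "Im \<tau> > 0"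
  obtains s t :: real where "z = of_real s + of_real t * \<tau>"
proof -
  define t where "t = Im z / Im \<tau>"
  define s where "s = Re z - t * Re \<tau>"
  have "z = of_real s + of_real t * \<tau>"
    using assms by (intro complex_eqI) (auto simp: s_def t_def)
  then show ?thesis by (rule that)
qed

context upper_half
begin

lemma Lambda_reduce:
  obtains w s t where "w \<in> \<Lambda>" "z = of_real s + of_real t * \<tau> + w" "s \<in> {0..1}" "t \<in> {0..1}"
proof -
  obtain s t :: real where st: "z = of_real s + of_real t * \<tau>"
    by (rule upper_half_basis[OF Im_pos])
  have "\<omega> (\<lfloor>s\<rfloor>, \<lfloor>t\<rfloor>) \<in> \<Lambda>" by (simp add: \<Lambda>_def)
  moreover have "z = of_real (frac s) + of_real (frac t) * \<tau> + \<omega> (\<lfloor>s\<rfloor>, \<lfloor>t\<rfloor>)"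
    by (simp add: st frac_def lat_def algebra_simps)
  moreover have "frac s \<in> {0..1}" "frac t \<in> {0..1}"
    using frac_lt_1[of s] frac_lt_1[of t] by auto
  ultimately show ?thesis by (rule that)
qed

text \<open>By periodicity a singularity that is removable at 0 is removable at all lattice points.
  The extended function \<open>F\<close> is entire and takes all its values on a compact period
  parallelogram, so Liouville's theorem applies.\<close>

lemma elliptic_entire_const:
  assumes f: "f holomorphic_on - \<Lambda>" and per: "\<And>z w. z \<notin> \<Lambda> \<Longrightarrow> w \<in> \<Lambda> \<Longrightarrow> f (z + w) = f z"
    and r: "r > 0" and g: "g holomorphic_on ball 0 r" and fg: "\<And>z. z \<in> ball 0 r - {0} \<Longrightarrow> z \<notin> \<Lambda> \<Longrightarrow> f z = g z"
  obtains c where "\<And>z. z \<notin> \<Lambda> \<Longrightarrow> f z = c"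
proof -
  obtain r' where r': "r' > 0" "ball 0 r' \<inter> \<Lambda> = {0}" by (rule wp_expansion) (rule that)
  define \<rho> where "\<rho> = min r r'"
  have \<rho>: "z = 0" if "z \<in> \<Lambda>" "norm z < \<rho>" for z
  proof -
    have "z \<in> ball 0 r' \<inter> \<Lambda>" using that by (simp add: \<rho>_def)
    then show "z = 0" unfolding r'(2) by simp
  qed
  have \<rho>0: "\<rho> > 0" by (simp add: \<rho>_def r(1) r'(1))
  define F where "F = (\<lambda>z. if z \<in> \<Lambda> then g 0 else f z)"
  have Fper: "F (z + w) = F z" if "w \<in> \<Lambda>" for z w
    using per[of z w] that by (auto simp: F_def)
  have "F field_differentiable (at z)" for z
  proof (cases "z \<in> \<Lambda>")
    case False
    have "f field_differentiable (at z)"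
      using f False by (auto intro: holomorphic_on_imp_differentiable_at)
    then obtain d where "(f has_field_derivative d) (at z)" by (auto simp: field_differentiable_def)
    then have "(F has_field_derivative d) (at z)"
      by (rule has_field_derivative_transform_within_open[OF _ open_compl_Lambda]) (use False in \<open>auto simp: F_def\<close>)
    then show ?thesis by (auto simp: field_differentiable_def)
  next
    case True
    have "((\<lambda>x. g (x - z)) has_field_derivative deriv g 0 * 1) (at z)"
      by (rule DERIV_chain2[of g]) (use g r in \<open>auto intro!: derivative_eq_intros holomorphic_derivI[of g "ball 0 r"]\<close>)
    then have "(F has_field_derivative deriv g 0 * 1) (at z)"
    proof (rule has_field_derivative_transform_within_open[OF _ open_ball[of z \<rho>]])
      fix x assume x: "x \<in> ball z \<rho>"
      show "g (x - z) = F x"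
      proof (cases "x = z")
        case False
        have "x - z \<notin> \<Lambda>" using x False \<rho>[of "x - z"] by (auto simp: dist_norm norm_minus_commute)
        moreover have "x - z \<in> ball 0 r - {0}" using x False by (auto simp: dist_norm norm_minus_commute \<rho>_def)
        ultimately have "f (x - z) = g (x - z)" using fg by blast
        then show ?thesis using Fper[OF True, of "x - z"] \<open>x - z \<notin> \<Lambda>\<close> by (simp add: F_def split: if_splits)
      qed (use True in \<open>auto simp: F_def\<close>)
    qed (use \<rho>0 in auto)
    then show ?thesis by (auto simp: field_differentiable_def)
  qed
  then have hol: "F holomorphic_on UNIV"
    by (auto simp: holomorphic_on_def intro: field_differentiable_at_within)
  let ?K = "(\<lambda>(s, t). of_real s + of_real t * \<tau>) ` ({0..1::real} \<times> {0..1::real})"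
  have "compact ?K"
    by (intro compact_continuous_image compact_Times) (auto intro!: continuous_intros simp: case_prod_unfold)
  then have "compact (F ` ?K)"
    using hol by (intro compact_continuous_image[OF _ \<open>compact ?K\<close>])
      (blast intro: holomorphic_on_imp_continuous_on continuous_on_subset)
  moreover have "range F \<subseteq> F ` ?K"
  proof
    fix y assume "y \<in> range F"
    then obtain z where y: "y = F z" by auto
    obtain w s t where "w \<in> \<Lambda>" "z = of_real s + of_real t * \<tau> + w" "s \<in> {0..1}" "t \<in> {0..1}"
      by (rule Lambda_reduce[of z])
    then show "y \<in> F ` ?K" using Fper[of w "of_real s + of_real t * \<tau>"] y by force
  qed
  ultimately have "bounded (range F)" using bounded_subset compact_imp_bounded by blast
  from Liouville_theorem[OF hol this] obtain c where "\<And>z. F z = c" by (auto simp: constant_on_def)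
  then show thesis using that[of c] by (metis F_def)
qed

lemma wp_deriv_holomorphic: "deriv P holomorphic_on - \<Lambda>"
  by (intro holomorphic_deriv wp_holomorphic open_compl_Lambda)

lemma wp_laurent:
  obtains r A B k where "r > 0" "ball 0 r \<inter> \<Lambda> = {0}" "k holomorphic_on ball 0 r"
    "\<And>z. A z = 3 * G4 + 5 * G6 * z ^ 2 + z ^ 4 * k z"
    "\<And>z. B z = 6 * G4 + 20 * G6 * z ^ 2 + 6 * z ^ 4 * k z + z ^ 5 * deriv k z"
    "\<And>z. z \<in> ball 0 r - {0} \<Longrightarrow> P z = 1 / z ^ 2 + z ^ 2 * A z"
    "\<And>z. z \<in> ball 0 r - {0} \<Longrightarrow> deriv P z = - 2 / z ^ 3 + z * B z"
proof -
  obtain r k where rk: "r > 0" "ball 0 r \<inter> \<Lambda> = {0}" "k holomorphic_on ball 0 r"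
    "\<And>z. z \<in> ball 0 r - {0} \<Longrightarrow> P z = 1 / z ^ 2 + 3 * G4 * z ^ 2 + 5 * G6 * z ^ 4 + z ^ 6 * k z"
    by (rule wp_expansion) blast
  have "deriv P z = - 2 / z ^ 3 + z * (6 * G4 + 20 * G6 * z ^ 2 + 6 * z ^ 4 * k z + z ^ 5 * deriv k z)"
    if z: "z \<in> ball 0 r - {0}" for z
  proof -
    have Dk: "(k has_field_derivative deriv k z) (at z)"
      using rk(3) z by (intro holomorphic_derivI[of k "ball 0 r"]) auto
    have "((\<lambda>z. z powi (-2) + 3 * G4 * z ^ 2 + 5 * G6 * z ^ 4 + z ^ 6 * k z) has_field_derivative
        (of_int (-2) * z powi (-3) + 3 * G4 * (2 * z) + 5 * G6 * (4 * z ^ 3) + (6 * z ^ 5 * k z + deriv k z * z ^ 6))) (at z)"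
      using z by (auto intro!: derivative_eq_intros Dk)
    then have "(P has_field_derivative
        (of_int (-2) * z powi (-3) + 3 * G4 * (2 * z) + 5 * G6 * (4 * z ^ 3) + (6 * z ^ 5 * k z + deriv k z * z ^ 6))) (at z)"
      by (rule has_field_derivative_transform_within_open[of _ _ _ "ball 0 r - {0}"])
         (use z rk(4) in \<open>auto simp: power_int_minus field_simps\<close>)
    from DERIV_imp_deriv[OF this] show ?thesis
      by (simp add: power_int_minus field_simps eval_nat_numeral)
  qed
  with rk show ?thesis
    by (intro that[of r k "\<lambda>z. 3 * G4 + 5 * G6 * z ^ 2 + z ^ 4 * k z"
         "\<lambda>z. 6 * G4 + 20 * G6 * z ^ 2 + 6 * z ^ 4 * k z + z ^ 5 * deriv k z"])
       (auto simp: algebra_simps eval_nat_numeral)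
qed

text \<open>The difference \<open>F\<close> of the two sides is elliptic, and its principal part at
  0 cancels. It is therefore constant, and the constant is the value at 0 of its regular
  continuation \<open>g\<close>, which is zero.\<close>

theorem wp_ode:
  assumes "z \<notin> \<Lambda>"
  shows "deriv P z ^ 2 = 4 * P z ^ 3 - 60 * G4 * P z - 140 * G6"
proof -
  obtain r A B k where rk: "r > 0" "ball 0 r \<inter> \<Lambda> = {0}" "k holomorphic_on ball 0 r"
    "\<And>z. A z = 3 * G4 + 5 * G6 * z ^ 2 + z ^ 4 * k z"
    "\<And>z. B z = 6 * G4 + 20 * G6 * z ^ 2 + 6 * z ^ 4 * k z + z ^ 5 * deriv k z"
    "\<And>z. z \<in> ball 0 r - {0} \<Longrightarrow> P z = 1 / z ^ 2 + z ^ 2 * A z"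
    "\<And>z. z \<in> ball 0 r - {0} \<Longrightarrow> deriv P z = - 2 / z ^ 3 + z * B z"
    by (rule wp_laurent) blast
  define F where "F = (\<lambda>z. deriv P z ^ 2 - 4 * P z ^ 3 + 60 * G4 * P z + 140 * G6)"
  define g where "g = (\<lambda>z. z ^ 2 * B z ^ 2 - 12 * z ^ 2 * A z ^ 2 - 4 * z ^ 6 * A z ^ 3 +
      60 * G4 * z ^ 2 * A z - 36 * z ^ 2 * k z - 4 * z ^ 3 * deriv k z)"
  have ghol: "g holomorphic_on ball 0 r"
    unfolding g_def rk(4,5) by (intro holomorphic_intros rk(3) open_ball)
  have Fg: "F z = g z" if z: "z \<in> ball 0 r - {0}" for z
  proof -
    define i where "i = 1 / z"
    have zi: "z * i = 1" using z by (simp add: i_def)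
    have PA: "P z = i ^ 2 + z ^ 2 * A z" and PB: "deriv P z = - 2 * i ^ 3 + z * B z"
      using rk(6,7)[OF z] by (simp_all add: i_def power_divide)
    have F1: "F z = - 4 * B z * (i ^ 3 * z) + z ^ 2 * B z ^ 2 - 12 * (i ^ 4 * z ^ 2) * A z - 12 * (i ^ 2 * z ^ 4) * A z ^ 2
        - 4 * z ^ 6 * A z ^ 3 + 60 * G4 * i ^ 2 + 60 * G4 * z ^ 2 * A z + 140 * G6"
      unfolding F_def PA PB by (simp add: power2_eq_square power3_eq_cube eval_nat_numeral algebra_simps)
    have i: "i ^ 3 * z = i ^ 2" "i ^ 4 * z ^ 2 = i ^ 2" "i ^ 2 * z ^ 4 = z ^ 2"
      using z by (simp_all add: i_def field_simps eval_nat_numeral)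
    have "F z = (- 4 * B z - 12 * A z + 60 * G4) * i ^ 2 + z ^ 2 * B z ^ 2 - 12 * z ^ 2 * A z ^ 2
        - 4 * z ^ 6 * A z ^ 3 + 60 * G4 * z ^ 2 * A z + 140 * G6"
      using F1 unfolding i by (simp add: algebra_simps)
    \<comment> \<open>The constant terms cancel because 24 + 36 = 60. What remains is divisible by
      \<open>z ^ 2\<close>, and its next coefficient \<open>- 140 * G6\<close> removes the constant
      in \<open>F\<close>.\<close>
    also have "- 4 * B z - 12 * A z + 60 * G4 = z ^ 2 * (- 140 * G6 - 36 * z ^ 2 * k z - 4 * z ^ 3 * deriv k z)"
      unfolding rk(4,5) by (simp add: algebra_simps eval_nat_numeral)
    also have "z ^ 2 * (- 140 * G6 - 36 * z ^ 2 * k z - 4 * z ^ 3 * deriv k z) * i ^ 2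
        = (z * i) ^ 2 * (- 140 * G6 - 36 * z ^ 2 * k z - 4 * z ^ 3 * deriv k z)"
      by (simp only: power_mult_distrib mult_ac)
    finally show ?thesis by (simp add: zi g_def)
  qed
  have Fhol: "F holomorphic_on - \<Lambda>"
    unfolding F_def by (intro holomorphic_intros wp_holomorphic wp_deriv_holomorphic)
  have Fper: "F (z + w) = F z" if "z \<notin> \<Lambda>" "w \<in> \<Lambda>" for z w
    using that by (simp add: F_def wp_periodic deriv_wp_periodic)
  obtain c where c: "\<And>z. z \<notin> \<Lambda> \<Longrightarrow> F z = c"
    by (rule elliptic_entire_const[OF Fhol Fper rk(1) ghol]) (use Fg in auto)
  have "(g \<longlongrightarrow> g 0) (at 0)"
    using ghol rk(1) by (intro isContD) (auto simp: holomorphic_on_imp_continuous_on continuous_on_interior intro!: continuous_on_interior[of "ball 0 r"])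
  moreover have "(g \<longlongrightarrow> c) (at 0)"
  proof (rule tendsto_eventually)
    have "eventually (\<lambda>z. z \<in> ball 0 r - {0}) (at 0)" 
      using rk(1) by (intro eventually_at_in_open) auto
    then show "eventually (\<lambda>z. g z = c) (at 0)"
    proof eventually_elim
      case (elim z)
      then have "z \<notin> \<Lambda>" using rk(2) by blast
      with elim show ?case using Fg[of z] c[of z] by simp
    qed
  qed
  ultimately have "c = g 0" by (metis tendsto_unique at_neq_bot)
  with c[OF assms] show ?thesis by (simp add: F_def g_def algebra_simps)
qed

end

lemma cubic_roots:
  fixes a b :: complex
  obtains e1 e2 e3 where "e1 + e2 + e3 = 0" "e1 * e2 + e1 * e3 + e2 * e3 = a" "e1 * e2 * e3 = - b"
proof -
  define p where "p = [:b, a, 0, 1:]"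
  have "p \<noteq> 0" by (simp add: p_def)
  then obtain A where A: "size A = degree p" "p = smult (lead_coeff p) (\<Prod>x\<in>#A. [:- x, 1:])"
    using alg_closed_imp_factorization by blast
  have "size A = Suc (Suc (Suc 0))" using A(1) by (simp add: p_def)
  then obtain e1 e2 e3 where "A = {#e1, e2, e3#}"
  proof -
    assume size: "size A = Suc (Suc (Suc 0))" and *: "\<And>e1 e2 e3. A = {#e1, e2, e3#} \<Longrightarrow> thesis"
    obtain e1 B where B: "A = add_mset e1 B" using size_eq_Suc_imp_eq_union[OF size] by blast
    then have "size B = Suc (Suc 0)" using size by simp
    then obtain e2 C where C: "B = add_mset e2 C" "size C = Suc 0"
      using size_eq_Suc_imp_eq_union by (metis Suc_inject size_add_mset)
    then obtain e3 where "C = {#e3#}" by (metis size_1_singleton_mset One_nat_def)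
    with B C * show thesis by blast
  qed
  then have "p = [:- e1, 1:] * ([:- e2, 1:] * [:- e3, 1:])" using A(2) by (simp add: p_def)
  then have *: "b = - (e1 * (e2 * e3))" "a = e2 * e3 - e1 * (- e2 - e3)" "0 = - e2 - e3 - e1"
    by (auto simp: p_def)
  show ?thesis
  proof (rule that[of e1 e2 e3])
    show "e1 + e2 + e3 = 0" using *(3) by algebra
  qed (simp_all add: *(1,2) algebra_simps)
qed

lemma deriv_shift:
  fixes f :: "complex \<Rightarrow> complex"
  assumes "f field_differentiable at (a + t)"
  shows "((\<lambda>t. f (a + t)) has_field_derivative deriv f (a + t)) (at t)"
proof -
  have "((\<lambda>t. f (a + t)) has_field_derivative deriv f (a + t) * 1) (at t)"
    using assms by (intro DERIV_chain2[of f]) (auto intro!: derivative_eq_intros simp: DERIV_deriv_iff_field_differentiable)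
  then show ?thesis by simp
qed

lemma shift_ode2:
  fixes f :: "complex \<Rightarrow> complex"
  assumes f: "f holomorphic_on T" and T: "open T"
    and ode: "\<And>z. z \<in> T \<Longrightarrow> deriv (deriv f) z = F (f z)"
    and S: "open S" "\<And>t. t \<in> S \<Longrightarrow> a + t \<in> T" and t: "t \<in> S"
  shows "deriv (\<lambda>t. f (a + t)) t = deriv f (a + t)"
    and "deriv (deriv (\<lambda>t. f (a + t))) t = F (f (a + t))"
proof -
  have 1: "deriv (\<lambda>t. f (a + t)) t = deriv f (a + t)" if "t \<in> S" for t
    using S(2)[OF that] f T by (intro DERIV_imp_deriv deriv_shift) (auto intro: holomorphic_on_imp_differentiable_at)
  then show "deriv (\<lambda>t. f (a + t)) t = deriv f (a + t)" using t by blast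
  have "deriv (deriv (\<lambda>t. f (a + t))) t = deriv (\<lambda>t. deriv f (a + t)) t"
    by (rule deriv_cong_ev) (use eventually_nhds_in_open[OF S(1) t] 1 in \<open>auto elim!: eventually_mono\<close>)
  also have "\<dots> = deriv (deriv f) (a + t)"
    using S(2)[OF t] holomorphic_deriv[OF f T] T
    by (intro DERIV_imp_deriv deriv_shift) (auto intro: holomorphic_on_imp_differentiable_at)
  finally show "deriv (deriv (\<lambda>t. f (a + t))) t = F (f (a + t))" using ode[OF S(2)[OF t]] by simp
qed

context upper_half
begin

section \<open>Poles, values and coincidences of the Weierstrass function\<close>

text \<open>Near 0 the reciprocal of \<open>P\<close> is \<open>z^2 / (1 + z^4 A(z))\<close>, with a
  double zero at the origin. It turns the pole into a point where initial values exist and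
  uniqueness theorems can be applied.\<close>

lemma wp_inverse_near_0:
  obtains r V where "r > 0" "ball 0 r \<inter> \<Lambda> = {0}" "V holomorphic_on ball 0 r" "V 0 = 0" "deriv V 0 = 0"
    "\<And>z. z \<in> ball 0 r - {0} \<Longrightarrow> V z \<noteq> 0 \<and> P z = 1 / V z"
    "((\<lambda>z. V z / z ^ 2) \<longlongrightarrow> 1) (at 0)"
proof -
  obtain r A B k where rk: "r > 0" "ball 0 r \<inter> \<Lambda> = {0}" "k holomorphic_on ball 0 r"
    "\<And>z. A z = 3 * G4 + 5 * G6 * z ^ 2 + z ^ 4 * k z"
    "\<And>z. B z = 6 * G4 + 20 * G6 * z ^ 2 + 6 * z ^ 4 * k z + z ^ 5 * deriv k z"
    "\<And>z. z \<in> ball 0 r - {0} \<Longrightarrow> P z = 1 / z ^ 2 + z ^ 2 * A z"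
    "\<And>z. z \<in> ball 0 r - {0} \<Longrightarrow> deriv P z = - 2 / z ^ 3 + z * B z"
    by (rule wp_laurent) blast
  define u where "u = (\<lambda>z. 1 + z ^ 4 * A z)"
  have uhol: "u holomorphic_on ball 0 r"
    unfolding u_def rk(4) by (intro holomorphic_intros rk(3))
  then have "isCont u 0" using rk(1)
    by (auto simp: continuous_on_eq_continuous_at dest!: holomorphic_on_imp_continuous_on)
  then have utend: "(u \<longlongrightarrow> 1) (at 0)" by (simp add: isCont_def u_def)
  then have "eventually (\<lambda>z. u z \<noteq> 0) (at 0)" by (rule tendsto_imp_eventually_ne) auto
  then obtain d where d: "d > 0" "\<And>z. z \<noteq> 0 \<Longrightarrow> norm z < d \<Longrightarrow> u z \<noteq> 0"
    by (auto simp: eventually_at dist_norm)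
  define r' where "r' = min r d"
  have u0: "u z \<noteq> 0" if "z \<in> ball 0 r'" for z
    using d(2)[of z] that by (cases "z = 0") (auto simp: r'_def u_def)
  define V where "V = (\<lambda>z. z ^ 2 / u z)"
  have Vhol: "V holomorphic_on ball 0 r'"
    unfolding V_def using u0 by (intro holomorphic_intros holomorphic_on_subset[OF uhol]) (auto simp: r'_def)
  have r': "r' > 0" using rk(1) d(1) by (simp add: r'_def)
  have "(V has_field_derivative 0) (at 0)"
  proof -
    have "(u has_field_derivative deriv u 0) (at 0)"
      using uhol rk(1) by (intro holomorphic_derivI[of u "ball 0 r"]) auto
    moreover have "u 0 = 1" by (simp add: u_def)
    ultimately show ?thesis unfolding V_def
      by - (rule derivative_eq_intros | assumption | simp)+
  qed
  then have "deriv V 0 = 0" by (rule DERIV_imp_deriv)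
  moreover have "V z \<noteq> 0 \<and> P z = 1 / V z" if "z \<in> ball 0 r' - {0}" for z
  proof -
    have "P z = 1 / z ^ 2 + z ^ 2 * A z" using that rk(6)[of z] by (auto simp: r'_def)
    then show ?thesis using that u0[of z]
      by (simp add: V_def u_def field_simps eval_nat_numeral)
  qed
  moreover have "ball 0 r' \<inter> \<Lambda> = {0}"
  proof -
    have "ball (0::complex) r' \<subseteq> ball 0 r" "0 \<in> ball (0::complex) r'" using r' by (auto simp: r'_def)
    then show ?thesis using rk(2) by blast
  qed
  moreover have "((\<lambda>z. V z / z ^ 2) \<longlongrightarrow> 1) (at 0)"
  proof (rule Lim_transform_eventually)
    show "((\<lambda>z. 1 / u z) \<longlongrightarrow> 1) (at 0)" using tendsto_divide[OF tendsto_const[of 1] utend] by simp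
    show "eventually (\<lambda>z. 1 / u z = V z / z ^ 2) (at 0)"
      unfolding eventually_at_filter by (rule always_eventually) (auto simp: V_def)
  qed
  ultimately show ?thesis using that r' Vhol by (simp add: V_def)
qed

lemma wp_pole: assumes "w \<in> \<Lambda>" shows "filterlim P at_infinity (at w)"
proof -
  obtain r V where V: "r > 0" "ball 0 r \<inter> \<Lambda> = {0}" "V holomorphic_on ball 0 r" "V 0 = 0" "deriv V 0 = 0"
    "\<And>z. z \<in> ball 0 r - {0} \<Longrightarrow> V z \<noteq> 0 \<and> P z = 1 / V z" by (rule wp_inverse_near_0) (rule that)
  have ev: "eventually (\<lambda>z. z \<in> ball 0 r - {0}) (at 0)"
    using V(1) by (intro eventually_at_in_open) auto
  have "isCont V 0" using V(1,3)
    by (auto simp: continuous_on_eq_continuous_at dest!: holomorphic_on_imp_continuous_on)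
  then have "(V \<longlongrightarrow> 0) (at 0)" using V(4) by (simp add: isCont_def)
  then have "filterlim V (at 0) (at 0)"
    by (rule filterlim_atI) (use ev V(6) in \<open>auto elim!: eventually_mono\<close>)
  then have "filterlim (\<lambda>z. inverse (V z)) at_infinity (at 0)"
    by (rule filterlim_compose[OF filterlim_inverse_at_infinity])
  then have P0: "filterlim P at_infinity (at 0)"
    by (rule filterlim_mono_eventually[OF _ order_refl order_refl])
       (use ev V(6) in \<open>auto elim!: eventually_mono simp: inverse_eq_divide\<close>)
  have "filterlim (\<lambda>z. P (w + z)) at_infinity (at 0)"
  proof (rule filterlim_mono_eventually[OF P0 order_refl order_refl])
    show "eventually (\<lambda>z. P z = P (w + z)) (at 0)"
      using ev
    proof eventually_elim
      case (elim z)
      then have "z \<notin> \<Lambda>" using V(2) by blast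
      then show ?case using wp_periodic[OF assms \<open>z \<notin> \<Lambda>\<close>] by (metis add.commute)
    qed
  qed
  then show ?thesis by (subst at_to_0) (simp add: filterlim_filtermap add.commute)
qed

text \<open>If \<open>c\<close> were omitted, \<open>1 / (P - c)\<close> would be elliptic and
  regular also at the lattice points, where it continues as \<open>V / (1 - c V)\<close>. It would
  be constant, and so would \<open>P\<close>, contradicting the pole.\<close>

lemma wp_surj: obtains z where "z \<notin> \<Lambda>" "P z = c"
proof (rule ccontr)
  assume "\<not> thesis"
  then have ne: "P z \<noteq> c" if "z \<notin> \<Lambda>" for z using that \<open>\<not> thesis\<close> \<open>\<And>z. z \<notin> \<Lambda> \<Longrightarrow> P z = c \<Longrightarrow> thesis\<close> by blast
  obtain r V where V: "r > 0" "ball 0 r \<inter> \<Lambda> = {0}" "V holomorphic_on ball 0 r" "V 0 = 0" "deriv V 0 = 0"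
    "\<And>z. z \<in> ball 0 r - {0} \<Longrightarrow> V z \<noteq> 0 \<and> P z = 1 / V z" by (rule wp_inverse_near_0) (rule that)
  have VL: "z \<notin> \<Lambda>" if "z \<in> ball 0 r - {0}" for z using V(2) that by blast
  define f where "f = (\<lambda>z. 1 / (P z - c))"
  define g where "g = (\<lambda>z. V z / (1 - c * V z))"
  have d: "1 - c * V z \<noteq> 0" if "z \<in> ball 0 r" for z
  proof (cases "z = 0")
    case False
    then show ?thesis using V(6)[of z] ne[OF VL, of z] that by (auto simp: field_simps)
  qed (simp add: V(4))
  have g: "g holomorphic_on ball 0 r" unfolding g_def using d by (intro holomorphic_intros V(3)) auto
  have f: "f holomorphic_on - \<Lambda>" unfolding f_def using ne by (intro holomorphic_intros wp_holomorphic) auto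
  obtain c' where c': "\<And>z. z \<notin> \<Lambda> \<Longrightarrow> f z = c'"
  proof (rule elliptic_entire_const[OF f _ V(1) g])
    show "f (z + w) = f z" if "z \<notin> \<Lambda>" "w \<in> \<Lambda>" for z w using that by (simp add: f_def wp_periodic)
    show "f z = g z" if "z \<in> ball 0 r - {0}" for z
      using V(6)[OF that] d[of z] that by (simp add: f_def g_def field_simps)
  qed auto
  have "1 / 2 \<notin> \<Lambda>" by (rule half_not_Lambda)
  then have "c' \<noteq> 0" using c'[of "1/2"] ne[of "1/2"] by (auto simp: f_def)
  then have "P z = c + 1 / c'" if "z \<notin> \<Lambda>" for z
    using c'[OF that] ne[OF that] by (auto simp: f_def field_simps)
  then have "eventually (\<lambda>z. P z = c + 1 / c') (at 0)"
    using VL V(1) eventually_at_in_open[of "ball 0 r" 0] by (auto elim!: eventually_mono)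
  then have "filterlim (\<lambda>z::complex. c + 1 / c') at_infinity (at 0)"
    using wp_pole[OF Lambda_0] by (rule filterlim_mono_eventually[OF _ order_refl order_refl, rotated])
  moreover have "((\<lambda>z::complex. c + 1 / c') \<longlongrightarrow> c + 1 / c') (at 0)" by (rule tendsto_const)
  ultimately show False using not_tendsto_and_filterlim_at_infinity[of "at (0::complex)"] by auto
qed

lemma wp_nonconst: obtains z where "z \<notin> \<Lambda>" "deriv P z \<noteq> 0"
proof (rule ccontr)
  assume "\<not> thesis"
  then have 0: "deriv P z = 0" if "z \<notin> \<Lambda>" for z using that \<open>\<And>z. z \<notin> \<Lambda> \<Longrightarrow> deriv P z \<noteq> 0 \<Longrightarrow> thesis\<close> by blast
  have D: "(P has_field_derivative 0) (at z)" if "z \<in> - \<Lambda>" for z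
    using wp_has_derivative[of z] 0[of z] that by simp
  have "continuous_on (- \<Lambda>) P" using wp_holomorphic by (rule holomorphic_on_imp_continuous_on)
  then obtain c where c: "\<And>x. x \<in> - \<Lambda> \<Longrightarrow> P x = c"
    by (rule DERIV_zero_connected_constant[OF connected_compl_Lambda open_compl_Lambda finite.emptyI])
       (use D in auto)
  obtain z where "z \<notin> \<Lambda>" "P z = c + 1" by (rule wp_surj)
  with c[of z] show False by simp
qed

text \<open>The vanishing terms give the equation the shape that \<open>ode2_unique\<close> expects.\<close>

lemma wp_ode2: assumes "z \<notin> \<Lambda>" shows "deriv (deriv P) z = - 30 * G4 + 0 * P z + 6 * P z ^ 2 + 0 * P z ^ 3"
proof -
  obtain z1 where z1: "z1 \<notin> \<Lambda>" "deriv P z1 \<noteq> 0" by (rule wp_nonconst)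
  have "deriv (deriv P) z = (- 60 * G4) / 2 + 0 * P z + 3 * 4 / 2 * P z ^ 2 + 2 * 0 * P z ^ 3"
    by (rule ode1_imp_ode2[OF wp_holomorphic open_compl_Lambda connected_compl_Lambda _ _ z1(2), where a = "- 140 * G6"])
       (use wp_ode z1 assms in auto)
  then show ?thesis by simp
qed

text \<open>The translates of \<open>P\<close> by \<open>z\<close> and by \<open>w\<close> solve the
  same second-order equation with the same initial data at \<open>t = 0\<close>, so they agree
  wherever both are finite. At \<open>t = - z\<close> the first has a pole; if \<open>z - w\<close>
  were not a period, the second would be finite there.\<close>

lemma wp_eq_imp:
  assumes z: "z \<notin> \<Lambda>" and w: "w \<notin> \<Lambda>" and eq: "P z = P w" "deriv P z = deriv P w"
  shows "z - w \<in> \<Lambda>"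
proof (rule ccontr)
  assume nL: "z - w \<notin> \<Lambda>"
  define S where "S = {t. z + t \<notin> \<Lambda>} \<inter> {t. w + t \<notin> \<Lambda>}"
  have *: "{t. a + t \<notin> \<Lambda>} = - ((+) (- a) ` \<Lambda>)" for a
  proof (intro set_eqI iffI)
    fix t assume "t \<in> {t. a + t \<notin> \<Lambda>}"
    then show "t \<in> - ((+) (- a) ` \<Lambda>)" by auto
  next
    fix t assume t: "t \<in> - ((+) (- a) ` \<Lambda>)"
    have "t = - a + (a + t)" by simp
    with t show "t \<in> {t. a + t \<notin> \<Lambda>}" by blast
  qed
  have "closed ((+) (- a) ` \<Lambda>)" for a using closed_Lambda by (rule closed_translation)
  then have S: "open S" unfolding S_def * by (intro open_Int) (auto simp: open_Compl)
  \<comment> \<open>Removing countably many points from the plane leaves a connected set.\<close>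
  have "S = UNIV - ((+) (- z) ` \<Lambda> \<union> (+) (- w) ` \<Lambda>)" unfolding S_def * by blast
  moreover have "connected (UNIV - ((+) (- z) ` \<Lambda> \<union> (+) (- w) ` \<Lambda>))"
    using countable_Lambda by (intro connected_open_diff_countable) auto
  ultimately have Sc: "connected S" by simp
  have hol: "(\<lambda>t. P (a + t)) holomorphic_on S" if "a = z \<or> a = w" for a
  proof -
    have "P \<circ> (\<lambda>t. a + t) holomorphic_on S"
      by (rule holomorphic_on_compose_gen[OF _ wp_holomorphic]) (use that in \<open>auto simp: S_def intro!: holomorphic_intros\<close>)
    then show ?thesis by (simp add: o_def)
  qed
  note sh = shift_ode2[OF wp_holomorphic open_compl_Lambda, of "\<lambda>x. - 30 * G4 + 0 * x + 6 * x ^ 2 + 0 * x ^ 3" S]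
  have S0: "0 \<in> S" using z w by (simp add: S_def)
  have d1: "deriv (\<lambda>t. P (a + t)) t = deriv P (a + t)"
    and d2: "deriv (deriv (\<lambda>t. P (a + t))) t = - 30 * G4 + 0 * P (a + t) + 6 * P (a + t) ^ 2 + 0 * P (a + t) ^ 3"
    if "a = z \<or> a = w" "t \<in> S" for a t
    by (rule sh; use wp_ode2 S that in \<open>auto simp: S_def\<close>)+
  have d0: "deriv (\<lambda>t. P (z + t)) 0 = deriv (\<lambda>t. P (w + t)) 0"
    using d1[OF _ S0] eq by simp
  have P_eq: "P (z + t) = P (w + t)" if "t \<in> S" for t
    by (rule ode2_unique[OF hol hol S Sc d2 d2 S0 _ d0 that]) (use eq in auto)
  have wz: "w - z \<notin> \<Lambda>" using nL Lambda_minus_iff[of "z - w"] by simp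
  have cont: "isCont P (w + - z)"
    using wp_derivative(1)[OF wz] field_differentiable_imp_continuous_at by simp
  have "isCont (\<lambda>t. P (w + t)) (- z)"
    by (rule isCont_o2[where f = "\<lambda>t. w + t" and g = P]) (use cont in simp_all)
  then have lim: "((\<lambda>t. P (w + t)) \<longlongrightarrow> P (w - z)) (at (- z))" by (simp add: isCont_def)
  have "filterlim (\<lambda>t. P (z + t)) at_infinity (at (- z))"
    using wp_pole[OF Lambda_0] by (subst at_to_0) (simp add: filterlim_filtermap)
  moreover have "eventually (\<lambda>t. P (z + t) = P (w + t)) (at (- z))"
  proof -
    obtain r where r: "r > 0" "ball 0 r \<inter> \<Lambda> = {0}" by (rule wp_inverse_near_0)
    have "eventually (\<lambda>t. t \<in> ball (- z) r - {- z}) (at (- z))"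
      using r(1) by (intro eventually_at_in_open) auto
    moreover have "eventually (\<lambda>t. w + t \<notin> \<Lambda>) (at (- z))"
    proof -
      have "open {t. w + t \<notin> \<Lambda>}" unfolding * using \<open>closed ((+) (- w) ` \<Lambda>)\<close> by (simp add: open_Compl)
      then have "eventually (\<lambda>t. t \<in> {t. w + t \<notin> \<Lambda>} - {- z}) (at (- z))"
        by (rule eventually_at_in_open) (use wz in simp)
      then show ?thesis by eventually_elim simp
    qed
    ultimately show ?thesis
    proof eventually_elim
      case (elim t)
      have "z + t \<in> ball 0 r - {0}" using elim(1) norm_minus_cancel[of "z + t"] by (auto simp: dist_norm add_eq_0_iff)
      then have "z + t \<notin> \<Lambda>" using r(2) by blast
      with elim(2) show ?case by (intro P_eq) (simp add: S_def)
    qed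
  qed
  ultimately have "filterlim (\<lambda>t. P (w + t)) at_infinity (at (- z))"
    by (rule filterlim_mono_eventually[OF _ order_refl order_refl])
  with lim show False using not_tendsto_and_filterlim_at_infinity[of "at (- z)"] by auto
qed

lemma deriv_wp_eq_0_iff: assumes z: "z \<notin> \<Lambda>" shows "deriv P z = 0 \<longleftrightarrow> 2 * z \<in> \<Lambda>"
proof
  assume "2 * z \<in> \<Lambda>"
  then have "deriv P (- z + 2 * z) = deriv P (- z)" using z by (intro deriv_wp_periodic) auto
  then have "deriv P z = - deriv P z" using deriv_wp_minus[OF z] by simp
  then show "deriv P z = 0" by simp
next
  assume "deriv P z = 0"
  then have "z - (- z) \<in> \<Lambda>"
    using z deriv_wp_minus[OF z] by (intro wp_eq_imp) (auto simp: wp_minus)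
  then show "2 * z \<in> \<Lambda>" by simp
qed

text \<open>The differential equation makes the derivative at a point depend on the value of
  \<open>P\<close> up to sign only, and the two signs belong to \<open>w\<close> and
  \<open>- w\<close>.\<close>

lemma wp_eq_iff:
  assumes z: "z \<notin> \<Lambda>" and w: "w \<notin> \<Lambda>"
  shows "P z = P w \<longleftrightarrow> z - w \<in> \<Lambda> \<or> z + w \<in> \<Lambda>"
proof
  assume eq: "P z = P w"
  have "deriv P z ^ 2 = deriv P w ^ 2" using wp_ode[OF z] wp_ode[OF w] eq by simp
  then consider "deriv P z = deriv P w" | "deriv P z = - deriv P w" by (auto simp: power2_eq_iff)
  then show "z - w \<in> \<Lambda> \<or> z + w \<in> \<Lambda>"
  proof cases
    case 1 then show ?thesis using wp_eq_imp[OF z w eq] by blast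
  next
    case 2
    then have "z - (- w) \<in> \<Lambda>"
      using w eq deriv_wp_minus[OF w] by (intro wp_eq_imp[OF z]) (auto simp: wp_minus)
    then show ?thesis by simp
  qed
next
  assume "z - w \<in> \<Lambda> \<or> z + w \<in> \<Lambda>"
  then show "P z = P w"
    using wp_periodic[of "z - w" w] wp_periodic[of "z + w" "- w"] w by (auto simp: wp_minus)
qed

section \<open>Branch values and the modular function\<close>

text \<open>By Vieta these are the roots, with multiplicity, of the cubic in the differential
  equation. Stated through symmetric functions, the notion is visibly invariant under
  permutations.\<close>

definition wp_roots :: "complex \<Rightarrow> complex \<Rightarrow> complex \<Rightarrow> bool" where
  "wp_roots e1 e2 e3 \<longleftrightarrow> e1 + e2 + e3 = 0 \<and> e1 * e2 + e1 * e3 + e2 * e3 = - 15 * G4 \<and> e1 * e2 * e3 = 35 * G6"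

lemma wp_roots_exist: obtains e1 e2 e3 where "wp_roots e1 e2 e3"
  by (rule cubic_roots[of "- 15 * G4" "- 35 * G6"]) (auto simp: wp_roots_def intro: that)

lemma wp_roots_poly:
  assumes "wp_roots e1 e2 e3"
  shows "4 * x ^ 3 - 60 * G4 * x - 140 * G6 = 4 * ((x - e1) * (x - e2) * (x - e3))"
proof -
  have "4 * ((x - e1) * (x - e2) * (x - e3)) =
     4 * x ^ 3 - 4 * (e1 + e2 + e3) * x ^ 2 + 4 * (e1 * e2 + e1 * e3 + e2 * e3) * x - 4 * (e1 * e2 * e3)"
    by (simp add: algebra_simps power2_eq_square power3_eq_cube)
  moreover have "e1 + e2 + e3 = 0" "e1 * e2 + e1 * e3 + e2 * e3 = - 15 * G4" "e1 * e2 * e3 = 35 * G6"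
    using assms by (simp_all add: wp_roots_def)
  ultimately show ?thesis by (simp only:) simp
qed

lemma wp_ode_roots:
  "wp_roots e1 e2 e3 \<Longrightarrow> z \<notin> \<Lambda> \<Longrightarrow> deriv P z ^ 2 = 4 * ((P z - e1) * (P z - e2) * (P z - e3))"
  using wp_ode wp_roots_poly by simp

lemma wp_roots_iff:
  "wp_roots e1 e2 e3 \<Longrightarrow> z \<notin> \<Lambda> \<Longrightarrow> P z \<in> {e1, e2, e3} \<longleftrightarrow> 2 * z \<in> \<Lambda>"
  using wp_ode_roots[of e1 e2 e3 z] by (subst deriv_wp_eq_0_iff[symmetric]) (auto simp: power2_eq_square)

lemma wp_roots_perm:
  "wp_roots e1 e2 e3 \<Longrightarrow> wp_roots e2 e1 e3" "wp_roots e1 e2 e3 \<Longrightarrow> wp_roots e1 e3 e2"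
  by (auto simp: wp_roots_def algebra_simps)

text \<open>At a double root \<open>e1\<close> the constant function \<open>e1\<close> also solves
  the second-order equation. \<open>P\<close> attains \<open>e1\<close> with derivative zero, so it
  would have to be this constant, contradicting surjectivity.\<close>

lemma wp_roots_neq: assumes R: "wp_roots e1 e2 e3" shows "e1 \<noteq> e2"
proof
  assume e: "e1 = e2"
  obtain z where z: "z \<notin> \<Lambda>" "P z = e1" by (rule wp_surj)
  have d0: "deriv P z = 0" using wp_ode_roots[OF R z(1)] z(2) by simp
  have e3: "e3 = - 2 * e1" using R e by (simp add: wp_roots_def) algebra
  have "e1 * e1 + e1 * e3 + e1 * e3 = - 15 * G4" using R e by (simp add: wp_roots_def)
  then have c0: "- 30 * G4 + 0 * e1 + 6 * e1 ^ 2 + 0 * e1 ^ 3 = 0" unfolding e3 by algebra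
  have "P w = e1" if w: "w \<in> - \<Lambda>" for w
  proof (rule ode2_unique[OF wp_holomorphic holomorphic_on_const open_compl_Lambda connected_compl_Lambda _ _ _ _ _ w])
    show "z \<in> - \<Lambda>" using z by simp
    show "deriv (deriv P) x = - 30 * G4 + 0 * P x + 6 * P x ^ 2 + 0 * P x ^ 3" if "x \<in> - \<Lambda>" for x
      using wp_ode2 that by simp
  qed (use z d0 c0 in auto)
  moreover obtain w where "w \<notin> \<Lambda>" "P w = e1 + 1" by (rule wp_surj)
  ultimately show False by simp
qed

lemma wp_roots_distinct: assumes R: "wp_roots e1 e2 e3" shows "distinct [e1, e2, e3]"
proof -
  note R2 = wp_roots_perm(2)[OF R] and R1 = wp_roots_perm(2)[OF wp_roots_perm(1)[OF R]]
  show ?thesis using wp_roots_neq[OF R] wp_roots_neq[OF R2] wp_roots_neq[OF R1] by simp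
qed

text \<open>Since the roots sum to zero they are determined by the differences \<open>u\<close> and
  \<open>v\<close>. Then \<open>g2\<close> is \<open>4/3 * N\<close>, and the discriminant
  \<open>g2^3 - 27 g3^2\<close> becomes \<open>16 u^2 v^2 (v - u)^2\<close>; dividing by powers of
  \<open>u\<close> leaves \<open>l = v / u\<close>. The roots enter in arbitrary order, so the right
  side is the same for all orderings.\<close>

lemma modular_j_eq:
  assumes R: "wp_roots e1 e2 e3" and l: "l = (e3 - e1) / (e2 - e1)"
  shows "modular_j \<tau> = 256 * (l ^ 2 - l + 1) ^ 3 / (l ^ 2 - l) ^ 2"
proof -
  define u v where "u = e2 - e1" and "v = e3 - e1"
  have d: "u \<noteq> 0" "v \<noteq> 0" "v - u \<noteq> 0" using wp_roots_distinct[OF R] by (auto simp: u_def v_def)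
  define N where "N = u ^ 2 - u * v + v ^ 2"
  have e: "3 * e1 = - (u + v)" "3 * e2 = 2 * u - v" "3 * e3 = 2 * v - u"
    using R by (auto simp: wp_roots_def u_def v_def) algebra+
  have "9 * (e1 * e2 + e1 * e3 + e2 * e3) = (3 * e1) * (3 * e2) + (3 * e1) * (3 * e3) + (3 * e2) * (3 * e3)"
    by algebra
  also have "\<dots> = - 3 * N" unfolding e N_def by algebra
  finally have g2: "3 * (60 * G4) = 4 * N" using R unfolding wp_roots_def by algebra
  have "27 * (e1 * e2 * e3) = (3 * e1) * (3 * e2) * (3 * e3)" by algebra
  also have "\<dots> = - ((u + v) * (2 * u - v) * (2 * v - u))" unfolding e by algebra
  finally have g3: "27 * (140 * G6) = - 4 * ((u + v) * (2 * u - v) * (2 * v - u))"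
    using R unfolding wp_roots_def by algebra
  have "27 * ((60 * G4) ^ 3 - 27 * (140 * G6) ^ 2) = (3 * (60 * G4)) ^ 3 - (27 * (140 * G6)) ^ 2"
    by algebra
  also have "\<dots> = 27 * (16 * (u ^ 2 * v ^ 2 * (v - u) ^ 2))" unfolding g2 g3 N_def by algebra
  finally have disc: "(60 * G4) ^ 3 - 27 * (140 * G6) ^ 2 = 16 * (u ^ 2 * v ^ 2 * (v - u) ^ 2)"
    by (subst (asm) mult_cancel_left) simp
  have "27 * (60 * G4) ^ 3 = (3 * (60 * G4)) ^ 3" by algebra
  also have "\<dots> = 64 * N ^ 3" unfolding g2 by algebra
  finally have num: "1728 * (60 * G4) ^ 3 = 4096 * N ^ 3" by algebra
  then have j: "modular_j \<tau> = 256 * N ^ 3 / (u ^ 2 * v ^ 2 * (v - u) ^ 2)"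
    unfolding modular_j_def Let_def disc num by simp
  have "l ^ 2 - l + 1 = N / u ^ 2" "l ^ 2 - l = v * (v - u) / u ^ 2"
    using d by (simp_all add: l u_def[symmetric] v_def[symmetric] N_def field_simps power2_eq_square)
  then have "256 * (l ^ 2 - l + 1) ^ 3 / (l ^ 2 - l) ^ 2 = 256 * (N / u ^ 2) ^ 3 / (v * (v - u) / u ^ 2) ^ 2"
    by simp
  also have "\<dots> = 256 * N ^ 3 / (u ^ 2 * v ^ 2 * (v - u) ^ 2)"
    using d by (simp add: field_simps eval_nat_numeral)
  finally show ?thesis using j by simp
qed

end

section \<open>Uniformization\<close>

lemma deriv_eq_0_imp_const:
  fixes f :: "complex \<Rightarrow> complex"
  assumes f: "f holomorphic_on S" "open S" "connected S" and 0: "\<And>z. z \<in> S \<Longrightarrow> deriv f z = 0" and ab: "a \<in> S" "b \<in> S"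
  shows "f a = f b"
proof -
  have D: "(f has_field_derivative 0) (at z)" if "z \<in> S" for z
    using holomorphic_derivI[OF f(1,2) that] 0[OF that] by simp
  obtain c where "\<And>x. x \<in> S \<Longrightarrow> f x = c"
    by (rule DERIV_zero_connected_constant[OF f(3,2) finite.emptyI holomorphic_on_imp_continuous_on[OF f(1)]])
       (use D in auto)
  then show ?thesis using ab by simp
qed

text \<open>The right-hand side has no constant term, so both derivatives vanish at 0 and the
  second-order equations have equal initial data. The points \<open>y1\<close>, \<open>y2\<close>
  exclude the zero solution, for which the second-order equation could not be derived.\<close>

lemma ode1_unique_at_0:
  fixes v w :: "complex \<Rightarrow> complex"
  assumes v: "v holomorphic_on ball 0 r" and w: "w holomorphic_on ball 0 r"
    and odev: "\<And>z. z \<in> ball 0 r \<Longrightarrow> deriv v z ^ 2 = b * v z + c * v z ^ 2 + d * v z ^ 3 + e * v z ^ 4"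
    and odew: "\<And>z. z \<in> ball 0 r \<Longrightarrow> deriv w z ^ 2 = b * w z + c * w z ^ 2 + d * w z ^ 3 + e * w z ^ 4"
    and 0: "v 0 = 0" "w 0 = 0" and y: "y1 \<in> ball 0 r" "v y1 \<noteq> 0" "y2 \<in> ball 0 r" "w y2 \<noteq> 0"
    and z: "z \<in> ball 0 r"
  shows "v z = w z"
proof -
  have r: "0 \<in> ball (0::complex) r" using z by (simp add: le_less_trans[OF norm_ge_zero])
  have *: "\<exists>y\<in>ball 0 r. deriv f y \<noteq> 0"
    if "f holomorphic_on ball 0 r" "f 0 = 0" "y \<in> ball 0 r" "f y \<noteq> 0" for f y
  proof (rule ccontr)
    assume "\<not> ?thesis"
    then have "f 0 = f y" by (intro deriv_eq_0_imp_const[OF that(1) open_ball connected_ball _ r that(3)]) blast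
    with that show False by simp
  qed
  obtain v1 where v1: "v1 \<in> ball 0 r" "deriv v v1 \<noteq> 0" using *[OF v 0(1) y(1,2)] by blast
  obtain w1 where w1: "w1 \<in> ball 0 r" "deriv w w1 \<noteq> 0" using *[OF w 0(2) y(3,4)] by blast
  have v2: "deriv (deriv v) x = b / 2 + c * v x + 3 * d / 2 * v x ^ 2 + 2 * e * v x ^ 3" if "x \<in> ball 0 r" for x
    by (rule ode1_imp_ode2[OF v open_ball connected_ball _ v1 that, where a = 0]) (use odev in simp)
  have w2: "deriv (deriv w) x = b / 2 + c * w x + 3 * d / 2 * w x ^ 2 + 2 * e * w x ^ 3" if "x \<in> ball 0 r" for x
    by (rule ode1_imp_ode2[OF w open_ball connected_ball _ w1 that, where a = 0]) (use odew in simp)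
  have "deriv v 0 = 0" "deriv w 0 = 0" using odev[OF r] odew[OF r] 0 by simp_all
  then show ?thesis
    using 0 by (intro ode2_unique[OF v w open_ball connected_ball v2 w2 r _ _ z]) simp_all
qed

lemma holomorphic_divide_linear:
  fixes f :: "complex \<Rightarrow> complex"
  assumes "f holomorphic_on ball 0 r" "f 0 = 0" "r > 0"
  obtains k where "k holomorphic_on ball 0 r" "\<And>z. z \<in> ball 0 r \<Longrightarrow> f z = z * k z" "k 0 = deriv f 0"
proof -
  define k where "k = (\<lambda>z. if z = 0 then deriv f 0 else (f z - f 0) / (z - 0))"
  have "k holomorphic_on ball 0 r"
    unfolding k_def by (rule pole_lemma) (use assms in auto)
  moreover have "f z = z * k z" if "z \<in> ball 0 r" for z using assms(2) by (simp add: k_def)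
  moreover have "k 0 = deriv f 0" by (simp add: k_def)
  ultimately show ?thesis by (rule that)
qed

lemma holomorphic_divide_square:
  fixes f :: "complex \<Rightarrow> complex"
  assumes f: "f holomorphic_on ball 0 r" "f 0 = 0" "deriv f 0 = 0" "r > 0"
  obtains k where "k holomorphic_on ball 0 r" "\<And>z. z \<in> ball 0 r \<Longrightarrow> f z = z ^ 2 * k z"
proof -
  obtain k1 where k1: "k1 holomorphic_on ball 0 r" "\<And>z. z \<in> ball 0 r \<Longrightarrow> f z = z * k1 z" "k1 0 = deriv f 0"
    by (rule holomorphic_divide_linear[OF f(1,2,4)]) (use that in blast)
  have "k1 0 = 0" using k1(3) f(3) by simp
  then obtain k where k: "k holomorphic_on ball 0 r" "\<And>z. z \<in> ball 0 r \<Longrightarrow> k1 z = z * k z" "k 0 = deriv k1 0"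
    by (rule holomorphic_divide_linear[OF k1(1) _ f(4)]) (rule that)
  show ?thesis by (rule that[OF k(1)]) (use k1 k in \<open>auto simp: power2_eq_square\<close>)
qed

lemma deriv_even_eq_0:
  fixes f :: "complex \<Rightarrow> complex"
  assumes "f field_differentiable at 0" and ev: "eventually (\<lambda>z. f (- z) = f z) (nhds 0)"
  shows "deriv f 0 = 0"
proof -
  have D: "(f has_field_derivative deriv f 0) (at 0)" using assms by (simp add: DERIV_deriv_iff_field_differentiable)
  have "((\<lambda>z. f (- z)) has_field_derivative deriv f 0 * (-1)) (at 0)"
    by (rule DERIV_chain2[of f]) (use D in \<open>auto intro!: derivative_eq_intros\<close>)
  then have "(f has_field_derivative deriv f 0 * (-1)) (at 0)"
    using DERIV_cong_ev[OF refl ev refl] by blast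
  from DERIV_unique[OF D this] show ?thesis by simp
qed

text \<open>The function \<open>V\<close> is the square of the local inverse of \<open>\<integral> dt / sqrt ((1 - t\<^sup>2) (1 - l t\<^sup>2))\<close>.\<close>

lemma local_uniformizer:
  obtains r V where "r > 0" "V holomorphic_on ball 0 r" "V 0 = 0"
    "\<And>z. z \<in> ball 0 r \<Longrightarrow> deriv V z ^ 2 = 4 * (V z * (1 - V z) * (1 - l * V z))"
    "((\<lambda>z. V z / z ^ 2) \<longlongrightarrow> 1) (at (0::complex))"
proof -
  define \<rho> where "\<rho> = 1 / (1 + norm l)"
  have \<rho>: "\<rho> > 0" "\<rho> \<le> 1" by (auto simp: \<rho>_def field_simps add_pos_nonneg)
  have small: "norm (t ^ 2) < 1 \<and> norm (l * t ^ 2) < 1" if "t \<in> ball 0 \<rho>" for t :: complex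
  proof -
    have t: "norm t < \<rho>" using that by simp
    have "norm t ^ 2 = norm t * norm t" by (simp add: power2_eq_square)
    also have "\<dots> \<le> norm t * 1" using t \<rho> by (intro mult_left_mono) auto
    finally have t2: "norm t ^ 2 < \<rho>" using t by simp
    have "norm l * norm t ^ 2 \<le> norm l * \<rho>" using t2 by (intro mult_left_mono) auto
    also have "\<dots> < 1" by (simp add: \<rho>_def field_simps add_pos_nonneg)
    finally show ?thesis using t2 \<rho> by (simp add: norm_mult norm_power)
  qed
  have nonneg: "1 - w \<notin> \<real>\<^sub>\<le>\<^sub>0" if "norm w < 1" for w :: complex
  proof -
    have "Re w < 1" using complex_Re_le_cmod[of w] that by linarith
    then show ?thesis by (auto simp: complex_nonpos_Reals_iff)
  qed
  define q where "q = (\<lambda>t. csqrt (1 - t ^ 2) * csqrt (1 - l * t ^ 2))"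
  have q2: "q t ^ 2 = (1 - t ^ 2) * (1 - l * t ^ 2)" for t by (simp add: q_def power_mult_distrib)
  have q0: "q t \<noteq> 0" if "t \<in> ball 0 \<rho>" for t
    using small[OF that] by (auto simp: q_def)
  define h where "h = (\<lambda>t. 1 / q t)"
  have hhol: "h holomorphic_on ball 0 \<rho>"
    unfolding h_def q_def using q0 small nonneg
    by (intro holomorphic_intros) (auto simp: q_def)
  obtain H0 where H0: "\<And>x. x \<in> ball 0 \<rho> \<Longrightarrow> (H0 has_field_derivative h x) (at x within ball 0 \<rho>)"
    by (rule holomorphic_convex_primitive'[OF _ _ hhol]) auto
  define H where "H = (\<lambda>z. H0 z - H0 0)"
  have DH: "(H has_field_derivative h x) (at x)" if "x \<in> ball 0 \<rho>" for x
    using H0[OF that] that unfolding H_def by (auto intro!: derivative_eq_intros simp: at_within_open[OF _ open_ball])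
  then have Hhol: "H holomorphic_on ball 0 \<rho>"
    by (meson holomorphic_on_open open_ball)
  have dH: "deriv H x = h x" if "x \<in> ball 0 \<rho>" for x using DH[OF that] by (rule DERIV_imp_deriv)
  have H00: "H 0 = 0" by (simp add: H_def)
  have mem0: "0 \<in> ball (0::complex) \<rho>" using \<rho> by simp
  have "deriv H 0 \<noteq> 0" using dH[OF mem0] q0[OF mem0] by (simp add: h_def)
  then obtain r1 where r1: "r1 > 0" "ball (0::complex) r1 \<subseteq> ball 0 \<rho>" "open (H ` ball 0 r1)" "inj_on H (ball 0 r1)"
    by (rule has_complex_derivative_locally_invertible[OF Hhol mem0 open_ball]) (rule that)
  have Hhol1: "H holomorphic_on ball 0 r1" using Hhol r1(2) holomorphic_on_subset by blast
  obtain u where u: "u holomorphic_on (H ` ball 0 r1)"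
      "\<And>z. z \<in> ball 0 r1 \<Longrightarrow> deriv H z * deriv u (H z) = 1" "\<And>z. z \<in> ball 0 r1 \<Longrightarrow> u (H z) = z"
    by (rule holomorphic_has_inverse[OF Hhol1 open_ball r1(4)]) (use that in blast)
  have "0 \<in> H ` ball 0 r1" using H00 r1(1) by (force simp: image_iff)
  then obtain r where r: "r > 0" "ball 0 r \<subseteq> H ` ball 0 r1" using r1(3) open_contains_ball by blast
  have uhol: "u holomorphic_on ball 0 r" using u(1) r(2) holomorphic_on_subset by blast
  have u0: "u 0 = 0" using u(3)[of 0] H00 r1(1) by simp
  have du: "deriv u y = q (u y)" if y: "y \<in> ball 0 r" for y
  proof -
    obtain z where z: "z \<in> ball 0 r1" "y = H z" using y r(2) by blast
    then have "z \<in> ball 0 \<rho>" using r1(2) by blast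
    then have "h z * deriv u y = 1" "q z \<noteq> 0" using u(2)[OF z(1)] dH z q0 by auto
    then show ?thesis using u(3)[OF z(1)] z by (simp add: h_def field_simps)
  qed
  define V where "V = (\<lambda>z. u z ^ 2)"
  show ?thesis
  proof (rule that[OF r(1)])
    show "V holomorphic_on ball 0 r" unfolding V_def by (intro holomorphic_intros uhol)
    show "V 0 = 0" by (simp add: V_def u0)
    show "deriv V z ^ 2 = 4 * (V z * (1 - V z) * (1 - l * V z))" if z: "z \<in> ball 0 r" for z
    proof -
      have "(u has_field_derivative deriv u z) (at z)" using uhol z by (intro holomorphic_derivI) auto
      then have "(V has_field_derivative 2 * u z * deriv u z) (at z)"
        unfolding V_def by (auto intro!: derivative_eq_intros)
      then have "deriv V z = 2 * u z * q (u z)" using du[OF z] DERIV_imp_deriv by simp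
      then have "deriv V z ^ 2 = 4 * u z ^ 2 * q (u z) ^ 2" by (simp add: power_mult_distrib)
      then show ?thesis unfolding q2 by (simp add: V_def)
    qed
    have "(u has_field_derivative 1) (at 0)"
      using holomorphic_derivI[OF uhol open_ball, of 0] du[of 0] r(1) by (simp add: u0 q_def)
    then have "((\<lambda>z. u z / z) \<longlongrightarrow> 1) (at 0)" by (simp add: has_field_derivative_iff u0)
    from tendsto_power[OF this, of 2] show "((\<lambda>z. V z / z ^ 2) \<longlongrightarrow> 1) (at 0)"
      by (simp add: V_def power_divide)
  qed
qed

lemma tendsto_1_imp_nonzero:
  fixes V :: "complex \<Rightarrow> complex"
  assumes "((\<lambda>z. V z / z ^ 2) \<longlongrightarrow> 1) (at 0)" "r > 0"
  shows "\<exists>y\<in>ball 0 r. V y \<noteq> 0"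
proof (rule ccontr)
  assume "\<not> ?thesis"
  then have "eventually (\<lambda>z. V z / z ^ 2 = 0) (at 0)"
    using eventually_at_ball[OF assms(2), of 0 UNIV] by (auto elim!: eventually_mono)
  then have "((\<lambda>z. V z / z ^ 2) \<longlongrightarrow> 0) (at 0)" by (rule tendsto_eventually)
  with assms(1) show False using tendsto_unique[of "at (0::complex)"] by fastforce
qed

section \<open>Duplication and extension to the whole plane\<close>

text \<open>The duplication formula of the squared Jacobi function \<open>sn^2\<close>, with squared
  modulus \<open>l\<close>.\<close>

definition doubling :: "complex \<Rightarrow> complex \<Rightarrow> complex" where
  "doubling l v = 4 * (v * (1 - v) * (1 - l * v)) / (1 - l * v ^ 2) ^ 2"

lemma doubling_deriv:
  assumes "1 - l * v ^ 2 \<noteq> 0"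
  shows "(doubling l has_field_derivative
     4 * (1 - 2 * v + l * v ^ 2) * (1 - 2 * l * v + l * v ^ 2) / (1 - l * v ^ 2) ^ 3) (at v)"
proof -
  define D where "D = 1 - l * v ^ 2"
  have D: "D \<noteq> 0" using assms by (simp add: D_def)
  have "(doubling l has_field_derivative
      (4 * ((1 - v) * (1 - l * v) - v * (1 - l * v) - l * (v * (1 - v))) * D ^ 2 -
       4 * (v * (1 - v) * (1 - l * v)) * (2 * D * (- (2 * l * v)))) / (D ^ 2 * D ^ 2)) (at v)"
    unfolding doubling_def D_def using assms
    by (auto intro!: derivative_eq_intros simp: algebra_simps)
  also have "4 * ((1 - v) * (1 - l * v) - v * (1 - l * v) - l * (v * (1 - v))) * D ^ 2 -
       4 * (v * (1 - v) * (1 - l * v)) * (2 * D * (- (2 * l * v))) =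
       D * (4 * (1 - 2 * v + l * v ^ 2) * (1 - 2 * l * v + l * v ^ 2))"
    unfolding D_def by algebra
  also have "D * (4 * (1 - 2 * v + l * v ^ 2) * (1 - 2 * l * v + l * v ^ 2)) / (D ^ 2 * D ^ 2) =
     4 * (1 - 2 * v + l * v ^ 2) * (1 - 2 * l * v + l * v ^ 2) / D ^ 3"
    using D by (simp add: field_simps eval_nat_numeral)
  finally show ?thesis by (simp add: D_def)
qed

text \<open>With \<open>M\<close> and \<open>N\<close> the two quadratic factors of the derivative,
  one minus the doubled value and one minus \<open>l\<close> times it are the squares of
  \<open>M / D\<close> and \<open>N / D\<close>. So the doubling map satisfies the differential
  equation of a Lattes map of degree four.\<close>

lemma doubling_identity:
  assumes "1 - l * v ^ 2 \<noteq> 0"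
  shows "(4 * (1 - 2 * v + l * v ^ 2) * (1 - 2 * l * v + l * v ^ 2) / (1 - l * v ^ 2) ^ 3) ^ 2 * (v * (1 - v) * (1 - l * v))
     = 4 * (doubling l v * (1 - doubling l v) * (1 - l * doubling l v))"
proof -
  define D M N K where "D = 1 - l * v ^ 2" and "M = 1 - 2 * v + l * v ^ 2" and "N = 1 - 2 * l * v + l * v ^ 2"
    and "K = v * (1 - v) * (1 - l * v)"
  have D: "D \<noteq> 0" using assms by (simp add: D_def)
  have s: "doubling l v = 4 * K / D ^ 2" by (simp add: doubling_def D_def K_def)
  have "1 - doubling l v = (D ^ 2 - 4 * K) / D ^ 2"
    using D by (simp add: s field_simps)
  also have "D ^ 2 - 4 * K = M ^ 2" unfolding D_def K_def M_def by algebra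
  finally have s1: "1 - doubling l v = M ^ 2 / D ^ 2" .
  have "1 - l * doubling l v = (D ^ 2 - 4 * l * K) / D ^ 2"
    using D by (simp add: s field_simps)
  also have "D ^ 2 - 4 * l * K = N ^ 2" unfolding D_def K_def N_def by algebra
  finally have s2: "1 - l * doubling l v = N ^ 2 / D ^ 2" .
  have "(4 * M * N / D ^ 3) ^ 2 * K = 4 * (4 * K / D ^ 2 * (M ^ 2 / D ^ 2) * (N ^ 2 / D ^ 2))"
    using D by (simp add: field_simps eval_nat_numeral)
  then show ?thesis unfolding s1 s2 unfolding s by (simp only: D_def M_def N_def K_def)
qed

lemma V_ode_expand:
  "4 * (v * (1 - v) * (1 - l * v)) = 4 * v + (- 4 * (1 + l)) * v ^ 2 + 4 * l * v ^ 3 + 0 * v ^ 4" for v l :: complex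
  by (simp add: algebra_simps power2_eq_square power3_eq_cube)

text \<open>The function \<open>T\<close>, doubling applied to \<open>V (z / 2)\<close>, solves the
  differential equation of \<open>V\<close>, vanishes at 0 and is not identically zero; by
  uniqueness it equals \<open>V\<close>. The bounds by 1/2 keep the denominator
  \<open>1 - l V^2\<close> away from zero.\<close>

lemma local_doubling:
  obtains r V where "r > 0" "V holomorphic_on ball 0 r" "V 0 = 0"
    "\<And>z. z \<in> ball 0 r \<Longrightarrow> deriv V z ^ 2 = 4 * (V z * (1 - V z) * (1 - l * V z))"
    "((\<lambda>z. V z / z ^ 2) \<longlongrightarrow> 1) (at (0::complex))"
    "\<And>z. z \<in> ball 0 r \<Longrightarrow> norm (V z) < 1 / 2 \<and> norm (l * V z) < 1 / 2 \<and> norm (V z) \<le> 2 * norm z ^ 2"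
    "\<And>z. z \<in> ball 0 (r / 2) \<Longrightarrow> V (2 * z) = doubling l (V z)"
proof -
  obtain r0 V where V: "r0 > 0" "V holomorphic_on ball 0 r0" "V 0 = 0"
    "\<And>z. z \<in> ball 0 r0 \<Longrightarrow> deriv V z ^ 2 = 4 * (V z * (1 - V z) * (1 - l * V z))"
    "((\<lambda>z. V z / z ^ 2) \<longlongrightarrow> 1) (at (0::complex))"
    by (rule local_uniformizer[of l]) (use that in blast)
  have "isCont V 0" using V(1,2)
    by (auto simp: continuous_on_eq_continuous_at dest!: holomorphic_on_imp_continuous_on)
  then have V0: "(V \<longlongrightarrow> 0) (at 0)" using V(3) by (simp add: isCont_def)
  have lV0: "((\<lambda>z. l * V z) \<longlongrightarrow> 0) (at 0)" using tendsto_mult_right_zero[OF V0] by simp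
  have "eventually (\<lambda>z. norm (V z) < 1 / 2) (at 0)"
    using tendstoD[OF V0, of "1/2"] by (simp add: dist_norm)
  moreover have "eventually (\<lambda>z. norm (l * V z) < 1 / 2) (at 0)"
    using tendstoD[OF lV0, of "1/2"] by (simp add: dist_norm)
  moreover have "eventually (\<lambda>z. norm (V z / z ^ 2) < 2) (at 0)"
  proof (rule eventually_mono[OF tendstoD[OF V(5) zero_less_one]])
    fix z :: complex assume "dist (V z / z ^ 2) 1 < 1"
    then show "norm (V z / z ^ 2) < 2" using norm_triangle_ineq2[of "V z / z ^ 2" 1] by (simp add: dist_norm)
  qed
  ultimately have "eventually (\<lambda>z. norm (V z) < 1 / 2 \<and> norm (l * V z) < 1 / 2 \<and> norm (V z / z ^ 2) < 2) (at 0)"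
    by eventually_elim simp
  then obtain d where d: "d > 0" "\<And>z. z \<noteq> 0 \<Longrightarrow> norm z < d \<Longrightarrow>
      norm (V z) < 1 / 2 \<and> norm (l * V z) < 1 / 2 \<and> norm (V z / z ^ 2) < 2"
    by (auto simp: eventually_at dist_norm)
  define r where "r = min r0 d"
  have r: "r > 0" "r \<le> r0" using V(1) d(1) by (auto simp: r_def)
  have sub: "ball (0::complex) r \<subseteq> ball 0 r0" using r by auto
  have Vhol: "V holomorphic_on ball 0 r" using V(2) sub holomorphic_on_subset by blast
  have bd: "norm (V z) < 1 / 2 \<and> norm (l * V z) < 1 / 2 \<and> norm (V z) \<le> 2 * norm z ^ 2" if "z \<in> ball 0 r" for z
  proof (cases "z = 0")
    case False
    then show ?thesis using d(2)[of z] that by (auto simp: r_def norm_divide norm_power field_simps)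
  qed (simp add: V(3))
  have ode: "deriv V z ^ 2 = 4 * (V z * (1 - V z) * (1 - l * V z))" if "z \<in> ball 0 r" for z
    using V(4) that sub by blast
  have half: "z / 2 \<in> ball 0 r" if "z \<in> ball (0::complex) r" for z using that r(1) by (simp add: norm_divide)
  have den: "1 - l * V z ^ 2 \<noteq> 0" if "z \<in> ball 0 r" for z
  proof -
    have "norm (l * V z ^ 2) = norm (l * V z) * norm (V z)" by (simp add: norm_mult power2_eq_square)
    also have "\<dots> \<le> 1 / 2 * (1 / 2)" using bd[OF that] by (intro mult_mono) auto
    finally show ?thesis by auto
  qed
  define T where "T = (\<lambda>z. doubling l (V (z / 2)))"
  have DT: "(T has_field_derivative
      (4 * (1 - 2 * V (z/2) + l * V (z/2) ^ 2) * (1 - 2 * l * V (z/2) + l * V (z/2) ^ 2) / (1 - l * V (z/2) ^ 2) ^ 3)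
        * (deriv V (z/2) * (1 / 2))) (at z)" if z: "z \<in> ball 0 r" for z
    unfolding T_def
  proof (rule DERIV_chain2[where f = "doubling l" and g = "\<lambda>z. V (z / 2)", OF doubling_deriv[OF den[OF half[OF z]]]])
    have "(V has_field_derivative deriv V (z / 2)) (at (z / 2))"
      using half[OF z] by (intro holomorphic_derivI[OF Vhol]) auto
    then show "((\<lambda>z. V (z / 2)) has_field_derivative deriv V (z / 2) * (1 / 2)) (at z)"
      by (rule DERIV_chain2) (auto intro!: derivative_eq_intros)
  qed
  have Thol: "T holomorphic_on ball 0 r" using DT by (meson holomorphic_on_open open_ball)
  have odeT: "deriv T z ^ 2 = 4 * (T z * (1 - T z) * (1 - l * T z))" if z: "z \<in> ball 0 r" for z
  proof -
    let ?v = "V (z / 2)"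
    let ?X = "4 * (1 - 2 * ?v + l * ?v ^ 2) * (1 - 2 * l * ?v + l * ?v ^ 2) / (1 - l * ?v ^ 2) ^ 3"
    have "deriv T z ^ 2 = ?X ^ 2 * (deriv V (z / 2) ^ 2 / 4)"
      unfolding DERIV_imp_deriv[OF DT[OF z]] by (simp only: power_mult_distrib power_divide) simp
    also have "deriv V (z / 2) ^ 2 / 4 = ?v * (1 - ?v) * (1 - l * ?v)"
      using ode[OF half[OF z]] by simp
    also have "?X ^ 2 * (?v * (1 - ?v) * (1 - l * ?v)) = 4 * (T z * (1 - T z) * (1 - l * T z))"
      unfolding T_def by (rule doubling_identity[OF den[OF half[OF z]]])
    finally show ?thesis .
  qed
  obtain y1 where y1: "y1 \<in> ball 0 r" "V y1 \<noteq> 0" using tendsto_1_imp_nonzero[OF V(5) r(1)] by blast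
  obtain y where y: "y \<in> ball 0 (r / 2)" "V y \<noteq> 0"
    using tendsto_1_imp_nonzero[OF V(5), of "r / 2"] r(1) by auto
  have y2: "2 * y \<in> ball 0 r" using y(1) by (simp add: norm_mult)
  have ymem: "y \<in> ball 0 r" using half[OF y2] by simp
  have "T (2 * y) \<noteq> 0"
  proof -
    have "norm (V y) \<noteq> 1" "norm (l * V y) \<noteq> 1" using bd[OF ymem] by auto
    then have "1 - V y \<noteq> 0" "1 - l * V y \<noteq> 0" by (metis norm_one eq_iff_diff_eq_0)+
    then show ?thesis using y(2) den[OF ymem] by (simp add: T_def doubling_def)
  qed
  have T0: "T 0 = 0" by (simp add: T_def V(3) doubling_def)
  have TV: "V z = T z" if "z \<in> ball 0 r" for z
    by (rule ode1_unique_at_0[OF Vhol Thol ode[unfolded V_ode_expand] odeT[unfolded V_ode_expand]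
          V(3) T0 y1 y2 \<open>T (2 * y) \<noteq> 0\<close> that])
  show ?thesis
  proof (rule that[OF r(1) Vhol V(3) ode V(5) bd])
    fix z :: complex assume "z \<in> ball 0 (r / 2)"
    then show "V (2 * z) = doubling l (V z)" using TV[of "2 * z"] by (simp add: T_def norm_mult)
  qed auto
qed

text \<open>For \<open>a = V b\<close> both duplication laws are polynomial as soon as
  \<open>b(2 z) = b(z)^4 (1 - l V(z)^2)^2\<close>. Writing \<open>b = exp \<beta>\<close> turns this
  into \<open>\<beta>(2 z) = 4 \<beta>(z) + g(z)\<close> with \<open>g = 2 ln (1 - l V^2)\<close>,
  which is solved by the sum of \<open>4^k g(z / 2^(k + 1))\<close>. The sum converges because
  \<open>g\<close> vanishes to fourth order at 0, so its terms decay like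
  \<open>4^k / 16^k\<close>.\<close>

lemma local_lift:
  obtains r a b where "r > 0" "a holomorphic_on ball 0 r" "b holomorphic_on ball 0 r" "a 0 = 0" "b 0 = 1"
    "\<And>z. z \<in> ball 0 r \<Longrightarrow> b z \<noteq> 0"
    "\<And>z. z \<in> ball 0 r \<Longrightarrow> deriv (\<lambda>z. a z / b z) z ^ 2 = 4 * (a z / b z * (1 - a z / b z) * (1 - l * (a z / b z)))"
    "((\<lambda>z. a z / b z / z ^ 2) \<longlongrightarrow> 1) (at (0::complex))"
    "\<And>z. z \<in> ball 0 (r / 2) \<Longrightarrow> a (2 * z) = 4 * (a z * b z * (b z - a z) * (b z - l * a z))"
    "\<And>z. z \<in> ball 0 (r / 2) \<Longrightarrow> b (2 * z) = (b z ^ 2 - l * a z ^ 2) ^ 2"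
proof -
  obtain r V where V: "r > 0" "V holomorphic_on ball 0 r" "V 0 = 0"
    "\<And>z. z \<in> ball 0 r \<Longrightarrow> deriv V z ^ 2 = 4 * (V z * (1 - V z) * (1 - l * V z))"
    "((\<lambda>z. V z / z ^ 2) \<longlongrightarrow> 1) (at (0::complex))"
    "\<And>z. z \<in> ball 0 r \<Longrightarrow> norm (V z) < 1 / 2 \<and> norm (l * V z) < 1 / 2 \<and> norm (V z) \<le> 2 * norm z ^ 2"
    "\<And>z. z \<in> ball 0 (r / 2) \<Longrightarrow> V (2 * z) = doubling l (V z)"
    by (rule local_doubling[of l]) (use that in blast)
  have lV2: "norm (l * V z ^ 2) < 1 / 2" "norm (l * V z ^ 2) \<le> 4 * norm l * norm z ^ 4" if "z \<in> ball 0 r" for z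
  proof -
    have "norm (l * V z ^ 2) = norm (l * V z) * norm (V z)" by (simp add: norm_mult power2_eq_square)
    also have "\<dots> \<le> 1 / 2 * (1 / 2)" using V(6)[OF that] by (intro mult_mono) auto
    finally show "norm (l * V z ^ 2) < 1 / 2" by simp
    have "norm (V z) ^ 2 \<le> (2 * norm z ^ 2) ^ 2" using V(6)[OF that] by (intro power_mono) auto
    then have "norm l * norm (V z) ^ 2 \<le> norm l * (2 * norm z ^ 2) ^ 2" by (intro mult_left_mono) auto
    then show "norm (l * V z ^ 2) \<le> 4 * norm l * norm z ^ 4"
      by (simp add: norm_mult norm_power power_mult_distrib flip: power_mult)
  qed
  define g where "g = (\<lambda>z. 2 * Ln (1 + - (l * V z ^ 2)))"
  have nz: "1 - l * V z ^ 2 \<noteq> 0" if "z \<in> ball 0 r" for z using lV2(1)[OF that] by auto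
  have nonneg: "1 + - w \<notin> \<real>\<^sub>\<le>\<^sub>0" if "norm w < 1 / 2" for w :: complex
  proof -
    have "Re w < 1" using complex_Re_le_cmod[of w] that by linarith
    then show ?thesis by (auto simp: complex_nonpos_Reals_iff)
  qed
  have ghol: "g holomorphic_on ball 0 r"
    unfolding g_def by (intro holomorphic_intros V(2) nonneg lV2(1))
  have gle: "norm (g z) \<le> 16 * norm l * norm z ^ 4" if "z \<in> ball 0 r" for z
  proof -
    have "norm (Ln (1 + - (l * V z ^ 2))) \<le> 2 * norm (- (l * V z ^ 2))"
      by (rule norm_Ln_le) (use lV2(1)[OF that] in simp)
    then show ?thesis using lV2(2)[OF that] by (simp add: g_def norm_mult)
  qed
  define t where "t = (\<lambda>(k::nat) z. 4 ^ k * g (z / 2 ^ Suc k))"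
  have small: "z / 2 ^ Suc k \<in> ball 0 r" if "z \<in> ball (0::complex) r" for k z
  proof -
    have "norm z / 2 ^ Suc k \<le> norm z / 1" using one_le_power[of "2::real" "Suc k"] by (intro divide_left_mono) (auto simp del: power_Suc)
    then show ?thesis using that by (simp add: norm_divide norm_power)
  qed
  have thol: "t k holomorphic_on ball 0 r" for k
  proof -
    have "g \<circ> (\<lambda>z. z / 2 ^ Suc k) holomorphic_on ball 0 r"
      by (rule holomorphic_on_compose_gen[OF _ ghol]) (use small in \<open>auto intro!: holomorphic_intros simp del: power_Suc\<close>)
    then show ?thesis unfolding t_def by (intro holomorphic_intros) (simp add: o_def)
  qed
  have tle: "norm (t k z) \<le> norm l * r ^ 4 * (1 / 4) ^ k" if z: "z \<in> ball 0 r" for k z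
  proof -
    have "norm (t k z) = 4 ^ k * norm (g (z / 2 ^ Suc k))" by (simp add: t_def norm_mult norm_power)
    also have "\<dots> \<le> 4 ^ k * (16 * norm l * norm (z / 2 ^ Suc k) ^ 4)"
      using gle[OF small[OF z]] by (intro mult_left_mono) auto
    also have "\<dots> \<le> 4 ^ k * (16 * norm l * (r / 2 ^ Suc k) ^ 4)"
      using z by (intro mult_left_mono power_mono) (auto simp: norm_divide norm_power divide_right_mono)
    also have "\<dots> = norm l * r ^ 4 * (4 ^ k * (1 / 2 ^ k) ^ 4)"
      by (simp add: power_divide field_simps)
    also have "(4::real) ^ k * (1 / 2 ^ k) ^ 4 = (4 * (1 / 2) ^ 4) ^ k"
      by (simp only: power_one_over[symmetric] power_mult_distrib power_mult[symmetric] mult.commute[of k 4])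
    also have "(4::real) * (1 / 2) ^ 4 = 1 / 4" by (simp add: power_divide)
    finally show ?thesis .
  qed
  have M: "(\<lambda>k. norm l * r ^ 4 * (1 / 4) ^ k) summable_on (UNIV :: nat set)"
    by (intro summable_on_cmult_right summable_nonneg_imp_summable_on) (auto intro: summable_geometric)
  define \<beta> where "\<beta> = (\<lambda>z. \<Sum>\<^sub>\<infinity>k\<in>UNIV. t k z)"
  have \<beta>hol: "\<beta> holomorphic_on ball 0 r"
    unfolding \<beta>_def by (rule holomorphic_infsum(1)[OF thol tle M])
  have tsum: "(\<lambda>k. t k z) summable_on UNIV" if "z \<in> ball 0 r" for z
    by (rule abs_summable_summable, rule Infinite_Sum.abs_summable_on_comparison_test'[OF M]) (use tle that in auto)
  have \<beta>2: "\<beta> (2 * z) = 4 * \<beta> z + g z" if z: "z \<in> ball 0 (r / 2)" for z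
  proof -
    have z2: "2 * z \<in> ball 0 r" and z1: "z \<in> ball 0 r" using z V(1) by (auto simp: norm_mult)
    have "\<beta> (2 * z) = t 0 (2 * z) + (\<Sum>\<^sub>\<infinity>k\<in>range Suc. t k (2 * z))"
    proof -
      have "(\<lambda>k. t k (2 * z)) summable_on range Suc"
        by (rule summable_on_subset[OF tsum[OF z2]]) auto
      then have "infsum (\<lambda>k. t k (2 * z)) (insert 0 (range Suc)) = t 0 (2 * z) + (\<Sum>\<^sub>\<infinity>k\<in>range Suc. t k (2 * z))"
        by (rule infsum_insert) auto
      then show ?thesis unfolding \<beta>_def UNIV_nat_eq[symmetric] .
    qed
    also have "(\<Sum>\<^sub>\<infinity>k\<in>range Suc. t k (2 * z)) = (\<Sum>\<^sub>\<infinity>k\<in>UNIV. t (Suc k) (2 * z))"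
      by (subst infsum_reindex) (auto simp: o_def)
    also have "\<dots> = (\<Sum>\<^sub>\<infinity>k\<in>UNIV. 4 * t k z)" by (simp add: t_def mult.assoc)
    also have "\<dots> = 4 * \<beta> z" unfolding \<beta>_def using tsum[OF z1] by (intro infsum_cmult_right) auto
    finally show ?thesis by (simp add: t_def)
  qed
  define b where "b = (\<lambda>z. exp (\<beta> z))"
  define a where "a = (\<lambda>z. V z * b z)"
  have V_eq: "(\<lambda>z. a z / b z) = V" by (simp add: a_def b_def)
  have bhol: "b holomorphic_on ball 0 r" unfolding b_def by (intro holomorphic_intros \<beta>hol)
  have ahol: "a holomorphic_on ball 0 r" unfolding a_def by (intro holomorphic_intros bhol V(2))
  have b2: "b (2 * z) = b z ^ 4 * (1 - l * V z ^ 2) ^ 2" if z: "z \<in> ball 0 (r / 2)" for z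
  proof -
    have z1: "z \<in> ball 0 r" using z V(1) by auto
    have "b (2 * z) = exp (4 * \<beta> z) * exp (g z)" by (simp add: b_def \<beta>2[OF z] exp_add)
    also have "exp (4 * \<beta> z) = b z ^ 4" using exp_of_nat_mult[of 4 "\<beta> z"] by (simp add: b_def)
    also have "exp (g z) = (1 - l * V z ^ 2) ^ 2"
      using nz[OF z1] exp_of_nat_mult[of 2 "Ln (1 + - (l * V z ^ 2))"] by (simp add: g_def)
    finally show ?thesis .
  qed
  show ?thesis
  proof (rule that[OF V(1) ahol bhol])
    show "a 0 = 0" by (simp add: a_def V(3))
    have "t k 0 = 0" for k using V(3) by (simp add: t_def g_def)
    then show "b 0 = 1" by (simp add: b_def \<beta>_def)
    show "b (2 * z) = (b z ^ 2 - l * a z ^ 2) ^ 2" if "z \<in> ball 0 (r / 2)" for z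
      unfolding b2[OF that] a_def by algebra
    show "a (2 * z) = 4 * (a z * b z * (b z - a z) * (b z - l * a z))" if z: "z \<in> ball 0 (r / 2)" for z
    proof -
      have "1 - l * V z ^ 2 \<noteq> 0" using nz[of z] z V(1) by auto
      then have "a (2 * z) = 4 * (V z * (1 - V z) * (1 - l * V z)) * b z ^ 4"
        unfolding a_def b2[OF z] V(7)[OF z] doubling_def by simp
      then show ?thesis unfolding a_def by algebra
    qed
    show "deriv (\<lambda>z. a z / b z) z ^ 2 = 4 * (a z / b z * (1 - a z / b z) * (1 - l * (a z / b z)))"
      if "z \<in> ball 0 r" for z
      using V(4)[OF that] unfolding V_eq by (simp add: a_def b_def)
    show "((\<lambda>z. a z / b z / z ^ 2) \<longlongrightarrow> 1) (at 0)" using V(5) by (simp add: a_def b_def)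
  qed (auto simp: b_def)
qed

text \<open>The pair is evaluated at \<open>z / 2^n\<close>, and the doubling forms are then applied
  \<open>n\<close> times.\<close>

primrec ext_iter :: "(complex \<Rightarrow> complex \<Rightarrow> complex) \<Rightarrow> (complex \<Rightarrow> complex \<Rightarrow> complex) \<Rightarrow>
    (complex \<Rightarrow> complex) \<Rightarrow> (complex \<Rightarrow> complex) \<Rightarrow> nat \<Rightarrow> complex \<Rightarrow> complex \<times> complex" where
  "ext_iter \<Phi> \<Psi> a b 0 z = (a z, b z)"
| "ext_iter \<Phi> \<Psi> a b (Suc n) z =
     (\<Phi> (fst (ext_iter \<Phi> \<Psi> a b n (z / 2))) (snd (ext_iter \<Phi> \<Psi> a b n (z / 2))),
      \<Psi> (fst (ext_iter \<Phi> \<Psi> a b n (z / 2))) (snd (ext_iter \<Phi> \<Psi> a b n (z / 2))))"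

text \<open>The \<open>n\<close>-th iterate is holomorphic on the ball of radius
  \<open>r 2^n\<close> and agrees with its successor there by the functional equation, so the
  iterates glue to entire functions.\<close>

lemma entire_extension:
  assumes r: "r > 0" and a: "a holomorphic_on ball 0 r" and b: "b holomorphic_on ball 0 r"
    and a2: "\<And>z. z \<in> ball 0 (r / 2) \<Longrightarrow> a (2 * z) = \<Phi> (a z) (b z)"
    and b2: "\<And>z. z \<in> ball 0 (r / 2) \<Longrightarrow> b (2 * z) = \<Psi> (a z) (b z)"
    and \<Phi>: "\<And>f g S. f holomorphic_on S \<Longrightarrow> g holomorphic_on S \<Longrightarrow> (\<lambda>z. \<Phi> (f z) (g z)) holomorphic_on S"
    and \<Psi>: "\<And>f g S. f holomorphic_on S \<Longrightarrow> g holomorphic_on S \<Longrightarrow> (\<lambda>z. \<Psi> (f z) (g z)) holomorphic_on S"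
  obtains A B where "A holomorphic_on UNIV" "B holomorphic_on UNIV"
    "\<And>z. z \<in> ball 0 r \<Longrightarrow> A z = a z" "\<And>z. z \<in> ball 0 r \<Longrightarrow> B z = b z"
    "\<And>z. A (2 * z) = \<Phi> (A z) (B z)" "\<And>z. B (2 * z) = \<Psi> (A z) (B z)"
proof -
  define it where "it = ext_iter \<Phi> \<Psi> a b"
  have it_Suc: "it (Suc n) z = (\<Phi> (fst (it n (z / 2))) (snd (it n (z / 2))), \<Psi> (fst (it n (z / 2))) (snd (it n (z / 2))))" for n z
    by (simp add: it_def)
  have half: "z / 2 \<in> ball 0 (r * 2 ^ n)" if "z \<in> ball (0::complex) (r * 2 ^ Suc n)" for n z
    using that by (simp add: norm_divide)
  have hol: "(\<lambda>z. fst (it n z)) holomorphic_on ball 0 (r * 2 ^ n) \<and> (\<lambda>z. snd (it n z)) holomorphic_on ball 0 (r * 2 ^ n)" for n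
  proof (induction n)
    case 0
    then show ?case using a b by (simp add: it_def)
  next
    case (Suc n)
    have "(\<lambda>z. fst (it n z)) \<circ> (\<lambda>z. z / 2) holomorphic_on ball 0 (r * 2 ^ Suc n)"
      by (rule holomorphic_on_compose_gen[OF _ conjunct1[OF Suc]]) (use half in \<open>auto intro!: holomorphic_intros simp del: power_Suc\<close>)
    moreover have "(\<lambda>z. snd (it n z)) \<circ> (\<lambda>z. z / 2) holomorphic_on ball 0 (r * 2 ^ Suc n)"
      by (rule holomorphic_on_compose_gen[OF _ conjunct2[OF Suc]]) (use half in \<open>auto intro!: holomorphic_intros simp del: power_Suc\<close>)
    ultimately show ?case unfolding it_Suc fst_conv snd_conv o_def using \<Phi> \<Psi> by blast
  qed
  have step: "it (Suc n) z = it n z" if "z \<in> ball 0 (r * 2 ^ n)" for n z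
    using that
  proof (induction n arbitrary: z)
    case 0
    then have "z / 2 \<in> ball 0 (r / 2)" by (simp add: norm_divide)
    from a2[OF this] b2[OF this] show ?case by (simp add: it_def)
  next
    case (Suc n)
    from Suc.IH[OF half[OF Suc.prems]] show ?case by (simp only: it_Suc[of "Suc n"] it_Suc[of n])
  qed
  have mono: "it (n + k) z = it n z" if z: "z \<in> ball 0 (r * 2 ^ n)" for n k z
  proof (induction k)
    case (Suc k)
    have "r * 2 ^ n \<le> r * 2 ^ (n + k)" using r by (intro mult_left_mono power_increasing) auto
    then have "z \<in> ball 0 (r * 2 ^ (n + k))" using z by auto
    from step[OF this] Suc show ?case by simp
  qed simp
  have ex: "\<exists>n. z \<in> ball 0 (r * 2 ^ n)" for z :: complex
  proof -
    obtain n where "norm z / r < 2 ^ n" using real_arch_pow[of 2 "norm z / r"] by auto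
    then show ?thesis using r by (auto simp: field_simps)
  qed
  \<comment> \<open>The choice is harmless, since all iterates defined at \<open>z\<close> have the
    same value there.\<close>
  define N where "N = (\<lambda>z::complex. SOME n. z \<in> ball 0 (r * 2 ^ n))"
  have N: "z \<in> ball 0 (r * 2 ^ N z)" for z unfolding N_def by (rule someI_ex[OF ex])
  define E where "E = (\<lambda>z. it (N z) z)"
  have E: "E z = it n z" if "z \<in> ball 0 (r * 2 ^ n)" for n z
  proof (cases "n \<le> N z")
    case True
    then show ?thesis using mono[OF that, of "N z - n"] by (simp add: E_def)
  next
    case False
    then show ?thesis using mono[OF N, of z "n - N z"] by (simp add: E_def)
  qed
  have Ehol: "(\<lambda>z. F (E z)) holomorphic_on UNIV"
    if F: "\<And>n. (\<lambda>z. F (it n z)) holomorphic_on ball 0 (r * 2 ^ n)" for F :: "complex \<times> complex \<Rightarrow> complex"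
    unfolding holomorphic_on_def
  proof
    fix z :: complex
    obtain n where n: "z \<in> ball 0 (r * 2 ^ n)" using ex by blast
    have "(\<lambda>z. F (E z)) holomorphic_on ball 0 (r * 2 ^ n)"
      by (rule holomorphic_transform[OF F]) (simp add: E)
    then show "(\<lambda>z. F (E z)) field_differentiable at z within UNIV"
      using n holomorphic_on_imp_differentiable_at[OF _ open_ball] by blast
  qed
  have dbl: "E (2 * z) = (\<Phi> (fst (E z)) (snd (E z)), \<Psi> (fst (E z)) (snd (E z)))" for z
  proof -
    obtain n where n: "z \<in> ball 0 (r * 2 ^ n)" using ex by blast
    then have "2 * z \<in> ball 0 (r * 2 ^ Suc n)" by (simp add: norm_mult)
    then show ?thesis using E[OF n] E[of "2 * z" "Suc n"] by (simp add: it_Suc)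
  qed
  show ?thesis
  proof (rule that[of "\<lambda>z. fst (E z)" "\<lambda>z. snd (E z)"])
    show "(\<lambda>z. fst (E z)) holomorphic_on UNIV" "(\<lambda>z. snd (E z)) holomorphic_on UNIV"
      using hol by (intro Ehol; simp)+
    show "fst (E z) = a z" "snd (E z) = b z" if "z \<in> ball 0 r" for z
      using E[of z 0] that by (simp_all add: it_def)
  qed (simp_all add: dbl)
qed

section \<open>Discrete subgroups of the plane\<close>

text \<open>A shortest nonzero element \<open>w1\<close> generates all elements on its real line. If
  there are others, one with the least nonzero \<open>|Im (v / w1)|\<close> completes a basis, by
  division with remainder in that coordinate.\<close>

lemma discrete_subgroup_cases:
  fixes G :: "complex set"
  assumes G0: "0 \<in> G" and Gd: "\<And>x y. x \<in> G \<Longrightarrow> y \<in> G \<Longrightarrow> x - y \<in> G"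
    and fin: "\<And>R. finite (G \<inter> cball 0 R)"
  obtains (cyclic) w where "w \<in> G" "\<And>g. g \<in> G \<Longrightarrow> \<exists>m::int. g = of_int m * w"
  | (lattice) w1 w2 where "w1 \<in> G" "w2 \<in> G" "w1 \<noteq> 0" "Im (w2 / w1) > 0"
      "\<And>g. g \<in> G \<Longrightarrow> \<exists>m n::int. g = of_int m * w1 + of_int n * w2"
proof (cases "G = {0}")
  case True
  \<comment> \<open>The trivial group counts as cyclic, with generator 0.\<close>
  show ?thesis by (rule cyclic[of 0]) (use True in auto)
next
  case False
  have Gm: "- x \<in> G" if "x \<in> G" for x using Gd[OF G0 that] by simp
  have Ga: "x + y \<in> G" if "x \<in> G" "y \<in> G" for x y using Gd[OF that(1) Gm[OF that(2)]] by simp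
  have Gi: "of_int m * x \<in> G" if x: "x \<in> G" for m x
  proof (induction m rule: int_induct[where k = 0])
    case (step1 i) from Ga[OF step1(2) x] show ?case by (simp add: algebra_simps)
  next
    case (step2 i) from Gd[OF step2(2) x] show ?case by (simp add: algebra_simps)
  qed (simp add: G0)
  obtain g1 where g1: "g1 \<in> G" "g1 \<noteq> 0" using False G0 by blast
  define S1 where "S1 = {g \<in> G. g \<noteq> 0 \<and> norm g \<le> norm g1}"
  have "finite S1" by (rule finite_subset[OF _ fin[of "norm g1"]]) (auto simp: S1_def)
  moreover have "S1 \<noteq> {}" using g1 by (auto simp: S1_def)
  ultimately obtain w1 where w1: "w1 \<in> S1" "\<forall>g\<in>S1. norm w1 \<le> norm g"
    using arg_min_if_finite[of S1 norm] by (metis not_le)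
  have w1G: "w1 \<in> G" "w1 \<noteq> 0" using w1(1) by (auto simp: S1_def)
  have w1min: "norm w1 \<le> norm g" if "g \<in> G" "g \<noteq> 0" for g
  proof (cases "norm g \<le> norm g1")
    case True then show ?thesis using w1(2) that by (auto simp: S1_def)
  next
    case False then show ?thesis using w1(1) by (auto simp: S1_def)
  qed
  have line: "\<exists>m::int. g = of_int m * w1" if g: "g \<in> G" "Im (g / w1) = 0" for g
  proof -
    define m where "m = round (Re (g / w1))"
    define g' where "g' = g - of_int m * w1"
    have g': "g' \<in> G" unfolding g'_def by (intro Gd g Gi w1G)
    have "g' / w1 = of_real (Re (g / w1) - of_int m)"
      using w1G(2) g(2) by (auto simp: g'_def diff_divide_distrib complex_eq_iff)
    then have "norm (g' / w1) = \<bar>Re (g / w1) - of_int m\<bar>" by (simp only: norm_of_real)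
    also have "\<dots> \<le> 1 / 2" unfolding m_def using of_int_round_abs_le[of "Re (g / w1)"] by linarith
    finally have "norm g' \<le> norm w1 / 2" using w1G(2) by (simp add: norm_divide field_simps)
    moreover have "norm w1 > 0" using w1G(2) by simp
    ultimately have "\<not> norm w1 \<le> norm g'" by linarith
    then have "g' = 0" using w1min[OF g'] by blast
    then show ?thesis unfolding g'_def by (intro exI[of _ m]) simp
  qed
  show ?thesis
  proof (cases "\<forall>g\<in>G. Im (g / w1) = 0")
    case True
    show ?thesis by (rule cyclic[OF w1G(1)]) (use line True in blast)
  next
    case nc: False
    then obtain g0 where g0: "g0 \<in> G" "Im (g0 / w1) \<noteq> 0" by blast
    \<comment> \<open>The bound on the real part makes \<open>S\<close> finite, so that a minimum
      exists. Subtracting multiples of \<open>w1\<close> brings every candidate into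
      \<open>S\<close> without changing the imaginary part.\<close>
    define S where "S = {g \<in> G. Im (g / w1) \<noteq> 0 \<and> \<bar>Im (g / w1)\<bar> \<le> \<bar>Im (g0 / w1)\<bar> \<and> \<bar>Re (g / w1)\<bar> \<le> 1}"
    have norm_le: "norm g \<le> (1 + \<bar>Im (g0 / w1)\<bar>) * norm w1" if "g \<in> S" for g
    proof -
      have "norm (g / w1) \<le> 1 + \<bar>Im (g0 / w1)\<bar>"
        using cmod_le[of "g / w1"] that by (auto simp: S_def)
      then show ?thesis using w1G(2) by (simp add: norm_divide field_simps)
    qed
    have "finite S"
      by (rule finite_subset[OF _ fin[of "(1 + \<bar>Im (g0 / w1)\<bar>) * norm w1"]]) (use norm_le in \<open>auto simp: S_def\<close>)
    moreover have red: "\<exists>h\<in>S. Im (h / w1) = Im (g / w1)"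
      if g: "g \<in> G" "Im (g / w1) \<noteq> 0" "\<bar>Im (g / w1)\<bar> \<le> \<bar>Im (g0 / w1)\<bar>" for g
    proof -
      define m where "m = round (Re (g / w1))"
      define h where "h = g - of_int m * w1"
      have "h \<in> G" unfolding h_def by (intro Gd g Gi w1G)
      moreover have hq: "h / w1 = g / w1 - of_int m" using w1G(2) by (simp add: h_def diff_divide_distrib)
      moreover have "\<bar>Re (g / w1) - of_int m\<bar> \<le> 1"
        unfolding m_def using of_int_round_abs_le[of "Re (g / w1)"] by linarith
      ultimately show ?thesis using g by (intro bexI[of _ h]) (auto simp: S_def)
    qed
    then have "S \<noteq> {}" using g0 by blast
    ultimately obtain v where v: "v \<in> S" "\<forall>g\<in>S. \<bar>Im (v / w1)\<bar> \<le> \<bar>Im (g / w1)\<bar>"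
      using arg_min_if_finite[of S "\<lambda>g. \<bar>Im (g / w1)\<bar>"] by (metis not_le)
    have vmin: "\<bar>Im (v / w1)\<bar> \<le> \<bar>Im (g / w1)\<bar>" if "g \<in> G" "Im (g / w1) \<noteq> 0" for g
    proof (cases "\<bar>Im (g / w1)\<bar> \<le> \<bar>Im (g0 / w1)\<bar>")
      case True
      then show ?thesis using red[OF that True] v(2) by metis
    next
      case False
      then show ?thesis using v(1) by (auto simp: S_def)
    qed
    define w2 where "w2 = (if Im (v / w1) > 0 then v else - v)"
    have w2: "w2 \<in> G" "Im (w2 / w1) = \<bar>Im (v / w1)\<bar>" "Im (w2 / w1) > 0"
      using v(1) Gm by (auto simp: w2_def S_def)
    show ?thesis
    proof (rule lattice[OF w1G(1) w2(1) w1G(2) w2(3)])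
      fix g assume g: "g \<in> G"
      define t where "t = Im (g / w1) / Im (w2 / w1)"
      define g' where "g' = g - of_int \<lfloor>t\<rfloor> * w2"
      have g': "g' \<in> G" unfolding g'_def by (intro Gd g Gi w2)
      have "g' / w1 = g / w1 - of_int \<lfloor>t\<rfloor> * (w2 / w1)"
        by (simp add: g'_def diff_divide_distrib)
      then have "Im (g' / w1) = Im (g / w1) - of_int \<lfloor>t\<rfloor> * Im (w2 / w1)"
        by (simp only: minus_complex.simps times_complex.simps complex_Re_of_int complex_Im_of_int mult_zero_left add_0_right)
      also have "\<dots> = (t - of_int \<lfloor>t\<rfloor>) * Im (w2 / w1)" using w2(3) by (simp add: t_def field_simps)
      finally have im: "Im (g' / w1) = frac t * Im (w2 / w1)" by (simp add: frac_def)
      have "Im (g' / w1) = 0"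
      proof (rule ccontr)
        assume "Im (g' / w1) \<noteq> 0"
        then have "Im (w2 / w1) \<le> \<bar>Im (g' / w1)\<bar>" using vmin[OF g'] w2(2) by simp
        also have "\<dots> = frac t * Im (w2 / w1)" using w2(3) by (simp add: im abs_mult)
        also have "\<dots> < 1 * Im (w2 / w1)" using w2(3) by (intro mult_strict_right_mono frac_lt_1)
        finally show False by simp
      qed
      from line[OF g' this] obtain m :: int where "g' = of_int m * w1" by blast
      then show "\<exists>m n::int. g = of_int m * w1 + of_int n * w2"
        unfolding g'_def by (intro exI[of _ m] exI[of _ "\<lfloor>t\<rfloor>"]) (simp add: algebra_simps)
    qed
  qed
qed

lemma entire_eq_0:
  fixes f :: "complex \<Rightarrow> complex"
  assumes f: "f holomorphic_on UNIV" and r: "r > 0" and z: "\<And>z. z \<in> ball a r \<Longrightarrow> f z = 0"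
  shows "f w = 0"
  by (rule analytic_continuation[OF f open_UNIV connected_UNIV, where U = "ball a r" and \<xi> = a])
     (use z r in \<open>auto simp: islimpt_ball\<close>)

section \<open>The entire pair and its group of periods\<close>

text \<open>\<open>A / B\<close> is \<open>sn^2\<close> with squared modulus \<open>l\<close>.
  Assumption \<open>W\<close> is its differential equation multiplied by \<open>B ^ 4\<close>, so
  that it makes sense on the whole plane.\<close>

locale jacobi_pair =
  fixes l :: complex and A B :: "complex \<Rightarrow> complex"
  assumes l: "l \<noteq> 0" "l \<noteq> 1"
    and A: "A holomorphic_on UNIV" and B: "B holomorphic_on UNIV"
    and A0: "A 0 = 0" and B0: "B 0 = 1"
    and W: "\<And>z. (deriv A z * B z - A z * deriv B z) ^ 2 = 4 * (A z * B z * (B z - A z) * (B z - l * A z))"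
    and lim: "((\<lambda>z. A z / B z / z ^ 2) \<longlongrightarrow> 1) (at 0)"
    and A2: "\<And>z. A (2 * z) = 4 * (A z * B z * (B z - A z) * (B z - l * A z))"
    and B2: "\<And>z. B (2 * z) = (B z ^ 2 - l * A z ^ 2) ^ 2"
begin

text \<open>By the doubling forms a common zero at \<open>2 w\<close> forces one at
  \<open>w\<close>; this uses that \<open>l\<close> is neither 0 nor 1. Halving repeatedly, the
  zeros would accumulate at 0, where \<open>B\<close> is 1.\<close>

lemma no_common_zero: "A z \<noteq> 0 \<or> B z \<noteq> 0"
proof (rule ccontr)
  assume *: "\<not> ?thesis"
  have half: "A w = 0 \<and> B w = 0" if "A (2 * w) = 0" "B (2 * w) = 0" for w
  proof -
    have "B w ^ 2 = l * A w ^ 2" using that(2) B2[of w] by simp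
    moreover have "A w = 0 \<or> B w = 0 \<or> B w = A w \<or> B w = l * A w" using that(1) A2[of w] by auto
    ultimately show ?thesis using l by (auto simp: power2_eq_square)
  qed
  have "A (z / 2 ^ n) = 0 \<and> B (z / 2 ^ n) = 0" for n
  proof (induction n)
    case (Suc n)
    then show ?case using half[of "z / 2 ^ Suc n"] by simp
  qed (use * in auto)
  moreover have "(\<lambda>n. B (z / 2 ^ n)) \<longlonglongrightarrow> B 0"
  proof -
    have "isCont B 0" by (intro field_differentiable_imp_continuous_at holomorphic_on_imp_differentiable_at[OF B]) auto
    moreover have "(\<lambda>n. z * (1 / 2) ^ n) \<longlonglongrightarrow> z * 0" by (intro tendsto_mult LIMSEQ_power_zero tendsto_const) (simp add: norm_divide)
    then have "(\<lambda>n. z / 2 ^ n) \<longlonglongrightarrow> 0" by (simp add: power_divide)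
    ultimately show ?thesis by (rule isCont_tendsto_compose)
  qed
  ultimately have "(\<lambda>n::nat. 0) \<longlonglongrightarrow> (1::complex)" using B0 by simp
  from LIMSEQ_unique[OF this tendsto_const] show False by simp
qed

lemma A_nz: assumes "r > 0" shows "\<exists>y\<in>ball 0 r. A y \<noteq> 0"
  using tendsto_1_imp_nonzero[OF lim assms] by auto

text \<open>Near 0 both quotients solve the same first-order equation with value 0 at the origin,
  hence agree. Cross-multiplication avoids the zeros of the denominators and extends the equality to
  the plane. Applied to reflected and translated pairs, it yields evenness and periods.\<close>

lemma pair_unique:
  assumes f: "f holomorphic_on UNIV" and g: "g holomorphic_on UNIV" and f0: "f 0 = 0" and g0: "g 0 \<noteq> 0"
    and Wf: "\<And>z. (deriv f z * g z - f z * deriv g z) ^ 2 = 4 * (f z * g z * (g z - f z) * (g z - l * f z))"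
    and y: "f y \<noteq> 0"
  shows "f t * B t = A t * g t"
proof -
  have "isCont g 0" "isCont B 0"
    by (intro field_differentiable_imp_continuous_at holomorphic_on_imp_differentiable_at[OF g]
      holomorphic_on_imp_differentiable_at[OF B]; simp)+
  then have "(g \<longlongrightarrow> g 0) (nhds 0)" "(B \<longlongrightarrow> B 0) (nhds 0)"
    by (simp_all add: isCont_def tendsto_at_iff_tendsto_nhds)
  then have "eventually (\<lambda>z. g z \<noteq> 0) (nhds 0)" "eventually (\<lambda>z. B z \<noteq> 0) (nhds 0)"
    using g0 B0 by (auto intro: tendsto_imp_eventually_ne)
  then have "eventually (\<lambda>z. g z \<noteq> 0 \<and> B z \<noteq> 0) (nhds 0)" by (rule eventually_conj)
  then obtain s where s: "s > 0" "\<And>z. z \<in> ball 0 s \<Longrightarrow> g z \<noteq> 0 \<and> B z \<noteq> 0"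
    by (auto simp: eventually_nhds_metric dist_commute)
  have ode: "(\<lambda>z. h z / k z) holomorphic_on ball 0 s \<and> (\<forall>z\<in>ball 0 s. deriv (\<lambda>z. h z / k z) z ^ 2 =
      4 * (h z / k z) + (- 4 * (1 + l)) * (h z / k z) ^ 2 + 4 * l * (h z / k z) ^ 3 + 0 * (h z / k z) ^ 4)"
    if h: "h holomorphic_on UNIV" and k: "k holomorphic_on UNIV" and k0: "\<And>z. z \<in> ball 0 s \<Longrightarrow> k z \<noteq> 0"
      and Wh: "\<And>z. (deriv h z * k z - h z * deriv k z) ^ 2 = 4 * (h z * k z * (k z - h z) * (k z - l * h z))" for h k
  proof (intro conjI ballI)
    show "(\<lambda>z. h z / k z) holomorphic_on ball 0 s"
      using k0 by (intro holomorphic_intros holomorphic_on_subset[OF h] holomorphic_on_subset[OF k]) auto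
    fix z :: complex assume z: "z \<in> ball 0 s"
    have "((\<lambda>z. h z / k z) has_field_derivative (deriv h z * k z - h z * deriv k z) / (k z * k z)) (at z)"
      using k0[OF z] by (intro DERIV_divide holomorphic_derivI[OF h] holomorphic_derivI[OF k]) auto
    then have "deriv (\<lambda>z. h z / k z) z ^ 2 = (deriv h z * k z - h z * deriv k z) ^ 2 / (k z * k z) ^ 2"
      by (simp only: DERIV_imp_deriv power_divide)
    also have "\<dots> = 4 * (h z / k z * (1 - h z / k z) * (1 - l * (h z / k z)))"
      unfolding Wh using k0[OF z] by (simp add: field_simps eval_nat_numeral)
    finally show "deriv (\<lambda>z. h z / k z) z ^ 2 =
      4 * (h z / k z) + (- 4 * (1 + l)) * (h z / k z) ^ 2 + 4 * l * (h z / k z) ^ 3 + 0 * (h z / k z) ^ 4"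
      unfolding V_ode_expand .
  qed
  have of: "(\<lambda>z. f z / g z) holomorphic_on ball 0 s"
      "\<And>z. z \<in> ball 0 s \<Longrightarrow> deriv (\<lambda>z. f z / g z) z ^ 2 =
      4 * (f z / g z) + (- 4 * (1 + l)) * (f z / g z) ^ 2 + 4 * l * (f z / g z) ^ 3 + 0 * (f z / g z) ^ 4"
    using ode[OF f g _ Wf] s(2) by auto
  have oA: "(\<lambda>z. A z / B z) holomorphic_on ball 0 s"
      "\<And>z. z \<in> ball 0 s \<Longrightarrow> deriv (\<lambda>z. A z / B z) z ^ 2 =
      4 * (A z / B z) + (- 4 * (1 + l)) * (A z / B z) ^ 2 + 4 * l * (A z / B z) ^ 3 + 0 * (A z / B z) ^ 4"
    using ode[OF A B _ W] s(2) by auto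
  obtain y1 where y1: "y1 \<in> ball 0 s" "f y1 \<noteq> 0" using entire_eq_0[OF f s(1), of 0 y] y by blast
  obtain y2 where y2: "y2 \<in> ball 0 s" "A y2 \<noteq> 0" using A_nz[OF s(1)] by blast
  have "f z * B z - A z * g z = 0" if z: "z \<in> ball 0 s" for z
  proof -
    have "f z / g z = A z / B z"
      by (rule ode1_unique_at_0[OF of(1) oA(1) of(2) oA(2) _ _ y1(1) _ y2(1) _ z]) (use y1 y2 s(2) f0 A0 in auto)
    then show ?thesis using s(2)[OF z] by (simp add: field_simps)
  qed
  moreover have "(\<lambda>z. f z * B z - A z * g z) holomorphic_on UNIV" by (intro holomorphic_intros f g A B)
  ultimately have "f t * B t - A t * g t = 0" using entire_eq_0[OF _ s(1)] by blast
  then show ?thesis by simp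
qed

lemma A_minus: "A (- t) * B t = A t * B (- t)"
proof -
  have D: "deriv (\<lambda>z. h (- z)) z = - deriv h (- z)" if "h holomorphic_on UNIV" for h :: "complex \<Rightarrow> complex" and z
  proof -
    have "((\<lambda>z. h (- z)) has_field_derivative deriv h (- z) * (- 1)) (at z)"
      by (rule DERIV_chain2[of h]) (use that in \<open>auto intro!: derivative_eq_intros holomorphic_derivI[OF that]\<close>)
    then show ?thesis using DERIV_imp_deriv by fastforce
  qed
  have hol: "(\<lambda>z. h (- z)) holomorphic_on UNIV" if "h holomorphic_on UNIV" for h :: "complex \<Rightarrow> complex"
  proof -
    have "h \<circ> (\<lambda>z. - z) holomorphic_on UNIV"
      by (rule holomorphic_on_compose_gen[OF _ that]) (auto intro!: holomorphic_intros)
    then show ?thesis by (simp add: o_def)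
  qed
  obtain y where y: "A y \<noteq> 0" using A_nz[of 1] by auto
  show ?thesis
  proof (rule pair_unique[OF hol[OF A] hol[OF B]])
    show "(deriv (\<lambda>z. A (- z)) z * B (- z) - A (- z) * deriv (\<lambda>z. B (- z)) z)\<^sup>2 =
         4 * (A (- z) * B (- z) * (B (- z) - A (- z)) * (B (- z) - l * A (- z)))" for z
      unfolding D[OF A] D[OF B] W[of "- z", symmetric] by (simp add: power2_eq_square algebra_simps)
    show "A (- (- y)) \<noteq> 0" using y by simp
  qed (use A0 B0 in auto)
qed

text \<open>A zero \<open>w\<close> of \<open>A\<close> is a period of \<open>A / B\<close>: the
  differential equation is invariant under translation, and the translated quotient again vanishes
  at 0.\<close>

lemma A_shift: assumes w: "A w = 0" shows "A (w + t) * B t = A t * B (w + t)"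
proof -
  have D: "deriv (\<lambda>z. h (w + z)) z = deriv h (w + z)" if "h holomorphic_on UNIV" for h :: "complex \<Rightarrow> complex" and z
    by (rule DERIV_imp_deriv, rule deriv_shift) (use that in \<open>auto intro: holomorphic_on_imp_differentiable_at[OF that open_UNIV]\<close>)
  have hol: "(\<lambda>z. h (w + z)) holomorphic_on UNIV" if "h holomorphic_on UNIV" for h :: "complex \<Rightarrow> complex"
  proof -
    have "h \<circ> (\<lambda>z. w + z) holomorphic_on UNIV"
      by (rule holomorphic_on_compose_gen[OF _ that]) (auto intro!: holomorphic_intros)
    then show ?thesis by (simp add: o_def)
  qed
  obtain y where y: "A y \<noteq> 0" using A_nz[of 1] by auto
  show ?thesis
  proof (rule pair_unique[OF hol[OF A] hol[OF B]])
    show "(deriv (\<lambda>z. A (w + z)) z * B (w + z) - A (w + z) * deriv (\<lambda>z. B (w + z)) z)\<^sup>2 =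
         4 * (A (w + z) * B (w + z) * (B (w + z) - A (w + z)) * (B (w + z) - l * A (w + z)))" for z
      unfolding D[OF A] D[OF B] W[of "w + z", symmetric] by simp
    show "A (w + (y - w)) \<noteq> 0" using y by simp
    show "B (w + 0) \<noteq> 0" using w no_common_zero[of w] by simp
  qed (use w in auto)
qed

text \<open>The group of periods of \<open>A / B\<close>, described as a zero set in order to use
  the discreteness of zeros.\<close>

definition G where "G = {w. A w = 0}"

lemma G_minus: assumes "x \<in> G" shows "- x \<in> G"
proof -
  have "A (- x) * B x = 0" using A_minus[of x] assms by (simp add: G_def)
  then show ?thesis using no_common_zero[of x] assms by (auto simp: G_def)
qed

lemma G_add: assumes "x \<in> G" "y \<in> G" shows "x + y \<in> G"
proof -
  have "A (x + y) * B y = 0" using A_shift[of x y] assms by (simp add: G_def)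
  then show ?thesis using no_common_zero[of y] assms by (auto simp: G_def)
qed

lemma G_diff: "x \<in> G \<Longrightarrow> y \<in> G \<Longrightarrow> x - y \<in> G"
  using G_add[OF _ G_minus] by simp

lemma G_finite: "finite (G \<inter> cball 0 R)"
proof -
  obtain y where "A y \<noteq> 0" using A_nz[of 1] by auto
  then have "\<not> A constant_on UNIV" using A0 unfolding constant_on_def by (metis UNIV_I)
  then have "finite {z \<in> cball 0 R. A z = 0}"
    by (intro holomorphic_compact_finite_zeros[OF A open_UNIV connected_UNIV]) auto
  moreover have "G \<inter> cball 0 R = {z \<in> cball 0 R. A z = 0}" by (auto simp: G_def)
  ultimately show ?thesis by simp
qed

lemma half_period: assumes "B z = e * A z" "e \<in> {0, 1, l}" shows "2 * z \<in> G"
  using assms by (auto simp: G_def A2)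

text \<open>Points where \<open>B / A\<close> is 0, 1 or \<open>l\<close> are half periods but not
  periods. If the periods are the multiples of a single \<open>w\<close>, these are odd multiples of
  \<open>w / 2\<close>; any two differ by a period, so the values agree.\<close>

lemma attained_unique:
  assumes w: "w \<in> G" "\<And>g. g \<in> G \<Longrightarrow> \<exists>m::int. g = of_int m * w"
    and z: "B z = e * A z" "e \<in> {0, 1, l}" and z': "B z' = e' * A z'" "e' \<in> {0, 1, l}"
  shows "e = e'"
proof -
  have Gi: "of_int m * w \<in> G" for m
  proof (induction m rule: int_induct[where k = 0])
    case (step1 i) from G_add[OF step1(2) w(1)] show ?case by (simp add: algebra_simps)
  next
    case (step2 i) from G_diff[OF step2(2) w(1)] show ?case by (simp add: algebra_simps)
  qed (simp add: G_def A0)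
  have nz: "A z \<noteq> 0" "A z' \<noteq> 0" using no_common_zero[of z] no_common_zero[of z'] z z' by auto
  obtain m m' :: int where m: "2 * z = of_int m * w" "2 * z' = of_int m' * w"
    using w(2) half_period[OF z] half_period[OF z'] by metis
  have odd: "odd n" if "2 * x = of_int n * w" "A x \<noteq> 0" for n x
  proof
    assume "even n"
    then obtain k where "n = 2 * k" by blast
    then have "x = of_int k * w" using that(1) by simp
    then show False using Gi[of k] that(2) by (simp add: G_def)
  qed
  have "even (m - m')" using odd[OF m(1) nz(1)] odd[OF m(2) nz(2)] by simp
  then obtain k where k: "m - m' = 2 * k" by blast
  have "2 * (z - z') = of_int (m - m') * w" using m by (simp add: algebra_simps)
  then have "2 * (z - z') = 2 * (of_int k * w)" unfolding k by simp
  then have "z - z' = of_int k * w" by (subst (asm) mult_cancel_left) simp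
  then have "A (z - z') = 0" using Gi[of k] by (simp add: G_def)
  from A_shift[OF this, of z'] have "A z * (e' * A z') = A z' * (e * A z)" using z z' by simp
  then show ?thesis using nz by simp
qed

text \<open>In \<open>x = B / A\<close> doubling reads
  \<open>x \<mapsto> (x^2 - l)^2 / (4 x (x - 1) (x - l))\<close>. For \<open>e\<close> equal to 0, 1
  or \<open>l\<close> the equation for a preimage of \<open>e\<close> is the square of a quadratic
  one, solved by \<open>csqrt\<close>.\<close>

lemma preimage_exists:
  assumes "e \<in> {0, 1, l}"
  obtains x where "x \<notin> {0, 1, l}" "\<And>z. B z = x * A z \<Longrightarrow> B (2 * z) = e * A (2 * z)"
proof -
  have "\<exists>x. x \<notin> {0, 1, l} \<and> (x ^ 2 - l) ^ 2 = 4 * e * (x * (x - 1) * (x - l))"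
  proof -
    have s: "csqrt w ^ 2 = w" for w by simp
    consider "e = 0" | "e = 1" | "e = l" using assms by blast
    then show ?thesis
    proof cases
      case 1
      have "csqrt l \<notin> {0, 1, l}" using s[of l] l by (auto simp: power2_eq_square)
      then show ?thesis using 1 by (intro exI[of _ "csqrt l"]) simp
    next
      case 2
      define x where "x = 1 + csqrt (1 - l)"
      have x: "x ^ 2 - 2 * x + l = 0" using s[of "1 - l"] unfolding x_def by algebra
      have "(x ^ 2 - l) ^ 2 - 4 * e * (x * (x - 1) * (x - l)) = (x ^ 2 - 2 * x + l) ^ 2" unfolding 2 by algebra
      moreover have "x \<notin> {0, 1, l}" using x l by (auto simp: power2_eq_square)
      ultimately show ?thesis using x by (intro exI[of _ x]) simp
    next
      case 3
      define x where "x = l + csqrt (l ^ 2 - l)"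
      have x: "x ^ 2 - 2 * l * x + l = 0" using s[of "l ^ 2 - l"] unfolding x_def by algebra
      have "(x ^ 2 - l) ^ 2 - 4 * e * (x * (x - 1) * (x - l)) = (x ^ 2 - 2 * l * x + l) ^ 2" unfolding 3 by algebra
      moreover have "x \<notin> {0, 1, l}" using x l by (auto simp: power2_eq_square)
      ultimately show ?thesis using x by (intro exI[of _ x]) simp
    qed
  qed
  then obtain x where x: "x \<notin> {0, 1, l}" "(x ^ 2 - l) ^ 2 = 4 * e * (x * (x - 1) * (x - l))" by blast
  have "B (2 * z) = e * A (2 * z)" if "B z = x * A z" for z
  proof -
    have "B (2 * z) = (x ^ 2 - l) ^ 2 * A z ^ 4" unfolding B2 that by algebra
    also have "\<dots> = e * A (2 * z)" unfolding A2 that x(2) by algebra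
    finally show ?thesis .
  qed
  with x(1) show ?thesis using that by blast
qed

text \<open>If the periods were cyclic, there would be at most one nonzero half period, so \<open>B / A\<close> would omit two of the
  values \<open>0, 1, l\<close>. By the duplication formula it would also omit some preimage of an omitted value under
  duplication, contradicting Picard.\<close>

lemma not_cyclic:
  assumes w: "w \<in> G" "\<And>g. g \<in> G \<Longrightarrow> \<exists>m::int. g = of_int m * w"
  shows False
proof -
  have "\<exists>e e'. e \<in> {0, 1, l} \<and> e' \<in> {0, 1, l} \<and> e \<noteq> e' \<and> (\<forall>z. B z \<noteq> e * A z) \<and> (\<forall>z. B z \<noteq> e' * A z)"
  proof (cases "\<exists>z e. e \<in> {0, 1, l} \<and> B z = e * A z")
    case True
    then obtain z e where ze: "e \<in> {0, 1, l}" "B z = e * A z" by blast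
    have un: "B z' \<noteq> e' * A z'" if "e' \<in> {0, 1, l}" "e' \<noteq> e" for e' z'
      using attained_unique[OF w ze(2,1) _ that(1)] that(2) by blast
    consider "e = 0" | "e = 1" | "e = l" using ze by blast
    then show ?thesis
    proof cases
      case 1 then show ?thesis using l un[of 1] un[of l] by (intro exI[of _ 1] exI[of _ l]) auto
    next
      case 2 then show ?thesis using l un[of 0] un[of l] by (intro exI[of _ 0] exI[of _ l]) auto
    next
      case 3 then show ?thesis using l un[of 0] un[of 1] by (intro exI[of _ 0] exI[of _ 1]) auto
    qed
  next
    case False
    then have "B z \<noteq> e * A z" if "e \<in> {0, 1, l}" for e z using that by blast
    from this[of 0] this[of 1] show ?thesis by (intro exI[of _ 0] exI[of _ 1]) auto
  qed
  then obtain e e' where e: "e \<in> {0, 1, l}" "e' \<in> {0, 1, l}" "e \<noteq> e'" "\<And>z. B z \<noteq> e * A z" "\<And>z. B z \<noteq> e' * A z"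
    by blast
  obtain x where x: "x \<notin> {0, 1, l}" "\<And>z. B z = x * A z \<Longrightarrow> B (2 * z) = e * A (2 * z)"
    by (rule preimage_exists[OF e(1)]) (use that in blast)
  have xe: "x \<noteq> e" "x \<noteq> e'" using x(1) e(1,2) by auto
  have xun: "B z \<noteq> x * A z" for z using x(2)[of z] e(4)[of "2 * z"] by blast
  define F where "F = (\<lambda>z. A z / (B z - e * A z))"
  have d: "B z - e * A z \<noteq> 0" for z using e(4)[of z] by simp
  have F: "F holomorphic_on UNIV" unfolding F_def using d by (intro holomorphic_intros A B) auto
  have omit: "F z \<noteq> 1 / (y - e)" if "y \<noteq> e" "\<And>z. B z \<noteq> y * A z" for y z
  proof
    assume "F z = 1 / (y - e)"
    then have "A z * (y - e) = B z - e * A z" using d[of z] that(1) by (simp add: F_def field_simps)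
    then have "B z = y * A z" by (simp add: algebra_simps)
    then show False using that(2) by blast
  qed
  have "1 / (e' - e) \<noteq> 1 / (x - e)" using xe e(3) by (simp add: divide_simps)
  moreover have "range F \<inter> {1 / (e' - e), 1 / (x - e)} = {}"
    using omit[of e'] omit[of x] e(3,5) xe xun by (auto simp: image_iff) metis+
  ultimately obtain c where c: "F = (\<lambda>x. c)" by (rule little_Picard[OF F])
  have "F 0 = 0" by (simp add: F_def A0)
  then have "F z = 0" for z using c by (metis)
  then have "A z = 0" for z using d[of z] by (auto simp: F_def)
  then show False using A_nz[of 1] by auto
qed

end

section \<open>Comparison with the Weierstrass function\<close>

lemma square_factor_unit:
  fixes V :: "complex \<Rightarrow> complex"
  assumes V: "V holomorphic_on ball 0 r" "V 0 = 0" "r > 0" and lim: "((\<lambda>z. V z / z ^ 2) \<longlongrightarrow> 1) (at 0)"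
  obtains k where "k holomorphic_on ball 0 r" "\<And>z. z \<in> ball 0 r \<Longrightarrow> V z = z ^ 2 * k z" "k 0 = 1"
proof -
  have "((\<lambda>z. z * (V z / z ^ 2)) \<longlongrightarrow> 0) (at 0)"
    using tendsto_mult[OF tendsto_ident_at[of 0 UNIV] lim] by simp
  then have "((\<lambda>z. (V z - V 0) / (z - 0)) \<longlongrightarrow> 0) (at 0)"
    by (rule Lim_transform_eventually) (auto simp: V(2) eventually_at_filter power2_eq_square)
  then have "(V has_field_derivative 0) (at 0)" by (simp add: has_field_derivative_iff)
  then have "deriv V 0 = 0" by (rule DERIV_imp_deriv)
  then obtain k where k: "k holomorphic_on ball 0 r" "\<And>z. z \<in> ball 0 r \<Longrightarrow> V z = z ^ 2 * k z"
    using holomorphic_divide_square[OF V(1,2) _ V(3)] by blast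
  have "k field_differentiable at 0" using holomorphic_on_imp_differentiable_at[OF k(1)] V(3) by simp
  then have "isCont k 0" by (rule field_differentiable_imp_continuous_at)
  then have "(k \<longlongrightarrow> k 0) (at 0)" by (simp add: isCont_def)
  moreover have "(k \<longlongrightarrow> 1) (at 0)"
  proof (rule Lim_transform_eventually[OF lim])
    have "eventually (\<lambda>z. z \<in> ball 0 r - {0}) (at 0)" using V(3) by (intro eventually_at_in_open) auto
    then show "eventually (\<lambda>z. V z / z ^ 2 = k z) (at 0)" by eventually_elim (use k(2) in auto)
  qed
  ultimately have "k 0 = 1" by (metis tendsto_unique at_neq_bot)
  with k that show ?thesis by blast
qed

text \<open>Both functions are \<open>z^2\<close> times a unit with value 1 at 0. The units are
  even, so their difference vanishes to second order and cancels the double pole.\<close>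

lemma diff_inverse_square_units:
  fixes v V :: "complex \<Rightarrow> complex"
  assumes v: "v holomorphic_on ball 0 r" "v 0 = 0" "((\<lambda>z. v z / z ^ 2) \<longlongrightarrow> 1) (at 0)" "\<And>z. z \<in> ball 0 r \<Longrightarrow> v (- z) = v z"
    and V: "V holomorphic_on ball 0 r" "V 0 = 0" "((\<lambda>z. V z / z ^ 2) \<longlongrightarrow> 1) (at 0)" "\<And>z. z \<in> ball 0 r \<Longrightarrow> V (- z) = V z"
    and r: "r > 0"
  obtains s h where "s > 0" "s \<le> r" "h holomorphic_on ball 0 s" "\<And>z. z \<in> ball 0 s - {0} \<Longrightarrow> 1 / v z - 1 / V z = h z"
proof -
  obtain k where k: "k holomorphic_on ball 0 r" "\<And>z. z \<in> ball 0 r \<Longrightarrow> v z = z ^ 2 * k z" "k 0 = 1"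
    by (rule square_factor_unit[OF v(1,2) r v(3)]) (use that in blast)
  obtain K where K: "K holomorphic_on ball 0 r" "\<And>z. z \<in> ball 0 r \<Longrightarrow> V z = z ^ 2 * K z" "K 0 = 1"
    by (rule square_factor_unit[OF V(1,2) r V(3)]) (use that in blast)
  define d where "d = (\<lambda>z. K z - k z)"
  have dh: "d holomorphic_on ball 0 r" unfolding d_def by (intro holomorphic_intros k K)
  have even: "d (- z) = d z" if z: "z \<in> ball 0 r" for z
  proof (cases "z = 0")
    case False
    have "z ^ 2 * K (- z) = V (- z)" "z ^ 2 * k (- z) = v (- z)"
      using K(2)[of "- z"] k(2)[of "- z"] z by simp_all
    then have "z ^ 2 * K (- z) = z ^ 2 * K z" "z ^ 2 * k (- z) = z ^ 2 * k z"
      unfolding v(4)[OF z] V(4)[OF z] K(2)[OF z] k(2)[OF z] by simp_all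
    then show ?thesis using False by (simp add: d_def)
  qed simp
  have "deriv d 0 = 0"
  proof (rule deriv_even_eq_0)
    show "d field_differentiable at 0" using holomorphic_on_imp_differentiable_at[OF dh] r by simp
    show "eventually (\<lambda>z. d (- z) = d z) (nhds 0)"
      using eventually_nhds_in_open[of "ball 0 r" "0::complex"] r even by (auto elim!: eventually_mono)
  qed
  moreover have "d 0 = 0" by (simp add: d_def k K)
  ultimately obtain e where e: "e holomorphic_on ball 0 r" "\<And>z. z \<in> ball 0 r \<Longrightarrow> d z = z ^ 2 * e z"
    using holomorphic_divide_square[OF dh _ _ r] by blast
  have "isCont (\<lambda>z. k z * K z) 0"
    using holomorphic_on_imp_differentiable_at[OF k(1)] holomorphic_on_imp_differentiable_at[OF K(1)] r
    by (intro continuous_intros field_differentiable_imp_continuous_at) auto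
  then have "((\<lambda>z. k z * K z) \<longlongrightarrow> k 0 * K 0) (nhds 0)"
    using tendsto_at_iff_tendsto_nhds[of "\<lambda>z. k z * K z" 0] by (simp add: isCont_def)
  then have "eventually (\<lambda>z. k z * K z \<noteq> 0) (nhds 0)" by (rule tendsto_imp_eventually_ne) (simp add: k K)
  then obtain s0 where s0: "s0 > 0" "\<And>z. z \<in> ball 0 s0 \<Longrightarrow> k z * K z \<noteq> 0"
    by (auto simp: eventually_nhds_metric dist_commute)
  define s where "s = min s0 r"
  have sub: "ball (0::complex) s \<subseteq> ball 0 r" by (auto simp: s_def)
  show ?thesis
  proof (rule that[of s "\<lambda>z. e z / (k z * K z)"])
    show "s > 0" "s \<le> r" using s0 r by (auto simp: s_def)
    show "(\<lambda>z. e z / (k z * K z)) holomorphic_on ball 0 s"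
      using s0(2) by (intro holomorphic_intros holomorphic_on_subset[OF e(1) sub]
        holomorphic_on_subset[OF k(1) sub] holomorphic_on_subset[OF K(1) sub]) (auto simp: s_def)
    fix z :: complex assume z: "z \<in> ball 0 s - {0}"
    then have zr: "z \<in> ball 0 r" and kK: "k z \<noteq> 0" "K z \<noteq> 0" using s0(2)[of z] by (auto simp: s_def)
    have "1 / v z - 1 / V z = (K z - k z) / (z ^ 2 * (k z * K z))"
      using z kK unfolding k(2)[OF zr] K(2)[OF zr] by (simp add: field_simps)
    also have "K z - k z = z ^ 2 * e z" using e(2)[OF zr] by (simp add: d_def)
    also have "z ^ 2 * e z / (z ^ 2 * (k z * K z)) = e z / (k z * K z)" using z by simp
    finally show "1 / v z - 1 / V z = e z / (k z * K z)" .
  qed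
qed

lemma cubic_coeffs_eq:
  fixes a b c a' b' c' :: complex
  assumes "\<And>x. x ^ 3 + a * x ^ 2 + b * x + c = x ^ 3 + a' * x ^ 2 + b' * x + c'"
  shows "a = a'" "b = b'" "c = c'"
proof -
  show c: "c = c'" using assms[of 0] by simp
  have 1: "a + b = a' + b'" using assms[of 1] c by simp
  have 2: "a - b = a' - b'" using assms[of "- 1"] c by simp
  have "2 * a = 2 * a'" using 1 2 by algebra
  then show "a = a'" by simp
  then show "b = b'" using 1 by simp
qed

context jacobi_pair
begin

text \<open>The factor \<open>w ^ 2\<close> normalizes the double pole at 0 to
  \<open>1 / z^2\<close>, so that the function can differ from a Weierstrass function by a constant
  only.\<close>

lemma X_derivative:
  assumes "A (w * z) \<noteq> 0"
  shows "((\<lambda>z. w ^ 2 * (B (w * z) / A (w * z))) has_field_derivative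
      (- (w ^ 3 * ((deriv A (w * z) * B (w * z) - A (w * z) * deriv B (w * z)) / A (w * z) ^ 2)))) (at z)"
proof -
  have D: "((\<lambda>z. h (w * z)) has_field_derivative deriv h (w * z) * w) (at z)" if "h holomorphic_on UNIV" for h
    by (rule DERIV_chain2[of h]) (auto intro!: derivative_eq_intros holomorphic_derivI[OF that])
  have "((\<lambda>z. w ^ 2 * (B (w * z) / A (w * z))) has_field_derivative
     w ^ 2 * ((deriv B (w * z) * w * A (w * z) - B (w * z) * (deriv A (w * z) * w)) / (A (w * z) * A (w * z)))) (at z)"
    by (intro DERIV_cmult DERIV_divide D A B assms)
  also have "w ^ 2 * ((deriv B (w * z) * w * A (w * z) - B (w * z) * (deriv A (w * z) * w)) / (A (w * z) * A (w * z))) =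
      - (w ^ 3 * ((deriv A (w * z) * B (w * z) - A (w * z) * deriv B (w * z)) / A (w * z) ^ 2))"
    using assms by (simp add: field_simps eval_nat_numeral)
  finally show ?thesis .
qed

lemma X_ode:
  assumes "A (w * z) \<noteq> 0"
  defines "X \<equiv> \<lambda>z. w ^ 2 * (B (w * z) / A (w * z))"
  shows "deriv X z ^ 2 = 4 * (X z * (X z - w ^ 2) * (X z - l * w ^ 2))"
proof -
  define a b where "a = A (w * z)" and "b = B (w * z)"
  have a: "a \<noteq> 0" using assms by (simp add: a_def)
  have "deriv X z ^ 2 = (- (w ^ 3 * ((deriv A (w * z) * B (w * z) - A (w * z) * deriv B (w * z)) / A (w * z) ^ 2))) ^ 2"
    unfolding X_def DERIV_imp_deriv[OF X_derivative[OF assms(1)]] ..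
  also have "\<dots> = w ^ 6 * ((deriv A (w * z) * B (w * z) - A (w * z) * deriv B (w * z)) ^ 2 / A (w * z) ^ 4)"
    by (simp add: power_mult_distrib power_divide flip: power_mult)
  also have "\<dots> = w ^ 6 * (4 * (a * b * (b - a) * (b - l * a)) / a ^ 4)"
    unfolding W a_def b_def ..
  also have "\<dots> = 4 * (w ^ 2 * (b / a) * (w ^ 2 * (b / a) - w ^ 2) * (w ^ 2 * (b / a) - l * w ^ 2))"
    using a by (simp add: field_simps eval_nat_numeral)
  finally show ?thesis by (simp add: X_def a_def b_def)
qed

text \<open>Scaling by \<open>w1\<close> turns the period group into the lattice of
  \<open>\<tau> = w2 / w1\<close>. The rescaled \<open>B / A\<close> and \<open>P\<close> have the
  same periods and the same principal part, so they differ by a constant \<open>c\<close>, and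
  comparing differential equations identifies the branch values.\<close>

lemma uniformization_lattice:
  assumes w: "w1 \<in> G" "w2 \<in> G" "w1 \<noteq> 0" "Im (w2 / w1) > 0"
    and gen: "\<And>g. g \<in> G \<Longrightarrow> \<exists>m n::int. g = of_int m * w1 + of_int n * w2"
  shows "\<exists>\<tau> e1 e2 e3. Im \<tau> > 0 \<and> upper_half.wp_roots \<tau> e1 e2 e3 \<and> l = (e3 - e1) / (e2 - e1)"
proof -
  define \<tau> where "\<tau> = w2 / w1"
  interpret upper_half \<tau> by standard (use w(4) in \<open>simp add: \<tau>_def\<close>)
  have Gi: "of_int m * x \<in> G" if x: "x \<in> G" for m x
  proof (induction m rule: int_induct[where k = 0])
    case (step1 i) from G_add[OF step1(2) x] show ?case by (simp add: algebra_simps)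
  next
    case (step2 i) from G_diff[OF step2(2) x] show ?case by (simp add: algebra_simps)
  qed (simp add: G_def A0)
  have L: "z \<in> \<Lambda> \<longleftrightarrow> w1 * z \<in> G" for z
  proof
    assume "z \<in> \<Lambda>"
    then obtain m n where "z = of_int m + of_int n * \<tau>" by (auto simp: \<Lambda>_def lat_def)
    then have "w1 * z = of_int m * w1 + of_int n * w2" using w(3) by (simp add: \<tau>_def field_simps)
    then show "w1 * z \<in> G" using Gi w(1,2) G_add by simp
  next
    assume "w1 * z \<in> G"
    then obtain m n :: int where "w1 * z = of_int m * w1 + of_int n * w2" using gen by blast
    then have "z = \<omega> (m, n)" using w(3) by (simp add: lat_def \<tau>_def field_simps)
    then show "z \<in> \<Lambda>" by (simp add: \<Lambda>_def)
  qed
  have nz: "A (w1 * z) \<noteq> 0" if "z \<notin> \<Lambda>" for z using that L by (simp add: G_def)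
  define X where "X = (\<lambda>z. w1 ^ 2 * (B (w1 * z) / A (w1 * z)))"
  have Xdiff: "X field_differentiable at z" if "z \<notin> \<Lambda>" for z
    unfolding X_def field_differentiable_def using X_derivative[OF nz[OF that]] by blast
  have Xhol: "X holomorphic_on - \<Lambda>"
    unfolding holomorphic_on_def using Xdiff by (auto intro: field_differentiable_at_within)
  have Xper: "X (z + x) = X z" if z: "z \<notin> \<Lambda>" and x: "x \<in> \<Lambda>" for z x
  proof -
    have "A (w1 * x) = 0" using x L by (simp add: G_def)
    from A_shift[OF this, of "w1 * z"] have "A (w1 * (z + x)) * B (w1 * z) = A (w1 * z) * B (w1 * (z + x))"
      by (simp add: algebra_simps)
    moreover have "A (w1 * z) \<noteq> 0" "A (w1 * (z + x)) \<noteq> 0" using nz[of z] nz[of "z + x"] z x by auto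
    ultimately show ?thesis by (simp add: X_def field_simps)
  qed
  define v where "v = (\<lambda>z. A (w1 * z) / (w1 ^ 2 * B (w1 * z)))"
  have hol: "(\<lambda>z. h (w1 * z)) holomorphic_on S" if "h holomorphic_on UNIV" for h S
  proof -
    have "h \<circ> (\<lambda>z. w1 * z) holomorphic_on S"
      by (rule holomorphic_on_compose_gen[OF _ that]) (auto intro!: holomorphic_intros)
    then show ?thesis by (simp add: o_def)
  qed
  have "isCont (\<lambda>z. B (w1 * z)) 0"
    by (intro field_differentiable_imp_continuous_at holomorphic_on_imp_differentiable_at[OF hol[OF B, of UNIV]]) auto
  then have "((\<lambda>z. B (w1 * z)) \<longlongrightarrow> 1) (nhds 0)"
    using tendsto_at_iff_tendsto_nhds[of "\<lambda>z. B (w1 * z)" 0] by (simp add: isCont_def B0)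
  then have "eventually (\<lambda>z. B (w1 * z) \<noteq> 0) (nhds 0)" by (rule tendsto_imp_eventually_ne) simp
  then obtain s0 where s0: "s0 > 0" "\<And>z. z \<in> ball 0 s0 \<Longrightarrow> B (w1 * z) \<noteq> 0"
    by (auto simp: eventually_nhds_metric dist_commute)
  obtain r0 V where V: "r0 > 0" "ball 0 r0 \<inter> \<Lambda> = {0}" "V holomorphic_on ball 0 r0" "V 0 = 0" "deriv V 0 = 0"
    "\<And>z. z \<in> ball 0 r0 - {0} \<Longrightarrow> V z \<noteq> 0 \<and> P z = 1 / V z" "((\<lambda>z. V z / z ^ 2) \<longlongrightarrow> 1) (at 0)"
    by (rule wp_inverse_near_0) (rule that)
  define r where "r = min s0 r0"
  have r: "r > 0" "r \<le> s0" "r \<le> r0" using s0 V by (auto simp: r_def)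
  have sub: "ball (0::complex) r \<subseteq> ball 0 r0" using r by auto
  have vhol: "v holomorphic_on ball 0 r"
    unfolding v_def using s0(2) r w(3) by (intro holomorphic_intros hol A B) auto
  have vlim: "((\<lambda>z. v z / z ^ 2) \<longlongrightarrow> 1) (at 0)"
  proof -
    have "filterlim (\<lambda>z. w1 * z) (at 0) (at 0)"
      by (rule filterlim_atI)
         (use w(3) tendsto_mult_right_zero[OF tendsto_ident_at, of w1 UNIV] in \<open>simp_all add: eventually_at_filter\<close>)
    from filterlim_compose[OF lim this]
    have "((\<lambda>z. A (w1 * z) / B (w1 * z) / (w1 * z) ^ 2) \<longlongrightarrow> 1) (at 0)" .
    then show ?thesis by (simp add: v_def power_mult_distrib field_simps)
  qed
  have veven: "v (- z) = v z" if "z \<in> ball 0 r" for z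
  proof -
    have "B (w1 * z) \<noteq> 0" "B (- (w1 * z)) \<noteq> 0" using s0(2)[of z] s0(2)[of "- z"] that r by auto
    then show ?thesis using A_minus[of "w1 * z"] w(3) by (simp add: v_def field_simps)
  qed
  have Veven: "V (- z) = V z" if "z \<in> ball 0 r" for z
  proof (cases "z = 0")
    case False
    have "1 / V (- z) = 1 / V z" using V(6)[of z] V(6)[of "- z"] False that r wp_minus[of z] by auto
    then show ?thesis by simp
  qed simp
  obtain s h where h: "s > 0" "s \<le> r" "h holomorphic_on ball 0 s" "\<And>z. z \<in> ball 0 s - {0} \<Longrightarrow> 1 / v z - 1 / V z = h z"
    by (rule diff_inverse_square_units[OF vhol _ vlim veven holomorphic_on_subset[OF V(3) sub] V(4) V(7) Veven r(1)])
       (use that in \<open>auto simp: v_def A0\<close>)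
  obtain c where c: "\<And>z. z \<notin> \<Lambda> \<Longrightarrow> X z - P z = c"
  proof (rule elliptic_entire_const[OF _ _ h(1) h(3)])
    show "(\<lambda>z. X z - P z) holomorphic_on - \<Lambda>" by (intro holomorphic_intros Xhol wp_holomorphic)
    show "X (z + x) - P (z + x) = X z - P z" if "z \<notin> \<Lambda>" "x \<in> \<Lambda>" for z x
      using Xper[OF that] wp_periodic[OF that(2,1)] by simp
    show "X z - P z = h z" if "z \<in> ball 0 s - {0}" for z
    proof -
      have "P z = 1 / V z" using V(6)[of z] that h(2) r(3) by auto
      moreover have "X z = 1 / v z" by (simp add: X_def v_def)
      ultimately show ?thesis using h(4)[OF that] by simp
    qed
  qed (use that in blast)
  \<comment> \<open>Every complex \<open>x\<close> is a value of \<open>P\<close>, so equating the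
    two differential equations gives a polynomial identity.\<close>
  have key: "4 * x ^ 3 - 60 * G4 * x - 140 * G6 = 4 * ((x + c) * (x + c - w1 ^ 2) * (x + c - l * w1 ^ 2))" for x
  proof -
    obtain z where z: "z \<notin> \<Lambda>" "P z = x" by (rule wp_surj)
    have Xz: "X z = x + c" using c[OF z(1)] z(2) by (simp add: algebra_simps)
    have "deriv X z = deriv (\<lambda>z. P z + c) z"
    proof (rule deriv_cong_ev)
      have "eventually (\<lambda>z. z \<in> - \<Lambda>) (nhds z)" using z(1) by (intro eventually_nhds_in_open) auto
      then show "eventually (\<lambda>z. X z = P z + c) (nhds z)"
        by eventually_elim (use c in \<open>auto simp: algebra_simps\<close>)
    qed simp
    also have "\<dots> = deriv P z" using wp_has_derivative[OF z(1)] by (intro DERIV_imp_deriv) (auto intro!: derivative_eq_intros)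
    finally have "deriv X z ^ 2 = 4 * x ^ 3 - 60 * G4 * x - 140 * G6" using wp_ode[OF z(1)] z(2) by simp
    moreover have "deriv X z ^ 2 = 4 * (X z * (X z - w1 ^ 2) * (X z - l * w1 ^ 2))"
      unfolding X_def by (rule X_ode[OF nz[OF z(1)]])
    ultimately show ?thesis unfolding Xz by simp
  qed
  \<comment> \<open>The values 0, 1 and \<open>l\<close> of \<open>B / A\<close>, scaled by
    \<open>w1 ^ 2\<close> and shifted by \<open>c\<close>; the cross ratio \<open>l\<close> is
    unaffected.\<close>
  define e1 e2 e3 where "e1 = - c" and "e2 = w1 ^ 2 - c" and "e3 = l * w1 ^ 2 - c"
  have eq: "x ^ 3 + - (e1 + e2 + e3) * x ^ 2 + (e1 * e2 + e1 * e3 + e2 * e3) * x + - (e1 * e2 * e3) =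
     x ^ 3 + 0 * x ^ 2 + (- 15 * G4) * x + (- 35 * G6)" for x
  proof -
    have "(x + c) * (x + c - w1 ^ 2) * (x + c - l * w1 ^ 2) = (x - e1) * (x - e2) * (x - e3)"
      by (simp add: e1_def e2_def e3_def algebra_simps)
    also have "\<dots> = x ^ 3 + - (e1 + e2 + e3) * x ^ 2 + (e1 * e2 + e1 * e3 + e2 * e3) * x + - (e1 * e2 * e3)"
      by (simp add: algebra_simps power2_eq_square power3_eq_cube)
    finally have h: "(x + c) * (x + c - w1 ^ 2) * (x + c - l * w1 ^ 2) =
      x ^ 3 + - (e1 + e2 + e3) * x ^ 2 + (e1 * e2 + e1 * e3 + e2 * e3) * x + - (e1 * e2 * e3)" .
    have "4 * x ^ 3 - 60 * G4 * x - 140 * G6 = 4 * (x ^ 3 + 0 * x ^ 2 + (- 15 * G4) * x + (- 35 * G6))"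
      by simp
    then have "4 * (x ^ 3 + - (e1 + e2 + e3) * x ^ 2 + (e1 * e2 + e1 * e3 + e2 * e3) * x + - (e1 * e2 * e3)) =
      4 * (x ^ 3 + 0 * x ^ 2 + (- 15 * G4) * x + (- 35 * G6))"
      using key[of x] unfolding h by (simp only:)
    then show ?thesis by (subst (asm) mult_cancel_left) simp
  qed
  have "wp_roots e1 e2 e3"
    using cubic_coeffs_eq[OF eq] unfolding wp_roots_def by (intro conjI; algebra)
  moreover have "l = (e3 - e1) / (e2 - e1)" using w(3) by (simp add: e1_def e2_def e3_def)
  moreover have "Im \<tau> > 0" by (rule Im_pos)
  ultimately show ?thesis by blast
qed

lemma uniformization_pair:
  "\<exists>\<tau> e1 e2 e3. Im \<tau> > 0 \<and> upper_half.wp_roots \<tau> e1 e2 e3 \<and> l = (e3 - e1) / (e2 - e1)"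
proof (rule discrete_subgroup_cases[of G])
  show "0 \<in> G" by (simp add: G_def A0)
  show "x - y \<in> G" if "x \<in> G" "y \<in> G" for x y using that by (rule G_diff)
  show "finite (G \<inter> cball 0 R)" for R by (rule G_finite)
  show ?thesis if "w \<in> G" "\<And>g. g \<in> G \<Longrightarrow> \<exists>m::int. g = of_int m * w" for w
    using not_cyclic[OF that] ..
  show ?thesis if "w1 \<in> G" "w2 \<in> G" "w1 \<noteq> 0" "Im (w2 / w1) > 0"
      "\<And>g. g \<in> G \<Longrightarrow> \<exists>m n::int. g = of_int m * w1 + of_int n * w2" for w1 w2
    by (rule uniformization_lattice[OF that])
qed

end

theorem uniformization:
  assumes l: "l \<noteq> 0" "l \<noteq> 1"
  shows "\<exists>\<tau> e1 e2 e3. Im \<tau> > 0 \<and> upper_half.wp_roots \<tau> e1 e2 e3 \<and> l = (e3 - e1) / (e2 - e1)"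
proof -
  obtain r a b where ab: "r > 0" "a holomorphic_on ball 0 r" "b holomorphic_on ball 0 r" "a 0 = 0" "b 0 = 1"
    "\<And>z. z \<in> ball 0 r \<Longrightarrow> b z \<noteq> 0"
    "\<And>z. z \<in> ball 0 r \<Longrightarrow> deriv (\<lambda>z. a z / b z) z ^ 2 = 4 * (a z / b z * (1 - a z / b z) * (1 - l * (a z / b z)))"
    "((\<lambda>z. a z / b z / z ^ 2) \<longlongrightarrow> 1) (at (0::complex))"
    "\<And>z. z \<in> ball 0 (r / 2) \<Longrightarrow> a (2 * z) = 4 * (a z * b z * (b z - a z) * (b z - l * a z))"
    "\<And>z. z \<in> ball 0 (r / 2) \<Longrightarrow> b (2 * z) = (b z ^ 2 - l * a z ^ 2) ^ 2"
    by (rule local_lift[of l]) (rule that)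
  obtain A B where AB: "A holomorphic_on UNIV" "B holomorphic_on UNIV"
    "\<And>z. z \<in> ball 0 r \<Longrightarrow> A z = a z" "\<And>z. z \<in> ball 0 r \<Longrightarrow> B z = b z"
    "\<And>z. A (2 * z) = 4 * (A z * B z * (B z - A z) * (B z - l * A z))" "\<And>z. B (2 * z) = (B z ^ 2 - l * A z ^ 2) ^ 2"
    by (rule entire_extension[OF ab(1-3), where \<Phi> = "\<lambda>a b. 4 * (a * b * (b - a) * (b - l * a))"
          and \<Psi> = "\<lambda>a b. (b ^ 2 - l * a ^ 2) ^ 2"])
       (use ab(9,10) that in \<open>auto intro!: holomorphic_intros\<close>)
  let ?W = "\<lambda>z. (deriv A z * B z - A z * deriv B z) ^ 2 - 4 * (A z * B z * (B z - A z) * (B z - l * A z))"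
  have "?W z = 0" if z: "z \<in> ball 0 r" for z
  proof -
    have Bz: "B z \<noteq> 0" using AB(4)[OF z] ab(6)[OF z] by simp
    have "((\<lambda>z. A z / B z) has_field_derivative (deriv A z * B z - A z * deriv B z) / (B z * B z)) (at z)"
      using Bz by (intro DERIV_divide holomorphic_derivI[OF AB(1)] holomorphic_derivI[OF AB(2)]) auto
    then have "((\<lambda>z. a z / b z) has_field_derivative (deriv A z * B z - A z * deriv B z) / (B z * B z)) (at z)"
      by (rule has_field_derivative_transform_within_open[OF _ open_ball z]) (simp add: AB(3,4))
    from ab(7)[OF z, unfolded DERIV_imp_deriv[OF this]]
    have "((deriv A z * B z - A z * deriv B z) / (B z * B z)) ^ 2 = 4 * (A z / B z * (1 - A z / B z) * (1 - l * (A z / B z)))"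
      by (simp add: AB(3,4)[OF z])
    then have "(deriv A z * B z - A z * deriv B z) ^ 2 = 4 * (A z / B z * (1 - A z / B z) * (1 - l * (A z / B z))) * (B z * B z) ^ 2"
      using Bz by (simp add: power_divide field_simps)
    also have "\<dots> = 4 * (A z * B z * (B z - A z) * (B z - l * A z))"
      using Bz by (simp add: field_simps power2_eq_square)
    finally show ?thesis by simp
  qed
  moreover have "?W holomorphic_on UNIV"
    by (intro holomorphic_intros AB(1,2) holomorphic_deriv open_UNIV)
  \<comment> \<open>Nothing in \<open>?W\<close> is divided by \<open>B\<close>, so the identity on
    the small ball extends to the whole plane.\<close>
  ultimately have W: "?W z = 0" for z using entire_eq_0[OF _ ab(1)] by blast
  interpret jacobi_pair l A B
  proof
    show "(deriv A z * B z - A z * deriv B z) ^ 2 = 4 * (A z * B z * (B z - A z) * (B z - l * A z))" for z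
      using W[of z] by simp
    show "((\<lambda>z. A z / B z / z ^ 2) \<longlongrightarrow> 1) (at 0)"
    proof (rule Lim_transform_eventually[OF ab(8)])
      have "eventually (\<lambda>z. z \<in> ball 0 r - {0}) (at 0)" using ab(1) by (intro eventually_at_in_open) auto
      then show "eventually (\<lambda>z. a z / b z / z ^ 2 = A z / B z / z ^ 2) (at 0)"
        by eventually_elim (simp add: AB(3,4))
    qed
    show "A 0 = 0" "B 0 = 1" using AB(3)[of 0] AB(4)[of 0] ab by auto
  qed (use l AB in auto)
  show ?thesis by (rule uniformization_pair)
qed

section \<open>Complex multiplication\<close>

lemma degree_eq_sum_order:
  fixes q :: "complex poly"
  assumes "q \<noteq> 0"
  shows "degree q = (\<Sum>z | poly q z = 0. order z q)"
proof -
  have "degree q = degree (smult (lead_coeff q) (\<Prod>z|poly q z = 0. [:- z, 1:] ^ order z q))"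
    by (simp only: complex_poly_decompose)
  also have "\<dots> = degree (\<Prod>z|poly q z = 0. [:- z, 1:] ^ order z q)" using assms by simp
  also have "\<dots> = (\<Sum>z | poly q z = 0. degree ([:- z, 1:] ^ order z q))"
    by (rule degree_prod_eq_sum_degree) simp
  also have "\<dots> = (\<Sum>z | poly q z = 0. order z q)"
    by (simp add: degree_power_eq)
  finally show ?thesis .
qed

context upper_half
begin

lemma Lambda_iff: "z \<in> \<Lambda> \<longleftrightarrow> (\<exists>m n::int. z = of_int m + of_int n * \<tau>)"
  by (auto simp: \<Lambda>_def lat_def image_iff)

lemma mult_Lambda:
  assumes "\<mu> \<in> \<Lambda>" "\<mu> * \<tau> \<in> \<Lambda>" "w \<in> \<Lambda>" shows "\<mu> * w \<in> \<Lambda>"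
proof -
  obtain m n :: int where w: "w = of_int m + of_int n * \<tau>" using assms(3) Lambda_iff by blast
  have "of_int m * \<mu> + of_int n * (\<mu> * \<tau>) \<in> \<Lambda>"
    by (intro Lambda_add Lambda_of_int assms)
  then show ?thesis by (simp add: w algebra_simps)
qed

section \<open>The index of \<open>\<mu> \<Lambda>\<close> in \<open>\<Lambda>\<close>\<close>

definition coset_reps :: "complex \<Rightarrow> complex set \<Rightarrow> bool" where
  "coset_reps \<mu> B \<longleftrightarrow> finite B \<and> B \<subseteq> \<Lambda> \<and> (\<forall>w\<in>\<Lambda>. \<exists>!b. b \<in> B \<and> (\<exists>x\<in>\<Lambda>. w - b = \<mu> * x))"

text \<open>The integers form the matrix of multiplication by \<open>\<mu>\<close> in the basis 1,
  \<open>\<tau>\<close>. Its determinant is that of a rotation with stretching by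
  \<open>|\<mu>|\<close>.\<close>

lemma norm_eq_det:
  fixes b c e g :: int
  assumes \<mu>: "\<mu> = of_int c + of_int b * \<tau>" and \<mu>\<tau>: "\<mu> * \<tau> = of_int e + of_int g * \<tau>"
  shows "cmod \<mu> ^ 2 = of_int (c * g - b * e)"
proof -
  define x y where "x = Re \<tau>" and "y = Im \<tau>"
  have y: "y > 0" using Im_pos by (simp add: y_def)
  have re: "of_int c * x + of_int b * (x ^ 2 - y ^ 2) = of_int e + of_int g * x"
    using arg_cong[OF \<mu>\<tau>, of Re] unfolding \<mu> by (simp add: x_def y_def algebra_simps power2_eq_square)
  have im: "of_int c * y + 2 * of_int b * x * y = of_int g * y"
    using arg_cong[OF \<mu>\<tau>, of Im] unfolding \<mu> by (simp add: x_def y_def algebra_simps)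
  then have "y * (of_int c + 2 * of_int b * x - of_int g) = 0" by (simp add: algebra_simps)
  then have g: "of_int g = of_int c + 2 * of_int b * x" using y by simp
  have "cmod \<mu> ^ 2 = (of_int c + of_int b * x) ^ 2 + (of_int b * y) ^ 2"
    unfolding \<mu> by (simp add: cmod_power2 x_def y_def)
  also have "\<dots> = of_int c * of_int g - of_int b * of_int e"
    using re unfolding g by algebra
  finally show ?thesis by simp
qed

text \<open>A Hermite normal form by hand: the second coordinates of points of
  \<open>\<mu> \<Lambda>\<close> are the multiples of \<open>d = gcd b g\<close>, and the points
  with second coordinate 0 have first coordinates the multiples of \<open>N = \<Delta> / d\<close>.
  So the box of size \<open>N\<close> times \<open>d\<close> is a transversal.\<close>

lemma coset_reps_exist:
  assumes "\<mu> \<noteq> 0" "\<mu> \<in> \<Lambda>" "\<mu> * \<tau> \<in> \<Lambda>"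
  obtains B where "coset_reps \<mu> B" "real (card B) = cmod \<mu> ^ 2"
proof -
  obtain c b :: int where \<mu>: "\<mu> = of_int c + of_int b * \<tau>" using assms(2) Lambda_iff by blast
  obtain e g :: int where \<mu>\<tau>: "\<mu> * \<tau> = of_int e + of_int g * \<tau>" using assms(3) Lambda_iff by blast
  define \<Delta> where "\<Delta> = c * g - b * e"
  have nd: "cmod \<mu> ^ 2 = of_int \<Delta>" unfolding \<Delta>_def by (rule norm_eq_det[OF \<mu> \<mu>\<tau>])
  have "cmod \<mu> ^ 2 > 0" using assms(1) by simp
  then have \<Delta>: "\<Delta> > 0" unfolding nd by simp
  define d where "d = gcd b g"
  have d: "d > 0"
  proof (rule ccontr)
    assume "\<not> d > 0"
    then have "b = 0 \<and> g = 0" using gcd_ge_0_int[of b g] by (simp add: d_def)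
    then show False using \<Delta> by (simp add: \<Delta>_def)
  qed
  obtain b' g' where bg: "b = d * b'" "g = d * g'" unfolding d_def by (meson dvdE gcd_dvd1 gcd_dvd2)
  obtain s0 t0 where "s0 * b + t0 * g = d" unfolding d_def using bezout_int by blast
  then have "d * (s0 * b' + t0 * g') = d * 1" unfolding bg by (simp add: algebra_simps)
  then have st: "s0 * b' + t0 * g' = 1" using d by simp
  define N where "N = c * g' - b' * e"
  have \<Delta>N: "\<Delta> = d * N" by (simp add: \<Delta>_def N_def bg algebra_simps)
  then have N: "N > 0" using \<Delta> d by (simp add: zero_less_mult_iff)
  have mul: "\<mu> * \<omega> (s, t) = \<omega> (s * c + t * e, s * b + t * g)" for s t
  proof -
    have "\<mu> * \<omega> (s, t) = of_int s * \<mu> + of_int t * (\<mu> * \<tau>)" by (simp add: lat_def algebra_simps)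
    also have "\<dots> = \<omega> (s * c + t * e, s * b + t * g)"
      unfolding \<mu>\<tau> unfolding \<mu> by (simp add: lat_def algebra_simps)
    finally show ?thesis .
  qed
  have mem: "\<omega> p \<in> \<Lambda>" for p by (simp add: \<Lambda>_def)
  define I where "I = {0..<N} \<times> {0..<d}"
  define B where "B = \<omega> ` I"
  have "card B = card I" unfolding B_def by (rule card_image) (auto simp: inj_on_def lat_inj)
  then have card: "real (card B) = cmod \<mu> ^ 2"
    using N d unfolding nd \<Delta>N by (simp add: I_def)
  have ex: "\<exists>p\<in>I. \<exists>x\<in>\<Lambda>. \<omega> (u, v) - \<omega> p = \<mu> * x" for u v
  proof -
    define j y where "j = v mod d" and "y = v div d"
    \<comment> \<open>The Bezout combination \<open>(s0, t0)\<close> reduces the second coordinate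
      modulo \<open>d\<close>. Multiples of \<open>(g', - b')\<close>, whose image is
      \<open>(N, 0)\<close>, then reduce the first modulo \<open>N\<close>.\<close>
    define x1 where "x1 = u - y * (s0 * c + t0 * e)"
    define i q where "i = x1 mod N" and "q = x1 div N"
    have v: "v = y * d + j" by (simp add: j_def y_def)
    have x1: "x1 = q * N + i" by (simp add: i_def q_def)
    have "(y * s0 + q * g') * c + (y * t0 - q * b') * e = u - i"
    proof -
      have "(y * s0 + q * g') * c + (y * t0 - q * b') * e = y * (s0 * c + t0 * e) + q * N"
        by (simp add: N_def algebra_simps)
      then show ?thesis using x1 by (simp add: x1_def)
    qed
    moreover have "(y * s0 + q * g') * b + (y * t0 - q * b') * g = v - j"
    proof -
      have "(y * s0 + q * g') * b + (y * t0 - q * b') * g = y * d * (s0 * b' + t0 * g')"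
        unfolding bg by (simp add: algebra_simps)
      then show ?thesis using v st by simp
    qed
    ultimately have "\<mu> * \<omega> (y * s0 + q * g', y * t0 - q * b') = \<omega> (u - i, v - j)"
      unfolding mul by simp
    also have "\<dots> = \<omega> (u, v) - \<omega> (i, j)" using lat_diff[of \<tau> "(u, v)" "(i, j)"] by simp
    finally show ?thesis
      using N d mem by (intro bexI[of _ "(i, j)"] bexI[of _ "\<omega> (y * s0 + q * g', y * t0 - q * b')"])
        (auto simp: I_def i_def j_def)
  qed
  have small: "x = 0" if "k dvd x" "\<bar>x\<bar> < k" for x k :: int
    using that dvd_imp_le_int[of x k] by fastforce
  have un: "p = p2" if p: "p \<in> I" "p2 \<in> I" and x: "x \<in> \<Lambda>" "\<omega> p2 - \<omega> p = \<mu> * x" for p p2 x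
  proof -
    obtain s t where st': "x = \<omega> (s, t)" using x(1) by (auto simp: \<Lambda>_def)
    obtain i j i2 j2 where ij: "p = (i, j)" "p2 = (i2, j2)" by (cases p, cases p2)
    have "\<omega> (p2 - p) = \<omega> (s * c + t * e, s * b + t * g)" using x(2) unfolding st' mul by (simp add: lat_diff)
    then have "p2 - p = (s * c + t * e, s * b + t * g)" by (simp only: lat_inj)
    then have eqs: "i2 - i = s * c + t * e" "j2 - j = s * b + t * g" by (auto simp: ij)
    have "d dvd j2 - j" unfolding eqs bg by (simp add: dvd_add)
    then have j: "j2 - j = 0" by (rule small) (use p in \<open>auto simp: I_def ij\<close>)
    then have "d * (s * b' + t * g') = 0" using eqs(2) by (simp add: bg algebra_simps)
    then have z: "s * b' + t * g' = 0" using d by simp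
    \<comment> \<open>With the Bezout relation, every solution of \<open>s * b' + t * g' = 0\<close>
      is \<open>r\<close> times \<open>(g', - b')\<close>.\<close>
    define r where "r = s * t0 - t * s0"
    have s: "s = g' * r" using st z unfolding r_def by algebra
    have t: "t = - b' * r" using st z unfolding r_def by algebra
    have "i2 - i = N * r" unfolding eqs(1) N_def by (subst s, subst t) (simp add: algebra_simps)
    then have "N dvd i2 - i" by simp
    then have "i2 - i = 0" by (rule small) (use p in \<open>auto simp: I_def ij\<close>)
    with j show ?thesis by (simp add: ij)
  qed
  have "coset_reps \<mu> B"
    unfolding coset_reps_def
  proof (intro conjI ballI)
    show "finite B" by (simp add: B_def I_def)
    show "B \<subseteq> \<Lambda>" using mem by (auto simp: B_def)
    fix w assume "w \<in> \<Lambda>"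
    then obtain u v where w: "w = \<omega> (u, v)" by (auto simp: \<Lambda>_def)
    obtain p x where p: "p \<in> I" "x \<in> \<Lambda>" "w - \<omega> p = \<mu> * x" using ex[of u v] w by blast
    show "\<exists>!b. b \<in> B \<and> (\<exists>x\<in>\<Lambda>. w - b = \<mu> * x)"
    proof (rule ex1I[of _ "\<omega> p"])
      show "\<omega> p \<in> B \<and> (\<exists>x\<in>\<Lambda>. w - \<omega> p = \<mu> * x)" using p by (auto simp: B_def)
      fix b assume "b \<in> B \<and> (\<exists>x\<in>\<Lambda>. w - b = \<mu> * x)"
      then obtain p2 x2 where p2: "p2 \<in> I" "b = \<omega> p2" "x2 \<in> \<Lambda>" "w - b = \<mu> * x2" by (auto simp: B_def)
      have "\<omega> p2 - \<omega> p = \<mu> * (x - x2)" using p(3) p2(2,4) by (simp add: algebra_simps)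
      then have "p = p2" using un[OF p(1) p2(1) Lambda_diff[OF p(2) p2(3)]] by blast
      then show "b = \<omega> p" using p2 by simp
    qed
  qed
  with card show ?thesis using that by blast
qed

lemma eventually_not_Lambda: "eventually (\<lambda>s. s \<notin> \<Lambda>) (at w)"
proof (cases "w \<in> \<Lambda>")
  case False
  then have "eventually (\<lambda>s. s \<in> - \<Lambda> - {w}) (at w)" by (intro eventually_at_in_open) auto
  then show ?thesis by eventually_elim simp
next
  case True
  obtain r k where r: "r > 0" "ball 0 r \<inter> \<Lambda> = {0}" by (rule wp_expansion) (rule that)
  have "eventually (\<lambda>s. s \<in> ball w r - {w}) (at w)" using r(1) by (intro eventually_at_in_open) auto
  then show ?thesis
  proof eventually_elim
    case (elim s)
    show "s \<notin> \<Lambda>"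
    proof
      assume "s \<in> \<Lambda>"
      then have "s - w \<in> \<Lambda>" using True by (rule Lambda_diff)
      moreover have "s - w \<in> ball 0 r" using elim by (simp add: dist_norm norm_minus_commute)
      ultimately have "s - w \<in> {0}" using r(2) by blast
      then show False using elim by simp
    qed
  qed
qed

lemma filterlim_mult_at: "\<mu> \<noteq> 0 \<Longrightarrow> filterlim (\<lambda>z. \<mu> * z) (at (\<mu> * w)) (at w)" for \<mu> w :: complex
  by (rule filterlim_atI) (auto intro!: tendsto_intros simp: eventually_at_filter)

lemma wp_isCont: "z \<notin> \<Lambda> \<Longrightarrow> isCont P z"
  using wp_derivative(1) field_differentiable_imp_continuous_at by blast

section \<open>Multiplication as a rational function of the Weierstrass function\<close>

text \<open>The relation \<open>P(\<mu> z) = f(P(z))\<close> for \<open>f = p / q\<close>, with the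
  denominator cleared and restricted to points where both sides avoid the poles of
  \<open>P\<close>.\<close>

definition mult_rel :: "complex \<Rightarrow> complex poly \<Rightarrow> complex poly \<Rightarrow> bool" where
  "mult_rel \<mu> p q \<longleftrightarrow> (\<forall>z. z \<notin> \<Lambda> \<longrightarrow> \<mu> * z \<notin> \<Lambda> \<longrightarrow> poly q (P z) * P (\<mu> * z) = poly p (P z))"

lemma mult_rel_pole_iff:
  assumes \<mu>: "\<mu> \<noteq> 0" and rel: "mult_rel \<mu> p q" and nr: "\<And>x. poly p x = 0 \<Longrightarrow> poly q x \<noteq> 0" and z: "z \<notin> \<Lambda>"
  shows "\<mu> * z \<in> \<Lambda> \<longleftrightarrow> poly q (P z) = 0"
proof
  assume "poly q (P z) = 0"
  then show "\<mu> * z \<in> \<Lambda>" using rel z nr[of "P z"] by (auto simp: mult_rel_def)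
next
  assume mz: "\<mu> * z \<in> \<Lambda>"
  show "poly q (P z) = 0"
  proof (rule ccontr)
    assume qz: "poly q (P z) \<noteq> 0"
    have cont: "((\<lambda>t. poly f (P t)) \<longlongrightarrow> poly f (P z)) (at z)" for f :: "complex poly"
      using wp_isCont[OF z] by (intro tendsto_intros) (simp add: isCont_def)
    have lim: "((\<lambda>t. poly p (P t) / poly q (P t)) \<longlongrightarrow> poly p (P z) / poly q (P z)) (at z)"
      by (intro tendsto_divide cont qz)
    have inf: "filterlim (\<lambda>t. P (\<mu> * t)) at_infinity (at z)"
      using filterlim_compose[OF wp_pole[OF mz] filterlim_mult_at[OF \<mu>]] .
    have ev: "eventually (\<lambda>t. P (\<mu> * t) = poly p (P t) / poly q (P t)) (at z)"
    proof -
      have "eventually (\<lambda>t. poly q (P t) \<noteq> 0) (at z)"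
        using cont[of q] qz by (rule tendsto_imp_eventually_ne)
      moreover have "eventually (\<lambda>t. \<mu> * t \<notin> \<Lambda>) (at z)"
        using filterlim_mult_at[OF \<mu>, of z] eventually_not_Lambda[of "\<mu> * z"] by (auto simp: filterlim_iff)
      ultimately show ?thesis using eventually_not_Lambda[of z]
        by eventually_elim (use rel in \<open>auto simp: mult_rel_def field_simps\<close>)
    qed
    have "filterlim (\<lambda>t. poly p (P t) / poly q (P t)) at_infinity (at z)"
      by (rule filterlim_mono_eventually[OF inf order_refl order_refl ev])
    then show False
      by (rule not_tendsto_and_filterlim_at_infinity[OF at_neq_bot lim])
  qed
qed

text \<open>The points \<open>b / \<mu>\<close> represent all solutions of
  \<open>\<mu> z \<in> \<Lambda>\<close> modulo \<open>\<Lambda>\<close>. One of them is the class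
  of 0; the others lie over the roots of \<open>q\<close>. Over a root lie the classes of
  \<open>z\<close> and \<open>- z\<close>, which coincide exactly when the root is a branch value.
  These counts match the multiplicities 1 and 2, so there are \<open>1 + degree q\<close>
  classes.\<close>

lemma card_coset_reps_eq_degree:
  assumes R: "wp_roots e1 e2 e3" and L: "lattes e1 e2 e3 p q \<kappa>" and \<mu>: "\<mu> \<noteq> 0" and B: "coset_reps \<mu> B"
    and rel: "mult_rel \<mu> p q"
  shows "card B = degree p"
proof -
  have nr: "\<And>x. poly p x = 0 \<Longrightarrow> poly q x \<noteq> 0" and dp: "degree p = Suc (degree q)" using L by (auto simp: lattes_def)
  have q0: "q \<noteq> 0" using lattes_nonzero(2)[OF L] .
  have pole: "\<mu> * z \<in> \<Lambda> \<longleftrightarrow> poly q (P z) = 0" if "z \<notin> \<Lambda>" for z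
    using mult_rel_pole_iff[OF \<mu> rel nr that] .
  have finB: "finite B" and BL: "B \<subseteq> \<Lambda>" and rep: "\<And>w. w \<in> \<Lambda> \<Longrightarrow> \<exists>!b. b \<in> B \<and> (\<exists>x\<in>\<Lambda>. w - b = \<mu> * x)"
    using B by (auto simp: coset_reps_def)
  have cong: "(\<exists>x\<in>\<Lambda>. w - b = \<mu> * x) \<longleftrightarrow> w / \<mu> - b / \<mu> \<in> \<Lambda>" for w b
  proof -
    have "w - b = \<mu> * x \<longleftrightarrow> w / \<mu> - b / \<mu> = x" for x using \<mu> by (auto simp: field_simps)
    then show ?thesis by auto
  qed
  have repE: "\<exists>b\<in>B. w / \<mu> - b / \<mu> \<in> \<Lambda> \<and> (\<forall>b'\<in>B. w / \<mu> - b' / \<mu> \<in> \<Lambda> \<longrightarrow> b' = b)" if "w \<in> \<Lambda>" for w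
    using rep[OF that] unfolding cong by (elim ex1E) blast
  define B0 where "B0 = {b \<in> B. b / \<mu> \<in> \<Lambda>}"
  define Bs where "Bs = (\<lambda>\<beta>. {b \<in> B. b / \<mu> \<notin> \<Lambda> \<and> P (b / \<mu>) = \<beta>})"
  have "card B0 = 1"
  proof -
    obtain b where b: "b \<in> B" "0 / \<mu> - b / \<mu> \<in> \<Lambda>" "\<forall>b'\<in>B. 0 / \<mu> - b' / \<mu> \<in> \<Lambda> \<longrightarrow> b' = b"
      using repE[OF Lambda_0] by blast
    have z: "0 / \<mu> - x / \<mu> \<in> \<Lambda> \<longleftrightarrow> x / \<mu> \<in> \<Lambda>" for x
      using Lambda_minus_iff[of "x / \<mu>"] by (simp del: Lambda_minus_iff)
    have "B0 = {b}" unfolding B0_def using b unfolding z by blast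
    then show ?thesis by simp
  qed
  have card_Bs: "card (Bs \<beta>) = order \<beta> q" if \<beta>: "poly q \<beta> = 0" for \<beta>
  proof -
    obtain z where z: "z \<notin> \<Lambda>" "P z = \<beta>" by (rule wp_surj)
    have mz: "\<mu> * z \<in> \<Lambda>" using pole[OF z(1)] z(2) \<beta> by simp
    have quot: "(\<mu> * z) / \<mu> = z" "(- (\<mu> * z)) / \<mu> = - z" using \<mu> by simp_all
    obtain b1 where b1: "b1 \<in> B" "z - b1 / \<mu> \<in> \<Lambda>" "\<forall>b'\<in>B. z - b' / \<mu> \<in> \<Lambda> \<longrightarrow> b' = b1"
      using repE[OF mz] unfolding quot by blast
    obtain b2 where b2: "b2 \<in> B" "- z - b2 / \<mu> \<in> \<Lambda>" "\<forall>b'\<in>B. - z - b' / \<mu> \<in> \<Lambda> \<longrightarrow> b' = b2"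
      using repE[OF Lambda_minus[OF mz]] unfolding quot by blast
    have eq: "b / \<mu> \<notin> \<Lambda> \<and> P (b / \<mu>) = \<beta> \<longleftrightarrow> z - b / \<mu> \<in> \<Lambda> \<or> - z - b / \<mu> \<in> \<Lambda>" for b
    proof (cases "b / \<mu> \<in> \<Lambda>")
      case True
      then show ?thesis using z(1) by simp
    next
      case False
      have "- z - b / \<mu> \<in> \<Lambda> \<longleftrightarrow> z + b / \<mu> \<in> \<Lambda>" using Lambda_minus_iff[of "z + b / \<mu>"] by simp
      then show ?thesis using wp_eq_iff[OF z(1) False] z(2) False by auto
    qed
    have Bs: "Bs \<beta> = {b1, b2}" unfolding Bs_def eq using b1 b2 by blast
    have "b1 = b2 \<longleftrightarrow> 2 * z \<in> \<Lambda>"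
    proof
      assume "b1 = b2"
      then have "(z - b1 / \<mu>) - (- z - b1 / \<mu>) \<in> \<Lambda>" using Lambda_diff[OF b1(2), of "- z - b1 / \<mu>"] b2(2) by simp
      then show "2 * z \<in> \<Lambda>" by simp
    next
      assume "2 * z \<in> \<Lambda>"
      then have "(z - b1 / \<mu>) - 2 * z \<in> \<Lambda>" by (rule Lambda_diff[OF b1(2)])
      moreover have "(z - b1 / \<mu>) - 2 * z = - z - b1 / \<mu>" by (simp add: algebra_simps)
      ultimately have "- z - b1 / \<mu> \<in> \<Lambda>" by (simp only:)
      then show "b1 = b2" using b2(3) b1(1) by blast
    qed
    then have "card (Bs \<beta>) = (if \<beta> \<in> {e1, e2, e3} then 1 else 2)"
      using wp_roots_iff[OF R z(1)] z(2) unfolding Bs by (auto simp: card_insert_if)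
    then show ?thesis using lattes_order_q[OF L \<beta>] by simp
  qed
  have fin: "finite {z. poly q z = 0}" using q0 by (rule poly_roots_finite)
  have "B = B0 \<union> (\<Union>\<beta>\<in>{z. poly q z = 0}. Bs \<beta>)"
  proof -
    have "poly q (P (b / \<mu>)) = 0" if "b \<in> B" "b / \<mu> \<notin> \<Lambda>" for b
      using pole[OF that(2)] that(1) BL \<mu> by auto
    then show ?thesis by (auto simp: B0_def Bs_def)
  qed
  then have "card B = card (B0 \<union> (\<Union>\<beta>\<in>{z. poly q z = 0}. Bs \<beta>))" by (rule arg_cong)
  also have "\<dots> = card B0 + card (\<Union>\<beta>\<in>{z. poly q z = 0}. Bs \<beta>)"
  proof (rule card_Un_disjoint)
    show "finite B0" using finB by (simp add: B0_def)
    show "finite (\<Union>\<beta>\<in>{z. poly q z = 0}. Bs \<beta>)" using finB fin by (auto simp: Bs_def)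
    show "B0 \<inter> (\<Union>\<beta>\<in>{z. poly q z = 0}. Bs \<beta>) = {}" unfolding B0_def Bs_def by blast
  qed
  also have "card (\<Union>\<beta>\<in>{z. poly q z = 0}. Bs \<beta>) = (\<Sum>\<beta>\<in>{z. poly q z = 0}. card (Bs \<beta>))"
    using finB fin by (intro card_UN_disjoint) (auto simp: Bs_def)
  also have "\<dots> = degree q" using degree_eq_sum_order[OF q0] card_Bs by simp
  finally show ?thesis using \<open>card B0 = 1\<close> dp by simp
qed

end

lemma holomorphic_on_poly_compose:
  "f holomorphic_on S \<Longrightarrow> (\<lambda>z. poly p (f z)) holomorphic_on S"
  by (induction p) (auto intro!: holomorphic_intros)

lemma DERIV_poly_compose:
  "(f has_field_derivative d) (at z) \<Longrightarrow> ((\<lambda>z. poly p (f z)) has_field_derivative poly (pderiv p) (f z) * d) (at z)"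
  by (rule DERIV_chain2[OF poly_DERIV])

lemma poly_reflect_inverse:
  fixes v :: complex
  assumes "v \<noteq> 0"
  shows "poly (reflect_poly p) v = v ^ degree p * poly p (1 / v)"
  using poly_reflect_poly_nz[OF assms, of p] by (simp add: inverse_eq_divide)

lemma poly_reflect_0: "poly (reflect_poly p) 0 = lead_coeff p"
  by (simp add: poly_0_coeff_0)

context upper_half
begin

definition mult_domain :: "complex \<Rightarrow> complex set" where
  "mult_domain \<mu> = {z. z \<notin> \<Lambda> \<and> \<mu> * z \<notin> \<Lambda>}"

lemma mult_domain_open: "\<mu> \<noteq> 0 \<Longrightarrow> open (mult_domain \<mu>)"
proof -
  have "mult_domain \<mu> = - \<Lambda> \<inter> (\<lambda>z. \<mu> * z) -` (- \<Lambda>)" by (auto simp: mult_domain_def)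
  moreover have "open ((\<lambda>z. \<mu> * z) -` (- \<Lambda>))"
    by (intro open_vimage open_compl_Lambda continuous_intros)
  ultimately show ?thesis by (auto intro: open_Int)
qed

lemma mult_domain_connected: assumes "\<mu> \<noteq> 0" shows "connected (mult_domain \<mu>)"
proof -
  have "mult_domain \<mu> = UNIV - (\<Lambda> \<union> (\<lambda>x. x / \<mu>) ` \<Lambda>)"
  proof (intro set_eqI iffI)
    fix z assume "z \<in> mult_domain \<mu>"
    then show "z \<in> UNIV - (\<Lambda> \<union> (\<lambda>x. x / \<mu>) ` \<Lambda>)" using assms by (auto simp: mult_domain_def)
  next
    fix z assume z: "z \<in> UNIV - (\<Lambda> \<union> (\<lambda>x. x / \<mu>) ` \<Lambda>)"
    have "z = (\<mu> * z) / \<mu>" using assms by simp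
    then have "\<mu> * z \<notin> \<Lambda>" using z by blast
    then show "z \<in> mult_domain \<mu>" using z by (simp add: mult_domain_def)
  qed
  moreover have "connected (UNIV - (\<Lambda> \<union> (\<lambda>x. x / \<mu>) ` \<Lambda>))"
    using countable_Lambda by (intro connected_open_diff_countable) auto
  ultimately show ?thesis by simp
qed

lemma eventually_mult_domain: assumes "\<mu> \<noteq> 0" shows "eventually (\<lambda>t. t \<in> mult_domain \<mu>) (at z)"
proof -
  have "eventually (\<lambda>t. \<mu> * t \<notin> \<Lambda>) (at z)"
    using filterlim_mult_at[OF assms, of z] eventually_not_Lambda[of "\<mu> * z"] by (auto simp: filterlim_iff)
  with eventually_not_Lambda[of z] show ?thesis by eventually_elim (simp add: mult_domain_def)
qed

lemma wp_mult_holomorphic: "(\<lambda>z. P (\<mu> * z)) holomorphic_on mult_domain \<mu>"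
proof -
  have "P \<circ> (\<lambda>z. \<mu> * z) holomorphic_on mult_domain \<mu>"
    by (rule holomorphic_on_compose_gen[OF _ wp_holomorphic]) (auto simp: mult_domain_def intro!: holomorphic_intros)
  then show ?thesis by (simp add: o_def)
qed

lemma wp_holomorphic_mult_domain: "P holomorphic_on mult_domain \<mu>"
  by (rule holomorphic_on_subset[OF wp_holomorphic]) (auto simp: mult_domain_def)

text \<open>\<open>P(\<mu> t)\<close> depends on \<open>P(t)\<close> only, so it does not change
  when \<open>t\<close> is replaced by \<open>w + t\<close>. At \<open>t = 0\<close> it has a pole,
  whereas \<open>P(\<mu> (w + t))\<close> would be finite if \<open>\<mu> w\<close> were not a
  lattice point.\<close>

lemma mult_rel_imp_stable:
  assumes \<mu>: "\<mu> \<noteq> 0" and rel: "mult_rel \<mu> p q" and nr: "\<And>x. poly p x = 0 \<Longrightarrow> poly q x \<noteq> 0" and w: "w \<in> \<Lambda>"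
  shows "\<mu> * w \<in> \<Lambda>"
proof (rule ccontr)
  assume n: "\<mu> * w \<notin> \<Lambda>"
  have ev: "eventually (\<lambda>t. P (\<mu> * t) = P (\<mu> * (w + t))) (at 0)"
  proof -
    have "filterlim (\<lambda>t. w + t) (at w) (at 0)" by (rule filterlim_atI) (auto intro!: tendsto_eq_intros simp: eventually_at_filter)
    then have "eventually (\<lambda>t. w + t \<in> mult_domain \<mu>) (at 0)"
      using eventually_mult_domain[OF \<mu>, of w] by (auto simp: filterlim_iff)
    with eventually_mult_domain[OF \<mu>, of 0] show ?thesis
    proof eventually_elim
      case (elim t)
      then have t: "t \<notin> \<Lambda>" "\<mu> * t \<notin> \<Lambda>" "w + t \<notin> \<Lambda>" "\<mu> * (w + t) \<notin> \<Lambda>" by (auto simp: mult_domain_def)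
      have Pw: "P (w + t) = P t" using wp_periodic[OF w t(1)] by (simp only: add.commute)
      have "poly q (P t) * P (\<mu> * t) = poly p (P t)" using rel t unfolding mult_rel_def by blast
      moreover have "poly q (P (w + t)) * P (\<mu> * (w + t)) = poly p (P (w + t))" using rel t unfolding mult_rel_def by blast
      moreover have "poly q (P t) \<noteq> 0" using mult_rel_pole_iff[OF \<mu> rel nr t(1)] t(2) by blast
      ultimately show ?case unfolding Pw by (metis mult_left_cancel)
    qed
  qed
  have "filterlim (\<lambda>t. P (\<mu> * t)) at_infinity (at 0)"
    using filterlim_compose[OF wp_pole[OF Lambda_0]] filterlim_mult_at[OF \<mu>, of 0] by simp
  then have inf: "filterlim (\<lambda>t. P (\<mu> * (w + t))) at_infinity (at 0)"
    by (rule filterlim_mono_eventually[OF _ order_refl order_refl ev])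
  have "isCont (\<lambda>t. P (\<mu> * (w + t))) 0"
    by (rule isCont_o2[where f = "\<lambda>t. \<mu> * (w + t)" and g = P]) (use wp_isCont[OF n] in \<open>auto intro!: continuous_intros\<close>)
  then have "((\<lambda>t. P (\<mu> * (w + t))) \<longlongrightarrow> P (\<mu> * (w + 0))) (at 0)" unfolding isCont_def .
  from not_tendsto_and_filterlim_at_infinity[OF at_neq_bot this inf] show False .
qed

lemma inverse_wp_ode:
  assumes V: "V holomorphic_on ball 0 r" "V 0 = 0" "deriv V 0 = 0" "ball 0 r \<inter> \<Lambda> = {0}"
    "\<And>z. z \<in> ball 0 r - {0} \<Longrightarrow> V z \<noteq> 0 \<and> P z = 1 / V z" and z: "z \<in> ball 0 r"
  shows "deriv V z ^ 2 = 4 * V z + 0 * V z ^ 2 + (- 60 * G4) * V z ^ 3 + (- 140 * G6) * V z ^ 4"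
proof (cases "z = 0")
  case False
  have zL: "z \<notin> \<Lambda>" using V(4) z False by blast
  have Vz: "V z \<noteq> 0" "P z = 1 / V z" using V(5)[of z] z False by auto
  have "(V has_field_derivative deriv V z) (at z)" using holomorphic_derivI[OF V(1) open_ball z] .
  then have "((\<lambda>z. 1 / V z) has_field_derivative - deriv V z / V z ^ 2) (at z)"
    using Vz(1) by (auto intro!: derivative_eq_intros simp: power2_eq_square)
  then have "(P has_field_derivative - deriv V z / V z ^ 2) (at z)"
    by (rule has_field_derivative_transform_within_open[of _ _ _ "ball 0 r - {0}"]) (use z False V(5) in auto)
  then have "deriv P z = - deriv V z / V z ^ 2" by (rule DERIV_imp_deriv)
  then have "deriv V z ^ 2 = deriv P z ^ 2 * V z ^ 4"
    using Vz(1) by (simp add: power_divide flip: power_mult)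
  also have "\<dots> = 4 * V z + 0 * V z ^ 2 + (- 60 * G4) * V z ^ 3 + (- 140 * G6) * V z ^ 4"
    unfolding wp_ode[OF zL] Vz(2) using Vz(1) by (simp add: field_simps eval_nat_numeral)
  finally show ?thesis .
qed (simp add: V)

text \<open>With \<open>\<mu>\<close> a square root of \<open>\<kappa>\<close>, the function
  \<open>G(z) = 1 / f(P(z / \<mu>))\<close> satisfies the differential equation of
  \<open>V = 1 / P\<close>, and both vanish at 0. Uniqueness gives
  \<open>P(z) = f(P(z / \<mu>))\<close> near 0, and analytic continuation gives the rest.\<close>

lemma lattes_imp_mult:
  assumes R: "wp_roots e1 e2 e3" and L: "lattes e1 e2 e3 p q \<kappa>"
  shows "\<exists>\<mu>. \<mu> \<noteq> 0 \<and> mult_rel \<mu> p q"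
proof -
  define \<mu> where "\<mu> = csqrt \<kappa>"
  have \<mu>2: "\<mu> ^ 2 = \<kappa>" by (simp add: \<mu>_def)
  have nr: "\<And>x. poly p x = 0 \<Longrightarrow> poly q x \<noteq> 0" and dp: "degree p = Suc (degree q)" and \<kappa>: "\<kappa> \<noteq> 0"
    and eq: "[:- e1, 1:] * [:- e2, 1:] * [:- e3, 1:] * wronskian p q ^ 2 =
       smult \<kappa> (q * (p - smult e1 q) * (p - smult e2 q) * (p - smult e3 q))"
    using L by (auto simp: lattes_def)
  have \<mu>: "\<mu> \<noteq> 0" using \<mu>2 \<kappa> by auto
  obtain r V where V: "r > 0" "ball 0 r \<inter> \<Lambda> = {0}" "V holomorphic_on ball 0 r" "V 0 = 0" "deriv V 0 = 0"
    "\<And>z. z \<in> ball 0 r - {0} \<Longrightarrow> V z \<noteq> 0 \<and> P z = 1 / V z" "((\<lambda>z. V z / z ^ 2) \<longlongrightarrow> 1) (at 0)"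
    by (rule wp_inverse_near_0) (rule that)
  \<comment> \<open>Reflected polynomials express \<open>q / p\<close> at \<open>1 / U\<close> as
    \<open>U qr(U) / pr(U)\<close>, which makes sense at \<open>U = 0\<close>. The single factor
    \<open>U\<close> comes from the difference of the degrees.\<close>
  define pr qr where "pr = reflect_poly p" and "qr = reflect_poly q"
  have pr0: "poly pr 0 \<noteq> 0" and qr0: "poly qr 0 \<noteq> 0"
    using lattes_nonzero(1,2)[OF L] by (simp_all add: pr_def qr_def poly_reflect_0)
  define r1 where "r1 = min r (r * cmod \<mu>)"
  have r1: "r1 > 0" "ball (0::complex) r1 \<subseteq> ball 0 r" using V(1) \<mu> by (auto simp: r1_def)
  have quot: "z / \<mu> \<in> ball 0 r" if "z \<in> ball (0::complex) r1" for z
    using that \<mu> by (simp add: norm_divide r1_def field_simps)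
  define U where "U = (\<lambda>z. V (z / \<mu>))"
  have Uhol: "U holomorphic_on ball 0 r1"
  proof -
    have "V \<circ> (\<lambda>z. z / \<mu>) holomorphic_on ball 0 r1"
      by (rule holomorphic_on_compose_gen[OF _ V(3)]) (use quot \<mu> in \<open>auto intro!: holomorphic_intros\<close>)
    then show ?thesis by (simp add: o_def U_def)
  qed
  have prq: "isCont (\<lambda>z. poly pr (U z) * poly qr (U z)) 0"
    using r1(1) by (intro field_differentiable_imp_continuous_at
      holomorphic_on_imp_differentiable_at[of _ "ball 0 r1"] holomorphic_intros holomorphic_on_poly_compose Uhol) auto
  then have "((\<lambda>z. poly pr (U z) * poly qr (U z)) \<longlongrightarrow> poly pr 0 * poly qr 0) (nhds 0)"
    using tendsto_at_iff_tendsto_nhds[of "\<lambda>z. poly pr (U z) * poly qr (U z)" 0] by (simp add: isCont_def U_def V(4))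
  then have "eventually (\<lambda>z. poly pr (U z) * poly qr (U z) \<noteq> 0) (nhds 0)"
    by (rule tendsto_imp_eventually_ne) (use pr0 qr0 in simp)
  then obtain s1 where s1: "s1 > 0" "\<And>z. z \<in> ball 0 s1 \<Longrightarrow> poly pr (U z) * poly qr (U z) \<noteq> 0"
    by (auto simp: eventually_nhds_metric dist_commute)
  define s where "s = min s1 r1"
  have s: "s > 0" "ball (0::complex) s \<subseteq> ball 0 r1" "ball (0::complex) s \<subseteq> ball 0 s1" using s1(1) r1(1) by (auto simp: s_def)
  have nz: "poly pr (U z) \<noteq> 0" "poly qr (U z) \<noteq> 0" if "z \<in> ball 0 s" for z
    using s1(2)[of z] that s(3) by auto
  define G where "G = (\<lambda>z. U z * poly qr (U z) / poly pr (U z))"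
  have Ghol: "G holomorphic_on ball 0 s"
    unfolding G_def using nz(1) by (intro holomorphic_intros holomorphic_on_poly_compose holomorphic_on_subset[OF Uhol s(2)]) auto
  have Gx: "G z = poly q (P (z / \<mu>)) / poly p (P (z / \<mu>))" "poly p (P (z / \<mu>)) \<noteq> 0" "poly q (P (z / \<mu>)) \<noteq> 0" "z / \<mu> \<notin> \<Lambda>"
    "G z \<noteq> 0"
    if z: "z \<in> ball 0 s - {0}" for z
  proof -
    have zq: "z / \<mu> \<in> ball 0 r - {0}" using quot[of z] z s(2) \<mu> by auto
    then have U: "U z \<noteq> 0" "P (z / \<mu>) = 1 / U z" using V(6)[OF zq] by (auto simp: U_def)
    show "z / \<mu> \<notin> \<Lambda>" using V(2) zq by blast
    have z': "z \<in> ball 0 s" using z by simp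
    have prx: "poly pr (U z) = U z ^ Suc (degree q) * poly p (P (z / \<mu>))"
      unfolding pr_def U(2) dp[symmetric] by (rule poly_reflect_inverse[OF U(1)])
    have qrx: "poly qr (U z) = U z ^ degree q * poly q (P (z / \<mu>))"
      unfolding qr_def U(2) by (rule poly_reflect_inverse[OF U(1)])
    show "poly p (P (z / \<mu>)) \<noteq> 0" using nz(1)[OF z'] prx by auto
    show q: "poly q (P (z / \<mu>)) \<noteq> 0" using nz(2)[OF z'] qrx by auto
    show "G z = poly q (P (z / \<mu>)) / poly p (P (z / \<mu>))"
      unfolding G_def prx qrx using U(1) by simp
    show "G z \<noteq> 0" using U(1) nz[OF z'] by (simp add: G_def)
  qed
  have G0: "G 0 = 0" by (simp add: G_def U_def V(4))
  have odeG: "deriv G z ^ 2 = 4 * G z + 0 * G z ^ 2 + (- 60 * G4) * G z ^ 3 + (- 140 * G6) * G z ^ 4"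
    if z: "z \<in> ball 0 s" for z
  proof (cases "z = 0")
    case True
    have "((\<lambda>z. V (z / \<mu>)) has_field_derivative deriv V 0 * (1 / \<mu>)) (at 0)"
      using holomorphic_derivI[OF V(3) open_ball, of 0] V(1) \<mu>
      by (intro DERIV_chain2[of V]) (auto intro!: derivative_eq_intros)
    then have U0: "(U has_field_derivative 0) (at 0)" by (simp add: U_def V(5))
    have "(G has_field_derivative (((0 * poly qr (U 0) + (poly (pderiv qr) (U 0) * 0) * U 0) * poly pr (U 0) -
        U 0 * poly qr (U 0) * (poly (pderiv pr) (U 0) * 0)) / (poly pr (U 0) * poly pr (U 0)))) (at 0)"
      unfolding G_def using nz(1)[of 0] s(1)
      by (intro DERIV_divide DERIV_mult DERIV_poly_compose U0) auto
    then have "deriv G 0 = 0" by (simp add: DERIV_imp_deriv)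
    then show ?thesis using True by (simp add: G0)
  next
    case False
    then have z': "z \<in> ball 0 s - {0}" using z by simp
    define x where "x = P (z / \<mu>)"
    have x: "poly p x \<noteq> 0" "poly q x \<noteq> 0" "z / \<mu> \<notin> \<Lambda>" "G z = poly q x / poly p x" using Gx[OF z'] by (auto simp: x_def)
    have "((\<lambda>z. P (z / \<mu>)) has_field_derivative deriv P (z / \<mu>) * (1 / \<mu>)) (at z)"
      using wp_has_derivative[OF x(3)] \<mu> by (intro DERIV_chain2[of P]) (auto intro!: derivative_eq_intros)
    then have "((\<lambda>z. poly q (P (z / \<mu>)) / poly p (P (z / \<mu>))) has_field_derivative
       ((poly (pderiv q) x * (deriv P (z / \<mu>) * (1 / \<mu>)) * poly p x - poly q x * (poly (pderiv p) x * (deriv P (z / \<mu>) * (1 / \<mu>)))) /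
         (poly p x * poly p x))) (at z)"
      unfolding x_def using x(1)[unfolded x_def] by (intro DERIV_divide DERIV_poly_compose) auto
    then have "(G has_field_derivative
       ((poly (pderiv q) x * (deriv P (z / \<mu>) * (1 / \<mu>)) * poly p x - poly q x * (poly (pderiv p) x * (deriv P (z / \<mu>) * (1 / \<mu>)))) /
         (poly p x * poly p x))) (at z)"
      by (rule has_field_derivative_transform_within_open[of _ _ _ "ball 0 s - {0}"]) (use z' Gx(1) in auto)
    then have "deriv G z = ((poly (pderiv q) x * (deriv P (z / \<mu>) * (1 / \<mu>)) * poly p x -
         poly q x * (poly (pderiv p) x * (deriv P (z / \<mu>) * (1 / \<mu>)))) / (poly p x * poly p x))"
      by (rule DERIV_imp_deriv)
    also have "\<dots> = - (poly (wronskian p q) x * (deriv P (z / \<mu>) / \<mu>)) / poly p x ^ 2"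
      by (simp add: wronskian_def power2_eq_square diff_divide_distrib algebra_simps)
    finally have "deriv G z ^ 2 = poly (wronskian p q) x ^ 2 * (deriv P (z / \<mu>) ^ 2 / \<kappa>) / poly p x ^ 4"
      by (simp add: power_mult_distrib power_divide \<mu>2 flip: power_mult)
    also have "deriv P (z / \<mu>) ^ 2 = 4 * ((x - e1) * (x - e2) * (x - e3))"
      unfolding wp_ode_roots[OF R x(3)] x_def ..
    finally have G1: "deriv G z ^ 2 = 4 * ((x - e1) * (x - e2) * (x - e3) * poly (wronskian p q) x ^ 2) / \<kappa> / poly p x ^ 4"
      by (simp add: field_simps)
    have "poly ([:- e1, 1:] * [:- e2, 1:] * [:- e3, 1:] * wronskian p q ^ 2) x =
        poly (smult \<kappa> (q * (p - smult e1 q) * (p - smult e2 q) * (p - smult e3 q))) x" by (simp only: eq)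
    then have "(x - e1) * (x - e2) * (x - e3) * poly (wronskian p q) x ^ 2 =
       \<kappa> * (poly q x * (poly p x - e1 * poly q x) * (poly p x - e2 * poly q x) * (poly p x - e3 * poly q x))"
      by (simp del: mult_pCons_left mult_pCons_right)
    with G1 have "deriv G z ^ 2 = 4 * (poly q x * (poly p x - e1 * poly q x) * (poly p x - e2 * poly q x) * (poly p x - e3 * poly q x)) / poly p x ^ 4"
      using \<kappa> by simp
    also have "\<dots> = 4 * (G z * (1 - e1 * G z) * (1 - e2 * G z) * (1 - e3 * G z))"
      unfolding x(4) using x(1) by (simp add: field_simps eval_nat_numeral)
    also have "\<dots> = 4 * G z - 4 * (e1 + e2 + e3) * G z ^ 2 + 4 * (e1 * e2 + e1 * e3 + e2 * e3) * G z ^ 3 - 4 * (e1 * e2 * e3) * G z ^ 4"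
      by algebra
    also have "\<dots> = 4 * G z + 0 * G z ^ 2 + (- 60 * G4) * G z ^ 3 + (- 140 * G6) * G z ^ 4"
      using R by (simp add: wp_roots_def)
    finally show ?thesis .
  qed
  have sr: "ball (0::complex) s \<subseteq> ball 0 r" using s(2) r1(2) by blast
  have odeV: "deriv V z ^ 2 = 4 * V z + 0 * V z ^ 2 + (- 60 * G4) * V z ^ 3 + (- 140 * G6) * V z ^ 4"
    if "z \<in> ball 0 s" for z
    by (rule inverse_wp_ode[OF V(3,4,5,2,6)]) (use that sr in auto)
  have half: "of_real (s / 2) \<in> ball (0::complex) s - {0}" using s(1) by simp
  have half': "of_real (s / 2) \<in> ball (0::complex) s" using half by blast
  have Vh: "V (of_real (s / 2)) \<noteq> 0" using V(6)[of "of_real (s / 2)"] half sr by blast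
  have VG: "V z = G z" if "z \<in> ball 0 s" for z
    using ode1_unique_at_0[OF holomorphic_on_subset[OF V(3) sr] Ghol odeV odeG V(4) G0 half' Vh half' Gx(5)[OF half] that] .
  \<comment> \<open>Clearing the denominator makes the relation holomorphic on the connected set
    where both \<open>t\<close> and \<open>\<mu> t\<close> avoid the lattice, so its vanishing near
    0 spreads.\<close>
  define H where "H = (\<lambda>t. poly q (P t) * P (\<mu> * t) - poly p (P t))"
  have Hhol: "H holomorphic_on mult_domain \<mu>"
    unfolding H_def by (intro holomorphic_intros holomorphic_on_poly_compose wp_holomorphic_mult_domain wp_mult_holomorphic)
  have small: "H t = 0" if "t \<noteq> 0" "\<mu> * t \<in> ball 0 s" for t
  proof -
    have z: "\<mu> * t \<in> ball 0 s - {0}" using that \<mu> by simp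
    have t: "(\<mu> * t) / \<mu> = t" using \<mu> by simp
    have "P (\<mu> * t) = 1 / V (\<mu> * t)" using V(6)[of "\<mu> * t"] z sr by blast
    also have "\<dots> = poly p (P t) / poly q (P t)"
      using VG[of "\<mu> * t"] Gx(1)[OF z] z unfolding t by simp
    finally show ?thesis using Gx(3)[OF z] unfolding t by (simp add: H_def)
  qed
  define Us where "Us = mult_domain \<mu> \<inter> ball 0 (s / cmod \<mu>) - {0}"
  have smem: "\<mu> * t \<in> ball 0 s" if "t \<in> Us" for t
    using that \<mu> by (simp add: Us_def norm_mult field_simps)
  have Uo: "open Us" unfolding Us_def using mult_domain_open[OF \<mu>] by auto
  have "eventually (\<lambda>t. t \<in> Us) (at 0)"
  proof -
    have "eventually (\<lambda>t. t \<in> ball (0::complex) (s / cmod \<mu>) - {0}) (at 0)"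
      using s(1) \<mu> by (intro eventually_at_in_open) auto
    with eventually_mult_domain[OF \<mu>, of 0] show ?thesis by eventually_elim (simp add: Us_def)
  qed
  then obtain t0 where t0: "t0 \<in> Us" using eventually_happens'[OF at_neq_bot] by blast
  have "H t = 0" if "t \<in> mult_domain \<mu>" for t
  proof (rule analytic_continuation[OF Hhol mult_domain_open[OF \<mu>] mult_domain_connected[OF \<mu>], where U = Us and \<xi> = t0])
    show "Us \<subseteq> mult_domain \<mu>" "t0 \<in> mult_domain \<mu>" using t0 by (auto simp: Us_def)
    show "t0 islimpt Us" using Uo t0 by (simp add: interior_limit_point interior_open)
    show "H z = 0" if "z \<in> Us" for z using small[OF _ smem[OF that]] that by (auto simp: Us_def)
  qed (fact that)
  then have "mult_rel \<mu> p q" by (auto simp: mult_rel_def mult_domain_def H_def)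
  with \<mu> show ?thesis by blast
qed

end

section \<open>From a multiplier to a rational function\<close>

lemma isCont_eq_0_at:
  fixes f :: "complex \<Rightarrow> complex"
  assumes "isCont f z" "eventually (\<lambda>t. f t = 0) (at z)"
  shows "f z = 0"
proof -
  have "(f \<longlongrightarrow> 0) (at z)" using assms(2) by (rule tendsto_eventually)
  moreover have "(f \<longlongrightarrow> f z) (at z)" using assms(1) by (simp add: isCont_def)
  ultimately show ?thesis using tendsto_unique[OF at_neq_bot] by blast
qed

lemma cancel_common_roots:
  fixes g h :: "complex poly"
  assumes "h \<noteq> 0"
  shows "\<exists>p q d. g = p * d \<and> h = q * d \<and> (\<forall>x. poly p x = 0 \<longrightarrow> poly q x \<noteq> 0)"
  using assms
proof (induction "degree h" arbitrary: g h rule: less_induct)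
  case less
  show ?case
  proof (cases "\<exists>a. poly g a = 0 \<and> poly h a = 0")
    case False
    then show ?thesis by (intro exI[of _ g] exI[of _ h] exI[of _ 1]) auto
  next
    case True
    then obtain a g' h' where gh: "g = [:- a, 1:] * g'" "h = [:- a, 1:] * h'"
      by (auto simp: poly_eq_0_iff_dvd dvd_def)
    have "h' \<noteq> 0" using less.prems gh(2) by auto
    moreover from this have "degree h' < degree h" unfolding gh(2) by (subst degree_mult_eq) auto
    ultimately obtain p q d where pqd: "g' = p * d" "h' = q * d" "\<forall>x. poly p x = 0 \<longrightarrow> poly q x \<noteq> 0"
      using less.hyps by blast
    have "g = p * ([:- a, 1:] * d)" "h = q * ([:- a, 1:] * d)" unfolding gh pqd(1,2) by (simp_all only: mult_ac)
    then show ?thesis using pqd(3) by blast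
  qed
qed

context upper_half
begin

lemma wp_inverse_factor:
  obtains r k where "r > 0" "ball 0 r \<inter> \<Lambda> = {0}" "k holomorphic_on ball 0 r" "k 0 = 1"
    "\<And>z. z \<in> ball 0 r \<Longrightarrow> k z \<noteq> 0" "\<And>z. z \<in> ball 0 r - {0} \<Longrightarrow> P z = 1 / (z ^ 2 * k z)"
proof -
  obtain r V where V: "r > 0" "ball 0 r \<inter> \<Lambda> = {0}" "V holomorphic_on ball 0 r" "V 0 = 0" "deriv V 0 = 0"
    "\<And>z. z \<in> ball 0 r - {0} \<Longrightarrow> V z \<noteq> 0 \<and> P z = 1 / V z" "((\<lambda>z. V z / z ^ 2) \<longlongrightarrow> 1) (at 0)"
    by (rule wp_inverse_near_0) (rule that)
  obtain k where k: "k holomorphic_on ball 0 r" "\<And>z. z \<in> ball 0 r \<Longrightarrow> V z = z ^ 2 * k z" "k 0 = 1"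
    by (rule square_factor_unit[OF V(3,4,1,7)]) (rule that)
  show thesis
  proof (rule that[OF V(1,2) k(1,3)])
    show "k z \<noteq> 0" if "z \<in> ball 0 r" for z
      using V(6)[of z] k(2)[OF that] k(3) that by (cases "z = 0") auto
    show "P z = 1 / (z ^ 2 * k z)" if "z \<in> ball 0 r - {0}" for z
      using V(6)[OF that] k(2)[of z] that by simp
  qed
qed

text \<open>Subtracting \<open>h 0\<close> times a power of \<open>P\<close> removes the leading
  term at the pole. As the remaining function is even, its pole order drops by two, so induction on
  half the order ends with Liouville's theorem.\<close>

lemma even_elliptic_poly:
  assumes "f holomorphic_on - \<Lambda>" "\<And>z w. z \<notin> \<Lambda> \<Longrightarrow> w \<in> \<Lambda> \<Longrightarrow> f (z + w) = f z" "\<And>z. z \<notin> \<Lambda> \<Longrightarrow> f (- z) = f z"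
    "r > 0" "h holomorphic_on ball 0 r" "\<And>z. z \<in> ball 0 r - {0} \<Longrightarrow> z \<notin> \<Lambda> \<Longrightarrow> f z = h z / z ^ (2 * n)"
  shows "\<exists>g. \<forall>z. z \<notin> \<Lambda> \<longrightarrow> f z = poly g (P z)"
  using assms
proof (induction n arbitrary: f h r)
  case 0
  have "f z = h z" if "z \<in> ball 0 r - {0}" "z \<notin> \<Lambda>" for z using 0(6)[OF that] by simp
  from elliptic_entire_const[OF 0(1,2,4,5) this] obtain c where "\<And>z. z \<notin> \<Lambda> \<Longrightarrow> f z = c" by blast
  then show ?case by (intro exI[of _ "[:c:]"]) simp
next
  case (Suc n)
  note f = Suc.prems
  obtain r' k where k: "r' > 0" "ball 0 r' \<inter> \<Lambda> = {0}" "k holomorphic_on ball 0 r'" "k 0 = 1"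
    "\<And>z. z \<in> ball 0 r' \<Longrightarrow> k z \<noteq> 0" "\<And>z. z \<in> ball 0 r' - {0} \<Longrightarrow> P z = 1 / (z ^ 2 * k z)"
    by (rule wp_inverse_factor) (rule that)
  define \<rho> where "\<rho> = min r r'"
  have \<rho>: "\<rho> > 0" "ball (0::complex) \<rho> \<subseteq> ball 0 r" "ball (0::complex) \<rho> \<subseteq> ball 0 r'" using f(4) k(1) by (auto simp: \<rho>_def)
  define f1 where "f1 = (\<lambda>z. f z - h 0 * P z ^ Suc n)"
  define h1 where "h1 = (\<lambda>z. h z - h 0 / k z ^ Suc n)"
  have nL: "z \<notin> \<Lambda>" if "z \<in> ball 0 \<rho> - {0}" for z using that k(2) \<rho>(3) by blast
  have f1h: "f1 z = h1 z / z ^ (2 * Suc n)" if z: "z \<in> ball 0 \<rho> - {0}" for z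
  proof -
    have "f z = h z / z ^ (2 * Suc n)" using f(6)[OF _ nL[OF z]] z \<rho>(2) by blast
    moreover have "P z = 1 / (z ^ 2 * k z)" using k(6)[of z] z \<rho>(3) by blast
    moreover have "(1 / (z ^ 2 * k z)) ^ Suc n = 1 / k z ^ Suc n / z ^ (2 * Suc n)"
      by (simp only: power_divide power_mult_distrib power_one flip: power_mult) simp
    ultimately show ?thesis by (simp only: f1_def h1_def diff_divide_distrib times_divide_eq_right mult_1_right)
  qed
  have h1hol: "h1 holomorphic_on ball 0 \<rho>"
    unfolding h1_def using k(5) \<rho>
    by (intro holomorphic_intros holomorphic_on_subset[OF f(5)] holomorphic_on_subset[OF k(3)]) auto
  have h10: "h1 0 = 0" by (simp add: h1_def k(4))
  have f1even: "f1 (- z) = f1 z" if "z \<notin> \<Lambda>" for z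
    using f(3)[OF that] by (simp add: f1_def wp_minus)
  have "h1 (- z) = h1 z" if z: "z \<in> ball 0 \<rho>" for z
  proof (cases "z = 0")
    case False
    then have z: "z \<in> ball 0 \<rho> - {0}" "- z \<in> ball 0 \<rho> - {0}" using z by auto
    have "h1 (- z) / z ^ (2 * Suc n) = h1 z / z ^ (2 * Suc n)"
      using f1h[OF z(1)] f1h[OF z(2)] f1even[OF nL[OF z(1)]] by (simp only: power_mult power2_minus)
    then have "h1 (- z) = h1 z \<or> z ^ (2 * Suc n) = 0" by (subst (asm) divide_cancel_right) blast
    then show ?thesis using False by (simp only: power_eq_0_iff) blast
  qed simp
  moreover have "eventually (\<lambda>z. z \<in> ball 0 \<rho>) (nhds (0::complex))"
    using \<rho>(1) by (intro eventually_nhds_in_open) auto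
  ultimately have ev: "eventually (\<lambda>z. h1 (- z) = h1 z) (nhds 0)" by (rule eventually_mono[rotated])
  have "deriv h1 0 = 0"
    using h1hol \<rho>(1) by (intro deriv_even_eq_0 ev holomorphic_on_imp_differentiable_at[of _ "ball 0 \<rho>"]) auto
  then obtain h2 where h2: "h2 holomorphic_on ball 0 \<rho>" "\<And>z. z \<in> ball 0 \<rho> \<Longrightarrow> h1 z = z ^ 2 * h2 z"
    by (rule holomorphic_divide_square[OF h1hol h10 _ \<rho>(1)]) (rule that)
  have "\<exists>g. \<forall>z. z \<notin> \<Lambda> \<longrightarrow> f1 z = poly g (P z)"
  proof (rule Suc.IH)
    show "f1 holomorphic_on - \<Lambda>" unfolding f1_def by (intro holomorphic_intros f(1) wp_holomorphic)
    show "f1 (z + w) = f1 z" if "z \<notin> \<Lambda>" "w \<in> \<Lambda>" for z w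
      using f(2)[OF that] wp_periodic[OF that(2,1)] by (simp add: f1_def)
    show "f1 z = h2 z / z ^ (2 * n)" if "z \<in> ball 0 \<rho> - {0}" for z
      using f1h[OF that] h2(2)[of z] that by (simp add: power2_eq_square)
  qed (use f1even \<rho>(1) h2(1) in blast)+
  then obtain g where g: "\<And>z. z \<notin> \<Lambda> \<Longrightarrow> f1 z = poly g (P z)" by blast
  have "f z = poly (g + monom (h 0) (Suc n)) (P z)" if "z \<notin> \<Lambda>" for z
    using g[OF that] by (simp add: f1_def poly_monom algebra_simps)
  then show ?case by blast
qed

lemma wp_mult_values_finite:
  assumes \<mu>: "\<mu> \<noteq> 0" and B: "coset_reps \<mu> B"
  shows "finite {P z | z. z \<notin> \<Lambda> \<and> \<mu> * z \<in> \<Lambda>}"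
proof (rule finite_subset)
  show "{P z | z. z \<notin> \<Lambda> \<and> \<mu> * z \<in> \<Lambda>} \<subseteq> (\<lambda>b. P (b / \<mu>)) ` B"
  proof safe
    fix z assume z: "z \<notin> \<Lambda>" "\<mu> * z \<in> \<Lambda>"
    have "\<forall>w\<in>\<Lambda>. \<exists>!b. b \<in> B \<and> (\<exists>x\<in>\<Lambda>. w - b = \<mu> * x)" using B unfolding coset_reps_def by (elim conjE)
    from ex1_implies_ex[OF bspec[OF this z(2)]] obtain b x where b: "b \<in> B" "x \<in> \<Lambda>" "\<mu> * z - b = \<mu> * x"
      by (elim exE conjE bexE) (rule that)
    have "b = \<mu> * (z + - x)" using b(3) by algebra
    then have e: "b / \<mu> = z + - x" using \<mu> by simp
    have "P (b / \<mu>) = P z" unfolding e by (rule wp_periodic[OF Lambda_minus[OF b(2)] z(1)])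
    then show "P z \<in> (\<lambda>b. P (b / \<mu>)) ` B" using b(1) by force
  qed
  show "finite ((\<lambda>b. P (b / \<mu>)) ` B)" using B by (simp add: coset_reps_def)
qed

lemma wp_mult_double_pole:
  assumes \<mu>: "\<mu> \<noteq> 0" and z: "\<mu> * z \<in> \<Lambda>"
  shows "((\<lambda>t. P (\<mu> * t) * (t - z) ^ 2) \<longlongrightarrow> 1 / \<mu> ^ 2) (at z)"
proof -
  obtain r k where k: "r > 0" "ball 0 r \<inter> \<Lambda> = {0}" "k holomorphic_on ball 0 r" "k 0 = 1"
    "\<And>z. z \<in> ball 0 r \<Longrightarrow> k z \<noteq> 0" "\<And>z. z \<in> ball 0 r - {0} \<Longrightarrow> P z = 1 / (z ^ 2 * k z)"
    by (rule wp_inverse_factor) (rule that)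
  have "isCont k 0" using k(1,3) by (intro field_differentiable_imp_continuous_at
    holomorphic_on_imp_differentiable_at[of _ "ball 0 r"]) auto
  then have "isCont (\<lambda>t. k (\<mu> * (t - z))) z"
    by (intro isCont_o2[where f = "\<lambda>t. \<mu> * (t - z)" and g = k]) (auto intro!: continuous_intros)
  then have "((\<lambda>t. k (\<mu> * (t - z))) \<longlongrightarrow> 1) (at z)" using k(4) by (simp add: isCont_def)
  then have "((\<lambda>t. 1 / (\<mu> ^ 2 * k (\<mu> * (t - z)))) \<longlongrightarrow> 1 / (\<mu> ^ 2 * 1)) (at z)"
    using \<mu> by (intro tendsto_intros) auto
  then have lim: "((\<lambda>t. 1 / (\<mu> ^ 2 * k (\<mu> * (t - z)))) \<longlongrightarrow> 1 / \<mu> ^ 2) (at z)" by simp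
  have "eventually (\<lambda>t. t \<in> ball z (r / cmod \<mu>) - {z}) (at z)"
    using k(1) \<mu> by (intro eventually_at_in_open) auto
  then have "eventually (\<lambda>t. 1 / (\<mu> ^ 2 * k (\<mu> * (t - z))) = P (\<mu> * t) * (t - z) ^ 2) (at z)"
  proof eventually_elim
    case (elim t)
    then have "cmod \<mu> * cmod (t - z) < r" "t \<noteq> z"
      using \<mu> by (auto simp: dist_norm norm_minus_commute field_simps)
    then have t: "\<mu> * (t - z) \<in> ball 0 r - {0}"
      using \<mu> by (simp only: Diff_iff mem_ball_0 norm_mult) simp
    have "\<mu> * (t - z) \<notin> \<Lambda>" using t k(2) by blast
    from wp_periodic[OF z this] have "P (\<mu> * t) = P (\<mu> * (t - z))" by (simp add: algebra_simps)
    also have "\<dots> = 1 / ((\<mu> * (t - z)) ^ 2 * k (\<mu> * (t - z)))" using k(6)[OF t] .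
    finally show ?case using t by (simp add: power_mult_distrib)
  qed
  with lim show ?thesis by (rule Lim_transform_eventually)
qed

text \<open>Multiplying \<open>P(\<mu> z)\<close> by a polynomial in \<open>P(z)\<close> removes all
  its poles outside the lattice. What remains is even, elliptic and has poles on
  \<open>\<Lambda>\<close> only, hence is a polynomial in \<open>P\<close>; cancelling common roots
  yields \<open>p\<close> and \<open>q\<close>.\<close>

lemma mult_imp_rel:
  assumes \<mu>: "\<mu> \<noteq> 0" and stable: "\<And>w. w \<in> \<Lambda> \<Longrightarrow> \<mu> * w \<in> \<Lambda>" and B: "coset_reps \<mu> B"
  obtains p q where "mult_rel \<mu> p q" "\<And>x. poly p x = 0 \<Longrightarrow> poly q x \<noteq> 0" "q \<noteq> 0"
proof -
  define Cs where "Cs = {P z | z. z \<notin> \<Lambda> \<and> \<mu> * z \<in> \<Lambda>}"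
  have fC: "finite Cs" unfolding Cs_def by (rule wp_mult_values_finite[OF \<mu> B])
  \<comment> \<open>The exponent 2 suffices: \<open>P(\<mu> z)\<close> has double poles, and
    \<open>P - c\<close> vanishes there at least to first order.\<close>
  define Bp where "Bp = (\<Prod>c\<in>Cs. [:- c, 1:] ^ 2)"
  define m where "m = degree Bp"
  have Bp0: "Bp \<noteq> 0" unfolding Bp_def using fC by simp
  have degB: "m = 2 * card Cs"
    unfolding m_def Bp_def by (subst degree_prod_eq_sum_degree) (auto simp: degree_power_eq)
  have polyB: "poly Bp x = (\<Prod>c\<in>Cs. (x - c) ^ 2)" for x
    unfolding Bp_def by (simp add: poly_prod poly_power)
  have nzB: "poly Bp (P z) \<noteq> 0" if "z \<in> mult_domain \<mu>" for z
  proof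
    assume "poly Bp (P z) = 0"
    then have "P z \<in> Cs" using fC by (auto simp: polyB)
    then obtain y where y: "y \<notin> \<Lambda>" "\<mu> * y \<in> \<Lambda>" "P z = P y" by (auto simp: Cs_def)
    have z: "z \<notin> \<Lambda>" "\<mu> * z \<notin> \<Lambda>" using that by (auto simp: mult_domain_def)
    from wp_eq_iff[OF z(1) y(1)] y(3) consider "z - y \<in> \<Lambda>" | "z + y \<in> \<Lambda>" by blast
    then show False
    proof cases
      case 1
      have "\<mu> * (z - y) + \<mu> * y \<in> \<Lambda>" by (rule Lambda_add[OF stable[OF 1] y(2)])
      then show False using z(2) by (simp add: algebra_simps)
    next
      case 2
      have "\<mu> * (z + y) - \<mu> * y \<in> \<Lambda>" by (rule Lambda_diff[OF stable[OF 2] y(2)])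
      then show False using z(2) by (simp add: algebra_simps)
    qed
  qed
  define G where "G = (\<lambda>z. P (\<mu> * z) * poly Bp (P z))"
  have Ghol: "G holomorphic_on mult_domain \<mu>"
    unfolding G_def by (intro holomorphic_intros holomorphic_on_poly_compose wp_holomorphic_mult_domain wp_mult_holomorphic)
  define f where "f = remove_sings G"
  have fG: "f z = G z" if "z \<in> mult_domain \<mu>" for z
    unfolding f_def using that Ghol mult_domain_open[OF \<mu>] by (intro remove_sings_at_analytic) (auto simp: analytic_at)
  have fan: "f analytic_on {z}" if z: "z \<notin> \<Lambda>" for z
  proof (cases "\<mu> * z \<in> \<Lambda>")
    case False
    then show ?thesis unfolding f_def using z Ghol mult_domain_open[OF \<mu>]
      by (intro remove_sings_analytic_on) (auto simp: analytic_at mult_domain_def)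
  next
    case True
    have "insert z (mult_domain \<mu>) - {z} = mult_domain \<mu>" using True by (auto simp: mult_domain_def)
    moreover have "open (insert z (mult_domain \<mu>))"
    proof -
      obtain U where U: "open U" "z \<in> U" "\<And>t. t \<in> U \<Longrightarrow> t \<noteq> z \<Longrightarrow> t \<in> mult_domain \<mu>"
        using eventually_mult_domain[OF \<mu>, of z] by (auto simp: eventually_at_topological)
      have "insert z (mult_domain \<mu>) = U \<union> mult_domain \<mu>" using U(2,3) by blast
      then show ?thesis using U(1) mult_domain_open[OF \<mu>] by (simp add: open_Un)
    qed
    ultimately have iso: "isolated_singularity_at G z"
      using Ghol by (intro isolated_singularity_at_holomorphic[of _ "insert z (mult_domain \<mu>)"]) auto
    define c where "c = P z"
    have c: "c \<in> Cs" using z True by (auto simp: Cs_def c_def)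
    define R where "R = (\<lambda>x. \<Prod>c\<in>Cs - {c}. (x - c) ^ 2)"
    have polyR: "poly Bp x = (x - c) ^ 2 * R x" for x
      unfolding polyB R_def using fC c by (subst prod.remove[of _ c]) auto
    have "((\<lambda>t. (P t - P z) / (t - z)) \<longlongrightarrow> deriv P z) (at z)"
      using wp_has_derivative[OF z] by (simp add: has_field_derivative_iff)
    moreover have "((\<lambda>t. R (P t)) \<longlongrightarrow> R (P z)) (at z)"
      unfolding R_def using wp_isCont[OF z] by (auto intro!: tendsto_intros simp: isCont_def)
    ultimately have "((\<lambda>t. P (\<mu> * t) * (t - z) ^ 2 * (((P t - P z) / (t - z)) ^ 2 * R (P t))) \<longlongrightarrow>
        1 / \<mu> ^ 2 * ((deriv P z) ^ 2 * R (P z))) (at z)"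
      by (intro tendsto_mult tendsto_power wp_mult_double_pole[OF \<mu> True])
    then have "G \<midarrow>z\<rightarrow> 1 / \<mu> ^ 2 * ((deriv P z) ^ 2 * R (P z))"
      by (rule Lim_transform_eventually)
         (auto simp: eventually_at_filter G_def polyR c_def power_divide)
    then show ?thesis unfolding f_def by (rule remove_sings_analytic_at[OF iso])
  qed
  have "f analytic_on - \<Lambda>" using fan by (subst analytic_on_analytic_at) blast
  then have fhol: "f holomorphic_on - \<Lambda>" by (rule analytic_imp_holomorphic)
  have fcont: "isCont f z" if "z \<notin> \<Lambda>" for z using fan[OF that] by (rule analytic_at_imp_isCont)
  have per: "f (z + w) = f z" if z: "z \<notin> \<Lambda>" and w: "w \<in> \<Lambda>" for z w
  proof -
    have "z + w \<notin> \<Lambda>" using z w by simp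
    then have "isCont (\<lambda>t. f (t + w)) z"
      by (intro isCont_o2[where f = "\<lambda>t. t + w" and g = f] fcont) (auto intro!: continuous_intros)
    then have "isCont (\<lambda>t. f (t + w) - f t) z" using fcont[OF z] by (rule continuous_diff)
    moreover have "eventually (\<lambda>t. f (t + w) - f t = 0) (at z)"
      using eventually_mult_domain[OF \<mu>, of z]
    proof eventually_elim
      case (elim t)
      then have t: "t \<notin> \<Lambda>" "\<mu> * t \<notin> \<Lambda>" by (auto simp: mult_domain_def)
      have e: "\<mu> * (t + w) = \<mu> * t + \<mu> * w" by (simp add: algebra_simps)
      have "t + w \<in> mult_domain \<mu>" using Lambda_add_iff(1)[OF w, of t] Lambda_add_iff(1)[OF stable[OF w], of "\<mu> * t"] t
        unfolding mult_domain_def e[symmetric] by blast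
      moreover have "G (t + w) = G t"
        unfolding G_def e by (simp only: wp_periodic[OF w t(1)] wp_periodic[OF stable[OF w] t(2)])
      ultimately show ?case using fG elim by simp
    qed
    ultimately have "f (z + w) - f z = 0" by (rule isCont_eq_0_at)
    then show ?thesis by simp
  qed
  have even: "f (- z) = f z" if z: "z \<notin> \<Lambda>" for z
  proof -
    have "- z \<notin> \<Lambda>" using z by simp
    then have "isCont (\<lambda>t. f (- t)) z"
      by (intro isCont_o2[where f = "\<lambda>t. - t" and g = f] fcont) (auto intro!: continuous_intros)
    then have "isCont (\<lambda>t. f (- t) - f t) z" using fcont[OF z] by (rule continuous_diff)
    moreover have "eventually (\<lambda>t. f (- t) - f t = 0) (at z)"
      using eventually_mult_domain[OF \<mu>, of z]
    proof eventually_elim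
      case (elim t)
      have "- t \<in> mult_domain \<mu>" using elim by (simp add: mult_domain_def)
      moreover have "G (- t) = G t" by (simp add: G_def wp_minus)
      ultimately show ?case using fG elim by simp
    qed
    ultimately have "f (- z) - f z = 0" by (rule isCont_eq_0_at)
    then show ?thesis by simp
  qed
  obtain r k where k: "r > 0" "ball 0 r \<inter> \<Lambda> = {0}" "k holomorphic_on ball 0 r" "k 0 = 1"
    "\<And>z. z \<in> ball 0 r \<Longrightarrow> k z \<noteq> 0" "\<And>z. z \<in> ball 0 r - {0} \<Longrightarrow> P z = 1 / (z ^ 2 * k z)"
    by (rule wp_inverse_factor) (rule that)
  define \<rho> where "\<rho> = min r (r / cmod \<mu>)"
  have \<rho>: "\<rho> > 0" "ball (0::complex) \<rho> \<subseteq> ball 0 r" using k(1) \<mu> by (auto simp: \<rho>_def)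
  have \<mu>\<rho>: "\<mu> * z \<in> ball 0 r" if "z \<in> ball 0 \<rho>" for z
    using that \<mu> by (simp add: \<rho>_def norm_mult field_simps)
  have k\<mu>: "(\<lambda>z. k (\<mu> * z)) holomorphic_on ball 0 \<rho>"
  proof -
    have "k \<circ> (\<lambda>z. \<mu> * z) holomorphic_on ball 0 \<rho>"
      by (rule holomorphic_on_compose_gen[OF _ k(3)]) (use \<mu>\<rho> in \<open>auto intro!: holomorphic_intros\<close>)
    then show ?thesis by (simp add: o_def)
  qed
  define h where "h = (\<lambda>z. poly (reflect_poly Bp) (z ^ 2 * k z) / (k z ^ m * \<mu> ^ 2 * k (\<mu> * z)))"
  have hhol: "h holomorphic_on ball 0 \<rho>"
    unfolding h_def using k(5) \<mu> \<rho>(2) \<mu>\<rho>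
    by (intro holomorphic_intros holomorphic_on_poly_compose k\<mu> holomorphic_on_subset[OF k(3)]) auto
  \<comment> \<open>The pole at 0 has order at most \<open>2 m + 2\<close>: each of the
    \<open>m\<close> degrees of \<open>Bp\<close> contributes a double pole, and
    \<open>P(\<mu> z)\<close> one more.\<close>
  have "f z = h z / z ^ (2 * (m + 1))" if z: "z \<in> ball 0 \<rho> - {0}" for z
  proof -
    have z1: "z \<in> ball 0 r - {0}" "\<mu> * z \<in> ball 0 r - {0}" using z \<rho>(2) \<mu>\<rho>[of z] \<mu> by auto
    have nz: "k z \<noteq> 0" "k (\<mu> * z) \<noteq> 0" "z \<noteq> 0" using k(5) z1 by auto
    have "z \<notin> \<Lambda>" "\<mu> * z \<notin> \<Lambda>" using z1 k(2) by blast+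
    then have "f z = G z" by (intro fG) (simp add: mult_domain_def)
    also have "\<dots> = 1 / ((\<mu> * z) ^ 2 * k (\<mu> * z)) * poly Bp (1 / (z ^ 2 * k z))"
      by (simp only: G_def k(6)[OF z1(1)] k(6)[OF z1(2)])
    also have "poly Bp (1 / (z ^ 2 * k z)) = poly (reflect_poly Bp) (z ^ 2 * k z) / (z ^ 2 * k z) ^ m"
      using poly_reflect_inverse[of "z ^ 2 * k z" Bp] nz by (simp add: m_def)
    also have "1 / ((\<mu> * z) ^ 2 * k (\<mu> * z)) * (poly (reflect_poly Bp) (z ^ 2 * k z) / (z ^ 2 * k z) ^ m) =
        h z / z ^ (2 * (m + 1))"
    proof -
      have "z ^ (2 * (m + 1)) = z ^ 2 * (z ^ 2) ^ m" by (simp only: power_mult power_Suc Suc_eq_plus1[symmetric])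
      then show ?thesis unfolding h_def power_mult_distrib by (simp only: divide_divide_eq_left times_divide_times_eq mult_1_left mult_ac)
    qed
    finally show ?thesis .
  qed
  then have "\<exists>g. \<forall>z. z \<notin> \<Lambda> \<longrightarrow> f z = poly g (P z)"
    by (intro even_elliptic_poly[OF fhol per even \<rho>(1) hhol])
  then obtain g where g: "\<And>z. z \<notin> \<Lambda> \<Longrightarrow> f z = poly g (P z)" by blast
  obtain p q d where pq: "g = p * d" "Bp = q * d" "\<And>x. poly p x = 0 \<Longrightarrow> poly q x \<noteq> 0"
    using cancel_common_roots[OF Bp0, of g] by blast
  have q0: "q \<noteq> 0" using pq(2) Bp0 by auto
  have "mult_rel \<mu> p q"
    unfolding mult_rel_def
  proof (intro allI impI)
    fix z assume z: "z \<notin> \<Lambda>" "\<mu> * z \<notin> \<Lambda>"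
    then have zS: "z \<in> mult_domain \<mu>" by (simp add: mult_domain_def)
    have "P (\<mu> * z) * poly Bp (P z) = poly g (P z)" using fG[OF zS] g[OF z(1)] by (simp add: G_def)
    moreover have "poly d (P z) \<noteq> 0" using nzB[OF zS] by (simp add: pq(2))
    ultimately show "poly q (P z) * P (\<mu> * z) = poly p (P z)" by (simp add: pq(1,2) mult_ac)
  qed
  then show thesis using pq(3) q0 by (rule that)
qed

text \<open>Near 0 the quotient \<open>P(\<mu> t) / P(t)\<close> tends to
  \<open>1 / \<mu>^2\<close>, so \<open>p(x) / (x q(x))\<close> has a finite nonzero limit as
  \<open>x = P(t)\<close> tends to infinity.\<close>

lemma mult_rel_degree:
  assumes \<mu>: "\<mu> \<noteq> 0" and rel: "mult_rel \<mu> p q" and nr: "\<And>x. poly p x = 0 \<Longrightarrow> poly q x \<noteq> 0" and q0: "q \<noteq> 0"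
  shows "degree p = Suc (degree q)"
proof -
  define F where "F = (\<lambda>x. poly p x / poly (pCons 0 q) x)"
  have dq: "degree (pCons 0 q) = Suc (degree q)" using q0 by simp
  have Pinf: "filterlim P at_infinity (at 0)" by (rule wp_pole) simp
  have "((\<lambda>t. P (\<mu> * t) * (t - 0) ^ 2 / (P (1 * t) * (t - 0) ^ 2)) \<longlongrightarrow> (1 / \<mu> ^ 2) / (1 / 1 ^ 2)) (at 0)"
    by (intro tendsto_divide wp_mult_double_pole) (use \<mu> in auto)
  then have L: "((\<lambda>t. P (\<mu> * t) * t ^ 2 / (P t * t ^ 2)) \<longlongrightarrow> 1 / \<mu> ^ 2) (at 0)" by simp
  have "eventually (\<lambda>t. P (\<mu> * t) * t ^ 2 / (P t * t ^ 2) = F (P t)) (at 0)"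
    using eventually_mult_domain[OF \<mu>, of 0]
  proof eventually_elim
    case (elim t)
    then have t: "t \<noteq> 0" by (auto simp: mult_domain_def)
    from elim have tS: "t \<notin> \<Lambda>" "\<mu> * t \<notin> \<Lambda>" by (auto simp: mult_domain_def)
    have "poly q (P t) \<noteq> 0" using mult_rel_pole_iff[OF \<mu> rel nr tS(1)] tS(2) by blast
    moreover have "poly q (P t) * P (\<mu> * t) = poly p (P t)" using rel tS by (simp add: mult_rel_def)
    ultimately show "P (\<mu> * t) * t ^ 2 / (P t * t ^ 2) = F (P t)"
      using t by (simp add: F_def flip: \<open>poly q (P t) * P (\<mu> * t) = poly p (P t)\<close>)
  qed
  with L have lim: "((\<lambda>t. F (P t)) \<longlongrightarrow> 1 / \<mu> ^ 2) (at 0)" by (rule Lim_transform_eventually)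
  consider "degree p < Suc (degree q)" | "degree p = Suc (degree q)" | "degree p > Suc (degree q)" by linarith
  then show ?thesis
  proof cases
    case 1
    then have "(F \<longlongrightarrow> 0) at_infinity" unfolding F_def using dq by (intro poly_divide_tendsto_0_at_infinity) simp
    then have "((\<lambda>t. F (P t)) \<longlongrightarrow> 0) (at 0)" using Pinf by (rule filterlim_compose)
    then have "1 / \<mu> ^ 2 = 0" using tendsto_unique[OF at_neq_bot lim] by blast
    then show ?thesis using \<mu> by simp
  next
    case 3
    then have "((\<lambda>x. poly (pCons 0 q) x / poly p x) \<longlongrightarrow> 0) at_infinity" using dq by (intro poly_divide_tendsto_0_at_infinity) simp
    moreover have "(\<lambda>x. poly (pCons 0 q) x / poly p x) = (\<lambda>x. inverse (F x))" by (simp add: F_def fun_eq_iff)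
    ultimately have "((\<lambda>x. inverse (F x)) \<longlongrightarrow> 0) at_infinity" by (simp only:)
    then have "((\<lambda>t. inverse (F (P t))) \<longlongrightarrow> 0) (at 0)" using Pinf by (rule filterlim_compose)
    moreover have "((\<lambda>t. inverse (F (P t))) \<longlongrightarrow> inverse (1 / \<mu> ^ 2)) (at 0)" using lim \<mu> by (intro tendsto_inverse) auto
    ultimately have "inverse (1 / \<mu> ^ 2) = 0" using tendsto_unique[OF at_neq_bot] by blast
    then show ?thesis using \<mu> by simp
  qed
qed

text \<open>Differentiating \<open>P(\<mu> z) = f(P(z))\<close>, squaring, and using the
  differential equation of \<open>P\<close> at both \<open>z\<close> and \<open>\<mu> z\<close>
  gives the required identity at \<open>x = P(z)\<close> with
  \<open>\<kappa> = \<mu>^2\<close>.\<close>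

lemma mult_imp_lattes:
  assumes R: "wp_roots e1 e2 e3" and \<mu>: "\<mu> \<noteq> 0" and stable: "\<And>w. w \<in> \<Lambda> \<Longrightarrow> \<mu> * w \<in> \<Lambda>" and B: "coset_reps \<mu> B"
  obtains p q \<kappa> where "lattes e1 e2 e3 p q \<kappa>" "mult_rel \<mu> p q"
proof -
  obtain p q where pq: "mult_rel \<mu> p q" "\<And>x. poly p x = 0 \<Longrightarrow> poly q x \<noteq> 0" "q \<noteq> 0"
    using mult_imp_rel[OF \<mu> stable B] by blast
  define Cs where "Cs = {P z | z. z \<notin> \<Lambda> \<and> \<mu> * z \<in> \<Lambda>}"
  have fC: "finite Cs" unfolding Cs_def by (rule wp_mult_values_finite[OF \<mu> B])
  define A where "A = [:- e1, 1:] * [:- e2, 1:] * [:- e3, 1:] * wronskian p q ^ 2"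
  define E where "E = smult (\<mu> ^ 2) (q * (p - smult e1 q) * (p - smult e2 q) * (p - smult e3 q))"
  have "poly A x = poly E x" if x: "x \<notin> Cs" for x
  proof -
    obtain z where z: "z \<notin> \<Lambda>" "P z = x" by (rule wp_surj)
    have mz: "\<mu> * z \<notin> \<Lambda>" using x z by (auto simp: Cs_def)
    have zS: "z \<in> mult_domain \<mu>" using z mz by (simp add: mult_domain_def)
    have qz: "poly q (P t) \<noteq> 0" if "t \<in> mult_domain \<mu>" for t
      using mult_rel_pole_iff[OF \<mu> pq(1,2), of t] that by (auto simp: mult_domain_def)
    have eq: "P (\<mu> * t) = poly p (P t) / poly q (P t)" if "t \<in> mult_domain \<mu>" for t
    proof -
      have "poly q (P t) * P (\<mu> * t) = poly p (P t)" using pq(1) that by (simp add: mult_rel_def mult_domain_def)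
      then show ?thesis using qz[OF that] by (simp add: field_simps)
    qed
    have "((\<lambda>t. P (\<mu> * t)) has_field_derivative deriv P (\<mu> * z) * \<mu>) (at z)"
      using wp_has_derivative[OF mz] by (intro DERIV_chain2[of P]) (auto intro!: derivative_eq_intros)
    moreover have "((\<lambda>t. P (\<mu> * t)) has_field_derivative
       ((poly (pderiv p) (P z) * deriv P z * poly q (P z) - poly p (P z) * (poly (pderiv q) (P z) * deriv P z)) /
         (poly q (P z) * poly q (P z)))) (at z)"
    proof (rule has_field_derivative_transform_within_open[OF _ mult_domain_open[OF \<mu>] zS eq[symmetric]])
      show "((\<lambda>t. poly p (P t) / poly q (P t)) has_field_derivative
       ((poly (pderiv p) (P z) * deriv P z * poly q (P z) - poly p (P z) * (poly (pderiv q) (P z) * deriv P z)) /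
         (poly q (P z) * poly q (P z)))) (at z)"
        using qz[OF zS] by (intro DERIV_divide DERIV_poly_compose wp_has_derivative z(1)) auto
    qed
    ultimately have "deriv P (\<mu> * z) * \<mu> =
       ((poly (pderiv p) (P z) * deriv P z * poly q (P z) - poly p (P z) * (poly (pderiv q) (P z) * deriv P z)) /
         (poly q (P z) * poly q (P z)))" by (rule DERIV_unique)
    also have "\<dots> = poly (wronskian p q) x * deriv P z / poly q x ^ 2"
      by (simp add: wronskian_def z(2) power2_eq_square algebra_simps)
    finally have "deriv P (\<mu> * z) ^ 2 * \<mu> ^ 2 = poly (wronskian p q) x ^ 2 * deriv P z ^ 2 / poly q x ^ 4"
      by (simp add: power_divide flip: power_mult_distrib power_mult)
    then have *: "4 * ((poly p x / poly q x - e1) * (poly p x / poly q x - e2) * (poly p x / poly q x - e3)) * \<mu> ^ 2 =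
        poly (wronskian p q) x ^ 2 * (4 * ((x - e1) * (x - e2) * (x - e3))) / poly q x ^ 4"
      using wp_ode_roots[OF R mz] wp_ode_roots[OF R z(1)] eq[OF zS] z(2) by simp
    have q: "poly q x \<noteq> 0" using qz[OF zS] z(2) by simp
    define W where "W = poly (wronskian p q) x ^ 2"
    define u where "u = (x - e1) * (x - e2) * (x - e3)"
    have "4 * (W * u) = poly q x ^ 4 * (W * (4 * u) / poly q x ^ 4)" using q by simp
    also have "\<dots> = poly q x ^ 4 * (4 * ((poly p x / poly q x - e1) * (poly p x / poly q x - e2) * (poly p x / poly q x - e3)) * \<mu> ^ 2)"
      unfolding W_def u_def by (simp only: *)
    also have "\<dots> = 4 * (\<mu> ^ 2 * (poly q x * (poly p x - e1 * poly q x) * (poly p x - e2 * poly q x) * (poly p x - e3 * poly q x)))"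
      using q by (simp add: field_simps eval_nat_numeral)
    finally have "4 * (poly (wronskian p q) x ^ 2 * ((x - e1) * (x - e2) * (x - e3))) =
      4 * (\<mu> ^ 2 * (poly q x * (poly p x - e1 * poly q x) * (poly p x - e2 * poly q x) * (poly p x - e3 * poly q x)))"
      unfolding W_def u_def .
    then have "poly (wronskian p q) x ^ 2 * ((x - e1) * (x - e2) * (x - e3)) =
      \<mu> ^ 2 * (poly q x * (poly p x - e1 * poly q x) * (poly p x - e2 * poly q x) * (poly p x - e3 * poly q x))"
      by (simp only: mult_cancel_left) simp
    then show ?thesis by (simp add: A_def E_def mult_ac del: mult_pCons_left mult_pCons_right)
  qed
  \<comment> \<open>The identity holds off a finite set, hence as an identity of
    polynomials.\<close>
  then have "- Cs \<subseteq> {x. poly (A - E) x = 0}" by auto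
  moreover have "infinite (- Cs)" using fC infinite_UNIV_char_0 by (simp add: finite_compl)
  ultimately have "A - E = 0" using poly_roots_finite[of "A - E"] finite_subset by blast
  then have "A = E" by simp
  then have "lattes e1 e2 e3 p q (\<mu> ^ 2)"
    using wp_roots_distinct[OF R] pq(2) mult_rel_degree[OF \<mu> pq] \<mu> unfolding lattes_def A_def E_def by simp
  then show thesis using pq(1) by (rule that)
qed

end

section \<open>Lattices with a multiplier of given norm\<close>

lemma even_diff_of_even_diff_squares: "even ((u::int) ^ 2 - a ^ 2) \<Longrightarrow> even (a - u)"
  by (auto simp: power2_eq_square)

context upper_half
begin

text \<open>Take \<open>\<mu> = c + b \<tau>\<close> with \<open>c = (a - u) / 2\<close>, so that
  \<open>2 \<mu> = a + s \<i>\<close> has norm \<open>4 D\<close>. It stabilizes the lattice because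
  \<open>\<tau>\<close> satisfies \<open>b \<tau>^2 - u \<tau> + k = 0\<close> with the integer
  \<open>k = (u^2 + 4 D - a^2) / (4 b)\<close>.\<close>

lemma cm_point_imp_mult:
  fixes u a b :: int and D :: nat
  assumes \<tau>: "\<tau> = 1 / (2 * of_int b) * (of_int u + complex_of_real (sqrt (4 * real D - real_of_int a ^ 2)) * \<i>)"
    and a: "real_of_int \<bar>a\<bar> < 2 * sqrt (real D)" and dv: "4 * b dvd u ^ 2 + 4 * int D - a ^ 2"
  obtains \<mu> where "\<mu> \<noteq> 0" "\<mu> \<in> \<Lambda>" "\<mu> * \<tau> \<in> \<Lambda>" "cmod \<mu> ^ 2 = real D"
proof -
  \<comment> \<open>Division by zero yields 0, so \<open>b = 0\<close> would give
    \<open>\<tau> = 0\<close>.\<close>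
  have b0: "b \<noteq> 0" using Im_pos \<tau> by (auto)
  define s where "s = sqrt (4 * real D - real_of_int a ^ 2)"
  have "(real_of_int a) ^ 2 < (2 * sqrt (real D)) ^ 2"
    using a power_strict_mono[of "real_of_int \<bar>a\<bar>" "2 * sqrt (real D)" 2] by simp
  then have s2: "s ^ 2 = 4 * real D - real_of_int a ^ 2" by (simp add: s_def power_mult_distrib)
  obtain k where k: "u ^ 2 + 4 * int D - a ^ 2 = 4 * b * k" using dv by (auto simp: dvd_def)
  have "even (u ^ 2 - a ^ 2)"
  proof -
    have "u ^ 2 - a ^ 2 = 2 * (2 * b * k - 2 * int D)" using k by simp
    then show ?thesis by simp
  qed
  then obtain c where c: "a - u = 2 * c" by (rule evenE[OF even_diff_of_even_diff_squares])
  then have "a = u + 2 * c" by simp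
  then have ac: "of_int a = (of_int u + 2 * of_int c :: complex)" by simp
  define \<mu> where "\<mu> = of_int c + of_int b * \<tau>"
  have b\<tau>: "2 * of_int b * \<tau> = of_int u + of_real s * \<i>" using b0 by (simp add: \<tau> s_def)
  have \<mu>2: "2 * \<mu> = of_int a + of_real s * \<i>" by (simp add: \<mu>_def distrib_left mult.assoc[symmetric] b\<tau> ac)
  have n: "cmod \<mu> ^ 2 = real D"
  proof -
    have "Re (2 * \<mu>) = of_int a" "Im (2 * \<mu>) = s" by (simp_all only: \<mu>2) simp_all
    then have "(2 * Re \<mu>) ^ 2 + (2 * Im \<mu>) ^ 2 = of_int a ^ 2 + s ^ 2" by simp
    then have "4 * cmod \<mu> ^ 2 = of_int a ^ 2 + s ^ 2" by (simp add: cmod_power2 power_mult_distrib)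
    then show ?thesis using s2 by simp
  qed
  have "4 * of_int b * (\<mu> * \<tau>) = 2 * \<mu> * (2 * of_int b * \<tau>)" by simp
  also have "\<dots> = (of_int a + of_real s * \<i>) * (of_int u + of_real s * \<i>)" by (simp only: b\<tau> \<mu>2)
  also have "\<dots> = of_int a * of_int u - of_real (s ^ 2) + (of_int a + of_int u) * (of_real s * \<i>)"
    by (simp add: algebra_simps power2_eq_square)
  also have "\<dots> = (of_int a + of_int u) * (2 * of_int b * \<tau>) - (of_int (u ^ 2 + 4 * int D - a ^ 2))"
    unfolding b\<tau> s2 by (simp add: algebra_simps power2_eq_square)
  also have "\<dots> = 4 * of_int b * ((of_int u + of_int c) * \<tau> - of_int k)"
    unfolding k ac by (simp add: algebra_simps)
  finally have mt: "\<mu> * \<tau> = of_int (- k) + of_int (u + c) * \<tau>" using b0 by simp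
  have "\<mu> \<in> \<Lambda>" unfolding \<mu>_def Lambda_iff by blast
  moreover have "\<mu> * \<tau> \<in> \<Lambda>" unfolding mt Lambda_iff by blast
  moreover have "\<mu> \<noteq> 0" if "D > 0" using n that by auto
  moreover have "D > 0" using a by (cases D) auto
  ultimately show thesis using n that by blast
qed

text \<open>The integer \<open>a\<close> is the trace \<open>c + g\<close> of multiplication by the
  multiplier, \<open>u\<close> is \<open>g - c\<close>, and \<open>- e\<close> is the quotient in
  the divisibility condition. The strict bound on \<open>a\<close> holds because
  \<open>\<tau>\<close> is not real.\<close>

lemma mult_imp_cm_point:
  fixes D :: nat
  assumes \<mu>: "\<mu> \<in> \<Lambda>" "\<mu> * \<tau> \<in> \<Lambda>" and n: "cmod \<mu> ^ 2 = real D" and nsq: "\<nexists>m::nat. D = m ^ 2"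
  shows "\<exists>u a b :: int.
       \<tau> = 1 / (2 * of_int b) * (of_int u + complex_of_real (sqrt (4 * real D - real_of_int a ^ 2)) * \<i>) \<and>
       real_of_int \<bar>a\<bar> < 2 * sqrt (real D) \<and> 4 * b dvd u ^ 2 + 4 * int D - a ^ 2"
proof -
  \<comment> \<open>A change of sign makes \<open>b\<close> nonnegative; this has to match the
    nonnegative square root and the positive imaginary part of \<open>\<tau>\<close>.\<close>
  obtain \<nu> and c b :: int where \<nu>: "\<nu> = of_int c + of_int b * \<tau>" "\<nu> * \<tau> \<in> \<Lambda>" "cmod \<nu> ^ 2 = real D" "b \<ge> 0"
  proof -
    note b_goal = that
    obtain c b :: int where cb: "\<mu> = of_int c + of_int b * \<tau>" using \<mu>(1) Lambda_iff by blast
    have "- \<mu> = of_int (- c) + of_int (- b) * \<tau>" using cb by simp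
    note neg = b_goal[OF this]
    have "- \<mu> * \<tau> \<in> \<Lambda>" using Lambda_minus[OF \<mu>(2)] by simp
    then have "thesis" if "b < 0" using that n neg by simp
    then show thesis using b_goal[OF cb \<mu>(2) n] by (cases "b \<ge> 0") simp_all
  qed
  \<comment> \<open>An integral multiplier would make \<open>D\<close> a square.\<close>
  have b: "b > 0"
  proof (rule ccontr)
    assume "\<not> b > 0"
    then have "\<nu> = of_int c" using \<nu>(1,4) by simp
    then have "real D = of_int (c ^ 2)" using \<nu>(3) by simp
    then have "int D = c ^ 2" by linarith
    then have "D = nat \<bar>c\<bar> ^ 2" by (simp flip: of_nat_eq_iff[where 'a = int])
    then show False using nsq by blast
  qed
  obtain e g :: int where eg: "\<nu> * \<tau> = of_int e + of_int g * \<tau>" using \<nu>(2) Lambda_iff by blast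
  have "real D = of_int (c * g - b * e)" using norm_eq_det[OF \<nu>(1) eg] \<nu>(3) by simp
  then have D: "int D = c * g - b * e" by linarith
  define x y where "x = Re \<tau>" and "y = Im \<tau>"
  have y: "y > 0" using Im_pos by (simp add: y_def)
  have "Im (\<nu> * \<tau>) = g * y" unfolding eg by (simp add: y_def)
  then have "y * (c + 2 * b * x) = y * g" unfolding \<nu>(1) by (simp add: x_def y_def algebra_simps)
  then have x: "2 * b * x = g - c" using y by simp
  define a u where "a = c + g" and "u = g - c"
  have au: "u ^ 2 + 4 * int D - a ^ 2 = 4 * b * (- e)" unfolding D a_def u_def by (simp add: algebra_simps power2_eq_square)
  have "cmod \<nu> ^ 2 = (c + b * x) ^ 2 + (b * y) ^ 2" by (simp add: \<nu>(1) cmod_power2 x_def y_def)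
  then have "4 * real D = (2 * c + 2 * b * x) ^ 2 + (2 * b * y) ^ 2" using \<nu>(3) by (simp add: power2_eq_square algebra_simps)
  also have "2 * c + 2 * b * x = of_int a" using x by (simp add: a_def)
  finally have by2: "4 * real D - of_int a ^ 2 = (2 * b * y) ^ 2" by simp
  have sq: "sqrt (4 * real D - of_int a ^ 2) = 2 * b * y" unfolding by2 using b y by simp
  have "(real_of_int (2 * b) * y) ^ 2 > 0" using b y by simp
  then have "real_of_int a ^ 2 < 4 * real D" using by2 by linarith
  then have "\<bar>real_of_int a\<bar> ^ 2 < (2 * sqrt (real D)) ^ 2" by (simp add: power_mult_distrib)
  then have "\<bar>real_of_int a\<bar> < 2 * sqrt (real D)" by (rule power2_less_imp_less) simp
  moreover have "\<tau> = 1 / (2 * of_int b) * (of_int u + complex_of_real (sqrt (4 * real D - real_of_int a ^ 2)) * \<i>)"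
  proof -
    have "of_int u = (2 * b * x :: real)" using x by (simp add: u_def)
    then have "2 * of_int b * \<tau> = of_int u + complex_of_real (sqrt (4 * real D - real_of_int a ^ 2)) * \<i>"
      unfolding sq by (intro complex_eqI) (simp_all add: x_def y_def)
    then show ?thesis using b by (simp add: field_simps)
  qed
  moreover have "4 * b dvd u ^ 2 + 4 * int D - a ^ 2" unfolding au by simp
  ultimately show ?thesis by (intro exI[of _ u] exI[of _ a] exI[of _ b]) simp
qed

end

theorem theorem1:
  fixes D :: nat
  assumes "D > 2" and "\<nexists>m::nat. D = m ^ 2"
  shows "{256 * (l ^ 2 - l + 1) ^ 3 / (l ^ 2 - l) ^ 2 | l :: complex.
            \<exists>k as bs cs ds. is_solution D k l as bs cs ds}
       = {modular_j \<tau> | \<tau>. Im \<tau> > 0 \<and>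
            (\<exists>u a b :: int.
               \<tau> = 1 / (2 * of_int b) *
                     (of_int u + complex_of_real (sqrt (4 * real D - real_of_int a ^ 2)) * \<i>) \<and>
               real_of_int \<bar>a\<bar> < 2 * sqrt (real D) \<and>
               4 * b dvd u ^ 2 + 4 * int D - a ^ 2)}"
    (is "?L = ?R")
proof (rule set_eqI, rule iffI)
  fix v assume "v \<in> ?L"
  then obtain l k as bs cs ds where v: "v = 256 * (l ^ 2 - l + 1) ^ 3 / (l ^ 2 - l) ^ 2"
    and sol: "is_solution D k l as bs cs ds" by blast
  from solution_imp_lattes[OF sol assms(1)] obtain p q \<kappa> where L: "lattes 0 1 l p q \<kappa>" and dp: "degree p = D" by blast
  have "l \<noteq> 0" "l \<noteq> 1" using L by (auto simp: lattes_def)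
  from uniformization[OF this] obtain \<tau> e1 e2 e3 where Im: "Im \<tau> > 0" and R: "upper_half.wp_roots \<tau> e1 e2 e3"
    and l: "l = (e3 - e1) / (e2 - e1)" by blast
  interpret upper_half \<tau> using Im by unfold_locales
  have \<alpha>: "e2 - e1 \<noteq> 0" using wp_roots_distinct[OF R] by auto
  \<comment> \<open>The affine map that carries 0, 1, \<open>l\<close> back to the branch values of
    the lattice.\<close>
  have val: "(e2 - e1) * 0 + e1 = e1" "(e2 - e1) * 1 + e1 = e2" "(e2 - e1) * l + e1 = e3" using \<alpha> by (simp_all add: l)
  obtain p' q' where L': "lattes e1 e2 e3 p' q' \<kappa>" and dp': "degree p' = D"
    using lattes_affine(1,2)[OF L \<alpha>, of e1] unfolding val dp by blast
  obtain \<mu> where \<mu>: "\<mu> \<noteq> 0" "mult_rel \<mu> p' q'" using lattes_imp_mult[OF R L'] by blast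
  have nr: "\<And>x. poly p' x = 0 \<Longrightarrow> poly q' x \<noteq> 0" using L' by (simp add: lattes_def)
  have m: "\<mu> * 1 \<in> \<Lambda>" "\<mu> * \<tau> \<in> \<Lambda>" by (rule mult_rel_imp_stable[OF \<mu> nr]; simp)+
  then have m1: "\<mu> \<in> \<Lambda>" by simp
  obtain B where B: "coset_reps \<mu> B" "real (card B) = cmod \<mu> ^ 2" by (rule coset_reps_exist[OF \<mu>(1) m1 m(2)])
  have "cmod \<mu> ^ 2 = real D" using card_coset_reps_eq_degree[OF R L' \<mu>(1) B(1) \<mu>(2)] B(2) dp' by simp
  from mult_imp_cm_point[OF m1 m(2) this assms(2)] have "modular_j \<tau> \<in> ?R" using Im by blast
  then show "v \<in> ?R" using modular_j_eq[OF R l] v by simp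
next
  fix v assume "v \<in> ?R"
  then obtain \<tau> u a b where v: "v = modular_j \<tau>" and Im: "Im \<tau> > 0" and
    \<tau>: "\<tau> = 1 / (2 * of_int b) * (of_int u + complex_of_real (sqrt (4 * real D - real_of_int a ^ 2)) * \<i>)"
      "real_of_int \<bar>a\<bar> < 2 * sqrt (real D)" "4 * b dvd u ^ 2 + 4 * int D - a ^ 2" by blast
  interpret upper_half \<tau> using Im by unfold_locales
  obtain \<mu> where \<mu>: "\<mu> \<noteq> 0" "\<mu> \<in> \<Lambda>" "\<mu> * \<tau> \<in> \<Lambda>" "cmod \<mu> ^ 2 = real D"
    by (rule cm_point_imp_mult[OF \<tau>])
  obtain B where B: "coset_reps \<mu> B" "real (card B) = cmod \<mu> ^ 2" by (rule coset_reps_exist[OF \<mu>(1-3)])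
  obtain e1 e2 e3 where R: "wp_roots e1 e2 e3" by (rule wp_roots_exist)
  obtain p q \<kappa> where L: "lattes e1 e2 e3 p q \<kappa>" "mult_rel \<mu> p q"
    by (rule mult_imp_lattes[OF R \<mu>(1) mult_Lambda[OF \<mu>(2,3)] B(1)])
  have "degree p = D" using card_coset_reps_eq_degree[OF R L(1) \<mu>(1) B(1) L(2)] B(2) \<mu>(4) by simp
  from lattes_imp_solution[OF L(1) this] obtain x y z k as bs cs ds where
    p: "{x, y, z} = {e1, e2, e3}" "distinct [x, y, z]" and
    sol: "is_solution D k ((z - x) / (y - x)) as bs cs ds" by blast
  \<comment> \<open>The system may hold only after relabelling the branch values. They are still the
    roots of the same cubic, so the formula for the modular function applies to the new order as
    well.\<close>
  have "wp_roots x y z"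
  proof -
    note perms = R wp_roots_perm(1)[OF R] wp_roots_perm(2)[OF R] wp_roots_perm(2)[OF wp_roots_perm(1)[OF R]]
      wp_roots_perm(1)[OF wp_roots_perm(2)[OF R]] wp_roots_perm(2)[OF wp_roots_perm(1)[OF wp_roots_perm(2)[OF R]]]
    have "x \<in> {e1, e2, e3}" "y \<in> {e1, e2, e3}" "z \<in> {e1, e2, e3}" unfolding p(1)[symmetric] by simp_all
    then show ?thesis using p(2) perms by (elim insertE emptyE) simp_all
  qed
  then have "v = 256 * (((z - x) / (y - x)) ^ 2 - (z - x) / (y - x) + 1) ^ 3 / (((z - x) / (y - x)) ^ 2 - (z - x) / (y - x)) ^ 2"
    unfolding v by (rule modular_j_eq) (rule refl)
  then show "v \<in> ?L" using sol by blast
qed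

end
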